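(* Let $p$ be a prime and let $\mathcal{O}$ be a complete local principal ideal domain with residue field $k$ of characteristic $p$ (the case $\mathcal{O}=k$ is allowed). Let $G$ be a finite group, and let $U$, $V$ be indecomposable $\mathcal{O}$-free $\mathcal{O}G$-modules having sources of $\mathcal{O}$-ranks prime to $p$. Suppose that $W=U\otimes_{\mathcal{O}}V$ (with diagonal $G$-action) is indecomposable and that $W$ has a simple multiplicity module. Assume that $k$ is large enough so that $U$, $V$, $W$ and their sources are absolutely indecomposable. Then the sources of $W$ have $\mathcal{O}$-rank prime to $p$, and there exist vertices $Q$, $R$ of $U$, $V$, respectively, such that $Q\cap R$ is a vertex of $W$ and such that $QR$ is a Sylow $p$-subgroup of $G$.
   Context: Modules are finitely generated left modules. An $\mathcal{O}$-free module is one that is free (of finite rank) as an $\mathcal{O}$-module. For an indecomposable $\mathcal{O}G$-module $U$, a vertex of $U$ is a minimal subgroup $Q$ of $G$ such that $U$ is isomorphic to a direct summand of $\mathrm{Ind}_Q^G\mathrm{Res}^G_Q(U)$; it is a $p$-subgroup, unique up to $G$-conjugacy. A source of $U$ (with respect to a vertex $Q$) is an indecomposable direct summand $X$ of $\mathrm{Res}^G_Q(U)$ such that $U$ is isomorphic to a direct summand of $\mathrm{Ind}_Q^G(X)$. Vertex-source pairs $(Q,X)$ of $U$ are unique up to $G$-conjugacy (with $X$ taken up to isomorphism). An indecomposable module $M$ over $\mathcal{O}H$, for $H$ a finite group, is absolutely indecomposable if $\mathrm{End}_{\mathcal{O}H}(M)/J(\mathrm{End}_{\mathcal{O}H}(M))\cong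 k$, where $J$ denotes the Jacobson radical. Multiplicity modules: let $W$ be an indecomposable $\mathcal{O}G$-module with vertex-source pair $(S,Z)$, where $Z$ is absolutely indecomposable. Let $N_G(S,Z)$ be the subgroup of those $g\in N_G(S)$ such that the conjugate module ${}^gZ$ is isomorphic to $Z$ as an $\mathcal{O}S$-module. Let $A=\mathrm{End}_{\mathcal{O}S}(\mathrm{Res}^G_S(W))$. There is a unique maximal two-sided ideal $\mathfrak{m}$ of $A$ not containing the projections of $W$ onto direct summands of $\mathrm{Res}^G_S(W)$ isomorphic to $Z$, and $A/\mathfrak{m}\cong \mathrm{End}_k(M_W)$ for a $k$-vector space $M_W$ whose dimension is the multiplicity of $Z$ as a summand in a decomposition of $\mathrm{Res}^G_S(W)$ as a direct sum of indecomposable modules. The group $N_G(S,Z)$ acts on $A$ by conjugation with the $G$-action on $W$, this action stabilises $\mathfrak{m}$, and $S$ acts trivially; so $N_G(S,Z)/S$ acts by $k$-algebra automorphisms on $\mathrm{End}_k(M_W)$. By the Skolem–Noether theorem this gives, for each $g\in N_G(S,Z)/S$, an element $T_g\in \mathrm{GL}(M_W)$, unique up to scalars in $k^\times$, inducing the automorphism by conjugation; thus $M_W$ is a module over a twisted group algebra $k_\alpha (N_G(S,Z)/S)$. This module $M_W$ is called the multiplicity module of $W$ associated with $(S,Z)$. It is simple if it is a simple $k_\alpha(N_G(S,Z)/S)$-module, i.e. $M_W\neq 0$ and no proper nonzero subspace of $M_W$ is stable under all $T_g$. Up to conjugation this does not depend on the choice of $(S,Z)$. *)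

theory Defs
  imports "HOL-Algebra.Multiplicative_Group" "HOL-Algebra.Group_Action" "HOL-Algebra.Ideal_Product"
    "HOL-Algebra.Ring_Divisibility" "HOL-Computational_Algebra.Primes"
begin

section \<open>Coefficient rings\<close>

definition max_ideal :: "('a, 'z) ring_scheme \<Rightarrow> 'a set"
  where "max_ideal R = (THE I. maximalideal I R)"

definition residue_field :: "('a, 'z) ring_scheme \<Rightarrow> 'a set ring"
  where "residue_field R = R Quot (max_ideal R)"

text \<open>The axiom \<open>complete\<close> says that the canonical map from \<open>R\<close> to the inverse limit of the
  quotients by the powers of the maximal ideal is bijective. Fields satisfy all three axioms.\<close>

locale complete_local_pid = principal_domain R for R (structure) +
  assumes local_ring: "\<exists>!I. maximalideal I R"
    and complete: "(\<And>n::nat. x n \<in> carrier R) \<Longrightarrow>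
      (\<And>n. x (Suc n) \<ominus> x n \<in> max_ideal R [^]\<^bsub>ideals_set R\<^esub> n) \<Longrightarrow>
      \<exists>!y. y \<in> carrier R \<and> (\<forall>n. y \<ominus> x n \<in> max_ideal R [^]\<^bsub>ideals_set R\<^esub> n)"

text \<open>The characteristic of a ring is the additive order of its unit element.\<close>

definition ring_char :: "('a, 'z) ring_scheme \<Rightarrow> nat"
  where "ring_char K = group.ord (add_monoid K) \<one>\<^bsub>K\<^esub>"

definition left_ideal :: "'a set \<Rightarrow> ('a, 'z) ring_scheme \<Rightarrow> bool"
  where "left_ideal I E \<longleftrightarrow>
    subgroup I (add_monoid E) \<and> (\<forall>a\<in>carrier E. \<forall>x\<in>I. a \<otimes>\<^bsub>E\<^esub> x \<in> I)"

definition maximal_left_ideal :: "'a set \<Rightarrow> ('a, 'z) ring_scheme \<Rightarrow> bool"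
  where "maximal_left_ideal I E \<longleftrightarrow>
    left_ideal I E \<and> I \<noteq> carrier E \<and>
    (\<forall>J. left_ideal J E \<and> I \<subseteq> J \<longrightarrow> J = I \<or> J = carrier E)"

definition jacobson_radical :: "('a, 'z) ring_scheme \<Rightarrow> 'a set"
  where "jacobson_radical E = carrier E \<inter> \<Inter>{I. maximal_left_ideal I E}"


section \<open>Modules\<close>

definition module_basis :: "('a, 'y) ring_scheme \<Rightarrow> ('a, 'b, 'z) module_scheme \<Rightarrow> 'b set \<Rightarrow> bool"
  where "module_basis R M B \<longleftrightarrow> finite B \<and> B \<subseteq> carrier M \<and>
    (\<forall>x\<in>carrier M. \<exists>!c. c \<in> B \<rightarrow>\<^sub>E carrier R \<and> x = (\<Oplus>\<^bsub>M\<^esub>b\<in>B. c b \<odot>\<^bsub>M\<^esub> b))"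

definition has_rank :: "('a, 'y) ring_scheme \<Rightarrow> ('a, 'b, 'z) module_scheme \<Rightarrow> nat \<Rightarrow> bool"
  where "has_rank R M n \<longleftrightarrow> (\<exists>B. module_basis R M B \<and> card B = n)"

text \<open>The record of \<open>R\<close>-linear endomorphisms of \<open>M\<close> is a noncommutative \<open>R\<close>-algebra, so it is not
  an instance of the library locale for (commutative) algebras. Its elements are extensional, so
  that equality of endomorphisms is equality of functions.\<close>

definition lin_end :: "('a, 'y) ring_scheme \<Rightarrow> ('a, 'b, 'z) module_scheme \<Rightarrow> ('a, 'b \<Rightarrow> 'b) module"
  where "lin_end R M =
    \<lparr>carrier = {f \<in> carrier M \<rightarrow>\<^sub>E carrier M.
       (\<forall>x\<in>carrier M. \<forall>y\<in>carrier M. f (x \<oplus>\<^bsub>M\<^esub> y) = f x \<oplus>\<^bsub>M\<^esub> f y) \<and>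
       (\<forall>r\<in>carrier R. \<forall>x\<in>carrier M. f (r \<odot>\<^bsub>M\<^esub> x) = r \<odot>\<^bsub>M\<^esub> f x)},
     monoid.mult = (\<lambda>f g. \<lambda>x\<in>carrier M. f (g x)),
     one = (\<lambda>x\<in>carrier M. x),
     ring.zero = (\<lambda>x\<in>carrier M. \<zero>\<^bsub>M\<^esub>),
     add = (\<lambda>f g. \<lambda>x\<in>carrier M. f x \<oplus>\<^bsub>M\<^esub> g x),
     smult = (\<lambda>r f. \<lambda>x\<in>carrier M. r \<odot>\<^bsub>M\<^esub> f x)\<rparr>"

text \<open>The free module on \<open>X\<close>, that is, the finitely supported functions on \<open>X\<close> extended by zero.
  The ring components \<open>mult\<close> and \<open>one\<close>, which every module record has, play no role.\<close>

definition free_module :: "('a, 'z) ring_scheme \<Rightarrow> 'x set \<Rightarrow> ('a, 'x \<Rightarrow> 'a) module"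
  where "free_module R X =
    \<lparr>carrier = {f. (\<forall>x. f x \<in> carrier R) \<and> finite {x. f x \<noteq> \<zero>\<^bsub>R\<^esub>} \<and> (\<forall>x. x \<notin> X \<longrightarrow> f x = \<zero>\<^bsub>R\<^esub>)},
     monoid.mult = undefined, one = undefined,
     ring.zero = (\<lambda>_. \<zero>\<^bsub>R\<^esub>),
     add = (\<lambda>f g x. f x \<oplus>\<^bsub>R\<^esub> g x),
     smult = (\<lambda>r f x. r \<otimes>\<^bsub>R\<^esub> f x)\<rparr>"

definition free_gen :: "('a, 'z) ring_scheme \<Rightarrow> 'x \<Rightarrow> 'x \<Rightarrow> 'a"
  where "free_gen R x = (\<lambda>y. if y = x then \<one>\<^bsub>R\<^esub> else \<zero>\<^bsub>R\<^esub>)"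

text \<open>The linear extension to free modules of a map \<open>\<sigma>\<close> between generating sets.\<close>

definition free_map :: "('a, 'z) ring_scheme \<Rightarrow> ('x \<Rightarrow> 'y) \<Rightarrow> ('x \<Rightarrow> 'a) \<Rightarrow> 'y \<Rightarrow> 'a"
  where "free_map R \<sigma> f = (\<lambda>y. \<Oplus>\<^bsub>R\<^esub>x\<in>{x. f x \<noteq> \<zero>\<^bsub>R\<^esub> \<and> \<sigma> x = y}. f x)"


section \<open>Modules with a group action\<close>

text \<open>A module over the group algebra \<open>RG\<close> is an \<open>R\<close>-module with an \<open>R\<close>-linear action of \<open>G\<close>.
  The acting group is a separate argument of all notions below, so restriction to a subgroup \<open>Q\<close>
  only replaces \<open>G\<close> by \<open>G\<lparr>carrier := Q\<rparr>\<close>.\<close>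

record ('a, 'b, 'g) gmodule = "('a, 'b) module" +
  act :: "'g \<Rightarrow> 'b \<Rightarrow> 'b"

locale gmodule = module R M + group G
  for R :: "('a, 'y) ring_scheme" and G :: "('g, 'z) monoid_scheme"
    and M :: "('a, 'b, 'g) gmodule" +
  assumes act_closed: "g \<in> carrier G \<Longrightarrow> x \<in> carrier M \<Longrightarrow> act M g x \<in> carrier M"
    and act_add: "g \<in> carrier G \<Longrightarrow> x \<in> carrier M \<Longrightarrow> y \<in> carrier M \<Longrightarrow>
      act M g (x \<oplus>\<^bsub>M\<^esub> y) = act M g x \<oplus>\<^bsub>M\<^esub> act M g y"
    and act_smult: "g \<in> carrier G \<Longrightarrow> r \<in> carrier R \<Longrightarrow> x \<in> carrier M \<Longrightarrow>
      act M g (r \<odot>\<^bsub>M\<^esub> x) = r \<odot>\<^bsub>M\<^esub> act M g x"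
    and act_one: "x \<in> carrier M \<Longrightarrow> act M \<one>\<^bsub>G\<^esub> x = x"
    and act_mult: "g \<in> carrier G \<Longrightarrow> h \<in> carrier G \<Longrightarrow> x \<in> carrier M \<Longrightarrow>
      act M (g \<otimes>\<^bsub>G\<^esub> h) x = act M g (act M h x)"

definition gmodule_iso ::
    "('a, 'y) ring_scheme \<Rightarrow> ('g, 'z) monoid_scheme \<Rightarrow>
     ('a, 'b, 'g) gmodule \<Rightarrow> ('a, 'c, 'g) gmodule \<Rightarrow> bool"
  where "gmodule_iso R H M N \<longleftrightarrow> (\<exists>f. bij_betw f (carrier M) (carrier N) \<and>
    (\<forall>x\<in>carrier M. \<forall>y\<in>carrier M. f (x \<oplus>\<^bsub>M\<^esub> y) = f x \<oplus>\<^bsub>N\<^esub> f y) \<and>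
    (\<forall>r\<in>carrier R. \<forall>x\<in>carrier M. f (r \<odot>\<^bsub>M\<^esub> x) = r \<odot>\<^bsub>N\<^esub> f x) \<and>
    (\<forall>h\<in>carrier H. \<forall>x\<in>carrier M. f (act M h x) = act N h (f x)))"

definition gmodule_end ::
    "('a, 'y) ring_scheme \<Rightarrow> ('g, 'z) monoid_scheme \<Rightarrow> ('a, 'b, 'g) gmodule \<Rightarrow> ('a, 'b \<Rightarrow> 'b) module"
  where "gmodule_end R H M = (lin_end R M)\<lparr>carrier := {f \<in> carrier (lin_end R M).
    \<forall>h\<in>carrier H. \<forall>x\<in>carrier M. f (act M h x) = act M h (f x)}\<rparr>"

definition gsubmodule ::
    "'b set \<Rightarrow> ('a, 'y) ring_scheme \<Rightarrow> ('g, 'z) monoid_scheme \<Rightarrow> ('a, 'b, 'g) gmodule \<Rightarrow> bool"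
  where "gsubmodule N R H M \<longleftrightarrow>
    submodule N R M \<and> (\<forall>h\<in>carrier H. \<forall>x\<in>N. act M h x \<in> N)"

definition internal_direct_sum ::
    "('a, 'y) ring_scheme \<Rightarrow> ('g, 'z) monoid_scheme \<Rightarrow> ('a, 'b, 'g) gmodule \<Rightarrow> 'b set \<Rightarrow> 'b set \<Rightarrow> bool"
  where "internal_direct_sum R H M N N' \<longleftrightarrow>
    gsubmodule N R H M \<and> gsubmodule N' R H M \<and>
    N \<inter> N' = {\<zero>\<^bsub>M\<^esub>} \<and> N <+>\<^bsub>M\<^esub> N' = carrier M"

definition direct_summand ::
    "('a, 'y) ring_scheme \<Rightarrow> ('g, 'z) monoid_scheme \<Rightarrow>
     ('a, 'b, 'g) gmodule \<Rightarrow> ('a, 'b, 'g) gmodule \<Rightarrow> bool"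
  where "direct_summand R H X M \<longleftrightarrow>
    (\<exists>N N'. internal_direct_sum R H M N N' \<and> X = M\<lparr>carrier := N\<rparr>)"

definition iso_to_direct_summand ::
    "('a, 'y) ring_scheme \<Rightarrow> ('g, 'z) monoid_scheme \<Rightarrow>
     ('a, 'b, 'g) gmodule \<Rightarrow> ('a, 'c, 'g) gmodule \<Rightarrow> bool"
  where "iso_to_direct_summand R H M N \<longleftrightarrow>
    (\<exists>X. direct_summand R H X N \<and> gmodule_iso R H M X)"

definition indecomposable ::
    "('a, 'y) ring_scheme \<Rightarrow> ('g, 'z) monoid_scheme \<Rightarrow> ('a, 'b, 'g) gmodule \<Rightarrow> bool"
  where "indecomposable R H M \<longleftrightarrow> carrier M \<noteq> {\<zero>\<^bsub>M\<^esub>} \<and>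
    (\<forall>N N'. internal_direct_sum R H M N N' \<longrightarrow> N = {\<zero>\<^bsub>M\<^esub>} \<or> N' = {\<zero>\<^bsub>M\<^esub>})"

text \<open>The isomorphism with the residue field is required to be one of \<open>R\<close>-algebras: an abstract
  ring isomorphism would not exclude that the quotient is a proper extension of the residue field
  that happens to be isomorphic to it.\<close>

definition absolutely_indecomposable ::
    "('a, 'y) ring_scheme \<Rightarrow> ('g, 'z) monoid_scheme \<Rightarrow> ('a, 'b, 'g) gmodule \<Rightarrow> bool"
  where "absolutely_indecomposable R H M \<longleftrightarrow> indecomposable R H M \<and>
    (let E = gmodule_end R H M; J = jacobson_radical E in
      \<exists>\<phi> \<in> ring_iso (E Quot J) (residue_field R).
        \<forall>r\<in>carrier R. \<phi> (J +>\<^bsub>E\<^esub> (r \<odot>\<^bsub>E\<^esub> \<one>\<^bsub>E\<^esub>)) = max_ideal R +>\<^bsub>R\<^esub> r)"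


section \<open>Tensor products and induction\<close>

definition bilinear_relations ::
    "('a, 'y) ring_scheme \<Rightarrow> ('a, 'b, 'u) module_scheme \<Rightarrow> ('a, 'c, 'v) module_scheme \<Rightarrow>
     ('b \<times> 'c \<Rightarrow> 'a) set"
  where "bilinear_relations R M N =
    (let F = free_module R (carrier M \<times> carrier N); \<delta> = free_gen R in
      {\<delta> (x \<oplus>\<^bsub>M\<^esub> x', y) \<ominus>\<^bsub>F\<^esub> (\<delta> (x, y) \<oplus>\<^bsub>F\<^esub> \<delta> (x', y)) | x x' y.
         x \<in> carrier M \<and> x' \<in> carrier M \<and> y \<in> carrier N} \<union>
      {\<delta> (x, y \<oplus>\<^bsub>N\<^esub> y') \<ominus>\<^bsub>F\<^esub> (\<delta> (x, y) \<oplus>\<^bsub>F\<^esub> \<delta> (x, y')) | x y y'.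
         x \<in> carrier M \<and> y \<in> carrier N \<and> y' \<in> carrier N} \<union>
      {\<delta> (r \<odot>\<^bsub>M\<^esub> x, y) \<ominus>\<^bsub>F\<^esub> (r \<odot>\<^bsub>F\<^esub> \<delta> (x, y)) | r x y.
         r \<in> carrier R \<and> x \<in> carrier M \<and> y \<in> carrier N} \<union>
      {\<delta> (x, r \<odot>\<^bsub>N\<^esub> y) \<ominus>\<^bsub>F\<^esub> (r \<odot>\<^bsub>F\<^esub> \<delta> (x, y)) | r x y.
         r \<in> carrier R \<and> x \<in> carrier M \<and> y \<in> carrier N})"

text \<open>The quotient of \<open>M \<otimes> N\<close> by additional relations \<open>B\<close>. The group acts through the maps \<open>\<sigma> g\<close>
  on the generators \<open>(x, y)\<close>; in all uses these preserve the relations. A class is a coset of the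
  submodule \<open>K\<close> of relations. The unions make operations on cosets out of operations on
  representatives, as in the library's quotient rings.\<close>

definition tensor_quotient ::
    "('a, 'y) ring_scheme \<Rightarrow> ('a, 'b, 'u) module_scheme \<Rightarrow> ('a, 'c, 'v) module_scheme \<Rightarrow>
     ('b \<times> 'c \<Rightarrow> 'a) set \<Rightarrow> ('g \<Rightarrow> 'b \<times> 'c \<Rightarrow> 'b \<times> 'c) \<Rightarrow> ('a, ('b \<times> 'c \<Rightarrow> 'a) set, 'g) gmodule"
  where "tensor_quotient R M N B \<sigma> =
    (let F = free_module R (carrier M \<times> carrier N);
         K = (\<lambda>L. submodule L R F) hull (bilinear_relations R M N \<union> B) in
      \<lparr>carrier = a_rcosets\<^bsub>F\<^esub> K,
       monoid.mult = undefined, one = undefined,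
       ring.zero = K,
       add = set_add F,
       smult = (\<lambda>r C. \<Union>f\<in>C. K +>\<^bsub>F\<^esub> (r \<odot>\<^bsub>F\<^esub> f)),
       act = (\<lambda>g C. \<Union>f\<in>C. K +>\<^bsub>F\<^esub> free_map R (\<sigma> g) f)\<rparr>)"

definition tensor_product ::
    "('a, 'y) ring_scheme \<Rightarrow> ('a, 'b, 'g) gmodule \<Rightarrow> ('a, 'c, 'g) gmodule \<Rightarrow>
     ('a, ('b \<times> 'c \<Rightarrow> 'a) set, 'g) gmodule"
  where "tensor_product R U V =
    tensor_quotient R U V {} (\<lambda>g (x, y). (act U g x, act V g y))"

text \<open>The induced module \<open>RG \<otimes>\<^bsub>RQ\<^esub> X\<close>. The group algebra \<open>RG\<close> is the free module on \<open>carrier G\<close>, on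
  which group elements act by translating the generators. It suffices to impose \<open>aq \<otimes> x = a \<otimes> qx\<close>
  for \<open>q\<close> in \<open>Q\<close>, since \<open>Q\<close> generates \<open>RQ\<close> as an \<open>R\<close>-module.\<close>

definition induced ::
    "('a, 'y) ring_scheme \<Rightarrow> ('g, 'z) monoid_scheme \<Rightarrow> 'g set \<Rightarrow> ('a, 'b, 'g) gmodule \<Rightarrow>
     ('a, (('g \<Rightarrow> 'a) \<times> 'b \<Rightarrow> 'a) set, 'g) gmodule"
  where "induced R G Q X =
    (let RG = free_module R (carrier G); F = free_module R (carrier RG \<times> carrier X) in
      tensor_quotient R RG X
        {free_gen R (free_map R (\<lambda>h. h \<otimes>\<^bsub>G\<^esub> q) a, x) \<ominus>\<^bsub>F\<^esub> free_gen R (a, act X q x) | a q x.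
           a \<in> carrier RG \<and> q \<in> Q \<and> x \<in> carrier X}
        (\<lambda>g (a, x). (free_map R (\<lambda>h. g \<otimes>\<^bsub>G\<^esub> h) a, x)))"


section \<open>Vertices and sources\<close>

definition relatively_projective ::
    "('a, 'y) ring_scheme \<Rightarrow> ('g, 'z) monoid_scheme \<Rightarrow> ('a, 'b, 'g) gmodule \<Rightarrow> 'g set \<Rightarrow> bool"
  where "relatively_projective R G U Q \<longleftrightarrow> iso_to_direct_summand R G U (induced R G Q U)"

definition vertex ::
    "('a, 'y) ring_scheme \<Rightarrow> ('g, 'z) monoid_scheme \<Rightarrow> ('a, 'b, 'g) gmodule \<Rightarrow> 'g set \<Rightarrow> bool"
  where "vertex R G U Q \<longleftrightarrow> subgroup Q G \<and> relatively_projective R G U Q \<and>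
    (\<forall>P. subgroup P G \<and> relatively_projective R G U P \<and> P \<subseteq> Q \<longrightarrow> P = Q)"

definition vertex_source ::
    "('a, 'y) ring_scheme \<Rightarrow> ('g, 'z) monoid_scheme \<Rightarrow> ('a, 'b, 'g) gmodule \<Rightarrow>
     'g set \<Rightarrow> ('a, 'b, 'g) gmodule \<Rightarrow> bool"
  where "vertex_source R G U Q X \<longleftrightarrow> vertex R G U Q \<and>
    direct_summand R (G\<lparr>carrier := Q\<rparr>) X U \<and>
    indecomposable R (G\<lparr>carrier := Q\<rparr>) X \<and>
    iso_to_direct_summand R G U (induced R G Q X)"

text \<open>Vertex-source pairs are conjugate, so quantifying over all of them or asking for one amounts
  to the same.\<close>

definition source_ranks_prime_to ::
    "nat \<Rightarrow> ('a, 'y) ring_scheme \<Rightarrow> ('g, 'z) monoid_scheme \<Rightarrow> ('a, 'b, 'g) gmodule \<Rightarrow> bool"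
  where "source_ranks_prime_to p R G U \<longleftrightarrow>
    (\<forall>Q X. vertex_source R G U Q X \<longrightarrow> (\<exists>n. has_rank R X n \<and> coprime n p))"

definition sources_absolutely_indecomposable ::
    "('a, 'y) ring_scheme \<Rightarrow> ('g, 'z) monoid_scheme \<Rightarrow> ('a, 'b, 'g) gmodule \<Rightarrow> bool"
  where "sources_absolutely_indecomposable R G U \<longleftrightarrow>
    (\<forall>Q X. vertex_source R G U Q X \<longrightarrow> absolutely_indecomposable R (G\<lparr>carrier := Q\<rparr>) X)"


section \<open>Multiplicity modules\<close>

definition conjugate_module ::
    "('g, 'z) monoid_scheme \<Rightarrow> 'g \<Rightarrow> ('a, 'b, 'g) gmodule \<Rightarrow> ('a, 'b, 'g) gmodule"
  where "conjugate_module G g Z = Z\<lparr>act := \<lambda>s. act Z (inv\<^bsub>G\<^esub> g \<otimes>\<^bsub>G\<^esub> s \<otimes>\<^bsub>G\<^esub> g)\<rparr>"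

definition stabilizer_of_source ::
    "('a, 'y) ring_scheme \<Rightarrow> ('g, 'z) monoid_scheme \<Rightarrow> 'g set \<Rightarrow> ('a, 'b, 'g) gmodule \<Rightarrow> 'g set"
  where "stabilizer_of_source R G S Z =
    {g \<in> normalizer G S. gmodule_iso R (G\<lparr>carrier := S\<rparr>) (conjugate_module G g Z) Z}"

text \<open>The projections onto direct summands are the idempotents of the endomorphism algebra.\<close>

definition multiplicity_ideal ::
    "('a, 'y) ring_scheme \<Rightarrow> ('g, 'z) monoid_scheme \<Rightarrow> ('a, 'b, 'g) gmodule \<Rightarrow>
     'g set \<Rightarrow> ('a, 'b, 'g) gmodule \<Rightarrow> ('b \<Rightarrow> 'b) set \<Rightarrow> bool"
  where "multiplicity_ideal R G W S Z I \<longleftrightarrow>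
    (let A = gmodule_end R (G\<lparr>carrier := S\<rparr>) W in
      maximalideal I A \<and>
      (\<forall>e\<in>carrier A. e \<otimes>\<^bsub>A\<^esub> e = e \<and>
        gmodule_iso R (G\<lparr>carrier := S\<rparr>) (W\<lparr>carrier := e ` carrier W\<rparr>) Z \<longrightarrow> e \<notin> I))"

text \<open>\<open>M\<close>, with the operators \<open>T C\<close> for the cosets \<open>C\<close> in \<open>N\<^sub>G(S,Z)/S\<close>, is a multiplicity module of
  \<open>W\<close> associated with \<open>(S,Z)\<close>. It is determined up to isomorphism of \<open>M\<close> and scalar multiples of
  the \<open>T C\<close>. The second condition on \<open>\<phi>\<close> makes it an isomorphism of algebras over the residue
  field, and not just of rings.\<close>

definition multiplicity_module ::
    "('a, 'y) ring_scheme \<Rightarrow> ('g, 'z) monoid_scheme \<Rightarrow> ('a, 'b, 'g) gmodule \<Rightarrow>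
     'g set \<Rightarrow> ('a, 'b, 'g) gmodule \<Rightarrow> ('a set, 'm) module \<Rightarrow> ('g set \<Rightarrow> 'm \<Rightarrow> 'm) \<Rightarrow> bool"
  where "multiplicity_module R G W S Z M T \<longleftrightarrow>
    (let k = residue_field R;
         A = gmodule_end R (G\<lparr>carrier := S\<rparr>) W;
         E = lin_end k M;
         N = stabilizer_of_source R G S Z in
      module k M \<and>
      (\<exists>I. multiplicity_ideal R G W S Z I \<and>
        (\<exists>\<phi> \<in> ring_iso (A Quot I) E.
          (\<forall>r\<in>carrier R. \<phi> (I +>\<^bsub>A\<^esub> (r \<odot>\<^bsub>A\<^esub> \<one>\<^bsub>A\<^esub>)) = (max_ideal R +>\<^bsub>R\<^esub> r) \<odot>\<^bsub>E\<^esub> \<one>\<^bsub>E\<^esub>) \<and>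
          (\<forall>C \<in> carrier (G\<lparr>carrier := N\<rparr> Mod S).
            T C \<in> Units E \<and>
            (\<forall>g\<in>C. \<forall>a\<in>carrier A.
              \<phi> (I +>\<^bsub>A\<^esub> (\<lambda>x\<in>carrier W. act W g (a (act W (inv\<^bsub>G\<^esub> g) x)))) =
              T C \<otimes>\<^bsub>E\<^esub> \<phi> (I +>\<^bsub>A\<^esub> a) \<otimes>\<^bsub>E\<^esub> inv\<^bsub>E\<^esub> (T C))))))"

definition simple_multiplicity_module ::
    "('a, 'y) ring_scheme \<Rightarrow> ('g, 'z) monoid_scheme \<Rightarrow> ('a, 'b, 'g) gmodule \<Rightarrow>
     'g set \<Rightarrow> ('a, 'b, 'g) gmodule \<Rightarrow> ('a set, 'm) module \<Rightarrow> ('g set \<Rightarrow> 'm \<Rightarrow> 'm) \<Rightarrow> bool"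
  where "simple_multiplicity_module R G W S Z M T \<longleftrightarrow>
    multiplicity_module R G W S Z M T \<and>
    carrier M \<noteq> {\<zero>\<^bsub>M\<^esub>} \<and>
    (\<forall>L. submodule L (residue_field R) M \<and>
      (\<forall>C \<in> carrier (G\<lparr>carrier := stabilizer_of_source R G S Z\<rparr> Mod S). T C ` L \<subseteq> L) \<longrightarrow>
      L = {\<zero>\<^bsub>M\<^esub>} \<or> L = carrier M)"


section \<open>Sylow subgroups\<close>

definition sylow_subgroup :: "nat \<Rightarrow> 'g set \<Rightarrow> ('g, 'z) monoid_scheme \<Rightarrow> bool"
  where "sylow_subgroup p P G \<longleftrightarrow>
    subgroup P G \<and> card P = p ^ Factorial_Ring.multiplicity p (order G)"

end

theory Submission
  imports Defs "HOL-Algebra.Left_Coset" "HOL-Algebra.Sylow" "HOL-Algebra.Zassenhaus"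
begin

text \<open>Reduce the traces on \<open>End(U)\<close>, \<open>End(V)\<close> and \<open>A = End(W)\<close> modulo the maximal ideal to functions
\<open>t\<close> with values in \<open>k\<close>, and let \<open>lam\<close> be the residue map of the local ring of fixed points \<open>A\<^sup>G\<close>. By Higman's
criterion \<open>1\<close> is the transfer of some \<open>x i y\<close>, \<open>i\<close> projecting onto a source \<open>Z\<close> with vertex \<open>S\<close>; this and
counting fixed points of \<open>p\<close>-groups show that \<open>t\<close> vanishes on \<open>A\<^sup>D\<close> unless \<open>D\<close> lies in a conjugate of \<open>S\<close>,
and that \<open>t(i)\<close>, which is the rank of \<open>Z\<close>, is nonzero if \<open>t\<close> does not vanish on \<open>A\<^sup>S\<close>. It does not, because
\<open>t\<close> is multiplicative on \<open>End(U) \<otimes> End(V)\<close>. If the multiplicity module is simple, then Schur's lemma makes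
\<open>lam(Tr(a))\<close> proportional to \<open>t(a)\<close> for \<open>a\<close> in \<open>A\<^sup>S\<close>. Expanding \<open>1 \<otimes> 1\<close> as a sum of transfers from the groups
\<open>\<^sup>xQ \<inter> \<^sup>yR\<close>, \<open>Q\<close> and \<open>R\<close> being vertices of \<open>U\<close> and \<open>V\<close>, this yields \<open>|G|\<^sub>p |S| = |Q| |R|\<close>. Conjugates of
\<open>Q\<close> and \<open>R\<close> in one Sylow group meet in at most a conjugate of \<open>S\<close>, hence their product is that group.\<close>

no_notation ideal_prod  (infixl \<open>\<cdot>\<index>\<close> 80)
notation monoid.mult  (infixl \<open>\<cdot>\<index>\<close> 70)
notation partial_object.carrier  (\<open>$_\<close> [1000] 1000)
syntax "_index" :: "logic \<Rightarrow> index"  (\<open>\<^sub>_\<close> [1000] 1000)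

text \<open>Since \<open>k\<close> need not be algebraically closed, Schur's lemma only makes an
  endomorphism of the multiplicity module that commutes with the operators zero or invertible. That
  elements of \<open>A^G\<close> act as scalars comes from \<open>A^G\<close> being local with
  residue field \<open>k\<close>: if a non-unit \<open>z\<close> acted invertibly, some transfer
  \<open>y\<close> would act as its inverse, and \<open>1 - y z\<close> would be a unit acting as
  zero. On elements \<open>a = x i y\<close>, both \<open>lam(Tr(a))\<close> and \<open>t(a)\<close>
  then depend only on the residue of \<open>i y x i\<close> in the local ring
  \<open>i A^S i\<close>, whose residue field is commutative; this is why they are proportional. The
  order formula is a count of the orbits of \<open>G\<close> on pairs of cosets of \<open>Q\<close>
  and \<open>R\<close>. Orbits with stabiliser conjugate to \<open>S\<close> all contribute the same
  scalar to \<open>lam(1) = 1\<close>, as \<open>t\<close> is multiplicative and invariant under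
  conjugation; all others contribute zero and have length divisible by \<open>p |G:S|\<close>. So
  the number of the former is prime to \<open>p\<close>, and comparing \<open>p\<close>-parts gives
  the formula.\<close>

lemma (in abelian_monoid) add_finsum:
 assumes S: "abelian_monoid S" and P: "P <= $G"
  and P0: "\<zero> : P" and Padd: "!!x y. x : P ==> y : P ==> x \<oplus> y : P"
  and h: "h : P \<rightarrow> $S" and h0: "h \<zero> = \<zero>\<^sub>S"
  and hadd: "!!x y. x : P ==> y : P ==> h (x \<oplus> y) = h x \<oplus>\<^sub>S h y"
  and f: "f : I \<rightarrow> P"
 shows "(\<Oplus>i\<in>I. f i) : P" and "h (\<Oplus>i\<in>I. f i) = (\<Oplus>\<^sub>S i\<in>I. h (f i))"
proof -
 interpret S: abelian_monoid S by fact
 have "(\<Oplus>i\<in>I. f i) : P & h (\<Oplus>i\<in>I. f i) = (\<Oplus>\<^sub>S i\<in>I. h (f i))" using f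
 proof (induction I rule: infinite_finite_induct)
  case (infinite A)
  thus ?case using P0 h0 by (simp add: finsum_infinite S.finsum_infinite)
 next
  case empty
  thus ?case using P0 h0 by simp
 next
  case (insert i I)
  have "f : I \<rightarrow> $G" "f i : $G" "(%i. h (f i)) : I \<rightarrow> $S" "h (f i) : $S" using insert.prems P h by (auto simp: Pi_def)
  thus ?case using insert Padd hadd by (simp add: Pi_def)
 qed
 thus "(\<Oplus>i\<in>I. f i) : P" "h (\<Oplus>i\<in>I. f i) = (\<Oplus>\<^sub>S i\<in>I. h (f i))" by auto
qed

lemma (in abelian_monoid) finsum_Sigma:
 assumes "finite I" "finite J" "!!i j. i : I ==> j : J ==> f i j : $G"
 shows "(\<Oplus>p\<in>I\<times>J. f (fst p) (snd p)) = (\<Oplus>i\<in>I. \<Oplus>j\<in>J. f i j)"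
proof -
 have "I \<times> J = \<Union>((%i. {i} \<times> J) ` I)" by auto
 also have "finsum G (%p. f (fst p) (snd p)) ...
   = (\<Oplus>i\<in>I. \<Oplus>p\<in>{i}\<times>J. f (fst p) (snd p))"
  using assms by (intro add.finprod_UN_disjoint) (auto simp: pairwise_def disjnt_def)
 also have "... = (\<Oplus>i\<in>I. \<Oplus>j\<in>J. f i j)"
 proof (rule finsum_cong')
  fix i assume i: "i : I"
  have "{i} \<times> J = Pair i ` J" by auto
  thus "(\<Oplus>p\<in>{i}\<times>J. f (fst p) (snd p)) = (\<Oplus>j\<in>J. f i j)"
   using finsum_reindex[of "%p. f (fst p) (snd p)" "Pair i" J] i assms by (auto simp: inj_on_def Pi_def)
 qed (use assms in "auto intro!: finsum_closed")
 finally show ?thesis .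
qed

lemma (in abelian_monoid) finsum_swap:
 assumes "finite I" "finite J" "!!i j. i : I ==> j : J ==> f i j : $G"
 shows "(\<Oplus>i\<in>I. \<Oplus>j\<in>J. f i j) = (\<Oplus>j\<in>J. \<Oplus>i\<in>I. f i j)"
proof -
 have e: "J \<times> I = prod.swap ` (I \<times> J)" by auto
 have "(\<Oplus>j\<in>J. \<Oplus>i\<in>I. f i j) = (\<Oplus>p\<in>J\<times>I. f (snd p) (fst p))"
  using finsum_Sigma[of J I "%j i. f i j"] assms by simp
 also have "... = (\<Oplus>p\<in>I\<times>J. f (fst p) (snd p))" unfolding e using assms by (subst finsum_reindex) (auto simp: Pi_def)
 also have "... = (\<Oplus>i\<in>I. \<Oplus>j\<in>J. f i j)" using finsum_Sigma[of I J f] assms by simp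
 finally show ?thesis by simp
qed

section \<open>Finite sets with a group action\<close>

text \<open>The axioms constrain \<rho> on \<Omega> only, so passing to a subgroup changes the group
  and keeps \<Omega> and \<rho> (\<open>restrict_gset\<close>).\<close>

locale gset = group G for G (structure) +
 fixes \<Omega> :: "'o set" and \<rho> :: "'a => 'o => 'o"
 assumes fin: "finite \<Omega>"
  and closed: "g : $G ==> w : \<Omega> ==> \<rho> g w : \<Omega>"
  and one: "w : \<Omega> ==> \<rho> \<one> w = w"
  and mult: "g : $G ==> h : $G ==> w : \<Omega> ==> \<rho> (g \<cdot> h) w = \<rho> g (\<rho> h w)"
begin

definition orb where "orb w = (%g. \<rho> g w) ` $G"
definition stab where "stab w = {g : $G. \<rho> g w = w}"
definition orbs where "orbs = orb ` \<Omega>"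

lemma orb_self: "w : \<Omega> ==> w : orb w" unfolding orb_def using one one_closed by (metis image_eqI)

lemma orb_sub: "w : \<Omega> ==> orb w <= \<Omega>" unfolding orb_def using closed by auto

lemma inv_act: "g : $G ==> w : \<Omega> ==> \<rho> (inv g) (\<rho> g w) = w" using mult[of "inv g" g w] one by simp

lemma orb_eq: assumes "w : \<Omega>" "v : orb w" shows "orb v = orb w"
proof -
 obtain g where g: "g : $G" "v = \<rho> g w" using assms(2) unfolding orb_def by auto
 have "\<rho> h v : orb w" if "h : $G" for h unfolding orb_def g(2) using mult[OF that g(1) assms(1)] that g(1) by (metis image_eqI m_closed)
 hence "orb v <= orb w" by (auto simp: orb_def[of v])
 moreover have "\<rho> h w : orb v" if "h : $G" for h
 proof -
  have "\<rho> h w = \<rho> (h \<cdot> inv g) v" unfolding g(2) using that g(1) assms(1) closed mult inv_act by simp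
  thus ?thesis unfolding orb_def using that g by auto
 qed
 ultimately show ?thesis unfolding orb_def[of w] by auto
qed

lemma orbs_disjoint: "pairwise disjnt orbs"
proof -
 have "orb w = orb v" if "w : \<Omega>" "v : \<Omega>" "u : orb w" "u : orb v" for u v w using orb_eq[OF that(1,3)] orb_eq[OF that(2,4)] by simp
 thus ?thesis unfolding pairwise_def disjnt_def orbs_def by blast
qed

lemma Union_orbs: "\<Union>orbs = \<Omega>" unfolding orbs_def using orb_self orb_sub by auto

lemma finite_orbs: "finite orbs" "X : orbs ==> finite X" unfolding orbs_def using fin by (auto intro: finite_subset[OF orb_sub])

lemma stab_subgroup: assumes w: "w : \<Omega>" shows "subgroup (stab w) G"
proof (rule subgroupI)
 show "stab w <= $G" by (auto simp: stab_def)
 show "stab w ~= {}" using one[OF w] by (auto simp: stab_def)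
next
 fix x assume "x : stab w"
 thus "inv x : stab w" unfolding stab_def using inv_act[of x w] w by auto
next
 fix x y assume "x : stab w" "y : stab w"
 thus "x \<cdot> y : stab w" using mult[of x y w] w by (simp add: stab_def)
qed

text \<open>Orbit and stabiliser. The representative of a coset is picked by the same
  \<open>SOME\<close> term as in \<open>transfer\<close>, so that an orbit sum turns into a transfer
  term by term.\<close>

lemma orb_bij: assumes w: "w : \<Omega>"
 shows "bij_betw (%C. \<rho> (SOME g. g : C) w) (lcosets stab w) (orb w)"
  and "!!g. g : $G ==> \<rho> (SOME h. h : g <# stab w) w = \<rho> g w"
proof -
 have rep: "\<rho> (SOME h. h : g <# stab w) w = \<rho> g w" if g: "g : $G" for g
 proof -
  have "\<rho> h w = \<rho> g w" if "h : g <# stab w" for h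
  proof -
   obtain d where "d : $G" "\<rho> d w = w" "h = g \<cdot> d" using \<open>h : g <# stab w\<close> unfolding l_coset_def stab_def by blast
   thus ?thesis using mult[OF g _ w, of d] by metis
  qed
  moreover have "(SOME h. h : g <# stab w) : g <# stab w" by (rule someI[where P="%h. h : g <# stab w"], rule lcos_self[OF g stab_subgroup[OF w]])
  ultimately show ?thesis by blast
 qed
 show "!!g. g : $G ==> \<rho> (SOME h. h : g <# stab w) w = \<rho> g w" by (rule rep)
 show "bij_betw (%C. \<rho> (SOME g. g : C) w) (lcosets stab w) (orb w)"
 proof (rule bij_betwI')
  fix C C' assume "C : lcosets stab w" "C' : lcosets stab w"
  then obtain g h where gh: "g : $G" "h : $G" "C = g <# stab w" "C' = h <# stab w" by (auto simp: LCOSETS_def)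
  show "(\<rho> (SOME g. g : C) w = \<rho> (SOME g. g : C') w) = (C = C')"
  proof
   assume "\<rho> (SOME g. g : C) w = \<rho> (SOME g. g : C') w"
   hence e: "\<rho> g w = \<rho> h w" using rep gh by simp
   hence "\<rho> (inv g \<cdot> h) w = w" using gh w mult inv_act by (metis inv_closed)
   hence "inv g \<cdot> h : stab w" using gh by (simp add: stab_def)
   hence "h : g <# stab w" using gh by (auto simp: l_coset_def m_assoc[symmetric] intro!: bexI[of _ "inv g \<cdot> h"])
   thus "C = C'" using gh l_repr_independence[OF _ _ stab_subgroup[OF w]] by blast
  qed simp
 next
  fix C assume "C : lcosets stab w"
  thus "\<rho> (SOME g. g : C) w : orb w" using rep by (auto simp: LCOSETS_def orb_def)
 next
  fix v assume "v : orb w"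
  then obtain g where "g : $G" "v = \<rho> g w" by (auto simp: orb_def)
  thus "EX C:lcosets stab w. v = \<rho> (SOME g. g : C) w" using rep by (auto simp: LCOSETS_def)
 qed
qed

lemma card_orb: assumes "w : \<Omega>" "finite ($G)"
 shows "card (orb w) * card (stab w) = order G"
 using bij_betw_same_card[OF orb_bij(1)[OF assms(1)]] l_lagrange[OF assms(2) stab_subgroup[OF assms(1)]] by simp

lemma stab_translate: assumes "w : \<Omega>" "x : $G"
 shows "stab (\<rho> x w) = (%g. x \<cdot> g \<cdot> inv x) ` stab w"
proof
 show "(%g. x \<cdot> g \<cdot> inv x) ` stab w <= stab (\<rho> x w)" using assms mult closed inv_act by (auto simp: stab_def)
 show "stab (\<rho> x w) <= (%g. x \<cdot> g \<cdot> inv x) ` stab w"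
 proof
  fix h assume "h : stab (\<rho> x w)"
  hence h: "h : $G" "\<rho> h (\<rho> x w) = \<rho> x w" by (auto simp: stab_def)
  hence "\<rho> (inv x \<cdot> h \<cdot> x) w = w" using assms mult closed inv_act by simp
  hence "inv x \<cdot> h \<cdot> x : stab w" using h assms by (simp add: stab_def)
  moreover have "h = x \<cdot> (inv x \<cdot> h \<cdot> x) \<cdot> inv x" using h assms by (simp add: m_assoc) (simp add: m_assoc[symmetric])
  ultimately show "h : (%g. x \<cdot> g \<cdot> inv x) ` stab w" by blast
 qed
qed

end

lemma (in group) lcosets_gset:
 assumes "finite ($G)" "subgroup H G"
 shows "gset G (lcosets H) (%g C. g <# C)"
proof (rule gset.intro[OF is_group], rule gset_axioms.intro)
 have subset: "H <= $G" using assms(2) by (rule subgroup.subset)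
 show "finite (lcosets H)" using assms(1) by (simp add: LCOSETS_def)
 have sub: "C <= $G" if "C : lcosets H" for C using subgroup.lcosets_carrier[OF assms(2) is_group that] .
 show "!!g w. g : $G ==> w : lcosets H ==> g <# w : lcosets H" using subset by (auto simp: LCOSETS_def lcos_m_assoc)
 show "!!w. w : lcosets H ==> \<one> <# w = w" using sub by (simp add: lcos_mult_one)
 show "!!g h w. g : $G ==> h : $G ==> w : lcosets H ==> g \<cdot> h <# w = g <# (h <# w)" using sub by (simp add: lcos_m_assoc)
qed

lemma (in group) lcoset_mem_iff:
 assumes "subgroup H G" "x : $G" "y : $G"
 shows "y : x <# H \<longleftrightarrow> inv x \<cdot> y : H"
proof -
 interpret subgroup H G by fact
 show ?thesis
 proof
  assume "y : x <# H"
  thus "inv x \<cdot> y : H" using assms by (auto simp: l_coset_def m_assoc[symmetric])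
 next
  assume "inv x \<cdot> y : H"
  thus "y : x <# H" using assms by (auto simp: l_coset_def m_assoc[symmetric] intro!: bexI[of _ "inv x \<cdot> y"])
 qed
qed

lemma (in group) lcos_eq_iff:
 assumes "subgroup H G" "x : $G" "y : $G"
 shows "x <# H = y <# H \<longleftrightarrow> inv x \<cdot> y : H"
proof -
 interpret subgroup H G by fact
 show ?thesis using lcoset_mem_iff[OF assms] lcos_self[OF assms(3,1)] l_repr_independence[OF _ assms(2,1)] by blast
qed

lemma (in group) lcos_fixed_iff:
 assumes "subgroup H G" "x : $G" "g : $G"
 shows "g <# (x <# H) = x <# H \<longleftrightarrow> inv x \<cdot> g \<cdot> x : H"
proof -
 interpret subgroup H G by fact
 have "g <# (x <# H) = x <# H \<longleftrightarrow> x <# H = g \<cdot> x <# H" using assms subset by (auto simp: lcos_m_assoc)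
 thus ?thesis using lcos_eq_iff[of H x "g \<cdot> x"] assms by (simp add: m_assoc)
qed

section \<open>Rings with a group action and their transfer maps\<close>

definition fixpts :: "('a, 'y) ring_scheme => ('g => 'a => 'a) => 'g set => 'a set"
 where "fixpts A c H = {a : $A. ALL h:H. c h a = a}"

text \<open>The relative trace map from \<open>A^H\<close> to \<open>A^G\<close>. On elements not
  fixed by \<open>H\<close> its value depends on the chosen representatives; on
  \<open>fixpts A c H\<close> it does not (\<open>c_rep\<close>).\<close>

definition transfer ::
  "('a, 'y) ring_scheme => ('g => 'a => 'a) => ('g, 'z) monoid_scheme => 'g set => 'a => 'a"
 where "transfer A c G H a = (\<Oplus>\<^sub>A C\<in>lcosets \<^sub>G H. c (SOME g. g : C) a)"

text \<open>A \<open>G\<close>-algebra in the sense of Green: a ring on which \<open>G\<close> acts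
  by ring automorphisms. The instances are endomorphism rings of modules, with \<open>G\<close>
  acting by conjugation.\<close>

locale galgebra = A: ring A + G: group G
 for A :: "('a, 'y) ring_scheme" (structure) and G :: "('g, 'z) monoid_scheme" and c +
 assumes finite_G: "finite ($G)"
  and c_hom: "g : $G ==> c g : ring_hom A A"
  and c_one: "a : $A ==> c \<one>\<^sub>G a = a"
  and c_mult: "g : $G ==> h : $G ==> a : $A ==> c (g \<cdot>\<^sub>G h) a = c g (c h a)"
begin

abbreviation fixd where "fixd \<equiv> fixpts A c"
abbreviation tr where "tr \<equiv> transfer A c"

lemma c_closed: "g : $G ==> a : $A ==> c g a : $A" using ring_hom_closed[OF c_hom] .

lemma c_add: "g : $G ==> a : $A ==> b : $A ==> c g (a \<oplus> b) = c g a \<oplus> c g b" using ring_hom_add[OF c_hom] .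

lemma c_times: "g : $G ==> a : $A ==> b : $A ==> c g (a \<cdot> b) = c g a \<cdot> c g b" using ring_hom_mult[OF c_hom] .

lemma c_unit: "g : $G ==> c g \<one> = \<one>" using ring_hom_one[OF c_hom] .

lemma c_zero: "g : $G ==> c g \<zero> = \<zero>" using ring_hom_zero[OF c_hom A.ring_axioms A.ring_axioms] .

lemma c_neg: assumes "g : $G" "a : $A" shows "c g (\<ominus> a) = \<ominus> c g a"
proof -
 have "c g (\<ominus> a) \<oplus> c g a = \<zero>" using assms c_add[of g "\<ominus> a" a] c_zero by (simp add: A.l_neg)
 thus ?thesis using assms c_closed by (simp add: A.minus_equality)
qed

lemma c_inv: "g : $G ==> a : $A ==> c (inv \<^sub>G g) (c g a) = a" using c_mult[of "inv \<^sub>G g" g a] c_one by simp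

lemma c_inv': "g : $G ==> a : $A ==> c g (c (inv \<^sub>G g) a) = a" using c_mult[of g "inv \<^sub>G g" a] c_one by simp

lemma c_finsum: "g : $G ==> f : I \<rightarrow> $A ==> c g (\<Oplus>i\<in>I. f i) = (\<Oplus>i\<in>I. c g (f i))"
 using A.add_finsum(2)[OF A.abelian_monoid_axioms, of "$A" "c g" f I]
  c_closed c_zero c_add by auto

lemma fixd_A: "a : fixd H ==> a : $A" by (simp add: fixpts_def)

lemma fixdD: "a : fixd H ==> h : H ==> c h a = a" by (simp add: fixpts_def)

lemma fixd_mono: "H <= H' ==> fixd H' <= fixd H" by (auto simp: fixpts_def)

lemma fixd_cl:
 assumes "H <= $G"
 shows "a : fixd H ==> b : fixd H ==> a \<oplus> b : fixd H"
  and "a : fixd H ==> b : fixd H ==> a \<cdot> b : fixd H"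
  and "a : fixd H ==> \<ominus> a : fixd H"
  and "a : fixd H ==> b : fixd H ==> a \<ominus> b : fixd H"
  and "\<zero> : fixd H" and "\<one> : fixd H" using assms by (auto simp: fixpts_def A.minus_eq subset_iff c_add c_times c_neg c_zero c_unit)

lemma restrict: assumes "subgroup H G" shows "galgebra A (G(|carrier := H|)) c"
proof -
 interpret H: group "G(|carrier := H|)" using subgroup.subgroup_is_group[OF assms G.is_group] .
 have H: "H <= $G" using assms by (rule subgroup.subset)
 show ?thesis
 proof unfold_locales
  show "finite ($(G(|carrier := H|)))" using finite_subset[OF H finite_G] by simp
  show "c g : ring_hom A A" if "g : $(G(|carrier := H|))" for g using that H by (intro c_hom) auto
  show "c \<one>\<^bsub>G(|carrier := H|)\<^esub> a = a" if "a : $A" for a using c_one[OF that] by simp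
  show "c (g \<cdot>\<^bsub>G(|carrier := H|)\<^esub> h) a = c g (c h a)"
   if "g : $(G(|carrier := H|))" "h : $(G(|carrier := H|))" "a : $A" for g h a using that H c_mult[of g h a] by auto
 qed
qed

lemma c_rep:
 assumes "subgroup H G" "a : fixd H" "g : $G"
 shows "c (SOME h. h : g <#\<^sub>G H) a = c g a"
proof -
 have "c h a = c g a" if h: "h : g <#\<^sub>G H" for h
 proof -
  obtain d where "d : H" "h = g \<cdot>\<^sub>G d" using h unfolding l_coset_def by blast
  thus ?thesis using c_mult[of g d a] assms subgroup.mem_carrier[OF assms(1)] by (simp add: fixpts_def)
 qed
 moreover have "(SOME h. h : g <#\<^sub>G H) : g <#\<^sub>G H" by (rule someI[where P="%h. h : g <#\<^sub>G H"], rule G.lcos_self[OF assms(3,1)])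
 ultimately show ?thesis by blast
qed

lemma c_conj_fixd:
 assumes "H <= $G" "a : fixd H" "x : $G"
 shows "c x a : fixd ((%h. x \<cdot>\<^sub>G h \<cdot>\<^sub>G inv \<^sub>G x) ` H)" unfolding fixpts_def
proof safe
 show "c x a : $A" using assms c_closed fixd_A by blast
 fix h assume h: "h : H"
 hence hG: "h : $G" using assms by auto
 have aA: "a : $A" and ha: "c h a = a" using assms h by (auto simp: fixpts_def)
 have "c (x \<cdot>\<^sub>G h \<cdot>\<^sub>G inv \<^sub>G x) (c x a) = c (x \<cdot>\<^sub>G h \<cdot>\<^sub>G inv \<^sub>G x \<cdot>\<^sub>G x) a"
  using assms hG aA by (simp add: c_mult)
 also have "x \<cdot>\<^sub>G h \<cdot>\<^sub>G inv \<^sub>G x \<cdot>\<^sub>G x = x \<cdot>\<^sub>G h" using assms hG by (simp add: G.m_assoc)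
 finally show "c (x \<cdot>\<^sub>G h \<cdot>\<^sub>G inv \<^sub>G x) (c x a) = c x a" using assms hG aA ha by (simp add: c_mult)
qed

text \<open>A group element merely permutes the summands.\<close>

lemma equivariant_sum:
 assumes "gset G \<Omega> \<rho>" "F : \<Omega> \<rightarrow> $A"
  and eq: "!!g w. g : $G ==> w : \<Omega> ==> F (\<rho> g w) = c g (F w)"
 shows "(\<Oplus>w\<in>\<Omega>. F w) : fixd ($G)"
proof -
 interpret gset G \<Omega> \<rho> by fact
 have "c g (\<Oplus>w\<in>\<Omega>. F w) = (\<Oplus>w\<in>\<Omega>. F w)" if g: "g : $G" for g
 proof -
  have inj: "inj_on (\<rho> g) \<Omega>" by (metis inj_onI inv_act g)
  have "\<rho> g ` \<Omega> = \<Omega>" using inj closed g fin by (intro endo_inj_surj) auto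
  hence "(\<Oplus>w\<in>\<Omega>. F w) = (\<Oplus>w\<in>\<rho> g ` \<Omega>. F w)" by simp
  also have "... = (\<Oplus>w\<in>\<Omega>. F (\<rho> g w))" using assms(2) closed g by (intro A.finsum_reindex[OF _ inj]) auto
  also have "... = (\<Oplus>w\<in>\<Omega>. c g (F w))" using assms(2) c_closed g by (intro A.finsum_cong') (auto simp: eq)
  also have "... = c g (\<Oplus>w\<in>\<Omega>. F w)" using c_finsum[OF g assms(2)] by simp
  finally show ?thesis by simp
 qed
 thus ?thesis using assms(2) by (simp add: fixpts_def)
qed

text \<open>Along the orbit, \<open>F (\<rho> g w)\<close> is \<open>c g (F w)\<close>, and
  \<open>g\<close> matters only modulo the stabiliser. Every Mackey type decomposition below is a
  sum of such orbit sums.\<close>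

lemma orbit_sum:
 assumes "gset G \<Omega> \<rho>" "F : \<Omega> \<rightarrow> $A"
  and eq: "!!g w. g : $G ==> w : \<Omega> ==> F (\<rho> g w) = c g (F w)"
  and w: "w : \<Omega>"
 shows "F w : fixd (gset.stab G \<rho> w)"
  and "(\<Oplus>v\<in>gset.orb G \<rho> w. F v) = tr G (gset.stab G \<rho> w) (F w)"
proof -
 interpret gset G \<Omega> \<rho> by fact
 show f: "F w : fixd (stab w)" using assms by (auto simp: fixpts_def stab_def simp flip: eq)
 let ?r = "%C. \<rho> (SOME g. g : C) w"
 have b: "bij_betw ?r (lcosets \<^sub>G stab w) (orb w)" by (rule orb_bij(1)[OF w])
 have "(\<Oplus>v\<in>orb w. F v) = (\<Oplus>v\<in>?r ` (lcosets \<^sub>G stab w). F v)" using b by (simp add: bij_betw_def)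
 also have "... = (\<Oplus>C\<in>lcosets \<^sub>G stab w. F (?r C))"
  using b assms(2) orb_sub[OF w] by (intro A.finsum_reindex) (auto simp: bij_betw_def)
 also have "... = (\<Oplus>C\<in>lcosets \<^sub>G stab w. c (SOME g. g : C) (F w))"
 proof (rule A.finsum_cong')
  have wA: "F w : $A" using assms by auto
  have *: "F (?r C) = c (SOME g. g : C) (F w) & c (SOME g. g : C) (F w) : $A"
   if C: "C : lcosets \<^sub>G stab w" for C
  proof -
   obtain g where g: "g : $G" "C = g <#\<^sub>G stab w" using C by (auto simp: LCOSETS_def)
   have "?r C = \<rho> g w" using orb_bij(2)[OF w g(1)] g(2) by simp
   thus ?thesis using eq[OF g(1) w] c_rep[OF stab_subgroup[OF w] f g(1)] g c_closed wA by simp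
  qed
  show "!!C. C : lcosets \<^sub>G stab w ==> F (?r C) = c (SOME g. g : C) (F w)" using * by blast
  show "(%C. c (SOME g. g : C) (F w)) : lcosets \<^sub>G stab w \<rightarrow> $A" using * by blast
 qed simp
 finally show "(\<Oplus>v\<in>orb w. F v) = tr G (stab w) (F w)" unfolding transfer_def .
qed

lemma sum_by_orbits:
 assumes "gset G \<Omega> \<rho>" "F : \<Omega> \<rightarrow> $A"
 shows "(\<Oplus>w\<in>\<Omega>. F w) = (\<Oplus>X\<in>gset.orbs G \<Omega> \<rho>. \<Oplus>w\<in>X. F w)"
proof -
 interpret gset G \<Omega> \<rho> by fact
 have "(\<Oplus>w\<in>\<Union>orbs. F w) = finsum A (finsum A F) orbs" using finite_orbs orbs_disjoint assms(2) Union_orbs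
  by (intro A.add.finprod_Union_disjoint) blast+
 thus ?thesis using Union_orbs by simp
qed

text \<open>Puts the summands of a transfer into the form that \<open>equivariant_sum\<close> and
  \<open>orbit_sum\<close> expect: an equivariant function on the cosets of
  \<open>H\<close>.\<close>

lemma coset_fun:
 assumes H: "subgroup H G" and a: "a : fixd H"
 defines "F \<equiv> %C. c (SOME g. g : C) a"
 shows "F : lcosets \<^sub>G H \<rightarrow> $A"
  and "!!g C. g : $G ==> C : lcosets \<^sub>G H ==> F (g <#\<^sub>G C) = c g (F C)"
  and "!!g. g : $G ==> F (g <#\<^sub>G H) = c g a"
proof -
 have aA: "a : $A" using a by (rule fixd_A)
 show 1: "!!g. g : $G ==> F (g <#\<^sub>G H) = c g a" unfolding F_def using c_rep[OF H a] .
 show "F : lcosets \<^sub>G H \<rightarrow> $A" using 1 c_closed aA by (auto simp: LCOSETS_def)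
 show "F (g <#\<^sub>G C) = c g (F C)" if g: "g : $G" and C: "C : lcosets \<^sub>G H" for g C
 proof -
  obtain x where x: "x : $G" "C = x <#\<^sub>G H" using C unfolding LCOSETS_def by blast
  have "g <#\<^sub>G C = (g \<cdot>\<^sub>G x) <#\<^sub>G H" unfolding x(2) using G.lcos_m_assoc[OF subgroup.subset[OF H] g x(1)] .
  thus ?thesis using 1 x g c_mult aA by simp
 qed
qed

lemma tr_fixd:
 assumes H: "subgroup H G" and a: "a : fixd H"
 shows "tr G H a : fixd ($G)" unfolding transfer_def using equivariant_sum[OF G.lcosets_gset[OF finite_G H] coset_fun(1,2)[OF H a]] by simp

lemma transfer_closed:
 assumes H: "subgroup H G" and a: "a : fixd H"
 shows "tr G H a : $A" using tr_fixd[OF assms] fixd_A by blast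

lemma lcoset_stab:
 assumes H: "subgroup H G" and x: "x : $G"
 shows "gset.stab G (%g C. g <#\<^sub>G C) (x <#\<^sub>G H) = (%h. x \<cdot>\<^sub>G h \<cdot>\<^sub>G inv \<^sub>G x) ` H"
proof -
 interpret gs: gset G "lcosets \<^sub>G H" "%g C. g <#\<^sub>G C" by (rule G.lcosets_gset[OF finite_G H])
 have sub: "H <= $G" using H by (rule subgroup.subset)
 have "gs.stab H = H" using G.lcos_fixed_iff[OF H G.one_closed] sub by (auto simp: gs.stab_def G.lcos_mult_one[OF sub])
 moreover have "H : lcosets \<^sub>G H" using G.lcos_mult_one[OF sub] by (auto simp: LCOSETS_def intro!: bexI[of _ "\<one>\<^sub>G"])
 ultimately show ?thesis using gs.stab_translate[of H x] x by simp
qed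

lemma lcoset_orb:
 assumes H: "subgroup H G" and x: "x : $G"
 shows "gset.orb G (%g C. g <#\<^sub>G C) (x <#\<^sub>G H) = lcosets \<^sub>G H"
proof -
 interpret gs: gset G "lcosets \<^sub>G H" "%g C. g <#\<^sub>G C" by (rule G.lcosets_gset[OF finite_G H])
 have sub: "H <= $G" using H by (rule subgroup.subset)
 have "y <#\<^sub>G H = (y \<cdot>\<^sub>G inv \<^sub>G x) <#\<^sub>G (x <#\<^sub>G H)" if "y : $G" for y
  using that x by (simp add: G.lcos_m_assoc[OF sub] G.m_assoc)
 hence "y <#\<^sub>G H : gs.orb (x <#\<^sub>G H)" if "y : $G" for y using that x unfolding gs.orb_def by blast
 moreover have "gs.orb (x <#\<^sub>G H) <= lcosets \<^sub>G H" using x by (intro gs.orb_sub) (auto simp: LCOSETS_def)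
 ultimately show ?thesis by (auto simp: LCOSETS_def)
qed

text \<open>The cosets of \<open>H\<close> form a single orbit. Evaluating its sum from the point
  \<open>xH\<close>, whose stabiliser is the conjugate of \<open>H\<close> by \<open>x\<close>,
  instead of from \<open>H\<close> gives the other side.\<close>

lemma transfer_conj:
 assumes H: "subgroup H G" and a: "a : fixd H" and x: "x : $G"
 shows "tr G ((%h. x \<cdot>\<^sub>G h \<cdot>\<^sub>G inv \<^sub>G x) ` H) (c x a) = tr G H a"
proof -
 have "x <#\<^sub>G H : lcosets \<^sub>G H" using x by (auto simp: LCOSETS_def)
 from orbit_sum(2)[OF G.lcosets_gset[OF finite_G H] coset_fun(1,2)[OF H a] this]
 show ?thesis using coset_fun(3)[OF H a x] by (simp add: lcoset_orb[OF H x] lcoset_stab[OF H x] transfer_def)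
qed

lemma transfer_add:
 assumes H: "subgroup H G" and "a : fixd H" "b : fixd H"
 shows "tr G H (a \<oplus> b) = tr G H a \<oplus> tr G H b"
proof -
 have ab: "a \<oplus> b : fixd H" using fixd_cl(1)[OF subgroup.subset[OF H]] assms by blast
 have "c (SOME g. g : C) (a \<oplus> b) = c (SOME g. g : C) a \<oplus> c (SOME g. g : C) b"
  if "C : lcosets \<^sub>G H" for C using that fixd_A[OF assms(2)] fixd_A[OF assms(3)] by (auto simp: LCOSETS_def c_rep[OF H] ab assms c_add)
 hence "tr G H (a \<oplus> b) = (\<Oplus>C\<in>lcosets \<^sub>G H. c (SOME g. g : C) a \<oplus> c (SOME g. g : C) b)" unfolding transfer_def
  using coset_fun(1)[OF H assms(2)] coset_fun(1)[OF H assms(3)] by (intro A.finsum_cong') auto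
 thus ?thesis unfolding transfer_def using A.finsum_addf[OF coset_fun(1)[OF H assms(2)] coset_fun(1)[OF H assms(3)]] by simp
qed

lemma transfer_zero: assumes H: "subgroup H G" shows "tr G H \<zero> = \<zero>"
proof -
 have "\<zero> : fixd H" using fixd_cl(5)[OF subgroup.subset[OF H]] .
 hence "c (SOME g. g : C) \<zero> = \<zero>" if "C : lcosets \<^sub>G H" for C using that c_rep[OF H] c_zero unfolding LCOSETS_def by auto
 thus ?thesis unfolding transfer_def by (rule A.add.finprod_one_eqI)
qed

lemma transfer_mult_left:
 assumes H: "subgroup H G" and "a : fixd H" and b: "b : fixd ($G)"
 shows "tr G H (b \<cdot> a) = b \<cdot> tr G H a"
proof -
 have bH: "b : fixd H" using fixd_mono[OF subgroup.subset[OF H]] b by blast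
 have ab: "b \<cdot> a : fixd H" using fixd_cl(2)[OF subgroup.subset[OF H]] assms bH by blast
 have "b \<cdot> tr G H a = (\<Oplus>C\<in>lcosets \<^sub>G H. b \<cdot> c (SOME g. g : C) a)" unfolding transfer_def
  using coset_fun(1)[OF H assms(2)] b fixd_A G.lcosets_gset[OF finite_G H] by (intro A.finsum_rdistr) (auto simp: gset_def gset_axioms_def)
 also have "... = tr G H (b \<cdot> a)" unfolding transfer_def using fixdD[OF b] fixd_A[OF b] fixd_A[OF assms(2)]
  by (intro A.finsum_cong') (auto simp: LCOSETS_def c_rep[OF H] ab assms(2) c_times c_closed)
 finally show ?thesis by simp
qed

lemma transfer_mult_right:
 assumes H: "subgroup H G" and "a : fixd H" and b: "b : fixd ($G)"
 shows "tr G H (a \<cdot> b) = tr G H a \<cdot> b"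
proof -
 have bH: "b : fixd H" using fixd_mono[OF subgroup.subset[OF H]] b by blast
 have ab: "a \<cdot> b : fixd H" using fixd_cl(2)[OF subgroup.subset[OF H]] assms bH by blast
 have "tr G H a \<cdot> b = (\<Oplus>C\<in>lcosets \<^sub>G H. c (SOME g. g : C) a \<cdot> b)" unfolding transfer_def
  using coset_fun(1)[OF H assms(2)] b fixd_A G.lcosets_gset[OF finite_G H] by (intro A.finsum_ldistr) (auto simp: gset_def gset_axioms_def)
 also have "... = tr G H (a \<cdot> b)" unfolding transfer_def using fixdD[OF b] fixd_A[OF b] fixd_A[OF assms(2)]
  by (intro A.finsum_cong') (auto simp: LCOSETS_def c_rep[OF H] ab assms(2) c_times c_closed)
 finally show ?thesis by simp
qed

text \<open>Transitivity of relative traces: the cosets of \<open>D\<close> in \<open>G\<close> are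
  fibred over those of \<open>S\<close>, and the fibre over a coset is the translate of the set of
  cosets of \<open>D\<close> in \<open>S\<close>.\<close>

lemma transfer_trans:
 assumes S: "subgroup S G" and D: "subgroup D (G(|carrier := S|))" and a: "a : fixd D"
 shows "tr G S (tr (G(|carrier := S|)) D a) = tr G D a"
proof -
 let ?S = "G(|carrier := S|)"
 interpret S: galgebra A ?S c by (rule restrict[OF S])
 have SG: "S <= $G" using S by (rule subgroup.subset)
 have DS: "D <= S" using subgroup.subset[OF D] by simp
 have DG: "subgroup D G" using G.incl_subgroup[OF S D] .
 have DsG: "D <= $G" using DS SG by blast
 have lS: "lcosets \<^sub>?S D = (%s. s <#\<^sub>G D) ` S" by (auto simp: LCOSETS_def l_coset_def)
 have lG: "lcosets \<^sub>G D = (%s. s <#\<^sub>G D) ` $G" by (auto simp: LCOSETS_def)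
 let ?F = "%C. c (SOME g. g : C) a"
 let ?t = "tr ?S D a"
 have t: "?t : fixd S" using S.tr_fixd[OF D a] by simp
 note F = coset_fun[OF DG a]
 \<comment> \<open>The fibre over the coset \<open>E\<close>: the cosets of \<open>D\<close>
   contained in \<open>E\<close>, written as a translate by the representative of \<open>E\<close>
   that \<open>transfer\<close> uses.\<close>
 let ?P = "%E. (%C. (SOME g. g : E) <#\<^sub>G C) ` (lcosets \<^sub>?S D)"
 have P: "?P (x <#\<^sub>G S) = {C : lcosets \<^sub>G D. C <= x <#\<^sub>G S}" if x: "x : $G" for x
 proof -
  have "(SOME g. g : x <#\<^sub>G S) : x <#\<^sub>G S" by (rule someI[where P="%h. h : x <#\<^sub>G S"], rule G.lcos_self[OF x S])
  moreover define y where "y = (SOME g. g : x <#\<^sub>G S)"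
  ultimately have y: "y : x <#\<^sub>G S" by simp
  have yG: "y : $G" using G.l_coset_subset_G[OF SG x] y by blast
  have xy: "x <#\<^sub>G S = y <#\<^sub>G S" using G.l_repr_independence[OF y x S] .
  have e1: "?P (x <#\<^sub>G S) = (%C. y <#\<^sub>G C) ` (lcosets \<^sub>?S D)" unfolding y_def ..
  have e3: "{C : lcosets \<^sub>G D. C <= y <#\<^sub>G S} = {C : lcosets \<^sub>G D. C <= x <#\<^sub>G S}" using xy by simp
  have e2: "(%C. y <#\<^sub>G C) ` (lcosets \<^sub>?S D) = {C : lcosets \<^sub>G D. C <= y <#\<^sub>G S}"
  proof (safe)
   fix C assume "C : lcosets \<^sub>?S D"
   then obtain s where s: "s : S" "C = s <#\<^sub>G D" unfolding lS by blast
   have e: "y <#\<^sub>G C = (y \<cdot>\<^sub>G s) <#\<^sub>G D" using G.lcos_m_assoc[OF DsG yG, of s] s SG by auto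
   thus "y <#\<^sub>G C : lcosets \<^sub>G D" unfolding lG using yG s SG by auto
   fix z assume "z : y <#\<^sub>G C"
   hence "z : (y \<cdot>\<^sub>G s) <#\<^sub>G D" using e by simp
   then obtain d where d: "d : D" "z = y \<cdot>\<^sub>G s \<cdot>\<^sub>G d" unfolding l_coset_def by blast
   hence "s \<cdot>\<^sub>G d : S" "z = y \<cdot>\<^sub>G (s \<cdot>\<^sub>G d)" using s DS subgroup.m_closed[OF S] SG yG by (auto intro!: G.m_assoc)
   thus "z : y <#\<^sub>G S" unfolding l_coset_def by blast
  next
   fix C assume C: "C : lcosets \<^sub>G D" "C <= y <#\<^sub>G S"
   then obtain g where g: "g : $G" "C = g <#\<^sub>G D" unfolding lG by blast
   have "g : y <#\<^sub>G S" using C(2) G.lcos_self[OF g(1) DG] g by auto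
   then obtain s where s: "s : S" "g = y \<cdot>\<^sub>G s" unfolding l_coset_def by blast
   have "C = y <#\<^sub>G (s <#\<^sub>G D)" using G.lcos_m_assoc[OF DsG yG, of s] s SG g by auto
   thus "C : (%C. y <#\<^sub>G C) ` (lcosets \<^sub>?S D)" unfolding lS using s by blast
  qed
  show ?thesis by (rule trans[OF e1 trans[OF e2 e3]])
 qed
 have U: "lcosets \<^sub>G D = \<Union>(?P ` (lcosets \<^sub>G S))"
 proof -
  have "EX E:lcosets \<^sub>G S. C <= E" if C: "C : lcosets \<^sub>G D" for C
  proof -
   obtain g where g: "g : $G" "C = g <#\<^sub>G D" using C unfolding lG by blast
   thus ?thesis using DS by (auto simp: LCOSETS_def l_coset_def)
  qed
  moreover have "?P E = {C : lcosets \<^sub>G D. C <= E}" if E: "E : lcosets \<^sub>G S" for E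
  proof -
   obtain x where x: "x : $G" "E = x <#\<^sub>G S" using E unfolding LCOSETS_def by blast
   show ?thesis unfolding x(2) by (rule P[OF x(1)])
  qed
  ultimately show ?thesis by auto
 qed
 have fin: "finite (lcosets \<^sub>G S)" "finite (lcosets \<^sub>?S D)" using finite_G SG by (auto simp: LCOSETS_def finite_subset)
 have inner: "(\<Oplus>C\<in>?P (x <#\<^sub>G S). ?F C) = c x ?t" if x: "x : $G" for x
 proof -
  have "(SOME g. g : x <#\<^sub>G S) : x <#\<^sub>G S" by (rule someI[where P="%h. h : x <#\<^sub>G S"], rule G.lcos_self[OF x S])
  moreover define y where "y = (SOME g. g : x <#\<^sub>G S)"
  ultimately have y: "y : x <#\<^sub>G S" by simp
  have yG: "y : $G" using G.l_coset_subset_G[OF SG x] y by blast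
  have lSG: "lcosets \<^sub>?S D <= lcosets \<^sub>G D" unfolding lS lG using SG by blast
  have sub: "C <= $G" if "C : lcosets \<^sub>?S D" for C using that lSG subgroup.lcosets_carrier[OF DG G.is_group] by blast
  have inj: "inj_on (%C. y <#\<^sub>G C) (lcosets \<^sub>?S D)"
  proof (rule inj_onI)
   fix C C' assume "C : lcosets \<^sub>?S D" "C' : lcosets \<^sub>?S D" "y <#\<^sub>G C = y <#\<^sub>G C'"
   hence "inv \<^sub>G y <#\<^sub>G (y <#\<^sub>G C) = inv \<^sub>G y <#\<^sub>G (y <#\<^sub>G C')" "C <= $G" "C' <= $G" using sub by auto
   thus "C = C'" using yG by (simp add: G.lcos_m_assoc G.lcos_mult_one)
  qed
  have "(\<Oplus>C\<in>(%C. y <#\<^sub>G C) ` (lcosets \<^sub>?S D). ?F C) = (\<Oplus>C\<in>lcosets \<^sub>?S D. ?F (y <#\<^sub>G C))"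
  proof (rule A.finsum_reindex[OF _ inj])
   show "?F : (%C. y <#\<^sub>G C) ` (lcosets \<^sub>?S D) \<rightarrow> $A" using F(1) P[OF x] by (auto simp flip: y_def)
  qed
  also have "... = (\<Oplus>C\<in>lcosets \<^sub>?S D. c y (?F C))"
   using F(1) F(2)[OF yG] lSG c_closed[OF yG] by (intro A.finsum_cong') (auto simp: subset_iff)
  also have "... = c y ?t" unfolding transfer_def using F(1) lSG by (intro c_finsum[OF yG, symmetric]) auto
  also have "... = c x ?t" using c_rep[OF S t x] by (simp flip: y_def)
  finally show ?thesis by (simp flip: y_def)
 qed
 have "tr G D a = (\<Oplus>C\<in>\<Union>(?P ` (lcosets \<^sub>G S)). ?F C)" unfolding transfer_def using U by simp
 also have "... = (\<Oplus>E\<in>lcosets \<^sub>G S. \<Oplus>C\<in>?P E. ?F C)"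
 proof (rule A.add.finprod_UN_disjoint)
  show "finite (lcosets \<^sub>G S)" "!!i. i : lcosets \<^sub>G S ==> finite (?P i)" using fin by auto
  show "!!E C. E : lcosets \<^sub>G S ==> C : ?P E ==> ?F C : $A" using F(1) U by auto
  show "pairwise (%i j. disjnt (?P i) (?P j)) (lcosets \<^sub>G S)"
  proof (rule pairwiseI)
   fix E E' assume E: "E : lcosets \<^sub>G S" "E' : lcosets \<^sub>G S" "E ~= E'"
   hence d: "E \<inter> E' = {}" using G.lcos_disjoint[OF S] by blast
   have "C <= E & C ~= {}" if "C : ?P E" "E : lcosets \<^sub>G S" for C E
   proof -
    obtain x where x: "x : $G" "E = x <#\<^sub>G S" using \<open>E : lcosets \<^sub>G S\<close> unfolding LCOSETS_def by blast
    have "C : {C : lcosets \<^sub>G D. C <= E}" using \<open>C : ?P E\<close> unfolding x(2) P[OF x(1)] .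
    hence "C : lcosets \<^sub>G D" "C <= E" by auto
    thus ?thesis using G.lcos_self[OF _ DG] by (auto simp: LCOSETS_def)
   qed
   note k = this
   show "disjnt (?P E) (?P E')" unfolding disjnt_iff
   proof (intro allI notI)
    fix C assume "C : ?P E & C : ?P E'"
    hence "C <= E" "C <= E'" "C ~= {}" using k[of C E] k[of C E'] E by blast+
    thus False using d by auto
   qed
  qed
 qed
 also have "... = (\<Oplus>E\<in>lcosets \<^sub>G S. c (SOME g. g : E) ?t)"
 proof (rule A.finsum_cong')
  show "(%E. c (SOME g. g : E) ?t) : lcosets \<^sub>G S \<rightarrow> $A" using coset_fun(1)[OF S t] .
  fix E assume "E : lcosets \<^sub>G S"
  then obtain x where x: "x : $G" "E = x <#\<^sub>G S" by (auto simp: LCOSETS_def)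
  show "(\<Oplus>C\<in>?P E. ?F C) = c (SOME g. g : E) ?t" unfolding x(2) using inner[OF x(1)] c_rep[OF S t x(1)] by simp
 qed simp
 also have "... = tr G S ?t" unfolding transfer_def[of A c G S] ..
 finally show ?thesis by simp
qed

text \<open>An orbit with more than one point sums to a transfer from a proper subgroup, which
  \<open>h\<close> kills. The map \<open>h\<close> is arbitrary and lives on the fixed points only,
  because it will be the trace, the map to the multiplicity algebra, and \<open>lam\<close> after a
  further transfer.\<close>

lemma additive_fixed_point_sum:
 assumes gs: "gset G \<Omega> \<rho>" and F: "F : \<Omega> \<rightarrow> $A"
  and eq: "!!g w. g : $G ==> w : \<Omega> ==> F (\<rho> g w) = c g (F w)"
  and K: "abelian_monoid K" and h: "h : fixd ($G) \<rightarrow> $K" and h0: "h \<zero> = \<zero>\<^sub>K"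
  and hadd: "!!a b. a : fixd ($G) ==> b : fixd ($G) ==> h (a \<oplus> b) = h a \<oplus>\<^sub>K h b"
  and htr: "!!D a. subgroup D G ==> D ~= $G ==> a : fixd D ==> h (tr G D a) = \<zero>\<^sub>K"
 defines "\<Phi> \<equiv> {w : \<Omega>. ALL g:$G. \<rho> g w = w}"
 shows "h (\<Oplus>w\<in>\<Omega>. F w) = (\<Oplus>\<^sub>K w\<in>\<Phi>. h (F w))"
  and "w : \<Phi> ==> F w : fixd ($G)"
proof -
 interpret gset G \<Omega> \<rho> by fact
 interpret K: abelian_monoid K by fact
 show fx: "F w : fixd ($G)" if "w : \<Phi>" for w
 proof -
  have w: "w : \<Omega>" "ALL g:$G. \<rho> g w = w" using that unfolding \<Phi>_def by auto
  hence "c g (F w) = F w" if "g : $G" for g using eq[OF that w(1)] that by simp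
  thus ?thesis using w F by (auto simp: fixpts_def)
 qed
 have O: "(\<Oplus>v\<in>orb w. F v) = tr G (stab w) (F w)" "F w : fixd (stab w)" "subgroup (stab w) G" if "w : \<Omega>" for w
  using orbit_sum[OF gs F eq that] stab_subgroup[OF that] by auto
 let ?s = "%X. \<Oplus>w\<in>X. F w"
 have sfix: "?s : orbs \<rightarrow> fixd ($G)" unfolding orbs_def using O tr_fixd by auto
 have "h (\<Oplus>w\<in>\<Omega>. F w) = (\<Oplus>\<^sub>K X\<in>orbs. h (?s X))" unfolding sum_by_orbits[OF gs F]
  by (rule A.add_finsum(2)[OF K _ _ _ h h0 hadd sfix])
   (auto simp: fixpts_def c_zero c_add)
 also have "... = (\<Oplus>\<^sub>K X\<in>(%w. {w}) ` \<Phi>. h (?s X))"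
 proof (rule K.add.finprod_mono_neutral_cong_right)
  show "finite orbs" by (rule finite_orbs)
  have sing: "orb w = {w}" if "w : \<Phi>" for w using that G.one_closed unfolding \<Phi>_def orb_def by auto
  thus "(%w. {w}) ` \<Phi> <= orbs" unfolding orbs_def \<Phi>_def by force
  show "(%X. h (?s X)) : orbs \<rightarrow> $K" using sfix h by auto
  fix X assume X: "X : orbs - (%w. {w}) ` \<Phi>"
  then obtain w where w: "w : \<Omega>" "X = orb w" unfolding orbs_def by auto
  have "w ~: \<Phi>" using X w sing by auto
  hence "stab w ~= $G" using w unfolding \<Phi>_def stab_def by auto
  thus "h (?s X) = \<zero>\<^sub>K" using htr O w by simp
 qed simp
 also have "... = (\<Oplus>\<^sub>K w\<in>\<Phi>. h (?s {w}))"
 proof (rule K.finsum_reindex)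
  have "?s {w} = F w" if "w : \<Phi>" for w using fixd_A[OF fx[OF that]] by simp
  thus "(%X. h (?s X)) : (%w. {w}) ` \<Phi> \<rightarrow> $K" using fx h by auto
 qed auto
 also have "... = (\<Oplus>\<^sub>K w\<in>\<Phi>. h (F w))"
 proof (rule K.finsum_cong')
  show "(%w. h (F w)) : \<Phi> \<rightarrow> $K" using fx h by auto
  show "h (?s {w}) = h (F w)" if "w : \<Phi>" for w using fixd_A[OF fx[OF that]] by simp
 qed simp
 finally show "h (\<Oplus>w\<in>\<Omega>. F w) = (\<Oplus>\<^sub>K w\<in>\<Phi>. h (F w))" .
qed

end

lemma (in gset) restrict_gset: assumes H: "subgroup H G" shows "gset (G(|carrier := H|)) \<Omega> \<rho>"
proof -
 have "group (G(|carrier := H|))" using subgroup.subgroup_is_group[OF H is_group] .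
 moreover have "H <= $G" using H by (rule subgroup.subset)
 ultimately show ?thesis unfolding gset_def gset_axioms_def using fin closed one mult by (auto simp: subset_iff)
qed

text \<open>The index divides a power of \<open>p\<close> and is not \<open>1\<close>.\<close>

lemma (in group) card_proper_subgroup_prime_power:
 assumes "finite ($G)" "Factorial_Ring.prime (p::nat)" "card ($G) = p ^ n"
  and "subgroup D G" "D ~= $G"
 shows "p dvd card (lcosets D)"
proof -
 have e: "card (lcosets D) * card D = p ^ n" using l_lagrange[OF assms(1,4)] assms(3) by (simp add: order_def)
 have "card D ~= card ($G)" using assms(1,4,5) card_subset_eq subgroup.subset by blast
 hence "card (lcosets D) ~= 1" using e assms(3) by auto
 moreover have "card (lcosets D) dvd p ^ n" using e by (metis dvd_triv_left)
 ultimately show ?thesis using assms(2) by (metis divides_primepow_nat dvd_power neq0_conv power_0)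
qed

section \<open>Conjugates of subgroups\<close>

definition conjs :: "('g, 'z) monoid_scheme => 'g => 'g set => 'g set"
 where "conjs G x H = (%h. x \<cdot>\<^sub>G h \<cdot>\<^sub>G inv \<^sub>G x) ` H"

context group
begin

lemma conj_inv_elt:
 assumes "x : $G" "h : $G"
 shows "x \<cdot> (inv x \<cdot> h \<cdot> x) \<cdot> inv x = h" "inv x \<cdot> (x \<cdot> h \<cdot> inv x) \<cdot> x = h"
proof -
 have "x \<cdot> (inv x \<cdot> h \<cdot> x) \<cdot> inv x = (x \<cdot> inv x) \<cdot> h \<cdot> (x \<cdot> inv x)"
  using assms by (simp only: m_assoc m_closed inv_closed)
 thus "x \<cdot> (inv x \<cdot> h \<cdot> x) \<cdot> inv x = h" using assms by simp
 have "inv x \<cdot> (x \<cdot> h \<cdot> inv x) \<cdot> x = (inv x \<cdot> x) \<cdot> h \<cdot> (inv x \<cdot> x)"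
  using assms by (simp only: m_assoc m_closed inv_closed)
 thus "inv x \<cdot> (x \<cdot> h \<cdot> inv x) \<cdot> x = h" using assms by simp
qed

lemma mem_conj_set:
 assumes "x : $G" "H <= $G" "g : $G"
 shows "g : conjs G x H \<longleftrightarrow> inv x \<cdot> g \<cdot> x : H"
proof
 assume "g : conjs G x H"
 then obtain h where h: "h : H" "g = x \<cdot> h \<cdot> inv x" unfolding conjs_def by blast
 hence "h : $G" using assms(2) by blast
 thus "inv x \<cdot> g \<cdot> x : H" using conj_inv_elt(2)[OF assms(1), of h] h by simp
next
 assume "inv x \<cdot> g \<cdot> x : H"
 hence "x \<cdot> (inv x \<cdot> g \<cdot> x) \<cdot> inv x : conjs G x H" unfolding conjs_def by blast
 thus "g : conjs G x H" using conj_inv_elt(1)[OF assms(1,3)] by simp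
qed

lemma conj_set_sub: "x : $G ==> H <= $G ==> conjs G x H <= $G" unfolding conjs_def by auto

lemma conj_set_conj:
 assumes "x : $G" "y : $G" "H <= $G"
 shows "conjs G x (conjs G y H) = conjs G (x \<cdot> y) H"
proof -
 have "x \<cdot> (y \<cdot> h \<cdot> inv y) \<cdot> inv x = x \<cdot> y \<cdot> h \<cdot> inv (x \<cdot> y)" if "h : H" for h
 proof -
  have "h : $G" using that assms by auto
  thus ?thesis using assms by (simp add: inv_mult_group m_assoc)
 qed
 thus ?thesis unfolding conjs_def by (force simp: image_image)
qed

lemma conj_set_one: assumes "H <= $G" shows "conjs G \<one> H = H"
proof -
 have "\<one> \<cdot> h \<cdot> inv \<one> = h" if "h : H" for h using that assms by auto
 thus ?thesis unfolding conjs_def by (simp add: image_def)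
qed

lemma conj_set_card: assumes "x : $G" "H <= $G" shows "card (conjs G x H) = card H" unfolding conjs_def
proof (rule card_image, rule inj_onI)
 fix g h assume "g : H" "h : H" "x \<cdot> g \<cdot> inv x = x \<cdot> h \<cdot> inv x"
 thus "g = h" using assms conj_inv_elt(2)[of x] by (metis subsetD)
qed

lemma conj_set_subgroup: assumes x: "x : $G" and H: "subgroup H G"
 shows "subgroup (conjs G x H) G"
proof (rule subgroupI)
 have sub: "H <= $G" using H by (rule subgroup.subset)
 show s: "conjs G x H <= $G" using conj_set_sub[OF x sub] .
 show "conjs G x H ~= {}" unfolding conjs_def using subgroup.one_closed[OF H] by auto
 fix a assume a: "a : conjs G x H"
 hence aG: "a : $G" using s by auto
 have "inv (inv x \<cdot> a \<cdot> x) : H" using a subgroup.m_inv_closed[OF H] mem_conj_set[OF x sub aG] by simp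
 thus "inv a : conjs G x H" using aG x mem_conj_set[OF x sub, of "inv a"] by (simp add: inv_mult_group m_assoc)
 fix b assume b: "b : conjs G x H"
 hence bG: "b : $G" using s by auto
 have "(inv x \<cdot> a \<cdot> x) \<cdot> (inv x \<cdot> b \<cdot> x) : H" using a b subgroup.m_closed[OF H] mem_conj_set[OF x sub] aG bG by simp
 moreover have "(inv x \<cdot> a \<cdot> x) \<cdot> (inv x \<cdot> b \<cdot> x) = inv x \<cdot> (a \<cdot> b) \<cdot> x"
 proof -
  have "x \<cdot> (inv x \<cdot> (b \<cdot> x)) = b \<cdot> x" using x bG by (simp add: m_assoc[symmetric])
  thus ?thesis using x aG bG by (simp add: m_assoc)
 qed
 ultimately show "a \<cdot> b : conjs G x H" using aG bG mem_conj_set[OF x sub, of "a \<cdot> b"] by simp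
qed

lemma conj_set_eqI:
 assumes "finite ($G)" "x : $G" "H <= $G" "H <= conjs G x H"
 shows "conjs G x H = H"
proof -
 have "finite (conjs G x H)" using assms conj_set_sub finite_subset by metis
 thus ?thesis using assms conj_set_card[of x H] card_subset_eq by metis
qed

lemma conj_set_fixed_inv:
 assumes "x : $G" "H <= $G" "conjs G x H = H"
 shows "conjs G (inv x) H = H" using conj_set_conj[of "inv x" x H] conj_set_one[of H] assms by simp

lemma coset_fixed_iff:
 assumes fin: "finite ($G)" and S: "subgroup S G" and D: "D <= $G" and x: "x : $G"
 shows "(ALL g:D. g <# (x <# S) = x <# S) \<longleftrightarrow> D <= conjs G x S"
proof -
 have "g <# (x <# S) = x <# S \<longleftrightarrow> g : conjs G x S" if "g : D" for g
 proof -
  have g: "g : $G" using that D by blast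
  show ?thesis using lcos_fixed_iff[OF S x g] mem_conj_set[OF x subgroup.subset[OF S] g] by simp
 qed
 thus ?thesis by blast
qed

end

text \<open>The case in mind: \<open>A\<close> is the endomorphism ring of a module over the
  coefficient ring, \<open>K\<close> the residue field, \<open>t\<close> the trace reduced modulo
  the maximal ideal, \<open>lam\<close> the residue map of the local ring \<open>A^G\<close>, and
  \<open>Sc\<close> the scalars, which realise every value of \<open>lam\<close> by a central
  element.\<close>

locale traced_galgebra = galgebra A G c + K: "domain" K
 for A :: "('a, 'y) ring_scheme" (structure) and G :: "('g, 'z) monoid_scheme" and c
  and K :: "('k, 'w) ring_scheme" +
 fixes t :: "'a => 'k" and lam :: "'a => 'k" and Sc :: "'a set" and p :: nat
 assumes prime_p: "Factorial_Ring.prime p"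
  and char_K: "add_pow K p \<one>\<^sub>K = \<zero>\<^sub>K"
  and t_closed: "a : $A ==> t a : $K"
  and t_add: "a : $A ==> b : $A ==> t (a \<oplus> b) = t a \<oplus>\<^sub>K t b"
  and t_comm: "a : $A ==> b : $A ==> t (a \<cdot> b) = t (b \<cdot> a)"
  and t_c: "g : $G ==> a : $A ==> t (c g a) = t a"
  and Sc_fixd: "Sc <= fixpts A c ($G)"
  and Sc_central: "s : Sc ==> a : $A ==> s \<cdot> a = a \<cdot> s"
  and lam_closed: "a : fixpts A c ($G) ==> lam a : $K"
  and lam_add: "a : fixpts A c ($G) ==> b : fixpts A c ($G) ==>
   lam (a \<oplus> b) = lam a \<oplus>\<^sub>K lam b"
  and lam_mult: "a : fixpts A c ($G) ==> b : fixpts A c ($G) ==>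
   lam (a \<cdot> b) = lam a \<cdot>\<^sub>K lam b"
  and lam_one: "lam \<one> = \<one>\<^sub>K"
  and lam_unit: "a : fixpts A c ($G) ==> lam a ~= \<zero>\<^sub>K ==>
   EX b:fixpts A c ($G). a \<cdot> b = \<one> & b \<cdot> a = \<one>"
  and lam_scalar: "a : fixpts A c ($G) ==> EX s:Sc. lam s = lam a"
begin

text \<open>Higman's criterion taken as the definition; \<open>relproj_iff\<close> and
  \<open>vertex_iff\<close> identify \<open>relproj\<close> and \<open>vtx\<close> with relative
  projectivity and vertices of the module.\<close>

definition relproj where "relproj H \<longleftrightarrow> (EX a:fixd H. tr G H a = \<one>)"
definition vtx where "vtx S \<longleftrightarrow> subgroup S G & relproj S &
 (\<forall>P. subgroup P G & relproj P & P <= S --> P = S)"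

lemma fixdG_closed:
 "a : fixd ($G) ==> b : fixd ($G) ==> a \<oplus> b : fixd ($G)"
 "a : fixd ($G) ==> b : fixd ($G) ==> a \<cdot> b : fixd ($G)"
 "a : fixd ($G) ==> \<ominus> a : fixd ($G)"
 "\<zero> : fixd ($G)" "\<one> : fixd ($G)" using fixd_cl[of "$G"] by auto

lemma t_zero: "t \<zero> = \<zero>\<^sub>K" using t_add[of \<zero> \<zero>] t_closed[of \<zero>] by (simp add: K.add.r_cancel_one')

lemma lam_zero: "lam \<zero> = \<zero>\<^sub>K"
 using lam_add[of \<zero> \<zero>] lam_closed[of \<zero>] fixdG_closed by (simp add: K.add.r_cancel_one')

lemma lam_neg: assumes "a : fixd ($G)" shows "lam (\<ominus> a) = \<ominus>\<^sub>K lam a"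
proof -
 have "lam (\<ominus> a) \<oplus>\<^sub>K lam a = \<zero>\<^sub>K"
  using lam_add[of "\<ominus> a" a] assms fixdG_closed fixd_A[OF assms] lam_zero by (simp add: A.l_neg)
 thus ?thesis using assms lam_closed fixdG_closed by (simp add: K.minus_equality)
qed

lemma lam_minus: "a : fixd ($G) ==> b : fixd ($G) ==> lam (a \<ominus> b) = lam a \<ominus>\<^sub>K lam b"
 using lam_add[of a "\<ominus> b"] lam_neg fixdG_closed by (simp add: A.minus_eq K.minus_eq)

lemma t_finsum: "f : I \<rightarrow> $A ==> t (\<Oplus>i\<in>I. f i) = (\<Oplus>\<^sub>K i\<in>I. t (f i))"
 using A.add_finsum(2)[OF K.abelian_monoid_axioms, of "$A" t f I] t_closed t_zero t_add by auto

lemma lam_finsum: "f : I \<rightarrow> fixd ($G) ==> lam (\<Oplus>i\<in>I. f i) = (\<Oplus>\<^sub>K i\<in>I. lam (f i))"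
 using A.add_finsum(2)[OF K.abelian_monoid_axioms, of "fixd ($G)" lam f I]
  lam_closed lam_zero lam_add fixdG_closed subsetI[of "fixd ($G)" "$A", OF fixd_A] by auto

lemma K_multiple: assumes "p dvd n" "k : $K" shows "add_pow K n k = \<zero>\<^sub>K"
proof -
 obtain m where m: "n = p * m" using assms(1) by (rule dvdE)
 have "add_pow K p k = add_pow K p \<one>\<^sub>K \<cdot>\<^sub>K k" using assms(2) by (simp add: K.add_pow_ldistr)
 hence "add_pow K p k = \<zero>\<^sub>K" using assms(2) char_K by simp
 thus ?thesis unfolding m K.add.nat_pow_pow[OF assms(2), symmetric] using K.add.nat_pow_one[of m] by simp
qed

text \<open>A transfer with nonzero residue is a unit of the local ring \<open>A^G\<close>, and its
  inverse, being fixed by \<open>G\<close>, can be moved inside the transfer.\<close>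

lemma lam_transfer_relproj:
 assumes H: "subgroup H G" and a: "a : fixd H" and "lam (tr G H a) ~= \<zero>\<^sub>K"
 shows "relproj H"
proof -
 obtain b where b: "b : fixd ($G)" "tr G H a \<cdot> b = \<one>" using lam_unit[OF tr_fixd[OF H a] assms(3)] by blast
 hence "tr G H (a \<cdot> b) = \<one>" using transfer_mult_right[OF H a b(1)] by simp
 moreover have "a \<cdot> b : fixd H" using fixd_cl(2)[OF subgroup.subset[OF H] a] b(1) fixd_mono[OF subgroup.subset[OF H]] by blast
 ultimately show ?thesis unfolding relproj_def by blast
qed

lemma relproj_conj:
 assumes H: "subgroup H G" and x: "x : $G" and r: "relproj H"
 shows "relproj (conjs G x H)"
proof -
 obtain a where a: "a : fixd H" "tr G H a = \<one>" using r unfolding relproj_def by blast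
 thus ?thesis unfolding relproj_def conjs_def using c_conj_fixd[OF subgroup.subset[OF H] a(1) x] transfer_conj[OF H a(1) x] by auto
qed

lemma vtx_conj:
 assumes x: "x : $G" and v: "vtx S"
 shows "vtx (conjs G x S)"
proof -
 have S: "subgroup S G" using v by (simp add: vtx_def)
 have Ss: "S <= $G" using S by (rule subgroup.subset)
 have "P = conjs G x S" if P: "subgroup P G" "relproj P" "P <= conjs G x S" for P
 proof -
  have Ps: "P <= $G" using P(1) by (rule subgroup.subset)
  have "conjs G (inv \<^sub>G x) P <= conjs G (inv \<^sub>G x) (conjs G x S)" using P(3) unfolding conjs_def by auto
  also have "... = S" using x Ss by (simp add: G.conj_set_conj G.conj_set_one)
  finally have "conjs G (inv \<^sub>G x) P = S" using v relproj_conj[OF P(1) _ P(2)] G.conj_set_subgroup[OF _ P(1)] x by (simp add: vtx_def)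
  hence "conjs G x S = conjs G x (conjs G (inv \<^sub>G x) P)" by simp
  thus ?thesis using x Ps by (simp add: G.conj_set_conj G.conj_set_one)
 qed
 thus ?thesis unfolding vtx_def using G.conj_set_subgroup[OF x S] relproj_conj[OF S x] v by (auto simp: vtx_def)
qed

lemma lam_transfer_proper:
 assumes "vtx S" "subgroup D G" "D <= S" "D ~= S" "a : fixd D"
 shows "lam (tr G D a) = \<zero>\<^sub>K" using lam_transfer_relproj[OF assms(2,5)] assms unfolding vtx_def by blast

text \<open>As \<open>t\<close> is invariant under conjugation, it takes the transfer to
  \<open>|S:D|\<close> times \<open>t a\<close>, and that index is divisible by the
  characteristic.\<close>

lemma t_transfer_proper:
 assumes S: "subgroup S G" and c: "card S = p ^ n" and D: "subgroup D (G(|carrier := S|))"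
  and neq: "D ~= S" and a: "a : fixd D"
 shows "t (tr (G(|carrier := S|)) D a) = \<zero>\<^sub>K"
proof -
 interpret S: galgebra A "G(|carrier := S|)" c by (rule restrict[OF S])
 have SG: "S <= $G" using S by (rule subgroup.subset)
 note F = S.coset_fun[OF D a]
 have aA: "a : $A" using a by (rule fixd_A)
 have tF: "t (c (SOME g. g : C) a) = t a" if "C : lcosets\<^bsub>G(|carrier := S|)\<^esub> D" for C
 proof -
  obtain g where g: "g : S" "C = g <#\<^bsub>G(|carrier := S|)\<^esub> D" using \<open>C : _\<close> unfolding LCOSETS_def by auto
  hence "c (SOME g. g : C) a = c g a" using F(3)[of g] by simp
  thus ?thesis using t_c[of g a] g SG aA by auto
 qed
 have "t (tr (G(|carrier := S|)) D a) = (\<Oplus>\<^sub>K C\<in>lcosets\<^bsub>G(|carrier := S|)\<^esub> D. t (c (SOME g. g : C) a))"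
  unfolding transfer_def by (rule t_finsum[OF F(1)])
 also have "... = (\<Oplus>\<^sub>K C\<in>lcosets\<^bsub>G(|carrier := S|)\<^esub> D. t a)" using tF t_closed[OF aA] by (intro K.finsum_cong') auto
 also have "... = add_pow K (card (lcosets\<^bsub>G(|carrier := S|)\<^esub> D)) (t a)" using t_closed[OF aA] by (rule K.add.finprod_const)
 also have "... = \<zero>\<^sub>K" using S.G.card_proper_subgroup_prime_power[OF S.finite_G prime_p _ D] c neq t_closed[OF aA]
  by (intro K_multiple) auto
 finally show ?thesis .
qed

text \<open>Writing \<open>1 = Tr\<^sub>S\<^sup>G(\<sigma>)\<close> and \<open>a = a \<cdot> 1\<close>, the group \<open>D\<close> permutes the summands.\<close>

lemma additive_decomposition:
 assumes D: "subgroup D G" and S: "subgroup S G" and \<sigma>: "\<sigma> : fixd S" "tr G S \<sigma> = \<one>" and a: "a : fixd D"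
  and L: "abelian_monoid L" and h: "h : fixd D \<rightarrow> $L" and h0: "h \<zero> = \<zero>\<^sub>L"
  and hadd: "!!a b. a : fixd D ==> b : fixd D ==> h (a \<oplus> b) = h a \<oplus>\<^sub>L h b"
  and htr: "!!D' a. subgroup D' (G(|carrier := D|)) ==> D' ~= D ==> a : fixd D' ==>
   h (tr (G(|carrier := D|)) D' a) = \<zero>\<^sub>L"
 defines "\<Phi> \<equiv> {C : lcosets \<^sub>G S. ALL g:D. g <#\<^sub>G C = C}"
 shows "h a = (\<Oplus>\<^sub>L C\<in>\<Phi>. h (a \<cdot> c (SOME g. g : C) \<sigma>))"
  and "C : \<Phi> ==> a \<cdot> c (SOME g. g : C) \<sigma> : fixd D"
proof -
 interpret D: galgebra A "G(|carrier := D|)" c by (rule restrict[OF D])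
 have DG: "D <= $G" using D by (rule subgroup.subset)
 have aA: "a : $A" using a by (rule fixd_A)
 have carrier_restrict: "$(G(|carrier := D|)) = D" by simp
 have gs: "gset (G(|carrier := D|)) (lcosets \<^sub>G S) (%g C. g <#\<^sub>G C)" using gset.restrict_gset[OF G.lcosets_gset[OF finite_G S] D] .
 note F = coset_fun[OF S \<sigma>(1)]
 let ?F = "%C. a \<cdot> c (SOME g. g : C) \<sigma>"
 have F1: "?F : lcosets \<^sub>G S \<rightarrow> $A" using F(1) aA by auto
 have F2: "?F (g <#\<^sub>G C) = c g (?F C)" if "g : $(G(|carrier := D|))" "C : lcosets \<^sub>G S" for g C
 proof -
  have g: "g : D" "g : $G" using that DG by auto
  have "c g (?F C) = c g a \<cdot> c g (c (SOME g. g : C) \<sigma>)" using F(1) that(2) by (intro c_times[OF g(2) aA]) auto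
  thus ?thesis using F(2)[OF g(2) that(2)] fixdD[OF a g(1)] by simp
 qed
 have "a = a \<cdot> tr G S \<sigma>" using \<sigma>(2) aA by simp
 also have "... = (\<Oplus>C\<in>lcosets \<^sub>G S. ?F C)" unfolding transfer_def using F(1) aA G.lcosets_gset[OF finite_G S]
  by (intro A.finsum_rdistr) (auto simp: gset_def gset_axioms_def)
 finally have e: "a = (\<Oplus>C\<in>lcosets \<^sub>G S. ?F C)" .
 note r = D.additive_fixed_point_sum[where h = h and \<rho> = "%g C. g <#\<^sub>G C" and F = ?F,
   OF gs F1 F2 L _ h0, unfolded carrier_restrict, OF _ _ h hadd htr]
 show "h a = (\<Oplus>\<^sub>L C\<in>\<Phi>. h (a \<cdot> c (SOME g. g : C) \<sigma>))"
 proof -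
  have "h (\<Oplus>C\<in>lcosets \<^sub>G S. ?F C) = (\<Oplus>\<^sub>L C\<in>\<Phi>. h (?F C))" unfolding \<Phi>_def by (rule r(1))
  thus ?thesis by (simp only: e[symmetric])
 qed
 show "C : \<Phi> ==> a \<cdot> c (SOME g. g : C) \<sigma> : fixd D" unfolding \<Phi>_def by (rule r(2))
qed

text \<open>If no conjugate of \<open>S\<close> contains \<open>D\<close>, then \<open>D\<close>
  fixes no coset of \<open>S\<close>, and the expansion of \<open>t a\<close> over the fixed cosets
  is empty.\<close>

lemma t_nonzero_contained:
 assumes D: "subgroup D G" "card D = p ^ n" and S: "subgroup S G" "relproj S"
  and a: "a : fixd D" "t a ~= \<zero>\<^sub>K"
 shows "EX x:$G. D <= conjs G x S"
proof (rule ccontr)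
 assume neg: "\<not> ?thesis"
 obtain \<sigma> where \<sigma>: "\<sigma> : fixd S" "tr G S \<sigma> = \<one>" using S(2) unfolding relproj_def by blast
 have "{C : lcosets \<^sub>G S. ALL g:D. g <#\<^sub>G C = C} = {}"
 proof -
  have "\<not> (ALL g:D. g <#\<^sub>G C = C)" if C: "C : lcosets \<^sub>G S" for C
  proof -
   obtain x where x: "x : $G" "C = x <#\<^sub>G S" using C unfolding LCOSETS_def by blast
   show ?thesis using neg G.coset_fixed_iff[OF finite_G S(1) subgroup.subset[OF D(1)] x(1)] x by simp
  qed
  thus ?thesis by blast
 qed
 moreover have "t : fixd D \<rightarrow> $K" using t_closed fixd_A by auto
 moreover from this have "t a = (\<Oplus>\<^sub>K C\<in>{C : lcosets \<^sub>G S. ALL g:D. g <#\<^sub>G C = C}. t (a \<cdot> c (SOME g. g : C) \<sigma>))"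
  using t_add fixd_A t_transfer_proper[OF D]
  by (intro additive_decomposition(1)[where h = t, OF D(1) S(1) \<sigma> a(1) K.abelian_monoid_axioms _ t_zero]) auto
 ultimately have "t a = \<zero>\<^sub>K" by (simp only: K.finsum_empty)
 thus False using a(2) by simp
qed

end

section \<open>Sources and multiplicity\<close>

text \<open>Here \<open>i\<close> projects onto a source, the corner \<open>i A^S i\<close> is the
  endomorphism ring of that source, \<open>chi\<close> is its residue map and \<open>n\<close> will
  be \<open>t i\<close>, the rank of the source in \<open>K\<close>. The axiom \<open>tr_one\<close>
  says that the module is a summand of the one induced from the source; \<open>t_chi\<close> holds
  because elements of the radical of the corner have trace in the maximal ideal.\<close>

locale source_data = traced_galgebra +
 fixes S :: "'c set" and i x0 y0 :: 'a and chi :: "'a => 'e" and n :: 'e and m :: nat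
 assumes vtx_S: "vtx S" and card_S: "card S = p ^ m"
  and i_fixd: "i : fixpts A c S" and i_idem: "i \<cdot> i = i"
  and x0: "x0 : fixpts A c S" and y0: "y0 : fixpts A c S"
  and tr_one: "transfer A c G S (x0 \<cdot> i \<cdot> y0) = \<one>"
  and n_closed: "n : $K"
  and chi_closed: "a : fixpts A c S ==> i \<cdot> a = a ==> a \<cdot> i = a ==> chi a : $K"
  and chi_add: "a : fixpts A c S ==> i \<cdot> a = a ==> a \<cdot> i = a ==>
   b : fixpts A c S ==> i \<cdot> b = b ==> b \<cdot> i = b ==> chi (a \<oplus> b) = chi a \<oplus>\<^sub>K chi b"
  and chi_mult: "a : fixpts A c S ==> i \<cdot> a = a ==> a \<cdot> i = a ==>
   b : fixpts A c S ==> i \<cdot> b = b ==> b \<cdot> i = b ==> chi (a \<cdot> b) = chi a \<cdot>\<^sub>K chi b"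
  and chi_one: "chi i = \<one>\<^sub>K"
  and chi_scalar: "s : Sc ==> chi (s \<cdot> i) = lam s"
  and chi_unit: "a : fixpts A c S ==> i \<cdot> a = a ==> a \<cdot> i = a ==> chi a ~= \<zero>\<^sub>K ==>
   \<exists>b. b : fixpts A c S & i \<cdot> b = b & b \<cdot> i = b & a \<cdot> b = i & b \<cdot> a = i"
  and t_chi: "a : fixpts A c S ==> i \<cdot> a = a ==> a \<cdot> i = a ==> t a = n \<cdot>\<^sub>K chi a"
begin

definition corner where "corner = {a : fixd S. i \<cdot> a = a & a \<cdot> i = a}"
abbreviation \<sigma> where "\<sigma> \<equiv> x0 \<cdot> i \<cdot> y0"
text \<open>As everything is finite, a coset \<open>xS\<close> is fixed by \<open>S\<close> just
  when \<open>x\<close> normalises \<open>S\<close>: these cosets are the elements of the group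
  \<open>N_G(S)/S\<close>.\<close>

definition \<Phi> where "\<Phi> = {C : lcosets \<^sub>G S. ALL g:S. g <#\<^sub>G C = C}"

lemma S_sub: "subgroup S G" "S <= $G" using vtx_S subgroup.subset by (auto simp: vtx_def)

lemmas fS = fixd_cl[OF S_sub(2)]

lemma fS_carrier: "a : fixd S ==> a : $A" by (rule fixd_A)

lemma fG_S: "a : fixd ($G) ==> a : fixd S" using fixd_mono[OF S_sub(2)] by blast

lemma cornerI: "a : fixd S ==> i \<cdot> a \<cdot> i : corner" unfolding corner_def using fS i_fixd i_idem fS_carrier
 by (auto simp: A.m_assoc) (auto simp: A.m_assoc[symmetric])

lemma corner_cl:
 "a : corner ==> b : corner ==> a \<oplus> b : corner"
 "a : corner ==> b : corner ==> a \<cdot> b : corner"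
 "a : corner ==> \<ominus> a : corner"
 "a : corner ==> b : corner ==> a \<ominus> b : corner"
 "\<zero> : corner" "i : corner"
proof -
 have iA: "i : $A" using i_fixd by (rule fixd_A)
 have cA: "a : $A" if "a : corner" for a using that fixd_A unfolding corner_def by blast
 show add: "a : corner ==> b : corner ==> a \<oplus> b : corner" for a b
  using cA[of a] cA[of b] iA fS unfolding corner_def by (auto simp: A.l_distr A.r_distr)
 show "a : corner ==> b : corner ==> a \<cdot> b : corner"
  using cA[of a] cA[of b] iA fS unfolding corner_def by (simp add: A.m_assoc) (simp add: A.m_assoc[symmetric])
 show neg: "a : corner ==> \<ominus> a : corner" for a using cA[of a] iA fS unfolding corner_def by (auto simp: A.l_minus A.r_minus)
 show "a : corner ==> b : corner ==> a \<ominus> b : corner" using add neg by (simp add: A.minus_eq)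
 show "\<zero> : corner" "i : corner" using iA fS i_fixd i_idem unfolding corner_def by auto
qed

lemma chi_corner:
 "a : corner ==> chi a : $K"
 "a : corner ==> b : corner ==> chi (a \<oplus> b) = chi a \<oplus>\<^sub>K chi b"
 "a : corner ==> b : corner ==> chi (a \<cdot> b) = chi a \<cdot>\<^sub>K chi b"
 "a : corner ==> t a = n \<cdot>\<^sub>K chi a" using chi_closed chi_add chi_mult t_chi unfolding corner_def by auto

lemma chi_zero: "chi \<zero> = \<zero>\<^sub>K"
 using chi_corner(1)[of \<zero>] chi_corner(2)[of \<zero> \<zero>] corner_cl(5) by (simp add: K.add.r_cancel_one')

lemma chi_minus: assumes "a : corner" "b : corner" shows "chi (a \<ominus> b) = chi a \<ominus>\<^sub>K chi b"
proof -
 have bA: "a : $A" "b : $A" using assms fixd_A unfolding corner_def by auto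
 have "chi (\<ominus> b) \<oplus>\<^sub>K chi b = \<zero>\<^sub>K"
  using chi_corner(2)[of "\<ominus> b" b] assms corner_cl bA chi_zero by (simp add: A.l_neg)
 hence "chi (\<ominus> b) = \<ominus>\<^sub>K chi b" using assms chi_corner corner_cl by (simp add: K.minus_equality)
 thus ?thesis using chi_corner(2)[of a "\<ominus> b"] assms corner_cl by (simp add: A.minus_eq K.minus_eq)
qed

lemma \<sigma>_fixd: "\<sigma> : fixd S" using fS x0 y0 i_fixd by auto

lemma \<Phi>_rep:
 assumes C: "C : \<Phi>"
 shows "EX x:$G. C = x <#\<^sub>G S & conjs G x S = S & (ALL a:fixd S. c (SOME g. g : C) a = c x a)"
proof -
 obtain x where x: "x : $G" "C = x <#\<^sub>G S" using C unfolding \<Phi>_def LCOSETS_def by blast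
 have "S <= conjs G x S" using C G.coset_fixed_iff[OF finite_G S_sub x(1)] unfolding \<Phi>_def x(2) by blast
 hence "conjs G x S = S" using G.conj_set_eqI[OF finite_G x(1) S_sub(2)] by blast
 thus ?thesis using x c_rep[OF S_sub(1) _ x(1)] by blast
qed

lemma norm_fixd: assumes "x : $G" "conjs G x S = S" "a : fixd S" shows "c x a : fixd S"
 using c_conj_fixd[OF S_sub(2) assms(3,1)] assms(2) unfolding conjs_def by simp

lemma finite_\<Phi>: "finite \<Phi>" using finite_G unfolding \<Phi>_def LCOSETS_def by simp

text \<open>Symmetry of \<open>t\<close> rotates \<open>x i y\<close> into the corner, where
  \<open>t\<close> is \<open>n\<close> times \<open>chi\<close>.\<close>

lemma t_sandwich:
 assumes "x : fixd S" "y : fixd S"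
 shows "t (x \<cdot> i \<cdot> y) = n \<cdot>\<^sub>K chi (i \<cdot> (y \<cdot> x) \<cdot> i)"
proof -
 have A: "x : $A" "y : $A" "i : $A" using assms i_fixd fixd_A by auto
 have "t (x \<cdot> i \<cdot> y) = t ((x \<cdot> i) \<cdot> (i \<cdot> y))" using A i_idem by (metis A.m_assoc A.m_closed)
 also have "... = t ((i \<cdot> y) \<cdot> (x \<cdot> i))" using A by (intro t_comm) auto
 also have "(i \<cdot> y) \<cdot> (x \<cdot> i) = i \<cdot> (y \<cdot> x) \<cdot> i" using A by (simp add: A.m_assoc)
 also have "t ... = n \<cdot>\<^sub>K chi ..." using assms fS by (intro chi_corner(4) cornerI) auto
 finally show ?thesis .
qed

text \<open>Pulling the conjugation by \<open>x\<close> out of the product leaves a sandwich around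
  \<open>i\<close> with the fixed right factor \<open>y0\<close>.\<close>

lemma \<Phi>_term:
 assumes x: "x : $G" "conjs G x S = S" and a: "a : fixd S"
 defines "a' \<equiv> c (inv \<^sub>G x) a"
 shows "a' : fixd S" and "a \<cdot> c x \<sigma> = c x (a' \<cdot> \<sigma>)"
  and "a' \<cdot> \<sigma> = (a' \<cdot> x0) \<cdot> i \<cdot> y0" and "a' \<cdot> x0 : fixd S"
proof -
 have A: "a : $A" "\<sigma> : $A" using a \<sigma>_fixd fixd_A by auto
 show a': "a' : fixd S" unfolding a'_def using norm_fixd[OF _ G.conj_set_fixed_inv[OF x(1) S_sub(2) x(2)] a] x by simp
 show "a \<cdot> c x \<sigma> = c x (a' \<cdot> \<sigma>)" using c_times[OF x(1) fixd_A[OF a'] A(2)] c_inv'[OF x(1) A(1)] unfolding a'_def by simp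
 show "a' \<cdot> x0 : fixd S" using fS a' x0 by blast
 show "a' \<cdot> \<sigma> = (a' \<cdot> x0) \<cdot> i \<cdot> y0" using fixd_A[OF a'] fixd_A[OF x0] fixd_A[OF y0] fixd_A[OF i_fixd]
  by (simp add: A.m_assoc)
qed

lemma t_decomposition:
 assumes a: "a : fixd S"
 shows "t a = (\<Oplus>\<^sub>K C\<in>\<Phi>. t (a \<cdot> c (SOME g. g : C) \<sigma>))"
proof -
 have "t : fixd S \<rightarrow> $K" using t_closed fixd_A by auto
 thus ?thesis unfolding \<Phi>_def using t_add fixd_A t_transfer_proper[OF S_sub(1) card_S]
  by (intro additive_decomposition(1)[where h = t, OF S_sub(1) S_sub(1) \<sigma>_fixd tr_one a
    K.abelian_monoid_axioms _ t_zero]) auto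
qed

text \<open>Conjugation by \<open>x\<close> changes neither \<open>t\<close> nor the transfer, so
  one and the same \<open>b\<close> serves for both. This is what later makes the expansions of
  \<open>t\<close> and of \<open>lam\<close> after transfer comparable term by term.\<close>

lemma t_term:
 assumes a: "a : fixd S" and C: "C : \<Phi>"
 shows "EX b:fixd S. t (a \<cdot> c (SOME g. g : C) \<sigma>) = n \<cdot>\<^sub>K chi (i \<cdot> (y0 \<cdot> b) \<cdot> i) &
  tr G S (a \<cdot> c (SOME g. g : C) \<sigma>) = tr G S (b \<cdot> i \<cdot> y0)"
proof -
 obtain x where x: "x : $G" "C = x <#\<^sub>G S" "conjs G x S = S"
  and r: "ALL a:fixd S. c (SOME g. g : C) a = c x a" using \<Phi>_rep[OF C] by blast
 let ?a = "c (inv \<^sub>G x) a"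
 note T = \<Phi>_term[OF x(1,3) a]
 have f: "?a \<cdot> \<sigma> : fixd S" using T(1) \<sigma>_fixd fS by blast
 have e: "a \<cdot> c (SOME g. g : C) \<sigma> = c x (?a \<cdot> \<sigma>)" using r \<sigma>_fixd T(2) by simp
 have "t (a \<cdot> c (SOME g. g : C) \<sigma>) = t (?a \<cdot> \<sigma>)" unfolding e using t_c[OF x(1) fixd_A[OF f]] .
 moreover have "t (?a \<cdot> \<sigma>) = n \<cdot>\<^sub>K chi (i \<cdot> (y0 \<cdot> (?a \<cdot> x0)) \<cdot> i)"
  unfolding T(3) by (rule t_sandwich[OF T(4) y0])
 moreover have "tr G S (c x (?a \<cdot> \<sigma>)) = tr G S (?a \<cdot> \<sigma>)"
  using transfer_conj[OF S_sub(1) f x(1)] x(3) unfolding conjs_def by simp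
 ultimately show ?thesis using T(3,4) e by auto
qed

text \<open>Every term in the expansion of \<open>t a\<close> over \<open>\<Phi>\<close> is a
  multiple of \<open>n\<close>.\<close>

lemma n_nonzero:
 assumes a: "a : fixd S" and "t a ~= \<zero>\<^sub>K"
 shows "n ~= \<zero>\<^sub>K"
proof
 assume n0: "n = \<zero>\<^sub>K"
 have "t (a \<cdot> c (SOME g. g : C) \<sigma>) = \<zero>\<^sub>K" if C: "C : \<Phi>" for C
 proof -
  obtain b where b: "b : fixd S" "t (a \<cdot> c (SOME g. g : C) \<sigma>) = n \<cdot>\<^sub>K chi (i \<cdot> (y0 \<cdot> b) \<cdot> i)"
   using t_term[OF a C] by blast
  thus ?thesis using n0 chi_corner(1)[OF cornerI] fS y0 by simp
 qed
 hence "t a = \<zero>\<^sub>K" unfolding t_decomposition[OF a] by (rule K.add.finprod_one_eqI)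
 thus False using assms by simp
qed

text \<open>An element of the corner on which \<open>chi\<close> does not vanish is invertible there, so proper
 transfers cannot meet it without contradicting the minimality of the vertex.\<close>

lemma chi_proper_transfer:
 assumes D: "subgroup D (G(|carrier := S|))" "D ~= S" and w: "w : fixd D"
  and x: "x : fixd S" and y: "y : fixd S"
 shows "chi (i \<cdot> (x \<cdot> tr (G(|carrier := S|)) D w \<cdot> y) \<cdot> i) = \<zero>\<^sub>K"
proof (rule ccontr)
 interpret S: galgebra A "G(|carrier := S|)" c by (rule restrict[OF S_sub(1)])
 let ?T = "tr (G(|carrier := S|)) D"
 have DS: "D <= S" using subgroup.subset[OF D(1)] by simp
 have DG: "subgroup D G" using G.incl_subgroup[OF S_sub(1) D(1)] .
 have fD: "a : fixd S ==> a : fixd D" for a using fixd_mono[OF DS] by blast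
 have fDc: "a : fixd D ==> b : fixd D ==> a \<cdot> b : fixd D" for a b using fixd_cl(2)[OF subgroup.subset[OF DG]] .
 have Tl: "?T (a \<cdot> b) = a \<cdot> ?T b" if "a : fixd S" "b : fixd D" for a b using S.transfer_mult_left[OF D(1) that(2)] that(1) by simp
 have Tr: "?T (b \<cdot> a) = ?T b \<cdot> a" if "a : fixd S" "b : fixd D" for a b using S.transfer_mult_right[OF D(1) that(2)] that(1) by simp
 have Tf: "?T b : fixd S" if "b : fixd D" for b using S.tr_fixd[OF D(1) that] by simp
 let ?u = "i \<cdot> (x \<cdot> ?T w \<cdot> y) \<cdot> i"
 assume "chi ?u ~= \<zero>\<^sub>K"
 moreover have "?u : corner" by (rule cornerI[OF fS(2)[OF fS(2)[OF x Tf[OF w]] y]])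
 ultimately obtain b where b: "b : fixd S" "?u \<cdot> b = i" using chi_unit[of ?u] unfolding corner_def by blast
 \<comment> \<open>The transfer from \<open>D\<close> to \<open>S\<close> is linear over
   \<open>A^S\<close> on both sides, so it replaces \<open>w\<close> by its transfer; the middle
   factor becomes \<open>?u b = i\<close> and the result is \<sigma>. So \<open>1\<close> is a
   transfer from \<open>D\<close>.\<close>
 let ?w = "x0 \<cdot> (i \<cdot> (x \<cdot> w \<cdot> y) \<cdot> i \<cdot> b) \<cdot> y0"
 have "?T ?w = x0 \<cdot> (?u \<cdot> b) \<cdot> y0" using x y w b i_fixd x0 y0 by (simp add: Tl Tr fD fDc)
 also have "... = \<sigma>" by (simp add: b(2))
 finally have "tr G S \<sigma> = tr G D ?w" using transfer_trans[OF S_sub(1) D(1), of ?w] x y w b i_fixd x0 y0 by (simp add: fD fDc)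
 hence "relproj D" unfolding relproj_def using tr_one x y w b i_fixd x0 y0 by (auto intro!: bexI[of _ ?w] simp: fD fDc)
 thus False using vtx_S DG DS D(2) unfolding vtx_def by blast
qed

end

text \<open>In the application \<open>B\<close> is the endomorphism ring of the multiplicity module,
  \<open>pi\<close> the quotient map onto it, \<open>N\<close> the stabiliser
  \<open>N_G(S,Z)\<close> and \<open>T\<close> its projective action. The axiom
  \<open>pi_max\<close> expresses that the kernel of \<open>pi\<close> is a maximal ideal;
  simplicity enters through \<open>schur\<close> alone. Closure of \<open>N\<close> under inverses
  is derived (\<open>N_inv\<close>).\<close>

locale multiplicity_data = source_data + B: ring B
 for B :: "('m, 'v) ring_scheme" +
 fixes pi :: "'a => 'm" and N :: "'c set" and T :: "'c => 'm"
 assumes pi_closed: "a : fixpts A c S ==> pi a : $B"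
  and pi_add: "a : fixpts A c S ==> b : fixpts A c S ==> pi (a \<oplus> b) = pi a \<oplus>\<^sub>B pi b"
  and pi_mult: "a : fixpts A c S ==> b : fixpts A c S ==> pi (a \<cdot> b) = pi a \<cdot>\<^sub>B pi b"
  and pi_one: "pi \<one> = \<one>\<^sub>B"
  and pi_surj: "u : $B ==> EX a:fixpts A c S. pi a = u"
  and pi_i: "pi i ~= \<zero>\<^sub>B"
  and pi_max: "!!J. J <= fixpts A c S ==>
   (!!a b. a : J ==> b : J ==> a \<oplus> b : J) ==>
   (!!a b. a : J ==> b : fixpts A c S ==> a \<cdot> b : J) ==>
   (!!a b. a : J ==> b : fixpts A c S ==> b \<cdot> a : J) ==>
   (!!a. a : fixpts A c S ==> pi a = \<zero>\<^sub>B ==> a : J) ==>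
   (ALL a:J. pi a = \<zero>\<^sub>B) \<or> J = fixpts A c S"
  and T_unit: "g : N ==> T g : Units B"
  and T_conj: "g : N ==> a : fixpts A c S ==>
   pi (c g a) = T g \<cdot>\<^sub>B pi a \<cdot>\<^sub>B inv \<^sub>B (T g)"
  and N_norm: "g : N ==> g : $G & conjs G g S = S"
  and not_N: "g : $G ==> conjs G g S = S ==> g ~: N ==> pi (c g i) = \<zero>\<^sub>B"
  and schur: "z : $B ==> (!!g. g : N ==> T g \<cdot>\<^sub>B z = z \<cdot>\<^sub>B T g) ==>
   z = \<zero>\<^sub>B \<or> z : Units B"
begin

lemma pi_zero: "pi \<zero> = \<zero>\<^sub>B" using pi_add[of \<zero> \<zero>] pi_closed[of \<zero>] fS(5) by (simp add: B.add.r_cancel_one')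

lemma pi_minus: assumes "a : fixd S" "b : fixd S" shows "pi (a \<ominus> b) = pi a \<ominus>\<^sub>B pi b"
proof -
 have bA: "b : $A" using assms fixd_A by auto
 have "pi (\<ominus> b) \<oplus>\<^sub>B pi b = \<zero>\<^sub>B" using pi_add[of "\<ominus> b" b] assms fS bA pi_zero by (simp add: A.l_neg)
 hence "pi (\<ominus> b) = \<ominus>\<^sub>B pi b" using assms pi_closed fS by (simp add: B.minus_equality)
 thus ?thesis using pi_add[of a "\<ominus> b"] assms fS by (simp add: A.minus_eq B.minus_eq)
qed

lemma B_nontrivial: "\<one>\<^sub>B ~= \<zero>\<^sub>B" using B.one_zeroD pi_i pi_closed[OF i_fixd] by auto

text \<open>An element on which \<open>chi\<close> does not vanish has an inverse in the corner, so
  a kernel containing it would also contain \<open>i\<close>.\<close>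

lemma corner_kernel: assumes a: "a : corner" and "pi a = \<zero>\<^sub>B" shows "chi a = \<zero>\<^sub>K"
proof (rule ccontr)
 assume "chi a ~= \<zero>\<^sub>K"
 then obtain b where b: "b : fixd S" "a \<cdot> b = i" using chi_unit a unfolding corner_def by blast
 have "pi i = pi a \<cdot>\<^sub>B pi b" using pi_mult[of a b] a b unfolding corner_def by simp
 thus False using assms(2) pi_closed[OF b(1)] pi_i by simp
qed

text \<open>The elements with this vanishing property form an ideal that contains the kernel of
  \<open>pi\<close> but not \<open>i\<close>; as that kernel is maximal, the two agree.\<close>

lemma kernel_char:
 assumes b: "b : fixd S" and z: "!!x y. x : fixd S ==> y : fixd S ==> chi (i \<cdot> (x \<cdot> b \<cdot> y) \<cdot> i) = \<zero>\<^sub>K"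
 shows "pi b = \<zero>\<^sub>B"
proof -
 let ?J = "{b : fixd S. ALL x:fixd S. ALL y:fixd S. chi (i \<cdot> (x \<cdot> b \<cdot> y) \<cdot> i) = \<zero>\<^sub>K}"
 have iA: "i : $A" using i_fixd by (rule fixd_A)
 have "(ALL a:?J. pi a = \<zero>\<^sub>B) \<or> ?J = fixd S"
 proof (rule pi_max)
  fix a b assume ab: "a : ?J" "b : ?J"
  have "chi (i \<cdot> (x \<cdot> (a \<oplus> b) \<cdot> y) \<cdot> i) = \<zero>\<^sub>K" if xy: "x : fixd S" "y : fixd S" for x y
  proof -
   have A: "x : $A" "y : $A" "a : $A" "b : $A" using ab xy fixd_A by auto
   have "i \<cdot> (x \<cdot> (a \<oplus> b) \<cdot> y) \<cdot> i = i \<cdot> (x \<cdot> a \<cdot> y) \<cdot> i \<oplus> i \<cdot> (x \<cdot> b \<cdot> y) \<cdot> i"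
    using A iA by (simp add: A.l_distr A.r_distr)
   thus ?thesis using ab xy chi_corner(2)[OF cornerI cornerI] fS by simp
  qed
  thus "a \<oplus> b : ?J" using ab fS by auto
 next
  fix a b assume ab: "a : ?J" "b : fixd S"
  have "chi (i \<cdot> (x \<cdot> (a \<cdot> b) \<cdot> y) \<cdot> i) = \<zero>\<^sub>K" if xy: "x : fixd S" "y : fixd S" for x y
  proof -
   have A: "x : $A" "y : $A" "a : $A" "b : $A" using ab xy fixd_A by auto
   have "x \<cdot> (a \<cdot> b) \<cdot> y = x \<cdot> a \<cdot> (b \<cdot> y)" using A by (simp add: A.m_assoc)
   thus ?thesis using ab xy fS by simp
  qed
  thus "a \<cdot> b : ?J" using ab fS by auto
  have "chi (i \<cdot> (x \<cdot> (b \<cdot> a) \<cdot> y) \<cdot> i) = \<zero>\<^sub>K" if xy: "x : fixd S" "y : fixd S" for x y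
  proof -
   have A: "x : $A" "y : $A" "a : $A" "b : $A" using ab xy fixd_A by auto
   have "x \<cdot> (b \<cdot> a) \<cdot> y = (x \<cdot> b) \<cdot> a \<cdot> y" using A by (simp add: A.m_assoc)
   thus ?thesis using ab xy fS by simp
  qed
  thus "b \<cdot> a : ?J" using ab fS by auto
 next
  fix a assume a: "a : fixd S" "pi a = \<zero>\<^sub>B"
  have "chi (i \<cdot> (x \<cdot> a \<cdot> y) \<cdot> i) = \<zero>\<^sub>K" if xy: "x : fixd S" "y : fixd S" for x y
   using corner_kernel[OF cornerI] a xy fS i_fixd pi_mult pi_closed by simp
  thus "a : ?J" using a by auto
 qed auto
 \<comment> \<open>Taking \<open>x = y = 1\<close> gives \<open>chi i\<close>, which is
   \<open>1\<close>.\<close>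
 moreover have "i ~: ?J" using chi_one fS(6) iA i_idem by (auto intro!: bexI[of _ \<one>] simp: i_fixd)
 hence "?J ~= fixd S" using i_fixd by blast
 ultimately show ?thesis using b z by blast
qed

lemma pi_proper_transfer:
 assumes "subgroup D (G(|carrier := S|))" "D ~= S" "w : fixd D"
 shows "pi (tr (G(|carrier := S|)) D w) = \<zero>\<^sub>B"
proof (rule kernel_char)
 interpret S: galgebra A "G(|carrier := S|)" c by (rule restrict[OF S_sub(1)])
 show "tr (G(|carrier := S|)) D w : fixd S" using S.tr_fixd[OF assms(1,3)] by simp
qed (rule chi_proper_transfer[OF assms])

text \<open>On the image of \<open>pi\<close> an element of \<open>N\<close> acts as an inner
  automorphism, so it preserves the kernel. For \<open>g\<close> outside \<open>N\<close> the
  conjugate of \<open>i\<close> falls into the kernel while \<open>i\<close> does not.\<close>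

lemma N_iff:
 assumes g: "g : $G" "conjs G g S = S"
 shows "g : N \<longleftrightarrow> (ALL a:fixd S. pi (c g a) = \<zero>\<^sub>B \<longleftrightarrow> pi a = \<zero>\<^sub>B)"
proof
 assume gN: "g : N"
 have "pi a = \<zero>\<^sub>B" if a: "a : fixd S" "pi (c g a) = \<zero>\<^sub>B" for a
 proof -
  have T: "T g : $B" "inv \<^sub>B (T g) : $B" "pi a : $B" using T_unit[OF gN] pi_closed a by auto
  have e: "T g \<cdot>\<^sub>B pi a \<cdot>\<^sub>B inv \<^sub>B (T g) = \<zero>\<^sub>B" using T_conj[OF gN a(1)] a(2) by simp
  have "\<zero>\<^sub>B = inv \<^sub>B (T g) \<cdot>\<^sub>B (T g \<cdot>\<^sub>B pi a \<cdot>\<^sub>B inv \<^sub>B (T g)) \<cdot>\<^sub>B T g"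
   unfolding e using T by simp
  also have "... = (inv \<^sub>B (T g) \<cdot>\<^sub>B T g) \<cdot>\<^sub>B pi a \<cdot>\<^sub>B (inv \<^sub>B (T g) \<cdot>\<^sub>B T g)"
   using T by (simp only: B.m_assoc B.m_closed)
  also have "... = pi a" using T_unit[OF gN] T by simp
  finally show ?thesis by simp
 qed
 moreover have "pi (c g a) = \<zero>\<^sub>B" if "a : fixd S" "pi a = \<zero>\<^sub>B" for a
  using T_conj[OF gN that(1)] that(2) B.Units_closed[OF T_unit[OF gN]] B.Units_inv_closed[OF T_unit[OF gN]] by simp
 ultimately show "ALL a:fixd S. pi (c g a) = \<zero>\<^sub>B \<longleftrightarrow> pi a = \<zero>\<^sub>B" by blast
next
 assume "ALL a:fixd S. pi (c g a) = \<zero>\<^sub>B \<longleftrightarrow> pi a = \<zero>\<^sub>B"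
 thus "g : N" using not_N[OF g] i_fixd pi_i by blast
qed

lemma N_inv:
 assumes g: "g : N" shows "inv \<^sub>G g : N"
proof -
 have gG: "g : $G" "conjs G g S = S" using N_norm[OF g] by auto
 have i: "inv \<^sub>G g : $G" "conjs G (inv \<^sub>G g) S = S" using gG G.conj_set_fixed_inv[OF gG(1) S_sub(2) gG(2)] by auto
 have "pi (c (inv \<^sub>G g) a) = \<zero>\<^sub>B \<longleftrightarrow> pi a = \<zero>\<^sub>B" if a: "a : fixd S" for a
 proof -
  have "pi (c g (c (inv \<^sub>G g) a)) = \<zero>\<^sub>B \<longleftrightarrow> pi (c (inv \<^sub>G g) a) = \<zero>\<^sub>B"
   using N_iff[OF gG] g norm_fixd[OF i a] by blast
  thus ?thesis using c_inv'[OF gG(1) fixd_A[OF a]] by simp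
 qed
 thus ?thesis using N_iff[OF i] by blast
qed

lemma pi_conj_outside:
 assumes g: "g : $G" "conjs G g S = S" "g ~: N" and "x : fixd S" "y : fixd S"
 shows "pi (c g (x \<cdot> i \<cdot> y)) = \<zero>\<^sub>B"
proof -
 have "c g (x \<cdot> i \<cdot> y) = c g x \<cdot> c g i \<cdot> c g y" using g assms i_fixd fixd_A by (simp add: c_times)
 thus ?thesis using not_N[OF g] norm_fixd[OF g(1,2)] assms i_fixd pi_mult pi_closed fS by simp
qed

text \<open>The Mackey formula for \<open>S\<close> acting on the cosets of \<open>S\<close>: orbits
  of length greater than one are transfers from proper subgroups of \<open>S\<close>, which
  \<open>pi\<close> kills.\<close>

lemma pi_transfer:
 assumes b: "b : fixd S"
 shows "pi (tr G S b) = (\<Oplus>\<^sub>B C\<in>\<Phi>. pi (c (SOME g. g : C) b))"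
proof -
 interpret S: galgebra A "G(|carrier := S|)" c by (rule restrict[OF S_sub(1)])
 have cr: "$(G(|carrier := S|)) = S" by simp
 have gs: "gset (G(|carrier := S|)) (lcosets \<^sub>G S) (%g C. g <#\<^sub>G C)"
  using gset.restrict_gset[OF G.lcosets_gset[OF finite_G S_sub(1)] S_sub(1)] .
 note F = coset_fun[OF S_sub(1) b]
 have F2: "c (SOME h. h : g <#\<^sub>G C) b = c g (c (SOME h. h : C) b)"
  if "g : $(G(|carrier := S|))" "C : lcosets \<^sub>G S" for g C using F(2) that S_sub(2) by auto
 have h: "pi : fixd S \<rightarrow> $B" using pi_closed by blast
 show ?thesis unfolding transfer_def \<Phi>_def by (rule S.additive_fixed_point_sum(1)[where h = pi and \<rho> = "%g C. g <#\<^sub>G C",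
   OF gs F(1) F2 B.abelian_monoid_axioms _ pi_zero, unfolded cr, OF _ _ h pi_add pi_proper_transfer])
qed

text \<open>Otherwise Schur's lemma makes \<open>pi z\<close> a unit. Its inverse \<open>w\<close>
  is the image of an element \<open>y\<close> of \<open>A^G\<close>, and \<open>1 - y z\<close> has
  residue \<open>1\<close>, hence is a unit of \<open>A^G\<close>, although \<open>pi\<close> maps
  it to zero.\<close>

lemma pi_lam_zero:
 assumes z: "z : fixd ($G)" and lz: "lam z = \<zero>\<^sub>K"
 shows "pi z = \<zero>\<^sub>B"
proof (rule ccontr)
 assume nz: "pi z ~= \<zero>\<^sub>B"
 have zS: "z : fixd S" using fG_S[OF z] .
 have comm: "T g \<cdot>\<^sub>B pi a = pi a \<cdot>\<^sub>B T g" if g: "g : N" and "a : fixd S" "pi (c g a) = pi a" for g a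
 proof -
  have T: "T g : Units B" "T g : $B" "pi a : $B" using T_unit[OF g] pi_closed[OF that(2)] by auto
  have "pi a \<cdot>\<^sub>B T g = T g \<cdot>\<^sub>B pi a \<cdot>\<^sub>B inv \<^sub>B (T g) \<cdot>\<^sub>B T g"
   using T_conj[OF g that(2)] that(3) by simp
  also have "... = T g \<cdot>\<^sub>B pi a" using T by (simp add: B.m_assoc)
  finally show ?thesis by simp
 qed
 have "pi (c g z) = pi z" if "g : N" for g using N_norm[OF that] fixdD[OF z] by simp
 hence u: "pi z : Units B" using schur[OF pi_closed[OF zS]] comm[OF _ zS] nz by blast
 define w where "w = inv \<^sub>B (pi z)"
 have w: "w : $B" "w \<cdot>\<^sub>B pi z = \<one>\<^sub>B" "pi z \<cdot>\<^sub>B w = \<one>\<^sub>B" unfolding w_def using u by auto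
 obtain b where b: "b : fixd S" "pi b = w" using pi_surj[OF w(1)] by blast
 \<comment> \<open>Although \<open>b\<close> is only fixed by \<open>S\<close>, its image is
   invariant under \<open>N\<close>, being the inverse of an invariant element.\<close>
 have cb: "pi (c g b) = w" if g: "g : N" for g
 proof -
  have gG: "g : $G" "conjs G g S = S" using N_norm[OF g] by auto
  have bz: "c g (b \<cdot> z) = c g b \<cdot> z" using c_times[OF gG(1) fixd_A[OF b(1)] fixd_A[OF z]] fixdD[OF z gG(1)] by simp
  have f: "c g b : fixd S" using norm_fixd[OF gG b(1)] .
  have T: "T g : Units B" "T g : $B" using T_unit[OF g] by auto
  have "pi (c g b) \<cdot>\<^sub>B pi z = pi (c g (b \<cdot> z))" unfolding bz using pi_mult[OF f zS] by simp
  also have "... = \<one>\<^sub>B" using T_conj[OF g fS(2)[OF b(1) zS]] pi_mult[OF b(1) zS] b(2) w(2) T by simp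
  finally have "pi (c g b) \<cdot>\<^sub>B pi z \<cdot>\<^sub>B w = w" using w by simp
  thus ?thesis using w pi_closed[OF f] pi_closed[OF zS] by (simp add: B.m_assoc)
 qed
 \<comment> \<open>Averaging \<open>b\<close> against the partition of unity formed by the
   conjugates of \<sigma>: modulo the kernel of \<open>pi\<close> only the conjugates by elements of
   \<open>N\<close> survive, and there \<open>b\<close> is constantly \<open>w\<close>.\<close>
 define y where "y = tr G S (b \<cdot> \<sigma>)"
 have bs: "b \<cdot> \<sigma> : fixd S" using fS(2)[OF b(1) \<sigma>_fixd] .
 have y: "y : fixd ($G)" unfolding y_def using tr_fixd[OF S_sub(1) bs] .
 have pc: "pi (c (SOME g. g : C) \<sigma>) : $B &
  pi (c (SOME g. g : C) (b \<cdot> \<sigma>)) = w \<cdot>\<^sub>B pi (c (SOME g. g : C) \<sigma>)" if C: "C : \<Phi>" for C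
 proof -
  obtain g where g: "g : $G" "conjs G g S = S"
   and r: "ALL a:fixd S. c (SOME g. g : C) a = c g a" using \<Phi>_rep[OF C] by blast
  have f: "c g b : fixd S" "c g \<sigma> : fixd S" using norm_fixd[OF g] b \<sigma>_fixd by auto
  have e: "pi (c g (b \<cdot> \<sigma>)) = pi (c g b) \<cdot>\<^sub>B pi (c g \<sigma>)"
   using c_times[OF g(1) fixd_A[OF b(1)] fixd_A[OF \<sigma>_fixd]] pi_mult[OF f] by simp
  have "pi (c g (b \<cdot> \<sigma>)) = w \<cdot>\<^sub>B pi (c g \<sigma>)"
  proof (cases "g : N")
   case True
   thus ?thesis using e cb by simp
  next
   case False
   thus ?thesis using e pi_conj_outside[OF g False x0 y0] pi_closed[OF f(1)] w by simp
  qed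
  thus ?thesis using r bs \<sigma>_fixd pi_closed[OF f(2)] by simp
 qed
 have "pi y = (\<Oplus>\<^sub>B C\<in>\<Phi>. w \<cdot>\<^sub>B pi (c (SOME g. g : C) \<sigma>))"
  unfolding y_def pi_transfer[OF bs] using pc w by (intro B.finsum_cong') auto
 also have "... = w \<cdot>\<^sub>B (\<Oplus>\<^sub>B C\<in>\<Phi>. pi (c (SOME g. g : C) \<sigma>))"
  using finite_\<Phi> w pc by (intro B.finsum_rdistr[symmetric]) auto
 also have "(\<Oplus>\<^sub>B C\<in>\<Phi>. pi (c (SOME g. g : C) \<sigma>)) = \<one>\<^sub>B"
  unfolding pi_transfer[OF \<sigma>_fixd, symmetric] tr_one by (rule pi_one)
 also have "w \<cdot>\<^sub>B \<one>\<^sub>B = w" using w(1) by simp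
 finally have py: "pi y = w" .
 have yz: "y \<cdot> z : fixd ($G)" by (rule fixdG_closed(2)[OF y z])
 let ?u = "\<one> \<ominus> y \<cdot> z"
 have uf: "?u : fixd ($G)" using yz fixdG_closed by (simp add: A.minus_eq)
 have "lam ?u = \<one>\<^sub>K" using lam_minus[OF fixdG_closed(5) yz] lam_mult[OF y z] lz lam_one lam_closed[OF y] by (simp add: K.minus_eq)
 then obtain v where v: "v : fixd ($G)" "?u \<cdot> v = \<one>" using lam_unit[OF uf] by auto
 have "pi ?u = \<zero>\<^sub>B" using pi_minus[OF fS(6) fG_S[OF yz]] pi_mult[OF fG_S[OF y] zS] py w pi_one by (simp add: B.r_neg B.minus_eq)
 hence "pi \<one> = \<zero>\<^sub>B" using pi_mult[OF fG_S[OF uf] fG_S[OF v(1)]] v(2) pi_closed[OF fG_S[OF v(1)]] by simp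
 thus False using pi_one B_nontrivial by simp
qed

lemma pi_lam_eq:
 assumes "a : fixd ($G)" "b : fixd ($G)" "lam a = lam b"
 shows "pi a = pi b"
proof -
 have "pi (a \<ominus> b) = \<zero>\<^sub>B" using pi_lam_zero[of "a \<ominus> b"] lam_minus[OF assms(1,2)] assms lam_closed fixdG_closed
  by (simp add: A.minus_eq K.minus_eq K.r_neg)
 thus ?thesis using pi_minus fG_S assms pi_closed by (simp add: B.r_right_minus_eq)
qed

text \<open>The exchange identity comes from commutativity of the corner modulo the kernel of \<open>pi\<close>.\<close>

lemma exchange:
 assumes g: "g : $G" "conjs G g S = S"
  and x: "x : fixd S" and y: "y : fixd S" and x': "x' : fixd S" and y': "y' : fixd S"
 shows "pi (i \<cdot> y' \<cdot> c g (x \<cdot> i \<cdot> y) \<cdot> (x' \<cdot> i)) = pi (i \<cdot> y \<cdot> c (inv \<^sub>G g) (x' \<cdot> i \<cdot> y') \<cdot> (x \<cdot> i))"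
proof -
 have ig: "inv \<^sub>G g : $G" "conjs G (inv \<^sub>G g) S = S" using g G.conj_set_fixed_inv[OF g(1) S_sub(2) g(2)] by auto
 have f: "x \<cdot> i \<cdot> y : fixd S" "x' \<cdot> i \<cdot> y' : fixd S" "i \<cdot> y : fixd S" "i \<cdot> y' : fixd S"
  "x \<cdot> i : fixd S" "x' \<cdot> i : fixd S" using x y x' y' i_fixd fS by auto
 have cf: "c g (x \<cdot> i \<cdot> y) : fixd S" "c (inv \<^sub>G g) (x' \<cdot> i \<cdot> y') : fixd S" using norm_fixd g ig f by auto
 show ?thesis
 proof (cases "g : N")
  case False
  hence "inv \<^sub>G g ~: N" using N_inv[of "inv \<^sub>G g"] g by auto
  thus ?thesis using pi_conj_outside[OF g False x y] pi_conj_outside[OF ig _ x' y'] f cf fS pi_mult pi_closed by simp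
 next
  case True
  have T: "T g : Units B" "T g : $B" "inv \<^sub>B (T g) : $B" using T_unit[OF True] by auto
  obtain u where u: "u : fixd S" "pi u = T g" using pi_surj T by blast
  obtain v where v: "v : fixd S" "pi v = inv \<^sub>B (T g)" using pi_surj T by blast
  have cinv: "pi (c (inv \<^sub>G g) a) = inv \<^sub>B (T g) \<cdot>\<^sub>B pi a \<cdot>\<^sub>B T g" if a: "a : fixd S" for a
  proof -
   have fa: "c (inv \<^sub>G g) a : fixd S" using norm_fixd[OF ig a] .
   let ?z = "pi (c (inv \<^sub>G g) a)"
   have "pi a = T g \<cdot>\<^sub>B ?z \<cdot>\<^sub>B inv \<^sub>B (T g)" using T_conj[OF True fa] c_inv'[OF g(1) fixd_A[OF a]] by simp
   hence "inv \<^sub>B (T g) \<cdot>\<^sub>B pi a \<cdot>\<^sub>B T g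
    = (inv \<^sub>B (T g) \<cdot>\<^sub>B T g) \<cdot>\<^sub>B ?z \<cdot>\<^sub>B (inv \<^sub>B (T g) \<cdot>\<^sub>B T g)"
    using T pi_closed[OF fa] by (simp only: B.m_assoc B.m_closed)
   thus ?thesis using T pi_closed[OF fa] by simp
  qed
  \<comment> \<open>With the lifts \<open>u\<close> and \<open>v\<close> of \<open>T g\<close> and
    its inverse inserted, the two sides of the claim are \<open>pi ?P\<close> times
    \<open>pi ?Q\<close> and the same product in the other order.\<close>
  let ?P = "i \<cdot> (y' \<cdot> u \<cdot> x) \<cdot> i" and ?Q = "i \<cdot> (y \<cdot> v \<cdot> x') \<cdot> i"
  have PQ: "?P : corner" "?Q : corner" using x y x' y' u v fS by (auto intro!: cornerI)
  hence PQf: "?P : fixd S" "?Q : fixd S" by (auto simp: corner_def)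
  let ?d = "?P \<cdot> ?Q \<ominus> ?Q \<cdot> ?P"
  have dc: "?d : corner" by (rule corner_cl(4)[OF corner_cl(2)[OF PQ] corner_cl(2)[OF PQ(2,1)]])
  have chid: "chi ?d = \<zero>\<^sub>K" using chi_minus[OF corner_cl(2)[OF PQ] corner_cl(2)[OF PQ(2,1)]] chi_corner(1,3) PQ
   by (simp add: K.m_comm K.r_right_minus_eq)
  have "pi ?d = \<zero>\<^sub>B"
  proof (rule kernel_char)
   show df: "?d : fixd S" using dc by (simp add: corner_def)
   fix a b assume ab: "a : fixd S" "b : fixd S"
   have A: "i : $A" "a : $A" "b : $A" "?d : $A" using fixd_A[OF i_fixd] fixd_A[OF ab(1)] fixd_A[OF ab(2)] fixd_A[OF df] by auto
   have d: "i \<cdot> ?d \<cdot> i = ?d" using dc by (simp add: corner_def)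
   have ca: "i \<cdot> a \<cdot> i : corner" "i \<cdot> b \<cdot> i : corner" using ab cornerI by auto
   have "i \<cdot> (a \<cdot> (i \<cdot> ?d \<cdot> i) \<cdot> b) \<cdot> i = (i \<cdot> a \<cdot> i) \<cdot> ?d \<cdot> (i \<cdot> b \<cdot> i)"
    using A by (simp only: A.m_assoc A.m_closed)
   hence "i \<cdot> (a \<cdot> ?d \<cdot> b) \<cdot> i = (i \<cdot> a \<cdot> i) \<cdot> ?d \<cdot> (i \<cdot> b \<cdot> i)" unfolding d .
   thus "chi (i \<cdot> (a \<cdot> ?d \<cdot> b) \<cdot> i) = \<zero>\<^sub>K" using chi_corner(1,3) ca dc chid corner_cl by simp
  qed
  hence PQpi: "pi ?P \<cdot>\<^sub>B pi ?Q = pi ?Q \<cdot>\<^sub>B pi ?P"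
   using pi_minus[OF fS(2)[OF PQf] fS(2)[OF PQf(2,1)]] pi_mult[OF PQf] pi_mult[OF PQf(2,1)] pi_closed PQf by (simp add: B.r_right_minus_eq)
  have pc: "pi x : $B" "pi y : $B" "pi x' : $B" "pi y' : $B" "pi i : $B" using pi_closed x y x' y' i_fixd by auto
  have ii: "pi i \<cdot>\<^sub>B pi i = pi i" using pi_mult[OF i_fixd i_fixd] i_idem by simp
  have pP: "pi ?P = pi i \<cdot>\<^sub>B pi y' \<cdot>\<^sub>B T g \<cdot>\<^sub>B pi x \<cdot>\<^sub>B pi i"
   and pQ: "pi ?Q = pi i \<cdot>\<^sub>B pi y \<cdot>\<^sub>B inv \<^sub>B (T g) \<cdot>\<^sub>B pi x' \<cdot>\<^sub>B pi i"
   using x y x' y' u v i_fixd fS pi_mult pc T by (auto simp: B.m_assoc)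
  have l: "pi (i \<cdot> y' \<cdot> c g (x \<cdot> i \<cdot> y) \<cdot> (x' \<cdot> i)) = pi ?P \<cdot>\<^sub>B pi ?Q"
  proof -
   have "pi (i \<cdot> y' \<cdot> c g (x \<cdot> i \<cdot> y) \<cdot> (x' \<cdot> i))
    = pi i \<cdot>\<^sub>B pi y' \<cdot>\<^sub>B (T g \<cdot>\<^sub>B (pi x \<cdot>\<^sub>B (pi i \<cdot>\<^sub>B pi i) \<cdot>\<^sub>B pi y) \<cdot>\<^sub>B inv \<^sub>B (T g)) \<cdot>\<^sub>B (pi x' \<cdot>\<^sub>B pi i)"
    using x y x' y' i_fixd f cf fS pi_mult T_conj[OF True f(1)] ii by simp
   thus ?thesis unfolding pP pQ using pc T by (simp add: B.m_assoc)
  qed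
  have r: "pi (i \<cdot> y \<cdot> c (inv \<^sub>G g) (x' \<cdot> i \<cdot> y') \<cdot> (x \<cdot> i)) = pi ?Q \<cdot>\<^sub>B pi ?P"
  proof -
   have "pi (i \<cdot> y \<cdot> c (inv \<^sub>G g) (x' \<cdot> i \<cdot> y') \<cdot> (x \<cdot> i))
    = pi i \<cdot>\<^sub>B pi y \<cdot>\<^sub>B (inv \<^sub>B (T g) \<cdot>\<^sub>B (pi x' \<cdot>\<^sub>B (pi i \<cdot>\<^sub>B pi i) \<cdot>\<^sub>B pi y') \<cdot>\<^sub>B T g) \<cdot>\<^sub>B (pi x \<cdot>\<^sub>B pi i)"
    using x y x' y' i_fixd f cf fS pi_mult cinv[OF f(2)] ii by simp
   thus ?thesis unfolding pP pQ using pc T by (simp add: B.m_assoc)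
  qed
  show ?thesis unfolding l r by (rule PQpi)
 qed
qed

text \<open>Summation of \<open>exchange\<close> over the group \<open>N_G(S)/S\<close>; inversion
  in this group reindexes one of the sums.\<close>

lemma exchange_transfer:
 assumes x: "x : fixd S" and y: "y : fixd S" and x': "x' : fixd S" and y': "y' : fixd S"
 shows "pi (i \<cdot> y' \<cdot> tr G S (x \<cdot> i \<cdot> y) \<cdot> (x' \<cdot> i)) = pi (i \<cdot> y \<cdot> tr G S (x' \<cdot> i \<cdot> y') \<cdot> (x \<cdot> i))"
proof -
 define rp where "rp C = (SOME g. g : C)" for C :: "'c set"
 \<comment> \<open>Inversion in \<open>N_G(S)/S\<close>. That it is an involution on cosets given by
   chosen representatives uses that these representatives normalise \<open>S\<close>.\<close>
 define iv where "iv C = inv \<^sub>G (rp C) <#\<^sub>G S" for C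
 have rp: "rp C : $G" "rp C <#\<^sub>G S = C" "conjs G (rp C) S = S" if C: "C : \<Phi>" for C
 proof -
  obtain g where g: "g : $G" "C = g <#\<^sub>G S" using \<Phi>_rep[OF C] by blast
  have "rp C : C" unfolding rp_def g(2) by (rule someI[where P="%h. h : g <#\<^sub>G S"], rule G.lcos_self[OF g(1) S_sub(1)])
  thus r: "rp C : $G" "rp C <#\<^sub>G S = C" using G.l_coset_subset_G[OF S_sub(2) g(1)] G.l_repr_independence[OF _ g(1) S_sub(1)] g(2) by auto
  have "S <= conjs G (rp C) S" using C G.coset_fixed_iff[OF finite_G S_sub r(1)] r(2) unfolding \<Phi>_def by simp
  thus "conjs G (rp C) S = S" by (rule G.conj_set_eqI[OF finite_G r(1) S_sub(2)])
 qed
 have mk: "g <#\<^sub>G S : \<Phi>" if "g : $G" "conjs G g S = S" for g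
  using that G.coset_fixed_iff[OF finite_G S_sub that(1)] unfolding \<Phi>_def LCOSETS_def by auto
 have ivP: "iv C : \<Phi>" if C: "C : \<Phi>" for C unfolding iv_def using rp[OF C] G.conj_set_fixed_inv[OF _ S_sub(2)] by (intro mk) auto
 have crp: "c (rp (g <#\<^sub>G S)) a = c g a" if "a : fixd S" "g : $G" for a g unfolding rp_def using c_rep[OF S_sub(1) that] .
 have iviv: "iv (iv C) = C" if C: "C : \<Phi>" for C
 proof -
  let ?g = "rp C" and ?h = "rp (iv C)"
  have g: "?g : $G" "?h : $G" "?h <#\<^sub>G S = inv \<^sub>G ?g <#\<^sub>G S" "conjs G ?g S = S"
   using rp[OF C] rp[OF ivP[OF C]] unfolding iv_def by auto
  have "inv \<^sub>G ?h \<cdot>\<^sub>G inv \<^sub>G ?g : S" using G.lcos_eq_iff[OF S_sub(1) g(2), of "inv \<^sub>G ?g"] g by simp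
  hence "inv \<^sub>G (inv \<^sub>G ?h \<cdot>\<^sub>G inv \<^sub>G ?g) : S" using subgroup.m_inv_closed[OF S_sub(1)] by blast
  hence s: "?g \<cdot>\<^sub>G ?h : S" using g by (simp add: G.inv_mult_group)
  hence "?g \<cdot>\<^sub>G ?h : conjs G ?g S" using g by simp
  hence "inv \<^sub>G ?g \<cdot>\<^sub>G (?g \<cdot>\<^sub>G ?h) \<cdot>\<^sub>G ?g : S"
   using G.mem_conj_set[OF g(1) S_sub(2), of "?g \<cdot>\<^sub>G ?h"] g by simp
  hence "?h \<cdot>\<^sub>G ?g : S" using g by (simp add: G.m_assoc[symmetric])
  hence "inv \<^sub>G ?h <#\<^sub>G S = ?g <#\<^sub>G S" using G.lcos_eq_iff[OF S_sub(1), of "inv \<^sub>G ?h" ?g] g by simp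
  thus ?thesis using rp(2)[OF C] unfolding iv_def[of "iv C"] by simp
 qed
 have img: "iv ` \<Phi> = \<Phi>"
 proof
  show "iv ` \<Phi> <= \<Phi>" using ivP by blast
  show "\<Phi> <= iv ` \<Phi>"
  proof
   fix C assume "C : \<Phi>"
   thus "C : iv ` \<Phi>" using iviv[of C] ivP[of C] by (metis imageI)
  qed
 qed
 have inj: "inj_on iv \<Phi>" by (rule inj_on_inverseI[of \<Phi> iv iv, OF iviv])
 have f: "x \<cdot> i \<cdot> y : fixd S" "x' \<cdot> i \<cdot> y' : fixd S" "i \<cdot> y : fixd S" "i \<cdot> y' : fixd S"
  "x \<cdot> i : fixd S" "x' \<cdot> i : fixd S" using x y x' y' i_fixd fS by auto
 have split: "pi (l \<cdot> tr G S b \<cdot> r) = (\<Oplus>\<^sub>B C\<in>\<Phi>. pi (l \<cdot> c (rp C) b \<cdot> r))"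
  if l: "l : fixd S" and b: "b : fixd S" and r: "r : fixd S" for l b r
 proof -
  have cf: "c (rp C) b : fixd S" if "C : \<Phi>" for C using norm_fixd rp[OF that] b by auto
  have pc: "pi (c (rp C) b) : $B" if "C : \<Phi>" for C using cf that pi_closed by blast
  have "pi (l \<cdot> tr G S b \<cdot> r) = pi l \<cdot>\<^sub>B (\<Oplus>\<^sub>B C\<in>\<Phi>. pi (c (rp C) b)) \<cdot>\<^sub>B pi r"
   using pi_mult l r fS fG_S[OF tr_fixd[OF S_sub(1) b]] pi_transfer[OF b] unfolding rp_def by simp
  also have "... = (\<Oplus>\<^sub>B C\<in>\<Phi>. pi l \<cdot>\<^sub>B pi (c (rp C) b)) \<cdot>\<^sub>B pi r"
   using finite_\<Phi> pi_closed[OF l] pc by (subst B.finsum_rdistr) auto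
  also have "... = (\<Oplus>\<^sub>B C\<in>\<Phi>. pi l \<cdot>\<^sub>B pi (c (rp C) b) \<cdot>\<^sub>B pi r)"
   using finite_\<Phi> pi_closed[OF l] pi_closed[OF r] pc by (subst B.finsum_ldistr) auto
  also have "... = (\<Oplus>\<^sub>B C\<in>\<Phi>. pi (l \<cdot> c (rp C) b \<cdot> r))"
  proof (rule B.finsum_cong')
   show "(%C. pi (l \<cdot> c (rp C) b \<cdot> r)) : \<Phi> \<rightarrow> $B" using fS(2)[OF fS(2)[OF l cf] r] pi_closed by blast
   show "!!C. C : \<Phi> ==> pi l \<cdot>\<^sub>B pi (c (rp C) b) \<cdot>\<^sub>B pi r = pi (l \<cdot> c (rp C) b \<cdot> r)"
    using cf l r fS pi_mult by simp
  qed simp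
  finally show ?thesis .
 qed
 let ?g = "%C. pi (i \<cdot> y \<cdot> c (rp C) (x' \<cdot> i \<cdot> y') \<cdot> (x \<cdot> i))"
 have gc: "?g : \<Phi> \<rightarrow> $B"
 proof
  fix C assume "C : \<Phi>"
  thus "?g C : $B" using norm_fixd rp f fS pi_closed by simp
 qed
 have "pi (i \<cdot> y' \<cdot> tr G S (x \<cdot> i \<cdot> y) \<cdot> (x' \<cdot> i)) = (\<Oplus>\<^sub>B C\<in>\<Phi>. ?g (iv C))"
  unfolding split[OF f(4) f(1) f(6)]
 proof (rule B.finsum_cong')
  show "(%C. ?g (iv C)) : \<Phi> \<rightarrow> $B" using gc ivP by auto
  fix C assume C: "C : \<Phi>"
  show "pi (i \<cdot> y' \<cdot> c (rp C) (x \<cdot> i \<cdot> y) \<cdot> (x' \<cdot> i)) = ?g (iv C)"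
   using exchange[OF rp(1,3)[OF C] x y x' y'] crp[OF f(2), of "inv \<^sub>G (rp C)"] rp(1)[OF C] by (simp add: iv_def)
 qed simp
 also have "... = (\<Oplus>\<^sub>B C\<in>iv ` \<Phi>. ?g C)" using gc img inj by (intro B.finsum_reindex[symmetric]) auto
 also have "... = pi (i \<cdot> y \<cdot> tr G S (x' \<cdot> i \<cdot> y') \<cdot> (x \<cdot> i))" unfolding img split[OF f(3) f(2) f(5)] ..
 finally show ?thesis .
qed

text \<open>Modulo the kernel of \<open>pi\<close> an element of \<open>A^G\<close> equals any
  scalar with the same residue (\<open>pi_lam_eq\<close>). Replacing the two transfers by scalars,
  \<open>exchange_transfer\<close> becomes an equation between corner elements, and
  \<open>corner_kernel\<close> lets \<open>chi\<close> be applied to it.\<close>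

lemma lam_transfer_sandwich:
 assumes x: "x : fixd S" and y: "y : fixd S"
 shows "lam (tr G S (x \<cdot> i \<cdot> y)) = lam (tr G S i) \<cdot>\<^sub>K chi (i \<cdot> (y \<cdot> x) \<cdot> i)"
proof -
 have iA: "i : $A" using i_fixd by (rule fixd_A)
 have xyi: "x \<cdot> i \<cdot> y : fixd S" using x y i_fixd fS by auto
 have tf: "tr G S (x \<cdot> i \<cdot> y) : fixd ($G)" "tr G S i : fixd ($G)" using tr_fixd[OF S_sub(1)] xyi i_fixd by auto
 obtain s1 where s1: "s1 : Sc" "lam s1 = lam (tr G S (x \<cdot> i \<cdot> y))" using lam_scalar[OF tf(1)] by blast
 obtain s0 where s0: "s0 : Sc" "lam s0 = lam (tr G S i)" using lam_scalar[OF tf(2)] by blast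
 have sf: "s0 : fixd ($G)" "s1 : fixd ($G)" using s0 s1 Sc_fixd by auto
 have sS: "s0 : fixd S" "s1 : fixd S" using sf fG_S by auto
 have A: "s0 : $A" "s1 : $A" "x : $A" "y : $A" using sS x y fixd_A by auto
 have p1: "pi (tr G S (x \<cdot> i \<cdot> y)) = pi s1" using pi_lam_eq[OF tf(1) sf(2)] s1 by simp
 have p0: "pi (tr G S i) = pi s0" using pi_lam_eq[OF tf(2) sf(1)] s0 by simp
 let ?e = "i \<cdot> (y \<cdot> x) \<cdot> i"
 have ec: "?e : corner" using x y fS by (intro cornerI) auto
 have pc: "pi i : $B" "pi x : $B" "pi y : $B" "pi s0 : $B" "pi s1 : $B" using pi_closed i_fixd x y sS by auto
 have isi: "i \<cdot> s \<cdot> i = s \<cdot> i" if "s : Sc" "s : $A" for s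
 proof -
  have "i \<cdot> s \<cdot> i = s \<cdot> i \<cdot> i" using Sc_central[OF that(1) iA] by simp
  also have "... = s \<cdot> (i \<cdot> i)" using that(2) iA by (rule A.m_assoc[OF _ iA])
  finally show ?thesis using i_idem by simp
 qed
 have sc: "s1 \<cdot> i : corner" "s0 \<cdot> i : corner" using cornerI[OF sS(1)] cornerI[OF sS(2)] isi[OF s0(1) A(1)] isi[OF s1(1) A(2)] by auto
 \<comment> \<open>The exchange identity with both primed elements equal to
   \<open>i\<close>.\<close>
 have "pi (i \<cdot> i \<cdot> tr G S (x \<cdot> i \<cdot> y) \<cdot> (i \<cdot> i)) = pi (i \<cdot> y \<cdot> tr G S (i \<cdot> i \<cdot> i) \<cdot> (x \<cdot> i))"
  by (rule exchange_transfer[OF x y i_fixd i_fixd])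
 hence e1: "pi (i \<cdot> tr G S (x \<cdot> i \<cdot> y) \<cdot> i) = pi (i \<cdot> y \<cdot> tr G S i \<cdot> (x \<cdot> i))" using i_idem by simp
 have "pi (i \<cdot> tr G S (x \<cdot> i \<cdot> y) \<cdot> i) = pi (i \<cdot> s1 \<cdot> i)" using pi_mult i_fixd fG_S[OF tf(1)] sS(2) fS p1 by simp
 also have "i \<cdot> s1 \<cdot> i = s1 \<cdot> i" by (rule isi[OF s1(1) A(2)])
 finally have e2: "pi (i \<cdot> tr G S (x \<cdot> i \<cdot> y) \<cdot> i) = pi (s1 \<cdot> i)" .
 have "pi (i \<cdot> y \<cdot> tr G S i \<cdot> (x \<cdot> i)) = pi (i \<cdot> y \<cdot> s0 \<cdot> (x \<cdot> i))"
  using pi_mult i_fixd fG_S[OF tf(2)] sS(1) fS p0 x y by simp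
 also have "i \<cdot> y \<cdot> s0 \<cdot> (x \<cdot> i) = s0 \<cdot> (i \<cdot> y) \<cdot> (x \<cdot> i)"
  using Sc_central[OF s0(1), of "i \<cdot> y"] iA A by simp
 also have "... = s0 \<cdot> ?e" using iA A by (simp add: A.m_assoc)
 also have "... = (s0 \<cdot> i) \<cdot> ?e" using ec A iA fixd_A unfolding corner_def by (simp add: A.m_assoc)
 finally have e3: "pi (s1 \<cdot> i) = pi ((s0 \<cdot> i) \<cdot> ?e)" using e1 e2 by simp
 have dc: "s1 \<cdot> i \<ominus> (s0 \<cdot> i) \<cdot> ?e : corner" by (rule corner_cl(4)[OF sc(1) corner_cl(2)[OF sc(2) ec]])
 have "pi (s1 \<cdot> i \<ominus> (s0 \<cdot> i) \<cdot> ?e) = \<zero>\<^sub>B"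
  using pi_minus[of "s1 \<cdot> i" "(s0 \<cdot> i) \<cdot> ?e"] e3 sc corner_cl(2)[OF sc(2) ec] pi_closed[of "s0 \<cdot> i \<cdot> ?e"]
  unfolding corner_def by (simp add: B.minus_eq B.r_neg)
 hence "chi (s1 \<cdot> i) \<ominus>\<^sub>K chi (s0 \<cdot> i) \<cdot>\<^sub>K chi ?e = \<zero>\<^sub>K"
  using corner_kernel[OF dc] chi_minus[OF sc(1) corner_cl(2)[OF sc(2) ec]] chi_corner(3)[OF sc(2) ec] by simp
 thus ?thesis using chi_scalar[OF s1(1)] chi_scalar[OF s0(1)] s0 s1 chi_corner(1)[OF ec] lam_closed tf by (simp add: K.r_right_minus_eq)
qed

text \<open>Both maps are expanded over \<open>\<Phi>\<close>; by \<open>t_term\<close> the terms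
  are sandwiches with the same \<open>b\<close>, where the claim is
  \<open>lam_transfer_sandwich\<close> together with \<open>t_sandwich\<close>. The factor
  \<open>n\<close> stands on the left so that nothing is divided by it.\<close>

theorem lam_transfer_trace:
 assumes a: "a : fixd S"
 shows "n \<cdot>\<^sub>K lam (tr G S a) = lam (tr G S i) \<cdot>\<^sub>K t a"
proof -
 let ?h = "%a. lam (tr G S a)" and ?b = "%C. a \<cdot> c (SOME g. g : C) \<sigma>"
 have hc: "?h b : $K" if "b : fixd S" for b using lam_closed tr_fixd[OF S_sub(1) that] by blast
 have h0: "?h \<zero> = \<zero>\<^sub>K" using transfer_zero[OF S_sub(1)] lam_zero by simp
 have hadd: "?h (a \<oplus> b) = ?h a \<oplus>\<^sub>K ?h b" if "a : fixd S" "b : fixd S" for a b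
  using transfer_add[OF S_sub(1) that] lam_add tr_fixd[OF S_sub(1)] that by simp
 \<comment> \<open>Transfer from \<open>D\<close> to \<open>S\<close> and on to \<open>G\<close> is
   transfer from \<open>D\<close> to \<open>G\<close>, and its residue vanishes as \<open>S\<close>
   is a minimal subgroup with \<open>relproj\<close>.\<close>
 have htr: "?h (tr (G(|carrier := S|)) D w) = \<zero>\<^sub>K"
  if "subgroup D (G(|carrier := S|))" "D ~= S" "w : fixd D" for D w
  using transfer_trans[OF S_sub(1) that(1,3)] lam_transfer_proper[OF vtx_S G.incl_subgroup[OF S_sub(1) that(1)] _ that(2,3)]
   subgroup.subset[OF that(1)] by simp
 have d: "?h a = (\<Oplus>\<^sub>K C\<in>\<Phi>. ?h (?b C))" unfolding \<Phi>_def using hc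
  by (intro additive_decomposition(1)[where h = ?h, OF S_sub(1) S_sub(1) \<sigma>_fixd tr_one a
    K.abelian_monoid_axioms _ h0 hadd htr]) auto
 have bC: "?b C : fixd S" if "C : \<Phi>" for C
 proof -
  obtain x where "x : $G" "conjs G x S = S" "ALL a:fixd S. c (SOME g. g : C) a = c x a" using \<Phi>_rep[OF \<open>C : \<Phi>\<close>] by blast
  thus ?thesis using norm_fixd[of x \<sigma>] \<sigma>_fixd a fS by simp
 qed
 let ?c = "lam (tr G S i)"
 have cc: "?c : $K" using hc i_fixd by blast
 have tb: "t (?b C) : $K" if "C : \<Phi>" for C using bC[OF that] fixd_A t_closed by blast
 have "n \<cdot>\<^sub>K ?h (?b C) = ?c \<cdot>\<^sub>K t (?b C)" if C: "C : \<Phi>" for C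
 proof -
  obtain b where b: "b : fixd S" "t (?b C) = n \<cdot>\<^sub>K chi (i \<cdot> (y0 \<cdot> b) \<cdot> i)"
   "tr G S (?b C) = tr G S (b \<cdot> i \<cdot> y0)" using t_term[OF a C] by blast
  have "chi (i \<cdot> (y0 \<cdot> b) \<cdot> i) : $K" using b y0 fS by (intro chi_corner(1) cornerI) auto
  thus ?thesis using b lam_transfer_sandwich[OF b(1) y0] cc n_closed by (simp add: K.m_lcomm)
 qed
 hence "(\<Oplus>\<^sub>K C\<in>\<Phi>. n \<cdot>\<^sub>K ?h (?b C)) = (\<Oplus>\<^sub>K C\<in>\<Phi>. ?c \<cdot>\<^sub>K t (?b C))"
  using cc tb by (intro K.finsum_cong') auto
 thus ?thesis unfolding d t_decomposition[OF a] using finite_\<Phi> n_closed cc tb hc bC by (subst (1 2) K.finsum_rdistr) auto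
qed

end

section \<open>Outer products of two algebras with a group action\<close>

lemma (in gset) orbit_dvd:
 assumes p: "Factorial_Ring.prime (p::nat)" and c: "card ($G) = p ^ n" and f: "finite ($G)"
  and w: "w : \<Omega>" and nf: "\<not> (ALL g:$G. \<rho> g w = w)"
 shows "p dvd card (orb w)"
proof -
 have s: "stab w ~= $G" using nf unfolding stab_def by auto
 show ?thesis using card_proper_subgroup_prime_power[OF f p c stab_subgroup[OF w] s] bij_betw_same_card[OF orb_bij(1)[OF w]] by simp
qed

lemma (in gset) card_by_orbits: "card \<Omega> = (\<Sum>X\<in>orbs. card X)"
 using card_Union_disjoint[OF orbs_disjoint] finite_orbs Union_orbs by simp

lemma (in gset) prime_power_fixed_point:
 assumes "Factorial_Ring.prime (p::nat)" "card ($G) = p ^ n" "finite ($G)" "\<not> p dvd card \<Omega>"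
 shows "EX w:\<Omega>. ALL g:$G. \<rho> g w = w"
proof (rule ccontr)
 assume "\<not> ?thesis"
 hence "p dvd card X" if "X : orbs" for X using that orbit_dvd[OF assms(1-3)] unfolding orbs_def by blast
 hence "p dvd card \<Omega>" unfolding card_by_orbits by (intro dvd_sum) auto
 thus False using assms(4) by simp
qed

lemma (in group) card_conj_inter_prime_power:
 assumes "finite ($G)" "Factorial_Ring.prime (p::nat)" "subgroup P G" "card P = p ^ n" "subgroup D G" "D <= P"
 shows "\<exists>k. card D = p ^ k"
proof -
 have DP: "subgroup D (G(|carrier := P|))" using subgroup_incl[OF assms(5,3,6)] .
 have gP: "group (G(|carrier := P|))" using subgroup.subgroup_is_group[OF assms(3) is_group] .
 have fP: "finite ($(G(|carrier := P|)))" using finite_subset[OF subgroup.subset[OF assms(3)] assms(1)] by simp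
 have "card (lcosets\<^bsub>G(|carrier := P|)\<^esub> D) * card D = p ^ n" using group.l_lagrange[OF gP fP DP] assms(4) by (simp add: order_def)
 hence "card D dvd p ^ n" by (metis dvd_triv_right)
 thus ?thesis unfolding divides_primepow_nat[OF assms(2)] by (elim exE conjE) (rule exI)
qed

text \<open>A \<open>p\<close>-group acting on a number of cosets prime to \<open>p\<close> fixes
  one of them: the usual proof of Sylow's second theorem.\<close>

lemma (in group) prime_power_subgroup_conj:
 assumes fin: "finite ($G)" and p: "Factorial_Ring.prime (p::nat)"
  and P: "subgroup P G" and ix: "\<not> p dvd card (lcosets P)" and D: "subgroup D G" "card D = p ^ n"
 shows "EX x:$G. conjs G x D <= P"
proof -
 interpret gs: gset "G(|carrier := D|)" "lcosets P" "%g C. g <#\<^sub>G C" using gset.restrict_gset[OF lcosets_gset[OF fin P] D(1)] .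
 have Ds: "D <= $G" using D(1) by (rule subgroup.subset)
 have cD: "card ($(G(|carrier := D|))) = p ^ n" "finite ($(G(|carrier := D|)))"
  "$(G(|carrier := D|)) = D" using D(2) finite_subset[OF Ds fin] by auto
 obtain C where C: "C : lcosets P" "ALL g:D. g <#\<^sub>G C = C" using gs.prime_power_fixed_point[of p n, OF p cD(1,2) ix] cD(3) by auto
 obtain x where x: "x : $G" "C = x <#\<^sub>G P" using C(1) unfolding LCOSETS_def by blast
 have "D <= conjs G x P" using C(2) coset_fixed_iff[OF fin P Ds x(1)] x(2) by simp
 hence "conjs G (inv x) D <= conjs G (inv x) (conjs G x P)" unfolding conjs_def by auto
 also have "... = P" using x subgroup.subset[OF P] by (simp add: conj_set_conj conj_set_one)
 finally show ?thesis using x by blast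
qed

text \<open>Each fibre of the multiplication map on \<open>H \<times> K\<close> is parametrised by
  \<open>H \<inter> K\<close> through \<open>d\<close> mapped to \<open>(h d, d^-1 k)\<close>. The
  product set need not be a subgroup.\<close>

lemma (in group) card_product_set:
 assumes fin: "finite ($G)" and H: "subgroup H G" and K: "subgroup K G"
 shows "card (H <#> K) * card (H \<inter> K) = card H * card K"
proof -
 have sub: "H <= $G" "K <= $G" using H K subgroup.subset by auto
 have finHK: "finite H" "finite K" using sub fin finite_subset by auto
 let ?f = "%(h, k). h \<cdot> k"
 have fib: "card {z : H \<times> K. ?f z = y} = card (H \<inter> K)" if y: "y : H <#> K" for y
 proof -
  obtain h k where hk: "h : H" "k : K" "y = h \<cdot> k" using y unfolding set_mult_def by blast
  have G: "h : $G" "k : $G" using hk sub by auto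
  have "bij_betw (%d. (h \<cdot> d, inv d \<cdot> k)) (H \<inter> K) {z : H \<times> K. ?f z = y}"
  proof (rule bij_betwI[where g = "%z. inv h \<cdot> fst z"])
   show "(%d. (h \<cdot> d, inv d \<cdot> k)) : H \<inter> K \<rightarrow> {z : H \<times> K. ?f z = y}"
   proof
    fix d assume d: "d : H \<inter> K"
    hence dG: "d : $G" using sub by auto
    have "h \<cdot> d \<cdot> (inv d \<cdot> k) = h \<cdot> (d \<cdot> inv d) \<cdot> k" using G dG by (simp only: m_assoc m_closed inv_closed)
    thus "(h \<cdot> d, inv d \<cdot> k) : {z : H \<times> K. ?f z = y}"
    using d hk G dG subgroup.m_closed[OF H] subgroup.m_closed[OF K] subgroup.m_inv_closed[OF K] by simp
   qed
   show "(%z. inv h \<cdot> fst z) : {z : H \<times> K. ?f z = y} \<rightarrow> H \<inter> K"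
   proof
    fix z assume "z : {z : H \<times> K. ?f z = y}"
    then obtain a b where ab: "z = (a, b)" "a : H" "b : K" "a \<cdot> b = h \<cdot> k" using hk by auto
    have abG: "a : $G" "b : $G" using ab sub by auto
    have "inv h \<cdot> a = inv h \<cdot> (a \<cdot> b) \<cdot> inv b" using abG G by (simp add: m_assoc)
    also have "... = k \<cdot> inv b" unfolding ab(4) using abG G by (simp add: m_assoc[symmetric])
    finally have "inv h \<cdot> a : K" using ab(3) hk(2) subgroup.m_closed[OF K] subgroup.m_inv_closed[OF K] by simp
    moreover have "inv h \<cdot> a : H" using ab(2) hk(1) subgroup.m_closed[OF H] subgroup.m_inv_closed[OF H] by simp
    ultimately show "inv h \<cdot> fst z : H \<inter> K" using ab(1) by simp
   qed
   show "inv h \<cdot> fst (h \<cdot> d, inv d \<cdot> k) = d" if "d : H \<inter> K" for d using that G sub by (auto simp: m_assoc[symmetric])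
   show "(h \<cdot> (inv h \<cdot> fst z), inv (inv h \<cdot> fst z) \<cdot> k) = z" if z: "z : {z : H \<times> K. ?f z = y}" for z
   proof -
    obtain a b where ab: "z = (a, b)" "a : H" "b : K" "a \<cdot> b = h \<cdot> k" using z hk by auto
    have abG: "a : $G" "b : $G" using ab sub by auto
    have "inv (inv h \<cdot> a) \<cdot> k = inv a \<cdot> (h \<cdot> k)" using abG G by (simp add: inv_mult_group m_assoc)
    also have "... = b" unfolding ab(4)[symmetric] using abG by (simp add: m_assoc[symmetric])
    finally show ?thesis using ab abG G by (simp add: m_assoc[symmetric])
   qed
  qed
  thus ?thesis by (simp add: bij_betw_same_card)
 qed
 have "card (H \<times> K) = (\<Sum>y\<in>H <#> K. card {z : H \<times> K. ?f z = y})"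
 proof -
  have "H \<times> K = (\<Union>y\<in>H <#> K. {z : H \<times> K. ?f z = y})" by (auto simp: set_mult_def)
  moreover have "finite (H <#> K)" unfolding set_mult_def using finHK by auto
  ultimately show ?thesis using finHK card_UN_disjoint[of "H <#> K" "%y. {z : H \<times> K. ?f z = y}"] by auto
 qed
 also have "... = (\<Sum>y\<in>H <#> K. card (H \<inter> K))" using fib by simp
 finally show ?thesis by (simp add: card_cartesian_product)
qed

text \<open>The map \<open>tens\<close> is the tensor product of endomorphisms. The elements
  \<open>aU\<close> and \<open>aV\<close> witness relative projectivity with respect to
  \<open>Q\<close> and \<open>R\<close>; \<open>eU\<close> and \<open>eV\<close> exist because the
  sources have rank prime to \<open>p\<close>, the trace of a projection being the rank of its
  image.\<close>

locale pair_data = traced_galgebra A G c K t lam Sc p + U: galgebra AU G cU + V: galgebra AV G cV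
 for A :: "('a, 'y) ring_scheme" (structure) and G :: "('g, 'z) monoid_scheme" and c
  and K :: "('k, 'w) ring_scheme" and t lam Sc p
  and AU :: "('d, 'x) ring_scheme" and cU and AV :: "('e, 'v) ring_scheme" and cV +
 fixes tens :: "'d => 'e => 'a" and tU :: "'d => 'k" and tV :: "'e => 'k" and Q R :: "'g set"
  and aU eU :: 'd and aV eV :: 'e and nQ nR :: nat
 assumes tens_closed: "u : $AU ==> v : $AV ==> tens u v : $A"
  and tens_add_l: "u : $AU ==> u' : $AU ==> v : $AV ==>
   tens (u \<oplus>\<^sub>AU u') v = tens u v \<oplus> tens u' v"
  and tens_add_r: "u : $AU ==> v : $AV ==> v' : $AV ==>
   tens u (v \<oplus>\<^sub>AV v') = tens u v \<oplus> tens u v'"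
  and tens_one: "tens \<one>\<^sub>AU \<one>\<^sub>AV = \<one>"
  and tens_c: "g : $G ==> u : $AU ==> v : $AV ==>
   c g (tens u v) = tens (cU g u) (cV g v)"
  and tU_closed: "u : $AU ==> tU u : $K" and tV_closed: "v : $AV ==> tV v : $K"
  and tU_c: "g : $G ==> u : $AU ==> tU (cU g u) = tU u"
  and tV_c: "g : $G ==> v : $AV ==> tV (cV g v) = tV v"
  and t_tens: "u : $AU ==> v : $AV ==> t (tens u v) = tU u \<cdot>\<^sub>K tV v"
  and Q: "subgroup Q G" "card Q = p ^ nQ" and R: "subgroup R G" "card R = p ^ nR"
  and aU: "aU : fixpts AU cU Q" "transfer AU cU G Q aU = \<one>\<^sub>AU"
  and aV: "aV : fixpts AV cV R" "transfer AV cV G R aV = \<one>\<^sub>AV"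
  and eU: "eU : fixpts AU cU Q" "tU eU ~= \<zero>\<^sub>K"
  and eV: "eV : fixpts AV cV R" "tV eV ~= \<zero>\<^sub>K"
begin

lemma sub: "Q <= $G" "R <= $G" using subgroup.subset[OF Q(1)] subgroup.subset[OF R(1)] by auto

lemma e_nonzero: "tU eU \<cdot>\<^sub>K tV eV ~= \<zero>\<^sub>K" using eU(2) eV(2)
  K.integral_iff[OF tU_closed[OF U.fixd_A[OF eU(1)]] tV_closed[OF V.fixd_A[OF eV(1)]]] by simp

lemma tens_fixd:
 assumes "x : $G" "y : $G" "u : fixpts AU cU Q" "v : fixpts AV cV R"
 shows "tens (cU x u) (cV y v) : fixd (conjs G x Q \<inter> conjs G y R)"
  and "t (tens (cU x u) (cV y v)) = tU u \<cdot>\<^sub>K tV v"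
proof -
 have A: "u : $AU" "v : $AV" using U.fixd_A[OF assms(3)] V.fixd_A[OF assms(4)] by blast+
 have f: "cU x u : fixpts AU cU (conjs G x Q)" "cV y v : fixpts AV cV (conjs G y R)"
  using U.c_conj_fixd[OF sub(1) assms(3,1)] V.c_conj_fixd[OF sub(2) assms(4,2)] unfolding conjs_def by blast+
 have cl: "cU x u : $AU" "cV y v : $AV" using U.c_closed[OF assms(1) A(1)] V.c_closed[OF assms(2) A(2)] by blast+
 show "t (tens (cU x u) (cV y v)) = tU u \<cdot>\<^sub>K tV v" unfolding t_tens[OF cl] tU_c[OF assms(1) A(1)] tV_c[OF assms(2) A(2)] ..
 show "tens (cU x u) (cV y v) : fixd (conjs G x Q \<inter> conjs G y R)" unfolding fixpts_def mem_Collect_eq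
 proof (intro conjI ballI)
  show "tens (cU x u) (cV y v) : $A" using tens_closed[OF cl] .
  fix h assume "h : conjs G x Q \<inter> conjs G y R"
  hence h: "h : conjs G x Q" "h : conjs G y R" by blast+
  hence hG: "h : $G" using G.conj_set_sub[OF assms(1) sub(1)] by auto
  show "c h (tens (cU x u) (cV y v)) = tens (cU x u) (cV y v)" using tens_c[OF hG cl] U.fixdD[OF f(1) h(1)] V.fixdD[OF f(2) h(2)] by simp
 qed
qed

lemma inter_subgroup:
 assumes "x : $G" "y : $G"
 shows "subgroup (conjs G x Q \<inter> conjs G y R) G" "\<exists>k. card (conjs G x Q \<inter> conjs G y R) = p ^ k"
proof -
 have s: "subgroup (conjs G x Q) G" "subgroup (conjs G y R) G"
  using G.conj_set_subgroup[OF assms(1) Q(1)] G.conj_set_subgroup[OF assms(2) R(1)] by blast+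
 show i: "subgroup (conjs G x Q \<inter> conjs G y R) G" using G.subgroups_Inter_pair[OF s] .
 show "\<exists>k. card (conjs G x Q \<inter> conjs G y R) = p ^ k"
 proof (rule G.card_conj_inter_prime_power[OF finite_G prime_p s(1) _ i])
  show "card (conjs G x Q) = p ^ nQ" using G.conj_set_card[OF assms(1) sub(1)] Q(2) by simp
 qed simp
qed

text \<open>The tensor product of suitable conjugates of \<open>eU\<close> and \<open>eV\<close> is
  fixed by the intersection and has nonzero trace, so \<open>t_nonzero_contained\<close>
  applies.\<close>

lemma inter_contained:
 assumes "x : $G" "y : $G" "vtx S"
 shows "EX z:$G. conjs G x Q \<inter> conjs G y R <= conjs G z S"
proof -
 obtain k where k: "card (conjs G x Q \<inter> conjs G y R) = p ^ k" using inter_subgroup(2)[OF assms(1,2)] by blast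
 have "t (tens (cU x eU) (cV y eV)) ~= \<zero>\<^sub>K" unfolding tens_fixd(2)[OF assms(1,2) eU(1) eV(1)] by (rule e_nonzero)
 moreover have "subgroup S G" "relproj S" using assms(3) unfolding vtx_def by blast+
 ultimately show ?thesis using t_nonzero_contained[OF inter_subgroup(1)[OF assms(1,2)] k _ _ tens_fixd(1)[OF assms(1,2) eU(1) eV(1)]] by blast
qed

abbreviation (input) "pairs \<equiv> (lcosets \<^sub>G Q) \<times> (lcosets \<^sub>G R)"
abbreviation (input) "pact \<equiv> (%g (C, C'). (g <#\<^sub>G C, g <#\<^sub>G C'))"
text \<open>The summand belonging to a pair of cosets when \<open>1\<close> is written as the tensor
  product of the transfers of \<open>aU\<close> and \<open>aV\<close> and multiplied out.\<close>

definition "pF w = tens (cU (SOME g. g : fst w) aU) (cV (SOME g. g : snd w) aV)"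

lemma pairs_gset: "gset G pairs pact"
proof -
 note gQ = G.lcosets_gset[OF finite_G Q(1)] and gR = G.lcosets_gset[OF finite_G R(1)]
 show ?thesis
 proof (intro gset.intro[OF G.is_group] gset_axioms.intro)
  show "finite pairs" using gset.fin[OF gQ] gset.fin[OF gR] by simp
  show "!!g w. g : $G ==> w : pairs ==> pact g w : pairs" using gset.closed[OF gQ] gset.closed[OF gR] by (simp add: split_beta mem_Times_iff)
  show "!!w. w : pairs ==> pact \<one>\<^sub>G w = w" using gset.one[OF gQ] gset.one[OF gR] by (simp add: split_beta mem_Times_iff)
  show "!!g h w. g : $G ==> h : $G ==> w : pairs ==> pact (g \<cdot>\<^sub>G h) w = pact g (pact h w)"
   using gset.mult[OF gQ] gset.mult[OF gR] by (simp add: split_beta mem_Times_iff)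
 qed
qed

lemma pF_equivariant:
 shows "pF : pairs \<rightarrow> $A"
  and "g : $G ==> w : pairs ==> pF (pact g w) = c g (pF w)"
  and "x : $G ==> y : $G ==> pF (x <#\<^sub>G Q, y <#\<^sub>G R) = tens (cU x aU) (cV y aV)"
proof -
 note FU = U.coset_fun[OF Q(1) aU(1)] and FV = V.coset_fun[OF R(1) aV(1)]
 have cl: "cU (SOME g. g : C) aU : $AU" "cV (SOME g. g : C') aV : $AV"
  if "C : lcosets \<^sub>G Q" "C' : lcosets \<^sub>G R" for C C' using FU(1) FV(1) that by auto
 show "pF : pairs \<rightarrow> $A" unfolding pF_def using tens_closed cl by auto
 show "pF (pact g w) = c g (pF w)" if g: "g : $G" and w: "w : pairs"
 proof -
  obtain C C' where w': "w = (C, C')" "C : lcosets \<^sub>G Q" "C' : lcosets \<^sub>G R" using w by auto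
  show ?thesis unfolding pF_def w'(1) using FU(2)[OF g w'(2)] FV(2)[OF g w'(3)] tens_c[OF g cl[OF w'(2,3)]] by simp
 qed
 show "x : $G ==> y : $G ==> pF (x <#\<^sub>G Q, y <#\<^sub>G R) = tens (cU x aU) (cV y aV)" unfolding pF_def using FU(3) FV(3) by simp
qed

lemma pF_sum: "(\<Oplus>w\<in>pairs. pF w) = \<one>"
proof -
 note FU = U.coset_fun[OF Q(1) aU(1)] and FV = V.coset_fun[OF R(1) aV(1)]
 note gQ = G.lcosets_gset[OF finite_G Q(1)] and gR = G.lcosets_gset[OF finite_G R(1)]
 let ?u = "%C. cU (SOME g. g : C) aU" and ?v = "%C. cV (SOME g. g : C) aV"
 have tz: "tens \<zero>\<^sub>AU v = \<zero>" if "v : $AV" for v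
  using tens_add_l[of "\<zero>\<^sub>AU" "\<zero>\<^sub>AU" v] tens_closed[of "\<zero>\<^sub>AU" v] that by (simp add: A.add.r_cancel_one')
 have tz': "tens u \<zero>\<^sub>AV = \<zero>" if "u : $AU" for u
  using tens_add_r[of u "\<zero>\<^sub>AV" "\<zero>\<^sub>AV"] tens_closed[of u "\<zero>\<^sub>AV"] that by (simp add: A.add.r_cancel_one')
 have "(\<Oplus>w\<in>pairs. pF w) = (\<Oplus>C\<in>lcosets \<^sub>G Q. \<Oplus>C'\<in>lcosets \<^sub>G R. tens (?u C) (?v C'))"
  unfolding pF_def using FU(1) FV(1) gset.fin[OF gQ] gset.fin[OF gR] tens_closed
  by (intro A.finsum_Sigma[of "lcosets \<^sub>G Q" "lcosets \<^sub>G R" "%C C'. tens (?u C) (?v C')"]) auto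
 also have "... = (\<Oplus>C\<in>lcosets \<^sub>G Q. tens (?u C) \<one>\<^sub>AV)"
 proof (rule A.finsum_cong')
  show "(%C. tens (?u C) \<one>\<^sub>AV) : lcosets \<^sub>G Q \<rightarrow> $A" using FU(1) tens_closed by auto
  fix C assume C: "C : lcosets \<^sub>G Q"
  have uC: "?u C : $AU" using FU(1) C by auto
  have "tens (?u C) (transfer AV cV G R aV) = (\<Oplus>C'\<in>lcosets \<^sub>G R. tens (?u C) (?v C'))" unfolding transfer_def
   by (rule V.A.add_finsum(2)[where P = "$AV", OF A.abelian_monoid_axioms])
    (use uC FV(1) tens_closed tens_add_r tz' in auto)
  thus "(\<Oplus>C'\<in>lcosets \<^sub>G R. tens (?u C) (?v C')) = tens (?u C) \<one>\<^sub>AV" using aV(2) by simp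
 qed simp
 also have "... = tens (transfer AU cU G Q aU) \<one>\<^sub>AV" unfolding transfer_def
  using U.A.add_finsum(2)[OF A.abelian_monoid_axioms, of "$AU" "%u. tens u \<one>\<^sub>AV" ?u]
   FU(1) tens_closed tens_add_l tz by auto
 finally show ?thesis using aU(2) tens_one by simp
qed

lemma pair_stab:
 assumes "x : $G" "y : $G"
 shows "gset.stab G pact (x <#\<^sub>G Q, y <#\<^sub>G R) = conjs G x Q \<inter> conjs G y R"
proof -
 interpret gp: gset G pairs pact by (rule pairs_gset)
 show ?thesis
 proof (rule Set.set_eqI)
  fix g
  show "g : gp.stab (x <#\<^sub>G Q, y <#\<^sub>G R) \<longleftrightarrow> g : conjs G x Q \<inter> conjs G y R"
  proof (cases "g : $G")
   case True
   thus ?thesis unfolding gp.stab_def using G.lcos_fixed_iff[OF Q(1) assms(1) True] G.lcos_fixed_iff[OF R(1) assms(2) True]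
    G.mem_conj_set[OF assms(1) sub(1) True] G.mem_conj_set[OF assms(2) sub(2) True] by simp
  next
   case False
   thus ?thesis unfolding gp.stab_def using G.conj_set_sub[OF assms(1) sub(1)] by blast
  qed
 qed
qed

lemma lam_orbit_sum:
 "\<one>\<^sub>K = (\<Oplus>\<^sub>K X\<in>gset.orbs G pairs pact. lam (\<Oplus>w\<in>X. pF w))"
 "X : gset.orbs G pairs pact ==> EX x:$G. EX y:$G. X = gset.orb G pact (x <#\<^sub>G Q, y <#\<^sub>G R) &
  (\<Oplus>w\<in>X. pF w) = tr G (conjs G x Q \<inter> conjs G y R) (tens (cU x aU) (cV y aV))"
 "X : gset.orbs G pairs pact ==> (\<Oplus>w\<in>X. pF w) : fixd ($G)"
proof -
 interpret gp: gset G pairs pact by (rule pairs_gset)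
 show ex: "EX x:$G. EX y:$G. X = gp.orb (x <#\<^sub>G Q, y <#\<^sub>G R) &
  (\<Oplus>w\<in>X. pF w) = tr G (conjs G x Q \<inter> conjs G y R) (tens (cU x aU) (cV y aV))"
  if X: "X : gp.orbs" for X
 proof -
  obtain w where w: "w : pairs" "X = gp.orb w" using X unfolding gp.orbs_def by blast
  obtain x y where xy: "x : $G" "y : $G" "w = (x <#\<^sub>G Q, y <#\<^sub>G R)" using w(1) unfolding LCOSETS_def by auto
  show ?thesis using orbit_sum(2)[OF pairs_gset pF_equivariant(1,2) w(1)] pair_stab[OF xy(1,2)] pF_equivariant(3)[OF xy(1,2)]
    xy w(2) by auto
 qed
 show fx: "(\<Oplus>w\<in>X. pF w) : fixd ($G)" if X: "X : gp.orbs" for X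
  using ex[OF X] tr_fixd[OF inter_subgroup(1) tens_fixd(1)[OF _ _ aU(1) aV(1)]] by auto
 have "lam \<one> = lam (\<Oplus>X\<in>gp.orbs. \<Oplus>w\<in>X. pF w)" using sum_by_orbits[OF pairs_gset pF_equivariant(1)] pF_sum by simp
 also have "... = (\<Oplus>\<^sub>K X\<in>gp.orbs. lam (\<Oplus>w\<in>X. pF w))" using fx by (intro lam_finsum) blast
 finally show "\<one>\<^sub>K = (\<Oplus>\<^sub>K X\<in>gp.orbs. lam (\<Oplus>w\<in>X. pF w))" using lam_one by simp
qed

text \<open>Some orbit sum has nonzero residue, so \<open>relproj\<close> holds for its stabiliser.
  That stabiliser lies in a conjugate of \<open>S\<close>, hence equals it by minimality, and it
  fixes a tensor product of conjugates of \<open>eU\<close> and \<open>eV\<close>, whose trace is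
  nonzero.\<close>

lemma vertex_nonzero_trace:
 assumes S: "vtx S"
 shows "EX a:fixd S. t a ~= \<zero>\<^sub>K"
proof -
 interpret gp: gset G pairs pact by (rule pairs_gset)
 have Ss: "S <= $G" using S by (auto simp: vtx_def dest: subgroup.subset)
 have "EX X:gp.orbs. lam (\<Oplus>w\<in>X. pF w) ~= \<zero>\<^sub>K"
 proof (rule ccontr)
  assume "\<not> ?thesis"
  hence "(\<Oplus>\<^sub>K X\<in>gp.orbs. lam (\<Oplus>w\<in>X. pF w)) = \<zero>\<^sub>K" by (intro K.add.finprod_one_eqI) auto
  thus False using lam_orbit_sum(1) by simp
 qed
 then obtain X where X: "X : gp.orbs" "lam (\<Oplus>w\<in>X. pF w) ~= \<zero>\<^sub>K" by blast
 obtain x y where xy: "x : $G" "y : $G"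
  "(\<Oplus>w\<in>X. pF w) = tr G (conjs G x Q \<inter> conjs G y R) (tens (cU x aU) (cV y aV))" using lam_orbit_sum(2)[OF X(1)] by blast
 let ?D = "conjs G x Q \<inter> conjs G y R"
 have D: "subgroup ?D G" "relproj ?D" using inter_subgroup(1)[OF xy(1,2)]
   lam_transfer_relproj[OF inter_subgroup(1)[OF xy(1,2)] tens_fixd(1)[OF xy(1,2) aU(1) aV(1)]] X(2) xy(3) by auto
 obtain z where z: "z : $G" "?D <= conjs G z S" using inter_contained[OF xy(1,2) S] by blast
 have e: "?D = conjs G z S" using vtx_conj[OF z(1) S] D z(2) unfolding vtx_def by blast
 let ?b = "tens (cU x eU) (cV y eV)"
 have b: "?b : fixd (conjs G z S)" using tens_fixd(1)[OF xy(1,2) eU(1) eV(1)] e by simp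
 have iz: "inv \<^sub>G z : $G" using z by simp
 have "conjs G (inv \<^sub>G z) (conjs G z S) = S" using z Ss by (simp add: G.conj_set_conj G.conj_set_one)
 hence "c (inv \<^sub>G z) ?b : fixd S" using c_conj_fixd[OF G.conj_set_sub[OF z(1) Ss] b iz] unfolding conjs_def by simp
 moreover have "t (c (inv \<^sub>G z) ?b) = tU eU \<cdot>\<^sub>K tV eV" using t_c[OF iz fixd_A[OF b]] tens_fixd(2)[OF xy(1,2) eU(1) eV(1)] by simp
 ultimately show ?thesis using e_nonzero by (intro bexI[of _ "c (inv \<^sub>G z) ?b"]) simp_all
qed

text \<open>A count of the orbits on pairs of cosets, weighted once by residues in \<open>K\<close>
  and once by length.\<close>

lemma order_formula:
 assumes S: "vtx S" "card S = p ^ m" and n: "n : $K" "n ~= \<zero>\<^sub>K" and k: "k : $K"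
  and proportional: "!!a. a : fixd S ==> n \<cdot>\<^sub>K lam (tr G S a) = k \<cdot>\<^sub>K t a"
 shows "p ^ Factorial_Ring.multiplicity p (order G) * card S = card Q * card R"
proof -
 interpret gp: gset G pairs pact by (rule pairs_gset)
 have SG: "subgroup S G" "S <= $G" using S by (auto simp: vtx_def dest: subgroup.subset)
 let ?q = "card (lcosets \<^sub>G S)"
 \<comment> \<open>The value of \<open>n\<close> times the residue of an orbit sum whose stabiliser
   is conjugate to \<open>S\<close>. By proportionality it is \<open>k\<close> times a trace of a
   tensor product, and this depends neither on the orbit nor on its representatives.\<close>
 let ?tau = "k \<cdot>\<^sub>K (tU aU \<cdot>\<^sub>K tV aV)"
 have tau: "?tau : $K" using k tU_closed[OF U.fixd_A[OF aU(1)]] tV_closed[OF V.fixd_A[OF aV(1)]] by simp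
 let ?l = "%X. lam (\<Oplus>w\<in>X. pF w)"
 let ?N = "{X : gp.orbs. card X = ?q}"
 have oG: "order G > 0" using finite_G G.order_gt_0_iff_finite by blast
 have qS: "?q * card S = order G" using G.l_lagrange[OF finite_G SG(1)] .
 have S0: "card S > 0" using qS oG by (metis gr0I mult_0_right not_gr_zero)
 have q0: "?q > 0" using qS oG by (metis gr0I mult_0)
 \<comment> \<open>The stabiliser \<open>?D\<close> lies in a conjugate of \<open>S\<close>.
   Equality is the first alternative; otherwise \<open>?D\<close> is a smaller
   \<open>p\<close>-group, the index gains a factor \<open>p\<close>, and the residue vanishes by
   minimality.\<close>
 have casesX: "(card X = ?q & n \<cdot>\<^sub>K ?l X = ?tau) \<or> (p * ?q dvd card X & card X ~= ?q & ?l X = \<zero>\<^sub>K)"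
  if X: "X : gp.orbs" for X
 proof -
  obtain x y where xy: "x : $G" "y : $G" "X = gp.orb (x <#\<^sub>G Q, y <#\<^sub>G R)"
   "(\<Oplus>w\<in>X. pF w) = tr G (conjs G x Q \<inter> conjs G y R) (tens (cU x aU) (cV y aV))" using lam_orbit_sum(2)[OF X] by blast
  let ?D = "conjs G x Q \<inter> conjs G y R"
  let ?b = "tens (cU x aU) (cV y aV)"
  have wp: "(x <#\<^sub>G Q, y <#\<^sub>G R) : pairs" using xy unfolding LCOSETS_def by auto
  have cD: "card X * card ?D = order G" using gp.card_orb[OF wp finite_G] pair_stab[OF xy(1,2)] xy(3) by simp
  obtain z where z: "z : $G" "?D <= conjs G z S" using inter_contained[OF xy(1,2) S(1)] by blast
  have zS: "subgroup (conjs G z S) G" "card (conjs G z S) = card S" using G.conj_set_subgroup[OF z(1) SG(1)] G.conj_set_card[OF z(1) SG(2)] by auto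
  show ?thesis
  proof (cases "?D = conjs G z S")
   case True
   have b: "?b : fixd (conjs G z S)" using tens_fixd(1)[OF xy(1,2) aU(1) aV(1)] True by simp
   have iz: "inv \<^sub>G z : $G" using z by simp
   have cz: "conjs G (inv \<^sub>G z) (conjs G z S) = S" using z SG(2) by (simp add: G.conj_set_conj G.conj_set_one)
   have f: "c (inv \<^sub>G z) ?b : fixd S" using c_conj_fixd[OF G.conj_set_sub[OF z(1) SG(2)] b iz] cz unfolding conjs_def by simp
   have "tr G S (c (inv \<^sub>G z) ?b) = tr G ?D ?b" using transfer_conj[OF zS(1) b iz] cz True unfolding conjs_def by simp
   hence "n \<cdot>\<^sub>K ?l X = k \<cdot>\<^sub>K t (c (inv \<^sub>G z) ?b)" using proportional[OF f] xy(4) by simp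
   also have "... = ?tau" using t_c[OF iz fixd_A[OF b]] tens_fixd(2)[OF xy(1,2) aU(1) aV(1)] by simp
   finally have "n \<cdot>\<^sub>K ?l X = ?tau" .
   moreover have "card X = ?q" using cD qS zS(2) True S0 by (metis mult_cancel2 less_not_refl2)
   ultimately show ?thesis by blast
  next
   case False
   have "?l X = \<zero>\<^sub>K" unfolding xy(4) using lam_transfer_proper[OF vtx_conj[OF z(1) S(1)] inter_subgroup(1)[OF xy(1,2)] z(2) False
    tens_fixd(1)[OF xy(1,2) aU(1) aV(1)]] .
   moreover obtain j where j: "card ?D = p ^ j" using inter_subgroup(2)[OF xy(1,2)] by blast
   have fin: "finite (conjs G z S)" using G.conj_set_sub[OF z(1) SG(2)] finite_G finite_subset by blast
   have "card ?D < card S" using psubset_card_mono[OF fin, of ?D] z(2) False zS(2) by auto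
   hence "p ^ j < p ^ m" using j S(2) by simp
   hence jm: "j < m" using prime_p by (metis power_strict_increasing_iff prime_gt_1_nat)
   have "p ^ m = p ^ j * (p * p ^ (m - Suc j))" using jm by (metis Suc_diff_Suc less_imp_le_nat le_add_diff_inverse power_Suc power_add)
   hence "card X * p ^ j = (p * ?q * p ^ (m - Suc j)) * p ^ j" using cD qS j S(2) by (simp add: mult.assoc mult.left_commute mult.commute)
   hence cX: "card X = p * ?q * p ^ (m - Suc j)" using prime_p by (metis mult_cancel2 not_prime_0 power_not_zero)
   moreover have "card X ~= ?q"
   proof
    assume "card X = ?q"
    hence "p dvd 1" using cX q0 by (metis dvd_triv_left mult.assoc mult.commute mult.right_neutral nat_mult_eq_cancel1)
    thus False using prime_p by (metis not_prime_unit)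
   qed
   ultimately show ?thesis by simp
  qed
 qed
 have lc: "?l X : $K" if "X : gp.orbs" for X using lam_closed lam_orbit_sum(3)[OF that] by blast
 \<comment> \<open>The residues add up to \<open>1\<close>, so \<open>n\<close> is
   \<open>?tau\<close> added up as many times as there are orbits of length \<open>|G:S|\<close>. As
   \<open>n\<close> is nonzero, this number is not divisible by \<open>p\<close>.\<close>
 have "n = n \<cdot>\<^sub>K (\<Oplus>\<^sub>K X\<in>gp.orbs. ?l X)" unfolding lam_orbit_sum(1)[symmetric] using n(1) by simp
 also have "... = (\<Oplus>\<^sub>K X\<in>gp.orbs. n \<cdot>\<^sub>K ?l X)" using gp.finite_orbs(1) n lc by (intro K.finsum_rdistr) auto
 also have "... = (\<Oplus>\<^sub>K X\<in>?N. n \<cdot>\<^sub>K ?l X)"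
  using gp.finite_orbs(1) n lc casesX by (intro K.add.finprod_mono_neutral_cong_right) fastforce+
 also have "... = (\<Oplus>\<^sub>K X\<in>?N. ?tau)" using casesX tau by (intro K.finsum_cong') fastforce+
 also have "... = add_pow K (card ?N) ?tau" using tau by (rule K.add.finprod_const)
 finally have "\<not> p dvd card ?N" using K_multiple[OF _ tau] n by auto
 have "card pairs = (\<Sum>X\<in>gp.orbs. card X)" by (rule gp.card_by_orbits)
 also have "... = (\<Sum>X\<in>?N. card X) + (\<Sum>X\<in>gp.orbs - ?N. card X)"
  using gp.finite_orbs(1) by (intro sum.subset_diff[of ?N gp.orbs card, THEN trans]) (auto simp: add.commute)
 also have "(\<Sum>X\<in>?N. card X) = card ?N * ?q" by simp
 finally have c1: "card pairs = card ?N * ?q + (\<Sum>X\<in>gp.orbs - ?N. card X)" .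
 have "p * ?q dvd (\<Sum>X\<in>gp.orbs - ?N. card X)" using casesX by (intro dvd_sum) blast
 then obtain M where "(\<Sum>X\<in>gp.orbs - ?N. card X) = p * ?q * M" by (auto simp: dvd_def)
 hence c2: "card (lcosets \<^sub>G Q) * card (lcosets \<^sub>G R) = ?q * (card ?N + p * M)"
  using c1 by (simp add: card_cartesian_product algebra_simps)
 have nd: "\<not> p dvd card ?N + p * M" using \<open>\<not> p dvd card ?N\<close> by (simp add: dvd_add_left_iff)
 have "order G * order G * card S
   = (card (lcosets \<^sub>G Q) * card Q) * (card (lcosets \<^sub>G R) * card R) * card S"
  unfolding G.l_lagrange[OF finite_G Q(1)] G.l_lagrange[OF finite_G R(1)] ..
 also have "... = (card (lcosets \<^sub>G Q) * card (lcosets \<^sub>G R)) * (card Q * card R) * card S"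
  by (simp only: mult.assoc mult.left_commute mult.commute)
 also have "... = (?q * card S) * (card Q * card R * (card ?N + p * M))" unfolding c2 by (simp only: mult.assoc mult.left_commute mult.commute)
 also have "... = order G * (card Q * card R * (card ?N + p * M))" unfolding qS ..
 finally have "order G * card S = card Q * card R * (card ?N + p * M)" using oG by simp
 \<comment> \<open>The last factor is prime to \<open>p\<close>, so comparing exponents of
   \<open>p\<close> determines the product of the orders of \<open>Q\<close> and
   \<open>R\<close>.\<close>
 hence eq: "order G * p ^ m = p ^ (nQ + nR) * (card ?N + p * M)" using S(2) Q(2) R(2) by (simp add: power_add)
 have pe: "prime_elem p" using prime_p by blast
 have "multiplicity p (order G * p ^ m) = multiplicity p (order G) + m"
  using oG prime_p prime_gt_0_nat[OF prime_p] by (simp add: prime_elem_multiplicity_mult_distrib[OF pe])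
 moreover have "multiplicity p (p ^ (nQ + nR) * (card ?N + p * M)) = nQ + nR" using nd prime_p prime_gt_0_nat[OF prime_p]
  by (subst prime_elem_multiplicity_mult_distrib[OF pe]) (auto simp: not_dvd_imp_multiplicity_0 intro: gr0I)
 ultimately have "multiplicity p (order G) + m = nQ + nR" using eq by simp
 thus ?thesis using S(2) Q(2) R(2) by (simp flip: power_add)
qed

text \<open>For conjugates inside one Sylow subgroup \<open>P\<close>, the product set and the
  intersection have at most \<open>card P\<close> and \<open>card S\<close> elements, while by the
  order formula the product of their sizes is exactly \<open>card P * card S\<close>. So both bounds
  are attained.\<close>

theorem sylow_factorization:
 assumes S: "vtx S" "card S = p ^ m"
  and ord: "p ^ Factorial_Ring.multiplicity p (order G) * card S = card Q * card R"
 shows "EX x:$G. EX y:$G. vtx (conjs G x Q \<inter> conjs G y R) &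
  sylow_subgroup p (conjs G x Q <#>\<^sub>G conjs G y R) G"
proof -
 let ?e = "Factorial_Ring.multiplicity p (order G)"
 have SG: "subgroup S G" "S <= $G" using S by (auto simp: vtx_def dest: subgroup.subset)
 have oG: "order G > 0" using finite_G G.order_gt_0_iff_finite by blast
 have pnu: "\<not> is_unit p" using prime_p not_prime_unit by blast
 obtain r where r: "order G = p ^ ?e * r" "\<not> p dvd r" using multiplicity_decompose'[of "order G" p] oG pnu by auto
 obtain P where P: "subgroup P G" "card P = p ^ ?e" using sylow_thm[OF prime_p G.is_group r(1) finite_G] by blast
 have "card (lcosets \<^sub>G P) * p ^ ?e = r * p ^ ?e" using G.l_lagrange[OF finite_G P(1)] P(2) r(1) by (simp add: mult.commute)
 hence "card (lcosets \<^sub>G P) = r" using prime_gt_0_nat[OF prime_p] by simp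
 hence ix: "\<not> p dvd card (lcosets \<^sub>G P)" using r by simp
 obtain x where x: "x : $G" "conjs G x Q <= P" using G.prime_power_subgroup_conj[OF finite_G prime_p P(1) ix Q] by blast
 obtain y where y: "y : $G" "conjs G y R <= P" using G.prime_power_subgroup_conj[OF finite_G prime_p P(1) ix R] by blast
 let ?Q = "conjs G x Q" and ?R = "conjs G y R"
 have QR: "subgroup ?Q G" "subgroup ?R G" "card ?Q = card Q" "card ?R = card R" using G.conj_set_subgroup G.conj_set_card x y Q R sub by auto
 have Ps: "P <= $G" using P(1) by (rule subgroup.subset)
 have finP: "finite P" using Ps finite_G finite_subset by blast
 have sP: "?Q <#>\<^sub>G ?R <= P" using x y subgroup.m_closed[OF P(1)] unfolding set_mult_def by blast
 have c: "card (?Q <#>\<^sub>G ?R) * card (?Q \<inter> ?R) = card P * card S" using G.card_product_set[OF finite_G QR(1,2)] QR ord P(2) by simp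
 have cP: "card (?Q <#>\<^sub>G ?R) \<le> card P" using card_mono[OF finP sP] .
 obtain z where z: "z : $G" "?Q \<inter> ?R <= conjs G z S" using inter_contained[OF x(1) y(1) S(1)] by blast
 have zS: "card (conjs G z S) = card S" "finite (conjs G z S)"
  using G.conj_set_card[OF z(1) SG(2)] G.conj_set_sub[OF z(1) SG(2)] finite_G finite_subset by auto
 have cS: "card (?Q \<inter> ?R) \<le> card S" using card_mono[OF zS(2) z(2)] zS(1) by simp
 have pos: "card P > 0" "card S > 0" using P(2) S(2) prime_gt_0_nat[OF prime_p] by auto
 have e1: "card (?Q <#>\<^sub>G ?R) = card P"
 proof (rule ccontr)
  assume "\<not> ?thesis"
  hence "card (?Q <#>\<^sub>G ?R) < card P" using cP by simp
  hence "card (?Q <#>\<^sub>G ?R) * card (?Q \<inter> ?R) \<le> card (?Q <#>\<^sub>G ?R) * card S" using cS by simp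
  also have "... < card P * card S" using \<open>card (?Q <#>\<^sub>G ?R) < card P\<close> pos by simp
  finally show False using c by simp
 qed
 hence "card (?Q \<inter> ?R) = card S" using c pos by simp
 hence "?Q \<inter> ?R = conjs G z S" using card_subset_eq[OF zS(2) z(2)] zS(1) by simp
 hence "vtx (?Q \<inter> ?R)" using vtx_conj[OF z(1) S(1)] by simp
 moreover have "?Q <#>\<^sub>G ?R = P" using card_subset_eq[OF finP sP e1] .
 hence "sylow_subgroup p (?Q <#>\<^sub>G ?R) G" unfolding sylow_subgroup_def using P by simp
 ultimately show ?thesis using x(1) y(1) by blast
qed

end

section \<open>Free modules over a local ring\<close>

definition lin_fun :: "('a, 'y) ring_scheme => ('a, 'b, 'u) module_scheme => ('b => 'a) => bool"
 where "lin_fun R M f \<longleftrightarrow> f : $M \<rightarrow> $R &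
  (ALL x:$M. ALL y:$M. f (x \<oplus>\<^sub>M y) = f x \<oplus>\<^sub>R f y) &
  (ALL r:$R. ALL x:$M. f (r \<odot>\<^sub>M x) = r \<cdot>\<^sub>R f x)"

definition lin_map ::
  "('a, 'y) ring_scheme => ('a, 'b, 'u) module_scheme => ('a, 'c, 'v) module_scheme => ('b => 'c) => bool"
 where "lin_map R M N f \<longleftrightarrow> f : $M \<rightarrow> $N &
  (ALL x:$M. ALL y:$M. f (x \<oplus>\<^sub>M y) = f x \<oplus>\<^sub>N f y) &
  (ALL r:$R. ALL x:$M. f (r \<odot>\<^sub>M x) = r \<odot>\<^sub>N f x)"

text \<open>A finite generating family with linear coordinates, as every finitely generated
  projective module has; the trace makes sense for it. Independence is added in
  \<open>fbasis\<close>.\<close>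

definition dual_basis ::
  "('a, 'y) ring_scheme => ('a, 'b, 'u) module_scheme => 'i set => ('i => 'b) => ('i => 'b => 'a) => bool"
 where "dual_basis R M I b f \<longleftrightarrow> finite I & b : I \<rightarrow> $M & (ALL i:I. lin_fun R M (f i)) &
  (ALL x:$M. x = (\<Oplus>\<^sub>M i\<in>I. f i x \<odot>\<^sub>M b i))"

definition fbasis ::
  "('a, 'y) ring_scheme => ('a, 'b, 'u) module_scheme => 'i set => ('i => 'b) => ('i => 'b => 'a) => bool"
 where "fbasis R M I b f \<longleftrightarrow> dual_basis R M I b f &
  (ALL i:I. ALL j:I. f i (b j) = (if i = j then \<one>\<^sub>R else \<zero>\<^sub>R))"

definition dtrace ::
  "('a, 'y) ring_scheme => 'i set => ('i => 'b) => ('i => 'b => 'a) => ('b => 'b) => 'a"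
 where "dtrace R I b f \<phi> = (\<Oplus>\<^sub>R i\<in>I. f i (\<phi> (b i)))"

lemma funD:
 assumes "lin_fun R M f"
 shows "x : $M ==> f x : $R"
  and "x : $M ==> y : $M ==> f (x \<oplus>\<^sub>M y) = f x \<oplus>\<^sub>R f y"
  and "r : $R ==> x : $M ==> f (r \<odot>\<^sub>M x) = r \<cdot>\<^sub>R f x" using assms unfolding lin_fun_def by auto

lemma linD:
 assumes "lin_map R M N f"
 shows "x : $M ==> f x : $N"
  and "x : $M ==> y : $M ==> f (x \<oplus>\<^sub>M y) = f x \<oplus>\<^sub>N f y"
  and "r : $R ==> x : $M ==> f (r \<odot>\<^sub>M x) = r \<odot>\<^sub>N f x" using assms unfolding lin_map_def by auto

lemma dualD:
 assumes "dual_basis R M I b f"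
 shows "finite I" "i : I ==> b i : $M" "i : I ==> lin_fun R M (f i)"
  "x : $M ==> x = (\<Oplus>\<^sub>M i\<in>I. f i x \<odot>\<^sub>M b i)" using assms unfolding dual_basis_def by auto

lemma basisD:
 assumes "fbasis R M I b f"
 shows "dual_basis R M I b f"
  "i : I ==> j : I ==> f i (b j) = (if i = j then \<one>\<^sub>R else \<zero>\<^sub>R)" using assms unfolding fbasis_def by auto

context module
begin

lemma linear_fun_zero: assumes "lin_fun R M f" shows "f \<zero>\<^sub>M = \<zero>"
 using funD(3)[OF assms, of \<zero> "\<zero>\<^sub>M"] funD(1)[OF assms, of "\<zero>\<^sub>M"] by simp

lemma linear_fun_finsum:
 assumes f: "lin_fun R M f" and "!!i. i : I ==> x i : $M"
 shows "f (\<Oplus>\<^sub>M i\<in>I. x i) = (\<Oplus>i\<in>I. f (x i))" by (rule M.add_finsum(2)[where P = "$M", OF R.abelian_monoid_axioms])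
  (use funD[OF f] linear_fun_zero[OF f] assms(2) in auto)

lemma lin_zero: assumes "module R N" "lin_map R M N f" shows "f \<zero>\<^sub>M = \<zero>\<^sub>N"
proof -
 interpret N: module R N by fact
 show ?thesis using linD(3)[OF assms(2), of \<zero> "\<zero>\<^sub>M"] linD(1)[OF assms(2), of "\<zero>\<^sub>M"] by simp
qed

lemma lin_neg: assumes "module R N" "lin_map R M N f" "x : $M" shows "f (\<ominus>\<^sub>M x) = \<ominus>\<^sub>N f x"
proof -
 interpret N: module R N by fact
 have "f (\<ominus>\<^sub>M x) \<oplus>\<^sub>N f x = \<zero>\<^sub>N"
  using linD(2)[OF assms(2), of "\<ominus>\<^sub>M x" x] assms(3) lin_zero[OF assms(1,2)] by (simp add: M.l_neg)
 thus ?thesis using linD(1)[OF assms(2)] assms(3) by (simp add: N.minus_equality)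
qed

lemma lin_finsum:
 assumes N: "module R N" and f: "lin_map R M N f" and "!!i. i : I ==> x i : $M"
 shows "f (\<Oplus>\<^sub>M i\<in>I. x i) = (\<Oplus>\<^sub>N i\<in>I. f (x i))"
proof -
 interpret N: module R N by fact
 show ?thesis by (rule M.add_finsum(2)[where P = "$M", OF N.M.abelian_monoid_axioms])
   (use linD[OF f] lin_zero[OF N f] assms(3) in auto)
qed

lemma finsum_lin_comb:
 assumes "finite I" "r : $R" "!!i. i : I ==> x i : $M" "!!i. i : I ==> y i : $M"
 shows "(\<Oplus>\<^sub>M i\<in>I. x i \<oplus>\<^sub>M r \<odot>\<^sub>M y i) = (\<Oplus>\<^sub>M i\<in>I. x i) \<oplus>\<^sub>M r \<odot>\<^sub>M (\<Oplus>\<^sub>M i\<in>I. y i)"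
proof -
 have "(\<Oplus>\<^sub>M i\<in>I. x i \<oplus>\<^sub>M r \<odot>\<^sub>M y i) = (\<Oplus>\<^sub>M i\<in>I. x i) \<oplus>\<^sub>M (\<Oplus>\<^sub>M i\<in>I. r \<odot>\<^sub>M y i)"
  using assms by (intro M.finsum_addf) auto
 thus ?thesis using finsum_smult_ldistr[of I r y] assms by (simp add: Pi_def)
qed

text \<open>Both sides are the double sum of \<open>f i (\<phi> (c j)) \<cdot> g j (\<psi> (b i))\<close>.\<close>

lemma dual_trace_commute:
 assumes N: "module R N" and bM: "dual_basis R M I b f" and bN: "dual_basis R N J c g"
  and \<phi>: "lin_map R N M \<phi>" and \<psi>: "lin_map R M N \<psi>"
 shows "dtrace R I b f (\<phi> \<circ> \<psi>) = dtrace R J c g (\<psi> \<circ> \<phi>)"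
proof -
 interpret N: module R N by fact
 note M' = dualD[OF bM] and N' = dualD[OF bN]
 have fc: "f i x : $R" if "i : I" "x : $M" for i x using funD(1)[OF M'(3)] that by blast
 have gc: "g j x : $R" if "j : J" "x : $N" for j x using funD(1)[OF N'(3)] that by blast
 note [simp] = M'(2) N'(2) fc gc linD(1)[OF \<phi>] linD(1)[OF \<psi>]
 have e1: "f i (\<phi> (\<psi> (b i))) = (\<Oplus>j\<in>J. g j (\<psi> (b i)) \<cdot> f i (\<phi> (c j)))" if i: "i : I" for i
 proof -
  have "\<psi> (b i) = (\<Oplus>\<^sub>N j\<in>J. g j (\<psi> (b i)) \<odot>\<^sub>N c j)" using N'(4)[of "\<psi> (b i)"] i by simp
  hence "f i (\<phi> (\<psi> (b i))) = f i (\<phi> (\<Oplus>\<^sub>N j\<in>J. g j (\<psi> (b i)) \<odot>\<^sub>N c j))" by (rule arg_cong)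
  also have "... = f i (\<Oplus>\<^sub>M j\<in>J. \<phi> (g j (\<psi> (b i)) \<odot>\<^sub>N c j))"
   using i by (subst N.lin_finsum[OF module_axioms \<phi>]) auto
  also have "... = (\<Oplus>j\<in>J. f i (\<phi> (g j (\<psi> (b i)) \<odot>\<^sub>N c j)))" using i by (intro linear_fun_finsum[OF M'(3)]) auto
  also have "... = (\<Oplus>j\<in>J. g j (\<psi> (b i)) \<cdot> f i (\<phi> (c j)))"
   using i by (intro R.finsum_cong') (auto simp: linD(3)[OF \<phi>] funD(3)[OF M'(3)])
  finally show ?thesis .
 qed
 have e2: "g j (\<psi> (\<phi> (c j))) = (\<Oplus>i\<in>I. g j (\<psi> (b i)) \<cdot> f i (\<phi> (c j)))" if j: "j : J" for j
 proof -
  have "\<phi> (c j) = (\<Oplus>\<^sub>M i\<in>I. f i (\<phi> (c j)) \<odot>\<^sub>M b i)" using M'(4)[of "\<phi> (c j)"] j by simp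
  hence "g j (\<psi> (\<phi> (c j))) = g j (\<psi> (\<Oplus>\<^sub>M i\<in>I. f i (\<phi> (c j)) \<odot>\<^sub>M b i))" by (rule arg_cong)
  also have "... = g j (\<Oplus>\<^sub>N i\<in>I. \<psi> (f i (\<phi> (c j)) \<odot>\<^sub>M b i))" using j by (subst lin_finsum[OF N \<psi>]) auto
  also have "... = (\<Oplus>i\<in>I. g j (\<psi> (f i (\<phi> (c j)) \<odot>\<^sub>M b i)))" using j by (intro N.linear_fun_finsum[OF N'(3)]) auto
  also have "... = (\<Oplus>i\<in>I. g j (\<psi> (b i)) \<cdot> f i (\<phi> (c j)))"
   using j by (intro R.finsum_cong') (auto simp: linD(3)[OF \<psi>] funD(3)[OF N'(3)] R.m_comm)
  finally show ?thesis .
 qed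
 have "dtrace R I b f (\<phi> \<circ> \<psi>) = (\<Oplus>i\<in>I. \<Oplus>j\<in>J. g j (\<psi> (b i)) \<cdot> f i (\<phi> (c j)))"
  unfolding dtrace_def comp_def using e1 by (intro R.finsum_cong') (auto intro!: R.finsum_closed)
 also have "... = (\<Oplus>j\<in>J. \<Oplus>i\<in>I. g j (\<psi> (b i)) \<cdot> f i (\<phi> (c j)))" using M'(1) N'(1) by (intro R.finsum_swap) auto
 also have "... = dtrace R J c g (\<psi> \<circ> \<phi>)" unfolding dtrace_def comp_def using e2
  by (intro R.finsum_cong') (auto intro!: R.finsum_closed)
 finally show ?thesis .
qed

lemma lin_id: "lin_map R M M (%x. x)" unfolding lin_map_def by auto

lemma submodule_finsum:
 assumes "submodule H R M" "y : X \<rightarrow> H"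
 shows "finsum (M(|carrier := H|)) y X = finsum M y X"
proof -
 interpret N: module R "M(|carrier := H|)" by (rule submodule.submodule_is_module[OF assms(1) module_axioms])
 have H: "H <= $M" using submoduleE(1)[OF assms(1)] .
 have "finsum (M(|carrier := H|)) y X = (\<Oplus>\<^sub>M i\<in>X. y i)"
  using N.M.add_finsum(2)[OF M.abelian_monoid_axioms, of H "%x. x" y X] assms(2) H N.M.zero_closed N.M.a_closed by (auto simp: subset_iff)
 thus ?thesis .
qed

lemma image_submodule:
 assumes "module R N" and f: "lin_map R N M f"
 shows "submodule (f ` $N) R M"
proof (rule submoduleI)
 interpret N: module R N by fact
 note F = linD[OF f]
 show "f ` $N <= $M" using F(1) by auto
 show "\<zero>\<^sub>M : f ` $N" using N.lin_zero[OF module_axioms f] by (metis N.M.zero_closed image_eqI)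
 show "\<ominus>\<^sub>M a : f ` $N" if a: "a : f ` $N" for a
 proof -
  obtain x where "x : $N" "a = f x" using a by blast
  thus ?thesis using N.lin_neg[OF module_axioms f, of x] by (metis N.M.a_inv_closed image_eqI)
 qed
 show "a \<oplus>\<^sub>M b : f ` $N" if ab: "a : f ` $N" "b : f ` $N" for a b
 proof -
  obtain x y where "x : $N" "a = f x" "y : $N" "b = f y" using ab by blast
  thus ?thesis using F(2)[of x y] by (metis N.M.a_closed image_eqI)
 qed
 show "r \<odot>\<^sub>M a : f ` $N" if ra: "r : $R" "a : f ` $N" for r a
 proof -
  obtain x where "x : $N" "a = f x" using ra by blast
  thus ?thesis using F(3)[of r x] ra(1) by (metis N.smult_closed image_eqI)
 qed
qed

text \<open>Commutation of the trace with one of the two maps the identity, between the module with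
  one basis and the same module with the other.\<close>

lemma dual_trace_independent:
 assumes "dual_basis R M I b f" "dual_basis R M J c g" "lin_map R M M \<phi>"
 shows "dtrace R I b f \<phi> = dtrace R J c g \<phi>" using dual_trace_commute[OF module_axioms assms(1,2,3) lin_id] by (simp add: comp_def)

end

section \<open>Linear algebra modulo the maximal ideal of a local ring\<close>

locale local_module = module +
 fixes m :: "'a set" and w :: 'a
 assumes m_gen: "w : $R" "m = {w \<cdot> r | r. r : $R}"
  and m_units: "r : $R ==> r ~: m ==> r : Units R"
  and m_proper: "\<one> ~: m"
begin

definition wM where "wM = {w \<odot>\<^sub>M x | x. x : $M}"
text \<open>Linear independence, over the residue field, of the images in the quotient of
  \<open>M\<close> by \<open>wM\<close>. Working with coefficients in the ring avoids forming the
  quotient; \<open>sp\<close> is the span in the same sense.\<close>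

definition indep where "indep J v \<longleftrightarrow> finite J & v : J \<rightarrow> $M &
 (ALL c:J \<rightarrow> $R. (\<Oplus>\<^sub>M j\<in>J. c j \<odot>\<^sub>M v j) : wM --> (ALL j:J. c j : m))"
definition sp where "sp J v = {x : $M. EX c:J \<rightarrow> $R. EX y:wM. x = (\<Oplus>\<^sub>M j\<in>J. c j \<odot>\<^sub>M v j) \<oplus>\<^sub>M y}"

lemma m_closed:
 "r : m ==> r : $R" "r : m ==> s : m ==> r \<oplus> s : m"
 "r : m ==> s : $R ==> s \<cdot> r : m" "\<zero> : m" "r : m ==> \<ominus> r : m"
proof -
 show c: "r : m ==> r : $R" for r using m_gen by auto
 show "r : m ==> s : m ==> r \<oplus> s : m" using m_gen by (auto simp: R.r_distr[symmetric])
 show mult: "r : m ==> s : $R ==> s \<cdot> r : m" for r s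
 proof -
  assume "r : m" "s : $R"
  then obtain r' where "r' : $R" "r = w \<cdot> r'" using m_gen by auto
  hence "s \<cdot> r = w \<cdot> (s \<cdot> r')" using m_gen(1) \<open>s : $R\<close> by (simp add: R.m_lcomm)
  thus "s \<cdot> r : m" using m_gen \<open>r' : $R\<close> \<open>s : $R\<close> by auto
 qed
 show "\<zero> : m" using m_gen by (auto intro!: exI[of _ \<zero>])
 show "r : m ==> \<ominus> r : m" using mult[of r "\<ominus> \<one>"] c by (simp add: R.l_minus)
qed

lemma wM_closed:
 "x : wM ==> x : $M" "x : wM ==> y : wM ==> x \<oplus>\<^sub>M y : wM"
 "x : wM ==> r : $R ==> r \<odot>\<^sub>M x : wM" "\<zero>\<^sub>M : wM" "x : wM ==> \<ominus>\<^sub>M x : wM"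
 "r : m ==> x : $M ==> r \<odot>\<^sub>M x : wM"
proof -
 show c: "x : wM ==> x : $M" for x using m_gen(1) by (auto simp: wM_def)
 show "x : wM ==> y : wM ==> x \<oplus>\<^sub>M y : wM" using m_gen(1) by (auto simp: wM_def smult_r_distr[symmetric])
 show mult: "x : wM ==> r : $R ==> r \<odot>\<^sub>M x : wM" for x r
 proof -
  assume "x : wM" and r: "r : $R"
  then obtain x' where x': "x' : $M" "x = w \<odot>\<^sub>M x'" by (auto simp: wM_def)
  hence "r \<odot>\<^sub>M x = w \<odot>\<^sub>M (r \<odot>\<^sub>M x')" using r m_gen(1) by (simp add: smult_assoc1[symmetric] R.m_comm)
  thus "r \<odot>\<^sub>M x : wM" using x' r by (auto simp: wM_def)
 qed
 show "\<zero>\<^sub>M : wM" using m_gen(1) by (auto simp: wM_def intro!: exI[of _ "\<zero>\<^sub>M"])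
 show "x : wM ==> \<ominus>\<^sub>M x : wM" using mult[of x "\<ominus> \<one>"] c by (simp add: smult_l_minus)
 show "r : m ==> x : $M ==> r \<odot>\<^sub>M x : wM" using m_gen by (auto simp: wM_def smult_assoc1)
qed

lemma wM_finsum: assumes "finite J" "!!j. j : J ==> x j : wM" shows "(\<Oplus>\<^sub>M j\<in>J. x j) : wM"
 using M.add_finsum(1)[OF M.abelian_monoid_axioms, of wM id x J] wM_closed assms by auto

lemma m_finsum: assumes "finite J" "!!j. j : J ==> x j : m" shows "(\<Oplus>j\<in>J. x j) : m"
 using R.add_finsum(1)[OF R.abelian_monoid_axioms, of m id x J] m_closed assms by auto

lemma linear_fun_wM: assumes "lin_fun R M f" "x : wM" shows "f x : m" using assms m_gen funD[OF assms(1)] by (auto simp: wM_def)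

lemma linear_map_wM: assumes "lin_map R M M f" "x : wM" shows "f x : wM" using assms m_gen linD[OF assms(1)] by (auto simp: wM_def)

lemma linear_fun_comb:
 assumes "lin_fun R M f" "lin_fun R M g" "r : $R"
 shows "lin_fun R M (%x. f x \<oplus> r \<cdot> g x)" "lin_fun R M (%x. r \<cdot> g x)"
proof -
 note F = funD[OF assms(1)] and G = funD[OF assms(2)]
 show "lin_fun R M (%x. f x \<oplus> r \<cdot> g x)" unfolding lin_fun_def using F G assms(3) by (auto simp: R.r_distr R.m_lcomm R.a_ac)
 show "lin_fun R M (%x. r \<cdot> g x)" unfolding lin_fun_def using G assms(3) by (auto simp: R.r_distr R.m_lcomm)
qed

lemma indepD:
 assumes "indep J v" "c : J \<rightarrow> $R" "(\<Oplus>\<^sub>M j\<in>J. c j \<odot>\<^sub>M v j) : wM" "j : J"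
 shows "c j : m" using assms unfolding indep_def by blast

lemma exchange_one:
 assumes B: "fbasis R M I b f" and k: "k : I" and v: "v : $M" and u: "f k v : Units R"
 shows "\<exists>f'. fbasis R M I (b(k := v)) f'"
proof -
 note D = dualD[OF basisD(1)[OF B]]
 let ?u = "inv (f k v)"
 have uc: "?u : $R" "f k v : $R" "?u \<cdot> f k v = \<one>" using u by auto
 have fc: "f i x : $R" if "i : I" "x : $M" for i x using funD(1)[OF D(3)] that by blast
 define s where "s x = ?u \<cdot> f k x" for x
 \<comment> \<open>Solving the expansion of \<open>v\<close> for \<open>b k\<close> and
   substituting: the coordinate at \<open>k\<close> becomes \<open>s\<close>, and the coordinate at
   \<open>i\<close> loses \<open>f i v\<close> times \<open>s\<close>.\<close>
 define f' where "f' i x = (if i = k then s x else f i x \<oplus> (\<ominus> (f i v)) \<cdot> s x)" for i x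
 have sl: "lin_fun R M s" unfolding s_def using linear_fun_comb(2)[OF D(3)[OF k] D(3)[OF k] uc(1)] .
 have sc: "s x : $R" if "x : $M" for x using funD(1)[OF sl that] .
 have lf: "lin_fun R M (f' i)" if "i : I" for i using linear_fun_comb(1)[OF D(3)[OF that] sl, of "\<ominus> (f i v)"] fc[OF that v] sl
  unfolding f'_def by (cases "i = k") auto
 have split: "(\<Oplus>\<^sub>M i\<in>I. y i) = y k \<oplus>\<^sub>M (\<Oplus>\<^sub>M i\<in>I-{k}. y i)" if "!!i. i : I ==> y i : $M" for y
  using M.finsum_insert[of "I - {k}" k y] D(1) k that by (simp add: insert_absorb Pi_def)
 have exp: "x = (\<Oplus>\<^sub>M i\<in>I. f' i x \<odot>\<^sub>M (b(k := v)) i)" if x: "x : $M" for x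
 proof -
  let ?X = "\<Oplus>\<^sub>M i\<in>I-{k}. f i x \<odot>\<^sub>M b i" and ?V = "\<Oplus>\<^sub>M i\<in>I-{k}. f i v \<odot>\<^sub>M b i"
  have XV: "?X : $M" "?V : $M" using D(2) fc x v by (auto intro!: M.finsum_closed)
  have ex: "x = f k x \<odot>\<^sub>M b k \<oplus>\<^sub>M ?X" using D(4)[OF x] split[of "%i. f i x \<odot>\<^sub>M b i"] D(2) fc x by simp
  have ev: "v = f k v \<odot>\<^sub>M b k \<oplus>\<^sub>M ?V" using D(4)[OF v] split[of "%i. f i v \<odot>\<^sub>M b i"] D(2) fc v by simp
  have sfk: "s x \<cdot> f k v = f k x" unfolding s_def using uc fc[OF k x] by (metis R.m_assoc R.m_comm R.l_one)
  have c: "s x : $R" "b k : $M" using sc x D(2) k by auto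
  have "s x \<odot>\<^sub>M v = s x \<odot>\<^sub>M (f k v \<odot>\<^sub>M b k \<oplus>\<^sub>M ?V)" using ev by (rule arg_cong)
  also have "... = f k x \<odot>\<^sub>M b k \<oplus>\<^sub>M s x \<odot>\<^sub>M ?V"
   using c XV uc sfk by (simp add: smult_r_distr smult_assoc1[symmetric])
  finally have sv: "s x \<odot>\<^sub>M v = f k x \<odot>\<^sub>M b k \<oplus>\<^sub>M s x \<odot>\<^sub>M ?V" .
  have f'c: "f' i x : $R" if "i : I" for i using funD(1)[OF lf[OF that] x] .
  have "(\<Oplus>\<^sub>M i\<in>I. f' i x \<odot>\<^sub>M (b(k := v)) i)
   = f' k x \<odot>\<^sub>M (b(k := v)) k \<oplus>\<^sub>M (\<Oplus>\<^sub>M i\<in>I-{k}. f' i x \<odot>\<^sub>M (b(k := v)) i)"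
   using f'c D(2) v by (intro split) auto
  also have "(\<Oplus>\<^sub>M i\<in>I-{k}. f' i x \<odot>\<^sub>M (b(k := v)) i)
   = (\<Oplus>\<^sub>M i\<in>I-{k}. f i x \<odot>\<^sub>M b i \<oplus>\<^sub>M (\<ominus> s x) \<odot>\<^sub>M (f i v \<odot>\<^sub>M b i))"
  proof (rule M.finsum_cong')
   show "(%i. f i x \<odot>\<^sub>M b i \<oplus>\<^sub>M (\<ominus> s x) \<odot>\<^sub>M (f i v \<odot>\<^sub>M b i)) : I - {k} \<rightarrow> $M"
    using fc x v D(2) c by auto
   fix i assume i: "i : I - {k}"
   have ic: "f i x : $R" "f i v : $R" "b i : $M" using i fc x v D(2) by auto
   have "f' i x = f i x \<oplus> (\<ominus> s x) \<cdot> f i v"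
    unfolding f'_def using i R.l_minus[OF ic(2) c(1)] R.l_minus[OF c(1) ic(2)] R.m_comm[OF c(1) ic(2)] by simp
   thus "f' i x \<odot>\<^sub>M (b(k := v)) i = f i x \<odot>\<^sub>M b i \<oplus>\<^sub>M (\<ominus> s x) \<odot>\<^sub>M (f i v \<odot>\<^sub>M b i)"
    using i ic c by (simp add: smult_l_distr smult_assoc1)
  qed simp
  also have "... = ?X \<oplus>\<^sub>M (\<ominus> s x) \<odot>\<^sub>M ?V" using D fc x v c by (intro finsum_lin_comb) auto
  also have "f' k x \<odot>\<^sub>M (b(k := v)) k = s x \<odot>\<^sub>M v" by (simp add: f'_def)
  finally have "(\<Oplus>\<^sub>M i\<in>I. f' i x \<odot>\<^sub>M (b(k := v)) i)
   = (f k x \<odot>\<^sub>M b k \<oplus>\<^sub>M s x \<odot>\<^sub>M ?V) \<oplus>\<^sub>M (?X \<oplus>\<^sub>M \<ominus>\<^sub>M (s x \<odot>\<^sub>M ?V))"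
   using sv c XV by (simp add: smult_l_minus)
  also have "... = f k x \<odot>\<^sub>M b k \<oplus>\<^sub>M ?X"
  proof -
   have P: "f k x \<odot>\<^sub>M b k : $M" "s x \<odot>\<^sub>M ?V : $M" using c XV fc[OF k x] by auto
   have "(p \<oplus>\<^sub>M q) \<oplus>\<^sub>M (r \<oplus>\<^sub>M \<ominus>\<^sub>M q) = p \<oplus>\<^sub>M r"
    if "p : $M" "q : $M" "r : $M" for p q r
   proof -
    have "(p \<oplus>\<^sub>M q) \<oplus>\<^sub>M (r \<oplus>\<^sub>M \<ominus>\<^sub>M q) = (p \<oplus>\<^sub>M r) \<oplus>\<^sub>M (q \<oplus>\<^sub>M \<ominus>\<^sub>M q)"
    using that by (simp add: M.a_ac)
    thus ?thesis using that by (simp add: M.r_neg)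
   qed
   thus ?thesis using P XV by blast
  qed
  finally show ?thesis using ex by simp
 qed
 have dk: "s v = \<one>" unfolding s_def using uc by simp
 have delta: "f' i ((b(k := v)) j) = (if i = j then \<one> else \<zero>)" if ij: "i : I" "j : I" for i j
 proof (cases "j = k")
  case True
  thus ?thesis using dk ij fc v by (simp add: f'_def R.r_neg)
 next
  case False
  have "f k (b j) = \<zero>" using basisD(2)[OF B k ij(2)] False by simp
  hence "s (b j) = \<zero>" unfolding s_def using uc by simp
  note sb = this
  show ?thesis
  proof (cases "i = k")
   case True
   thus ?thesis using False sb by (simp add: f'_def)
  next
   case ik: False
   have "f' i (b j) = f i (b j)" using ik sb fc[OF ij(1) v] fc[OF ij(1) D(2)[OF ij(2)]] by (simp add: f'_def)
   thus ?thesis using False basisD(2)[OF B ij] by simp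
  qed
 qed
 have "fbasis R M I (b(k := v)) f'" unfolding fbasis_def dual_basis_def using D(1,2) v lf exp delta by auto
 thus ?thesis by blast
qed

text \<open>Some coordinate of the next vector, at a place not yet taken, lies outside
  \<open>m\<close> and is a unit, so \<open>exchange_one\<close> applies. If there were none, the
  vector would agree modulo \<open>wM\<close> with a combination of the earlier ones.\<close>

lemma steinitz:
 assumes B: "fbasis R M I b f" and v: "indep J v"
 shows "\<exists>h b' f'. inj_on h J & h ` J <= I & fbasis R M I b' f' & (ALL j:J. b' (h j) = v j)"
proof -
 have "finite J" using v by (simp add: indep_def)
 thus ?thesis using v
 proof (induction J rule: finite_induct)
  case empty
  thus ?case using B by auto
 next
  case (insert j0 J)
  have vc: "v j : $M" if "j : insert j0 J" for j using insert.prems that by (auto simp: indep_def)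
  have "indep J v" unfolding indep_def
  proof (intro conjI ballI impI)
   show "finite J" "v : J \<rightarrow> $M" using insert.hyps vc by auto
   fix c j assume c: "c : J \<rightarrow> $R" "(\<Oplus>\<^sub>M j\<in>J. c j \<odot>\<^sub>M v j) : wM" and j: "j : J"
   let ?c = "c(j0 := \<zero>)"
   have cc: "c j : $R" if "j : J" for j using c that by auto
   have "(\<Oplus>\<^sub>M j\<in>J. ?c j \<odot>\<^sub>M v j) = (\<Oplus>\<^sub>M j\<in>J. c j \<odot>\<^sub>M v j)"
    using cc insert.hyps vc by (intro M.finsum_cong') auto
   hence "(\<Oplus>\<^sub>M j\<in>insert j0 J. ?c j \<odot>\<^sub>M v j) : wM"
    using cc c insert.hyps vc wM_closed(1)[OF c(2)] by (subst M.finsum_insert) auto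
   moreover have "?c : insert j0 J \<rightarrow> $R" using c by auto
   ultimately have "?c j : m" using j by (intro indepD[OF insert.prems]) auto
   thus "c j : m" using j insert.hyps by (auto split: if_splits)
  qed
  then obtain h b' f' where h: "inj_on h J" "h ` J <= I" and B': "fbasis R M I b' f'"
   and e: "ALL j:J. b' (h j) = v j" using insert.IH by blast
  note D = dualD[OF basisD(1)[OF B']]
  have fc: "f' i x : $R" if "i : I" "x : $M" for i x using funD(1)[OF D(3)] that by blast
  let ?v = "v j0"
  have vM: "?v : $M" using vc by simp
  have "EX k:I - h ` J. f' k ?v ~: m"
  proof (rule ccontr)
   assume "\<not> ?thesis"
   hence al: "f' k ?v : m" if "k : I - h ` J" for k using that by blast
   let ?T = "\<Oplus>\<^sub>M k\<in>I - h ` J. f' k ?v \<odot>\<^sub>M b' k" and ?H = "\<Oplus>\<^sub>M j\<in>J. f' (h j) ?v \<odot>\<^sub>M v j"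
   have T: "?T : wM" using D(1,2) al wM_closed(6) by (intro wM_finsum) auto
   have TM: "?T : $M" using wM_closed(1)[OF T] .
   have HM: "?H : $M" using h fc vM vc by (auto intro!: M.finsum_closed)
   have "?v = (\<Oplus>\<^sub>M k\<in>h ` J \<union> (I - h ` J). f' k ?v \<odot>\<^sub>M b' k)" using D(4)[OF vM] h(2) by (simp add: Un_absorb1)
   also have "... = (\<Oplus>\<^sub>M k\<in>h ` J. f' k ?v \<odot>\<^sub>M b' k) \<oplus>\<^sub>M ?T"
    using D(1,2) h fc vM insert.hyps by (intro M.finsum_Un_disjoint) auto
   also have "(\<Oplus>\<^sub>M k\<in>h ` J. f' k ?v \<odot>\<^sub>M b' k) = (\<Oplus>\<^sub>M j\<in>J. f' (h j) ?v \<odot>\<^sub>M b' (h j))"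
    using D(1,2) h fc vM by (intro M.finsum_reindex) auto
   also have "... = ?H" using h e fc vM vc by (intro M.finsum_cong') auto
   finally have ev: "?v = ?H \<oplus>\<^sub>M ?T" .
   \<comment> \<open>A relation modulo \<open>wM\<close> whose coefficient at \<open>j0\<close> is
     \<open>1\<close>; independence would force \<open>1\<close> into \<open>m\<close>.\<close>
   let ?c = "%j. if j = j0 then \<one> else \<ominus> f' (h j) ?v"
   have cc: "?c : insert j0 J \<rightarrow> $R" using h fc vM by auto
   have "(\<Oplus>\<^sub>M j\<in>J. ?c j \<odot>\<^sub>M v j) = (\<Oplus>\<^sub>M j\<in>J. (\<ominus> \<one>) \<odot>\<^sub>M (f' (h j) ?v \<odot>\<^sub>M v j))"
    using h fc vM vc insert.hyps by (intro M.finsum_cong') (auto simp: smult_l_minus image_subset_iff)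
   also have "... = (\<ominus> \<one>) \<odot>\<^sub>M ?H" using h fc vM vc insert.hyps by (intro finsum_smult_ldistr[symmetric]) auto
   also have "... = \<ominus>\<^sub>M ?H" using HM by (simp add: smult_l_minus)
   finally have "(\<Oplus>\<^sub>M j\<in>insert j0 J. ?c j \<odot>\<^sub>M v j) = ?v \<oplus>\<^sub>M \<ominus>\<^sub>M ?H"
    using cc vc vM insert.hyps h fc by (subst M.finsum_insert) (auto simp: Pi_def image_subset_iff)
   also have "... = (?T \<oplus>\<^sub>M ?H) \<oplus>\<^sub>M \<ominus>\<^sub>M ?H" using ev HM TM by (simp add: M.a_comm)
   also have "... = ?T" using HM TM by (simp add: M.a_assoc M.r_neg)
   finally have "(\<Oplus>\<^sub>M j\<in>insert j0 J. ?c j \<odot>\<^sub>M v j) : wM" using T by simp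
   hence "?c j0 : m" by (rule indepD[OF insert.prems cc]) simp
   thus False using m_proper by simp
  qed
  then obtain k where k: "k : I" "k ~: h ` J" "f' k ?v ~: m" by blast
  obtain f'' where B'': "fbasis R M I (b'(k := ?v)) f''" using exchange_one[OF B' k(1) vM m_units[OF fc[OF k(1) vM] k(3)]] by blast
  let ?h = "h(j0 := k)"
  have "inj_on ?h (insert j0 J)" using h k insert.hyps by (auto simp: inj_on_def)
  moreover have "?h ` insert j0 J <= I" using h k by auto
  moreover have "ALL j:insert j0 J. (b'(k := ?v)) (?h j) = v j" using e k insert.hyps by auto
  ultimately show ?case using B'' by blast
 qed
qed

lemma indep_card: assumes "fbasis R M I b f" "indep J v" shows "card J \<le> card I"
proof -
 obtain h where "inj_on h J" "h ` J <= I" using steinitz[OF assms] by blast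
 thus ?thesis using card_inj_on_le dualD(1)[OF basisD(1)[OF assms(1)]] by blast
qed

lemma spI:
 assumes "x : $M" "c : J \<rightarrow> $R" "y : wM" "x = (\<Oplus>\<^sub>M j\<in>J. c j \<odot>\<^sub>M v j) \<oplus>\<^sub>M y"
 shows "x : sp J v" using assms unfolding sp_def by blast

lemma wM_sp: assumes "v : J \<rightarrow> $M" "x : wM" shows "x : sp J v"
proof -
 have "v j : $M" if "j : J" for j using assms(1) that by auto
 hence "(\<Oplus>\<^sub>M j\<in>J. \<zero> \<odot>\<^sub>M v j) = \<zero>\<^sub>M" by (intro M.add.finprod_one_eqI) auto
 thus ?thesis unfolding sp_def using assms wM_closed(1)[OF assms(2)] by (auto intro!: bexI[of _ "%_. \<zero>"] bexI[of _ x])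
qed

lemma indep_extend:
 assumes B: "indep B (%x. x)" and x: "x : $M" "x ~: sp B (%x. x)"
 shows "x ~: B" "indep (insert x B) (%x. x)"
proof -
 have fB: "finite B" "B <= $M" using B by (auto simp: indep_def)
 show xB: "x ~: B"
 proof
  assume xB: "x : B"
  have "(\<Oplus>\<^sub>M b\<in>B. (if x = b then b else \<zero>\<^sub>M)) = x" using M.finsum_singleton[OF xB fB(1), of "%b. b"] fB by auto
  moreover have "(\<Oplus>\<^sub>M b\<in>B. (if x = b then \<one> else \<zero>) \<odot>\<^sub>M b) = (\<Oplus>\<^sub>M b\<in>B. (if x = b then b else \<zero>\<^sub>M))"
   using fB by (intro M.finsum_cong') auto
  ultimately have "x : sp B (%x. x)" unfolding sp_def using x(1) wM_closed(4)
   by (auto intro!: bexI[of _ "%b. if x = b then \<one> else \<zero>"] bexI[of _ "\<zero>\<^sub>M"])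
  thus False using x(2) by simp
 qed
 show "indep (insert x B) (%x. x)" unfolding indep_def
 proof (intro conjI ballI impI)
  show "finite (insert x B)" "(%x. x) : insert x B \<rightarrow> $M" using fB x by auto
  fix c j assume c: "c : insert x B \<rightarrow> $R" and s: "(\<Oplus>\<^sub>M j\<in>insert x B. c j \<odot>\<^sub>M j) : wM" and j: "j : insert x B"
  let ?S = "\<Oplus>\<^sub>M j\<in>B. c j \<odot>\<^sub>M j"
  have cc: "c j : $R" "j : $M" if "j : B" for j using c fB that by auto
  have SM: "?S : $M" using c fB by (auto intro!: M.finsum_closed)
  have cx: "c x : $R" using c by auto
  have e: "c x \<odot>\<^sub>M x \<oplus>\<^sub>M ?S : wM"
  proof -
   have "(\<Oplus>\<^sub>M j\<in>insert x B. c j \<odot>\<^sub>M j) = c x \<odot>\<^sub>M x \<oplus>\<^sub>M ?S"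
    using c x(1) fB xB by (intro M.finsum_insert) auto
   thus ?thesis using s by simp
  qed
  have cm: "c x : m"
  proof (rule ccontr)
   assume "c x ~: m"
   hence u: "c x : Units R" using m_units cx by blast
   let ?u = "inv (c x)"
   have uc: "?u : $R" "?u \<cdot> c x = \<one>" using u by auto
   let ?c = "%j. (\<ominus> ?u) \<cdot> c j"
   have "(\<Oplus>\<^sub>M j\<in>B. ?c j \<odot>\<^sub>M j) = (\<Oplus>\<^sub>M j\<in>B. (\<ominus> ?u) \<odot>\<^sub>M (c j \<odot>\<^sub>M j))"
    using cc uc by (intro M.finsum_cong') (auto simp: smult_assoc1)
   also have "... = (\<ominus> ?u) \<odot>\<^sub>M ?S" using c fB uc by (intro finsum_smult_ldistr[symmetric]) auto
   finally have s': "(\<Oplus>\<^sub>M j\<in>B. ?c j \<odot>\<^sub>M j) = \<ominus>\<^sub>M (?u \<odot>\<^sub>M ?S)" using uc SM by (simp add: smult_l_minus)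
   have "?u \<odot>\<^sub>M (c x \<odot>\<^sub>M x \<oplus>\<^sub>M ?S) = x \<oplus>\<^sub>M ?u \<odot>\<^sub>M ?S"
    using uc cx x(1) SM by (simp add: smult_r_distr smult_assoc1[symmetric])
   hence y: "x \<oplus>\<^sub>M ?u \<odot>\<^sub>M ?S : wM" using wM_closed(3)[OF e uc(1)] by simp
   have "x = \<ominus>\<^sub>M (?u \<odot>\<^sub>M ?S) \<oplus>\<^sub>M (x \<oplus>\<^sub>M ?u \<odot>\<^sub>M ?S)"
   proof -
    have uS: "?u \<odot>\<^sub>M ?S : $M" using uc SM by simp
    have "\<ominus>\<^sub>M q \<oplus>\<^sub>M (x \<oplus>\<^sub>M q) = x" if q: "q : $M" for q
    proof -
    have "\<ominus>\<^sub>M q \<oplus>\<^sub>M (x \<oplus>\<^sub>M q) = x \<oplus>\<^sub>M (\<ominus>\<^sub>M q \<oplus>\<^sub>M q)" using q x(1) by (simp add: M.a_ac)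
    thus ?thesis using q x(1) by (simp add: M.l_neg)
    qed
    thus ?thesis using uS by simp
   qed
   hence ex: "x = (\<Oplus>\<^sub>M j\<in>B. ?c j \<odot>\<^sub>M j) \<oplus>\<^sub>M (x \<oplus>\<^sub>M ?u \<odot>\<^sub>M ?S)" unfolding s' .
   have "?c : B \<rightarrow> $R" using c uc by auto
   hence "x : sp B (%x. x)" by (rule spI[OF x(1) _ y ex])
   thus False using x(2) by simp
  qed
  have "\<ominus>\<^sub>M (c x \<odot>\<^sub>M x) : wM" using wM_closed(5)[OF wM_closed(6)[OF cm x(1)]] .
  hence "\<ominus>\<^sub>M (c x \<odot>\<^sub>M x) \<oplus>\<^sub>M (c x \<odot>\<^sub>M x \<oplus>\<^sub>M ?S) : wM" using e wM_closed(2) by blast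
  moreover have "\<ominus>\<^sub>M (c x \<odot>\<^sub>M x) \<oplus>\<^sub>M (c x \<odot>\<^sub>M x \<oplus>\<^sub>M ?S) = ?S"
   using cx x(1) SM by (simp add: M.a_assoc[symmetric] M.l_neg)
  ultimately have "?S : wM" by simp
  moreover have "c : B \<rightarrow> $R" using c by auto
  ultimately have "ALL j:B. c j : m" using indepD[OF B] by blast
  thus "c j : m" using cm j by auto
 qed
qed

text \<open>A form of Nakayama's lemma. By \<open>steinitz\<close> the family is part of a basis; if
  a further basis vector were left, applying its coordinate to its expansion modulo
  \<open>wM\<close> would give \<open>1\<close> in \<open>m\<close>.\<close>

lemma spanning_basis:
 assumes B: "fbasis R M I b f" and v: "indep J v" and s: "!!x. x : $M ==> x : sp J v"
 shows "\<exists>g. fbasis R M J v g" "card J = card I"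
proof -
 obtain h b' f' where h: "inj_on h J" "h ` J <= I" and B': "fbasis R M I b' f'"
  and e: "ALL j:J. b' (h j) = v j" using steinitz[OF B v] by blast
 note D = dualD[OF basisD(1)[OF B']]
 have fc: "f' i x : $R" if "i : I" "x : $M" for i x using funD(1)[OF D(3)] that by blast
 have vc: "v j : $M" if "j : J" for j using v that by (auto simp: indep_def)
 have im: "h ` J = I"
 proof (rule ccontr)
  assume "h ` J ~= I"
  then obtain k where k: "k : I" "k ~: h ` J" using h by blast
  obtain c y where c: "c : J \<rightarrow> $R" "y : wM" "b' k = (\<Oplus>\<^sub>M j\<in>J. c j \<odot>\<^sub>M v j) \<oplus>\<^sub>M y"
   using s[OF D(2)[OF k(1)]] unfolding sp_def by blast
  have z: "f' k (c j \<odot>\<^sub>M v j) = \<zero>" if j: "j : J" for j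
  proof -
   have "h j : I" "h j ~= k" using h(2) k j by auto
   hence "f' k (b' (h j)) = \<zero>" using basisD(2)[OF B' k(1), of "h j"] by simp
   hence "f' k (v j) = \<zero>" using e j by simp
   thus ?thesis using funD(3)[OF D(3)[OF k(1)], of "c j" "v j"] c vc j by auto
  qed
  have SM: "(\<Oplus>\<^sub>M j\<in>J. c j \<odot>\<^sub>M v j) : $M" using c vc by (auto intro!: M.finsum_closed)
  have "f' k (\<Oplus>\<^sub>M j\<in>J. c j \<odot>\<^sub>M v j) = (\<Oplus>j\<in>J. f' k (c j \<odot>\<^sub>M v j))"
   using c vc by (intro linear_fun_finsum[OF D(3)[OF k(1)]]) auto
  also have "... = \<zero>" using z by (intro R.add.finprod_one_eqI) auto
  finally have "f' k (b' k) = f' k y" using funD(2)[OF D(3)[OF k(1)] SM wM_closed(1)[OF c(2)]] c(3) fc[OF k(1) wM_closed(1)[OF c(2)]] by simp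
  hence "\<one> : m" using linear_fun_wM[OF D(3)[OF k(1)] c(2)] basisD(2)[OF B' k(1) k(1)] by simp
  thus False using m_proper by simp
 qed
 show "card J = card I" using card_image[OF h(1)] im by simp
 have "fbasis R M J v (%j. f' (h j))" unfolding fbasis_def dual_basis_def
 proof (intro conjI ballI)
  show "finite J" using v by (simp add: indep_def)
  show "v : J \<rightarrow> $M" using vc by auto
  show "lin_fun R M (f' (h j))" if "j : J" for j using D(3) im that by auto
  show "f' (h i) (v j) = (if i = j then \<one> else \<zero>)" if "i : J" "j : J" for i j
   using basisD(2)[OF B', of "h i" "h j"] e im that h(1) by (auto simp: inj_on_def)
  fix x assume x: "x : $M"
  have "x = (\<Oplus>\<^sub>M i\<in>h ` J. f' i x \<odot>\<^sub>M b' i)" using D(4)[OF x] im by simp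
  also have "... = (\<Oplus>\<^sub>M j\<in>J. f' (h j) x \<odot>\<^sub>M b' (h j))" using h(1) im D(2) fc x by (intro M.finsum_reindex) auto
  also have "... = (\<Oplus>\<^sub>M j\<in>J. f' (h j) x \<odot>\<^sub>M v j)" using e im fc x vc by (intro M.finsum_cong') auto
  finally show "x = (\<Oplus>\<^sub>M j\<in>J. f' (h j) x \<odot>\<^sub>M v j)" .
 qed
 thus "\<exists>g. fbasis R M J v g" by blast
qed

text \<open>The sizes of independent sets are bounded by the rank, so a set of largest size with
  property \<open>P\<close> exists.\<close>

lemma maximal_indep:
 assumes B: "fbasis R M I b f" and P0: "P {}"
  and Pind: "!!B. P B ==> indep B (%x. x)"
 obtains B where "P B" "!!x. x ~: B ==> \<not> P (insert x B)"
proof -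
 let ?C = "{card B | B. P B}"
 have "?C <= {..card I}" using indep_card[OF B Pind] by auto
 hence fin: "finite ?C" using finite_subset by blast
 have "?C ~= {}" using P0 by blast
 hence "Max ?C : ?C" using Max_in[OF fin] by blast
 then obtain B where B: "P B" "card B = Max ?C" by auto
 have "\<not> P (insert x B)" if "x ~: B" for x
 proof
  assume P: "P (insert x B)"
  hence "card (insert x B) \<le> Max ?C" using Max_ge[OF fin] by blast
  moreover have "finite B" using Pind[OF B(1)] by (simp add: indep_def)
  ultimately show False using B(2) that by simp
 qed
 thus thesis using that B(1) by blast
qed

lemma indep_empty: "indep {} v" by (simp add: indep_def)

text \<open>A nilpotent endomorphism modulo the maximal ideal has trace zero there: build a basis
 each of whose members is mapped into the span of the other ones.\<close>

lemma trace_locally_nilpotent: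
 assumes B: "fbasis R M I b f" and \<phi>: "lin_map R M M \<phi>"
  and nil: "!!x. x : $M ==> \<exists>a. (\<phi> ^^ a) x : wM"
 shows "dtrace R I b f \<phi> : m"
proof -
 let ?id = "%x. x"
 define P where "P B \<longleftrightarrow> indep B ?id & (ALL b:B. \<phi> b : sp (B - {b}) ?id)" for B
 have P0: "P {}" by (simp add: P_def indep_empty)
 obtain X where X: "P X" and max: "!!x. x ~: X ==> \<not> P (insert x X)" using maximal_indep[where P = P, OF B P0] unfolding P_def by blast
 have iX: "indep X ?id" and fX: "finite X" "X <= $M" using X by (auto simp: P_def indep_def)
 have mono: "sp Y ?id <= sp Y' ?id" if "Y <= Y'" "finite Y'" "Y' <= $M" for Y Y'
 proof
  fix x assume "x : sp Y ?id"
  then obtain c y where c: "x : $M" "c : Y \<rightarrow> $R" "y : wM" "x = (\<Oplus>\<^sub>M j\<in>Y. c j \<odot>\<^sub>M j) \<oplus>\<^sub>M y"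
   unfolding sp_def by blast
  let ?c = "%j. if j : Y then c j else \<zero>"
  have cc: "c j : $R" if "j : Y" for j using c that by auto
  have yc: "j : $M" if "j : Y'" for j using that \<open>Y' <= $M\<close> by auto
  have "(\<Oplus>\<^sub>M j\<in>Y. c j \<odot>\<^sub>M j) = (\<Oplus>\<^sub>M j\<in>Y'. ?c j \<odot>\<^sub>M j)"
   using that cc yc by (intro M.add.finprod_mono_neutral_cong_left) auto
  moreover have "?c : Y' \<rightarrow> $R" using c by auto
  ultimately show "x : sp Y' ?id" using c(4) by (intro spI[OF c(1) _ c(3)]) simp_all
 qed
 have all: "x : sp X ?id" if x: "x : $M" for x
 proof (rule ccontr)
  assume nx: "x ~: sp X ?id"
  have pc: "(\<phi> ^^ a) x : $M" for a by (induction a) (use x linD(1)[OF \<phi>] in auto)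
  have "\<exists>a. (\<phi> ^^ a) x : sp X ?id" using nil[OF x] wM_sp[of ?id X] fX by auto
  \<comment> \<open>The first iterate of \<open>x\<close> that falls into the span. The iterate just
    before it lies outside the span and is mapped into it, so it could be added to
    \<open>X\<close>.\<close>
  moreover define a where "a = (LEAST a. (\<phi> ^^ a) x : sp X ?id)"
  ultimately have a: "(\<phi> ^^ a) x : sp X ?id" "!!a'. a' < a ==> (\<phi> ^^ a') x ~: sp X ?id"
   using LeastI_ex[of "%a. (\<phi> ^^ a) x : sp X ?id"] not_less_Least[of _ "%a. (\<phi> ^^ a) x : sp X ?id"] by simp_all
  have "a ~= 0" using a(1) nx by (cases a) auto
  then obtain a' where a': "a = Suc a'" by (cases a) auto
  let ?y = "(\<phi> ^^ a') x"
  have y: "?y : $M" "?y ~: sp X ?id" "\<phi> ?y : sp X ?id" using pc a a' by auto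
  note E = indep_extend[OF iX y(1,2)]
  have "P (insert ?y X)" unfolding P_def
  proof (intro conjI ballI)
   show "indep (insert ?y X) ?id" by (rule E(2))
   fix b assume "b : insert ?y X"
   then consider "b = ?y" | "b : X" "b ~= ?y" using E(1) by auto
   thus "\<phi> b : sp (insert ?y X - {b}) ?id"
   proof cases
    case 1
    thus ?thesis using y(3) E(1) by simp
   next
    case 2
    have "\<phi> b : sp (X - {b}) ?id" using X 2 by (simp add: P_def)
    moreover have "sp (X - {b}) ?id <= sp (insert ?y X - {b}) ?id" using fX y(1) by (intro mono) auto
    ultimately show ?thesis by blast
   qed
  qed
  thus False using max[OF E(1)] by blast
 qed
 obtain g where G: "fbasis R M X ?id g" using spanning_basis(1)[OF B iX all] by blast
 note D = dualD[OF basisD(1)[OF G]]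
 \<comment> \<open>The diagonal entry at \<open>b\<close>: the combination of the other basis
   elements contributes nothing, the remainder in \<open>wM\<close> contributes an element of
   \<open>m\<close>.\<close>
 have "g b (\<phi> b) : m" if b: "b : X" for b
 proof -
  obtain c y where c: "c : X - {b} \<rightarrow> $R" "y : wM" "\<phi> b = (\<Oplus>\<^sub>M j\<in>X - {b}. c j \<odot>\<^sub>M j) \<oplus>\<^sub>M y"
   using X b unfolding P_def sp_def by blast
  have z: "g b (c j \<odot>\<^sub>M j) = \<zero>" if j: "j : X - {b}" for j
  proof -
   have "g b j = \<zero>" using basisD(2)[OF G b, of j] j by auto
   moreover have "c j : $R" "j : $M" using j c fX by auto
   ultimately show ?thesis using funD(3)[OF D(3)[OF b], of "c j" j] by simp
  qed
  have cM: "c j \<odot>\<^sub>M j : $M" if "j : X - {b}" for j using that c fX by auto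
  have SM: "(\<Oplus>\<^sub>M j\<in>X - {b}. c j \<odot>\<^sub>M j) : $M" using cM by (auto intro!: M.finsum_closed)
  have "g b (\<Oplus>\<^sub>M j\<in>X - {b}. c j \<odot>\<^sub>M j) = (\<Oplus>j\<in>X - {b}. g b (c j \<odot>\<^sub>M j))"
   using cM by (intro linear_fun_finsum[OF D(3)[OF b]]) auto
  also have "... = \<zero>" using z by (intro R.add.finprod_one_eqI) auto
  finally have "g b (\<phi> b) = g b y" using funD(2)[OF D(3)[OF b] SM wM_closed(1)[OF c(2)]] c(3)
    funD(1)[OF D(3)[OF b] wM_closed(1)[OF c(2)]] by simp
  thus ?thesis using linear_fun_wM[OF D(3)[OF b] c(2)] by simp
 qed
 hence "dtrace R X ?id g \<phi> : m" unfolding dtrace_def using fX by (intro m_finsum) auto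
 thus ?thesis using dual_trace_independent[OF basisD(1)[OF B] basisD(1)[OF G] \<phi>] by simp
qed

text \<open>A maximal independent set of vectors fixed by \<open>e\<close> and one of vectors killed
  by \<open>e\<close> together form a basis of \<open>M\<close>, so the image is free. The strict
  drop in rank for a proper summand is what a descent on ranks needs when sources are
  constructed.\<close>

lemma summand_basis:
 assumes B: "fbasis R M I b f" and e: "lin_map R M M e" and ee: "!!x. x : $M ==> e (e x) = e x"
 shows "\<exists>X g. X <= e ` $M & fbasis R (M(|carrier := e ` $M|)) X (%x. x) g & card X \<le> card I &
  ((EX x:$M. e x ~= x) --> card X < card I)"
proof -
 let ?id = "%x. x"
 have ec: "e x : $M" if "x : $M" for x using linD(1)[OF e that] .
 define P where "P X \<longleftrightarrow> indep X ?id & (ALL x:X. e x = x)" for X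
 define Q where "Q X \<longleftrightarrow> indep X ?id & (ALL x:X. e x = \<zero>\<^sub>M)" for X
 obtain X where X: "P X" and Xmax: "!!x. x ~: X ==> \<not> P (insert x X)" using maximal_indep[where P = P, OF B] indep_empty unfolding P_def by blast
 obtain Y where Y: "Q Y" and Ymax: "!!x. x ~: Y ==> \<not> Q (insert x Y)" using maximal_indep[where P = Q, OF B] indep_empty unfolding Q_def by blast
 have iX: "indep X ?id" and fX: "finite X" "X <= $M" and eX: "!!x. x : X ==> e x = x" using X by (auto simp: P_def indep_def)
 have iY: "indep Y ?id" and fY: "finite Y" "Y <= $M" and eY: "!!x. x : Y ==> e x = \<zero>\<^sub>M" using Y by (auto simp: Q_def indep_def)
 have sX: "x : sp X ?id" if "x : $M" "e x = x" for x using indep_extend[OF iX that(1)] Xmax[of x] X that(2) unfolding P_def by blast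
 have sY: "x : sp Y ?id" if "x : $M" "e x = \<zero>\<^sub>M" for x using indep_extend[OF iY that(1)] Ymax[of x] Y that(2) unfolding Q_def by blast
 have nX: "x ~= \<zero>\<^sub>M" if x: "x : X" for x
 proof
  assume x0: "x = \<zero>\<^sub>M"
  have "(\<Oplus>\<^sub>M j\<in>X. (if j = x then \<one> else \<zero>) \<odot>\<^sub>M j) = \<zero>\<^sub>M"
   using fX x0 by (intro M.add.finprod_one_eqI) auto
  hence "(\<Oplus>\<^sub>M j\<in>X. (if j = x then \<one> else \<zero>) \<odot>\<^sub>M j) : wM" using wM_closed(4) by simp
  moreover have "(%j. if j = x then \<one> else \<zero>) : X \<rightarrow> $R" by auto
  ultimately have "(if x = x then \<one> else \<zero>) : m" by (intro indepD[OF iX _ _ x])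
  thus False using m_proper by simp
 qed
 have dis: "X \<inter> Y = {}" using nX eX eY by force
 let ?Z = "X \<union> Y"
 have sumZ: "(\<Oplus>\<^sub>M j\<in>?Z. y j) = (\<Oplus>\<^sub>M j\<in>X. y j) \<oplus>\<^sub>M (\<Oplus>\<^sub>M j\<in>Y. y j)"
  if "!!j. j : ?Z ==> y j : $M" for y using fX fY dis that by (intro M.finsum_Un_disjoint) auto
 have eZ: "e (\<Oplus>\<^sub>M j\<in>?Z. c j \<odot>\<^sub>M j) = (\<Oplus>\<^sub>M j\<in>X. c j \<odot>\<^sub>M j)" if c: "!!j. j : ?Z ==> c j : $R" for c
 proof -
  have cM: "c j \<odot>\<^sub>M j : $M" if "j : ?Z" for j using that c fX fY by auto
  have "e (\<Oplus>\<^sub>M j\<in>?Z. c j \<odot>\<^sub>M j) = (\<Oplus>\<^sub>M j\<in>?Z. e (c j \<odot>\<^sub>M j))"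
   using cM by (intro lin_finsum[OF module_axioms e]) auto
  also have "... = (\<Oplus>\<^sub>M j\<in>X. c j \<odot>\<^sub>M j)"
  proof (rule M.add.finprod_mono_neutral_cong_right)
   show "finite ?Z" "X <= ?Z" using fX fY by auto
   show "e (c j \<odot>\<^sub>M j) = \<zero>\<^sub>M" if "j : ?Z - X" for j using linD(3)[OF e, of "c j" j] that c fY eY by auto
   show "e (c j \<odot>\<^sub>M j) = c j \<odot>\<^sub>M j" if "j : X" for j using linD(3)[OF e, of "c j" j] that c fX eX by auto
   show "(%j. e (c j \<odot>\<^sub>M j)) : ?Z \<rightarrow> $M" using cM ec by auto
  qed
  finally show ?thesis .
 qed
 \<comment> \<open>Applying \<open>e\<close> to a relation modulo \<open>wM\<close> isolates the
   part over \<open>X\<close>, and subtracting it leaves the part over \<open>Y\<close>.\<close>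
 have iZ: "indep ?Z ?id" unfolding indep_def
 proof (intro conjI ballI impI)
  show "finite ?Z" "?id : ?Z \<rightarrow> $M" using fX fY by auto
  fix c j assume c: "c : ?Z \<rightarrow> $R" and s: "(\<Oplus>\<^sub>M j\<in>?Z. c j \<odot>\<^sub>M j) : wM" and j: "j : ?Z"
  have cc: "!!j. j : ?Z ==> c j : $R" using c by auto
  let ?SX = "\<Oplus>\<^sub>M j\<in>X. c j \<odot>\<^sub>M j" and ?SY = "\<Oplus>\<^sub>M j\<in>Y. c j \<odot>\<^sub>M j"
  have a: "?SX : wM" using linear_map_wM[OF e s] eZ[OF cc] by simp
  have YM: "?SY : $M" using cc fY by (auto intro!: M.finsum_closed)
  have cM: "c j \<odot>\<^sub>M j : $M" if "j : ?Z" for j using that cc fX fY by auto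
  have "?SX \<oplus>\<^sub>M ?SY : wM" using s sumZ[of "%j. c j \<odot>\<^sub>M j", OF cM] by simp
  hence "\<ominus>\<^sub>M ?SX \<oplus>\<^sub>M (?SX \<oplus>\<^sub>M ?SY) : wM" using a wM_closed(2,5) by blast
  moreover have "\<ominus>\<^sub>M ?SX \<oplus>\<^sub>M (?SX \<oplus>\<^sub>M ?SY) = ?SY"
   using wM_closed(1)[OF a] YM by (simp add: M.a_assoc[symmetric] M.l_neg)
  ultimately have b: "?SY : wM" by simp
  show "c j : m"
  proof (cases "j : X")
   case True
   have "c : X \<rightarrow> $R" using cc by auto
   thus ?thesis by (rule indepD[OF iX _ a True])
  next
   case False
   have "c : Y \<rightarrow> $R" using cc by auto
   moreover have "j : Y" using False j by blast
   ultimately show ?thesis by (rule indepD[OF iY _ b])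
  qed
 qed
 have split: "x = e x \<oplus>\<^sub>M (\<ominus>\<^sub>M e x \<oplus>\<^sub>M x) & \<ominus>\<^sub>M e x \<oplus>\<^sub>M x : $M & e (\<ominus>\<^sub>M e x \<oplus>\<^sub>M x) = \<zero>\<^sub>M"
  if x: "x : $M" for x using ec[OF x] x linD(2)[OF e, of "\<ominus>\<^sub>M e x" x] lin_neg[OF module_axioms e ec[OF x]] ee[OF x]
  by (simp add: M.a_assoc[symmetric] M.r_neg M.l_neg)
 have sZ: "x : sp ?Z ?id" if x: "x : $M" for x
 proof -
  let ?y = "\<ominus>\<^sub>M e x \<oplus>\<^sub>M x"
  obtain c p where c: "c : X \<rightarrow> $R" "p : wM" "e x = (\<Oplus>\<^sub>M j\<in>X. c j \<odot>\<^sub>M j) \<oplus>\<^sub>M p"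
   using sX[OF ec[OF x] ee[OF x]] unfolding sp_def by blast
  obtain d q where d: "d : Y \<rightarrow> $R" "q : wM" "?y = (\<Oplus>\<^sub>M j\<in>Y. d j \<odot>\<^sub>M j) \<oplus>\<^sub>M q"
   using sY[of ?y] split[OF x] unfolding sp_def by blast
  let ?c = "%j. if j : X then c j else d j"
  let ?SX = "\<Oplus>\<^sub>M j\<in>X. c j \<odot>\<^sub>M j" and ?SY = "\<Oplus>\<^sub>M j\<in>Y. d j \<odot>\<^sub>M j"
  have cZ: "?c j : $R" if "j : ?Z" for j using that c d by auto
  have cZM: "?c j \<odot>\<^sub>M j : $M" if "j : ?Z" for j using cZ[OF that] that fX fY by blast
  have s1: "?SX = (\<Oplus>\<^sub>M j\<in>X. ?c j \<odot>\<^sub>M j)" using cZM by (intro M.finsum_cong') auto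
  have s2: "?SY = (\<Oplus>\<^sub>M j\<in>Y. ?c j \<odot>\<^sub>M j)"
  proof (rule M.finsum_cong')
   show "(%j. ?c j \<odot>\<^sub>M j) : Y \<rightarrow> $M" using cZM by blast
   show "d j \<odot>\<^sub>M j = ?c j \<odot>\<^sub>M j" if "j : Y" for j using that dis by auto
  qed simp
  have s: "(\<Oplus>\<^sub>M j\<in>?Z. ?c j \<odot>\<^sub>M j) = ?SX \<oplus>\<^sub>M ?SY" unfolding s1 s2 by (rule sumZ[OF cZM])
  have "c j \<odot>\<^sub>M j : $M" if "j : X" for j using cZ[of j] that fX by auto
  moreover have "d j \<odot>\<^sub>M j : $M" if "j : Y" for j using d that fY by (auto simp: Pi_def)
  ultimately have M: "?SX : $M" "?SY : $M" "p : $M" "q : $M" using c(2) d(2) wM_closed(1) by (auto intro!: M.finsum_closed)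
  have "x = e x \<oplus>\<^sub>M ?y" using split[OF x] by blast
  also have "... = (?SX \<oplus>\<^sub>M p) \<oplus>\<^sub>M (?SY \<oplus>\<^sub>M q)" unfolding d(3) c(3)[symmetric] ..
  also have "... = (?SX \<oplus>\<^sub>M ?SY) \<oplus>\<^sub>M (p \<oplus>\<^sub>M q)" using M by (simp add: M.a_ac)
  finally have ex: "x = (\<Oplus>\<^sub>M j\<in>?Z. ?c j \<odot>\<^sub>M j) \<oplus>\<^sub>M (p \<oplus>\<^sub>M q)" unfolding s .
  have "?c : ?Z \<rightarrow> $R" using cZ by blast
  thus ?thesis by (rule spI[OF x _ wM_closed(2)[OF c(2) d(2)] ex])
 qed
 obtain g where G: "fbasis R M ?Z ?id g" using spanning_basis(1)[OF B iZ sZ] by blast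
 have cZ: "card ?Z = card I" by (rule spanning_basis(2)[OF B iZ sZ])
 note D = dualD[OF basisD(1)[OF G]]
 let ?N = "M(|carrier := e ` $M|)"
 have NM: "e ` $M <= $M" using ec by auto
 have XN: "X <= e ` $M" using eX fX by (metis image_eqI subsetD subsetI)
 have sN: "submodule (e ` $M) R M" by (rule image_submodule[OF module_axioms e])
 have "fbasis R ?N X ?id g" unfolding fbasis_def dual_basis_def
 proof (intro conjI ballI)
  show "finite X" "?id : X \<rightarrow> $?N" using fX XN by auto
  show "lin_fun R ?N (g j)" if "j : X" for j using D(3)[of j] that NM unfolding lin_fun_def by (auto simp: subset_iff)
  show "g i j = (if i = j then \<one> else \<zero>)" if "i : X" "j : X" for i j using basisD(2)[OF G] that by simp
  fix x assume "x : $?N"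
  hence x: "x : $M" "e x = x" using ec ee by auto
  have gc: "g j x : $R" if "j : ?Z" for j using funD(1)[OF D(3)[OF that] x(1)] .
  have "x = e (\<Oplus>\<^sub>M j\<in>?Z. g j x \<odot>\<^sub>M j)" using D(4)[OF x(1)] x(2) by simp
  also have "... = (\<Oplus>\<^sub>M j\<in>X. g j x \<odot>\<^sub>M j)" using gc by (rule eZ)
  also have "... = (\<Oplus>\<^sub>?N j\<in>X. g j x \<odot>\<^sub>M j)"
   using gc XN submoduleE(4)[OF sN] by (intro submodule_finsum[OF sN, symmetric]) auto
  finally show "x = (\<Oplus>\<^sub>?N j\<in>X. g j x \<odot>\<^sub>?N j)" by simp
 qed
 moreover have "card X \<le> card I" using cZ card_Un_disjoint[OF fX(1) fY(1) dis] by simp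
 moreover have "card X < card I" if ne: "EX x:$M. e x ~= x"
 proof -
  obtain x where x: "x : $M" "e x ~= x" using ne by blast
  have "Y ~= {}"
  proof
   assume "Y = {}"
   hence "!!j. j : ?Z ==> g j x : $R" "?Z = X" using funD(1)[OF D(3) x(1)] by auto
   hence "e x = x" using eZ[of "%j. g j x"] D(4)[OF x(1)] by simp
   thus False using x by simp
  qed
  hence "card Y > 0" using fY by (simp add: card_gt_0_iff)
  thus ?thesis using cZ card_Un_disjoint[OF fX(1) fY(1) dis] by simp
 qed
 ultimately show ?thesis using XN by blast
qed

text \<open>One vector more than the rank; the index set \<open>{..card I}\<close> has
  \<open>card I + 1\<close> elements.\<close>

lemma dependent_family:
 assumes B: "fbasis R M I b f" and v: "!!j. j \<le> card I ==> v j : $M"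
 shows "EX c:{..card I} \<rightarrow> $R. (\<Oplus>\<^sub>M j\<in>{..card I}. c j \<odot>\<^sub>M v j) : wM & (\<exists>j\<le>card I. c j ~: m)"
proof (rule ccontr)
 assume "\<not> ?thesis"
 hence "indep {..card I} v" unfolding indep_def using v by auto
 thus False using indep_card[OF B] by fastforce
qed

end

section \<open>Local endomorphism rings\<close>

lemma (in ring) left_idealD:
 assumes "left_ideal I R"
 shows "I <= $R" "\<zero> : I" "x : I ==> y : I ==> x \<oplus> y : I" "x : I ==> \<ominus> x : I"
  "a : $R ==> x : I ==> a \<cdot> x : I"
proof -
 have s: "additive_subgroup I R" using assms by (simp add: left_ideal_def additive_subgroup_def)
 show "I <= $R" using additive_subgroup.a_subset[OF s] .
 show "\<zero> : I" using additive_subgroup.zero_closed[OF s] .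
 show "x : I ==> y : I ==> x \<oplus> y : I" using additive_subgroup.a_closed[OF s] .
 show "x : I ==> \<ominus> x : I" using additive_subgroup.a_inv_closed[OF s] .
 show "a : $R ==> x : I ==> a \<cdot> x : I" using assms by (simp add: left_ideal_def)
qed

lemma (in ring) left_idealI:
 assumes "I <= $R" "\<zero> : I" "!!x y. x : I ==> y : I ==> x \<oplus> y : I"
  "!!a x. a : $R ==> x : I ==> a \<cdot> x : I"
 shows "left_ideal I R"
proof -
 have neg: "\<ominus> x : I" if "x : I" for x
 proof -
  have "\<ominus> \<one> \<cdot> x = \<ominus> x" using that assms(1) by (auto simp: l_minus)
  thus ?thesis using assms(4)[of "\<ominus> \<one>" x] that by simp
 qed
 have "subgroup I (add_monoid R)" using assms neg by (intro add.subgroupI) (auto simp: a_inv_def)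
 thus ?thesis using assms(4) by (simp add: left_ideal_def)
qed

lemma (in ring) exists_maximal_left_ideal:
 assumes L: "left_ideal L R" "\<one> ~: L"
 shows "\<exists>M. maximal_left_ideal M R & L <= M"
proof -
 let ?A = "{I. left_ideal I R & \<one> ~: I & L <= I}"
 have full: "I = $R" if "left_ideal I R" "\<one> : I" for I using left_idealD[OF that(1)] that(2) by (metis r_one subsetI subset_antisym)
 have "EX M:?A. ALL X:?A. M <= X --> X = M"
 proof (rule subset_Zorn_nonempty)
  show "?A ~= {}" using L by blast
  fix C assume C: "C ~= {}" "subset.chain ?A C"
  have CA: "C <= ?A" and ch: "!!X Y. X : C ==> Y : C ==> X <= Y \<or> Y <= X" using C(2) by (auto simp: subset_chain_def)
  have Cl: "left_ideal X R" if "X : C" for X using CA that by blast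
  have "left_ideal (\<Union>C) R"
  proof (rule left_idealI)
   show "\<Union>C <= $R" using left_idealD(1)[OF Cl] by blast
   show "\<zero> : \<Union>C" using left_idealD(2)[OF Cl] C(1) by blast
   show "x \<oplus> y : \<Union>C" if xy: "x : \<Union>C" "y : \<Union>C" for x y
   proof -
    obtain X Y where XY: "X : C" "x : X" "Y : C" "y : Y" using xy by blast
    show ?thesis
    proof (cases "X <= Y")
    case True
    thus ?thesis using left_idealD(3)[OF Cl[OF XY(3)], of x y] XY by blast
    next
    case False
    hence "Y <= X" using ch[OF XY(1,3)] by blast
    thus ?thesis using left_idealD(3)[OF Cl[OF XY(1)], of x y] XY by blast
    qed
   qed
   show "a \<cdot> x : \<Union>C" if "a : $R" "x : \<Union>C" for a x using left_idealD(5)[OF Cl] that by blast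
  qed
  moreover have "\<one> ~: \<Union>C" "L <= \<Union>C" using CA C(1) by auto
  ultimately show "\<Union>C : ?A" by blast
 qed
 then obtain M where MA: "M : ?A" "ALL X:?A. M <= X --> X = M" by (rule bexE)
 have M: "left_ideal M R" "\<one> ~: M" "L <= M" using MA(1) by simp_all
 have max: "X = M" if "left_ideal X R" "\<one> ~: X" "L <= X" "M <= X" for X using bspec[OF MA(2), of X] that by simp
 have "maximal_left_ideal M R" unfolding maximal_left_ideal_def
 proof (intro conjI allI impI)
  show "left_ideal M R" by (rule M(1))
  show "M ~= $R" using M(2) by auto
  fix X assume X: "left_ideal X R & M <= X"
  thus "X = M \<or> X = $R" using full[of X] max[of X] M(3) by blast
 qed
 thus ?thesis using M(3) by blast
qed

lemma (in ring) jacobson_left_ideal: "left_ideal (jacobson_radical R) R"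
proof (rule left_idealI)
 have l: "left_ideal I R" if "maximal_left_ideal I R" for I using that by (simp add: maximal_left_ideal_def)
 show "jacobson_radical R <= $R" "\<zero> : jacobson_radical R" using left_idealD(2)[OF l] by (auto simp: jacobson_radical_def)
 show "!!x y. x : jacobson_radical R ==> y : jacobson_radical R ==> x \<oplus> y : jacobson_radical R"
  using left_idealD(3)[OF l] by (auto simp: jacobson_radical_def)
 show "!!a x. a : $R ==> x : jacobson_radical R ==> a \<cdot> x : jacobson_radical R" using left_idealD(5)[OF l] by (auto simp: jacobson_radical_def)
qed

text \<open>If \<open>1 + x\<close> had no left inverse, its left multiples would lie in a maximal
  left ideal, which also contains \<open>x\<close> and therefore \<open>1\<close>.\<close>

lemma (in ring) jacobson_unit:
 assumes x: "x : jacobson_radical R"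
 shows "\<one> \<oplus> x : Units R"
proof -
 note J = left_idealD[OF jacobson_left_ideal]
 have left: "EX u:$R. u \<cdot> (\<one> \<oplus> x) = \<one>" if x: "x : jacobson_radical R" for x
 proof (rule ccontr)
  assume neg: "\<not> ?thesis"
  have xR: "x : $R" using x J(1) by blast
  let ?L = "(%u. u \<cdot> (\<one> \<oplus> x)) ` $R"
  have L1: "left_ideal ?L R"
  proof (rule left_idealI)
   show "?L <= $R" using xR by auto
   show "\<zero> : ?L" using xR by (intro image_eqI[of _ _ \<zero>]) auto
   show "a \<oplus> b : ?L" if ab: "a : ?L" "b : ?L" for a b
   proof -
    obtain u v where "u : $R" "a = u \<cdot> (\<one> \<oplus> x)" "v : $R" "b = v \<cdot> (\<one> \<oplus> x)" using ab by blast
    thus ?thesis using xR by (intro image_eqI[of _ _ "u \<oplus> v"]) (auto simp: l_distr)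
   qed
   show "a \<cdot> b : ?L" if ab: "a : $R" "b : ?L" for a b
   proof -
    obtain v where "v : $R" "b = v \<cdot> (\<one> \<oplus> x)" using ab by blast
    thus ?thesis using xR ab(1) by (intro image_eqI[of _ _ "a \<cdot> v"]) (auto simp: m_assoc)
   qed
  qed
  have L2: "\<one> ~: ?L"
  proof
   assume "\<one> : ?L"
   then obtain u where u: "u : $R" "\<one> = u \<cdot> (\<one> \<oplus> x)" by (rule imageE)
   from u(2)[symmetric] u(1) neg show False by blast
  qed
  obtain M where M: "maximal_left_ideal M R" "?L <= M" using exists_maximal_left_ideal[OF L1 L2] by (elim exE conjE)
  have Ml: "left_ideal M R" "M ~= $R" using M(1) by (auto simp: maximal_left_ideal_def)
  have "\<one> \<cdot> (\<one> \<oplus> x) : M" using subsetD[OF M(2) imageI[OF one_closed]] .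
  moreover have xM: "x : M" using x M(1) by (auto simp: jacobson_radical_def)
  ultimately have "(\<one> \<oplus> x) \<oplus> \<ominus> x : M"
   using left_idealD(3)[OF Ml(1), of "\<one> \<oplus> x" "\<ominus> x"] left_idealD(4)[OF Ml(1), of x] xR by simp
  hence "\<one> : M" using xR by (simp add: a_assoc r_neg)
  hence "a \<cdot> \<one> : M" if "a : $R" for a using left_idealD(5)[OF Ml(1) that] by simp
  hence "$R <= M" by (simp add: subset_iff)
  thus False using Ml left_idealD(1)[OF Ml(1)] by blast
 qed
 have xR: "x : $R" using x J(1) by blast
 obtain u where u: "u : $R" "u \<cdot> (\<one> \<oplus> x) = \<one>" using left[OF x] by blast
 have "u \<oplus> u \<cdot> x = \<one>" using u xR by (simp add: r_distr)
 moreover have "u = (u \<oplus> u \<cdot> x) \<oplus> \<ominus> (u \<cdot> x)" using u(1) xR by (simp add: a_assoc r_neg)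
 ultimately have ux: "u = \<one> \<oplus> \<ominus> (u \<cdot> x)" by simp
 have "\<ominus> (u \<cdot> x) : jacobson_radical R" using J(4)[OF J(5)[OF u(1) x]] .
 then obtain v where v: "v : $R" "v \<cdot> u = \<one>" using left[of "\<ominus> (u \<cdot> x)"] ux by auto
 have "v = v \<cdot> (u \<cdot> (\<one> \<oplus> x))" using u v by simp
 also have "... = (v \<cdot> u) \<cdot> (\<one> \<oplus> x)" using u(1) v(1) xR by (intro m_assoc[symmetric]) auto
 also have "... = \<one> \<oplus> x" unfolding v(2) using xR by simp
 finally have "v = \<one> \<oplus> x" .
 thus ?thesis unfolding Units_def using u v xR by auto
qed

text \<open>The radical is an intersection of left ideals, and that the coset map is a ring
  homomorphism requires it to be two-sided. This follows once every element is known to be a scalar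
  plus a radical element, which makes all elements outside the radical units.\<close>

lemma local_residue_hom:
 fixes E :: "('e, 'x) ring_scheme" and R :: "('r, 'y) ring_scheme"
 assumes E: "ring E" and R: "cring R" and m: "maximalideal mm R"
  and mu: "!!r. r : $R ==> r ~: mm ==> r : Units R"
  and sc: "sc : ring_hom R E"
  and \<phi>: "\<phi> : ring_iso (E Quot jacobson_radical E) (R Quot mm)"
  and \<phi>sc: "!!r. r : $R ==> \<phi> (jacobson_radical E +>\<^sub>E sc r) = mm +>\<^sub>R r"
 shows "\<exists>lam. lam : ring_hom E (R Quot mm) & (ALL r:$R. lam (sc r) = mm +>\<^sub>R r) &
  (ALL e:$E. lam e ~= \<zero>\<^bsub>R Quot mm\<^esub> --> e : Units E)"
proof -
 interpret E: ring E by fact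
 interpret R: cring R by fact
 interpret m: maximalideal mm R by fact
 let ?J = "jacobson_radical E"
 note J = E.left_idealD[OF E.jacobson_left_ideal]
 have aJ: "abelian_subgroup ?J E" using E.jacobson_left_ideal E.abelian_group_axioms
  by (intro abelian_subgroupI3) (auto simp: left_ideal_def additive_subgroup_def)
 have cosJ: "?J +>\<^sub>E a = ?J +>\<^sub>E b \<longleftrightarrow> a \<ominus>\<^sub>E b : ?J" if a: "a : $E" and b: "b : $E" for a b
 proof
  assume "?J +>\<^sub>E a = ?J +>\<^sub>E b"
  hence "a : ?J +>\<^sub>E b" using abelian_subgroup.a_rcos_self[OF aJ a] by simp
  thus "a \<ominus>\<^sub>E b : ?J" using abelian_subgroup.a_rcos_module_minus[OF aJ E b a] by simp
 next
  assume "a \<ominus>\<^sub>E b : ?J"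
  hence "a : ?J +>\<^sub>E b" using abelian_subgroup.a_rcos_module_minus[OF aJ E b a] by simp
  thus "?J +>\<^sub>E a = ?J +>\<^sub>E b" using abelian_subgroup.a_repr_independence'[OF aJ _ b] by metis
 qed
 have scc: "sc r : $E" if "r : $R" for r using ring_hom_closed[OF sc that] .
 have inj: "inj_on \<phi> ($(E Quot ?J))" using \<phi> by (simp add: ring_iso_def bij_betw_def)
 have cE: "?J +>\<^sub>E e : $(E Quot ?J)" if "e : $E" for e using that by (auto simp: FactRing_def A_RCOSETS_def RCOSETS_def a_r_coset_def)
 \<comment> \<open>The isomorphism respects scalars, so every class of the quotient is the class of
   a scalar.\<close>
 have dec: "EX r:$R. e \<ominus>\<^sub>E sc r : ?J" if e: "e : $E" for e
 proof -
  have "\<phi> (?J +>\<^sub>E e) : $(R Quot mm)" using \<phi> cE[OF e] by (auto simp: ring_iso_def bij_betw_def)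
  then obtain r where r: "r : $R" "\<phi> (?J +>\<^sub>E e) = mm +>\<^sub>R r" by (auto simp: FactRing_def A_RCOSETS_def RCOSETS_def a_r_coset_def)
  hence "\<phi> (?J +>\<^sub>E e) = \<phi> (?J +>\<^sub>E sc r)" using \<phi>sc by simp
  hence "?J +>\<^sub>E e = ?J +>\<^sub>E sc r" using inj cE[OF e] cE[OF scc[OF r(1)]] by (simp add: inj_on_def)
  thus ?thesis using cosJ[OF e scc[OF r(1)]] r(1) by blast
 qed
 have mcos: "mm +>\<^sub>R r = mm +>\<^sub>R s \<longleftrightarrow> r \<ominus>\<^sub>R s : mm" if "r : $R" "s : $R" for r s
  using R.quotient_eq_iff_same_a_r_cos[OF m.ideal_axioms that] by blast
 have scJ: "sc r : ?J \<longleftrightarrow> r : mm" if r: "r : $R" for r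
 proof -
  have s0: "sc \<zero>\<^sub>R = \<zero>\<^sub>E" using ring_hom_zero[OF sc R.ring_axioms E] .
  have "sc r : ?J \<longleftrightarrow> ?J +>\<^sub>E sc r = ?J +>\<^sub>E sc \<zero>\<^sub>R"
   using cosJ[OF scc[OF r] scc[OF R.zero_closed]] s0 scc[OF r] by (simp add: E.minus_eq)
  also have "... \<longleftrightarrow> mm +>\<^sub>R r = mm +>\<^sub>R \<zero>\<^sub>R"
   unfolding \<phi>sc[OF r, symmetric] \<phi>sc[OF R.zero_closed, symmetric]
   using inj_on_eq_iff[OF inj cE[OF scc[OF r]] cE[OF scc[OF R.zero_closed]]] by simp
  also have "... \<longleftrightarrow> r : mm" using mcos[OF r R.zero_closed] r by (simp add: R.minus_eq)
  finally show ?thesis .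
 qed
 have one_m: "\<one>\<^sub>R ~: mm" using m.I_notcarr m.one_imp_carrier by blast
 have one_J: "\<one>\<^sub>E ~: ?J" using scJ[OF R.one_closed] one_m ring_hom_one[OF sc] by simp
 have unit: "e : Units E" if e: "e : $E" "e ~: ?J" for e
 proof -
  obtain r where r: "r : $R" "e \<ominus>\<^sub>E sc r : ?J" using dec[OF e(1)] by blast
  let ?j = "e \<ominus>\<^sub>E sc r"
  have jE: "?j : $E" using e scc[OF r(1)] by simp
  have ej: "e = sc r \<oplus>\<^sub>E ?j" using e scc[OF r(1)] by (simp add: E.minus_eq E.a_lcomm E.r_neg)
  have "r ~: mm"
  proof
   assume "r : mm"
   hence "sc r \<oplus>\<^sub>E ?j : ?J" using scJ[OF r(1)] J(3)[OF _ r(2)] by blast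
   thus False using ej e(2) by simp
  qed
  hence ru: "r : Units R" using mu r(1) by blast
  let ?s = "sc (inv \<^sub>R r)"
  have sE: "?s : $E" using ru scc by simp
  have ss: "sc r \<cdot>\<^sub>E ?s = \<one>\<^sub>E" "?s \<cdot>\<^sub>E sc r = \<one>\<^sub>E"
   using ring_hom_mult[OF sc, of r "inv \<^sub>R r"] ring_hom_mult[OF sc, of "inv \<^sub>R r" r] ring_hom_one[OF sc] ru r(1) by auto
  hence su: "sc r : Units E" unfolding Units_def using sE scc[OF r(1)] by blast
  have "\<one>\<^sub>E \<oplus>\<^sub>E ?s \<cdot>\<^sub>E ?j : Units E" using E.jacobson_unit J(5)[OF sE r(2)] by blast
  hence "sc r \<cdot>\<^sub>E (\<one>\<^sub>E \<oplus>\<^sub>E ?s \<cdot>\<^sub>E ?j) : Units E" using su by simp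
  moreover have "sc r \<cdot>\<^sub>E (\<one>\<^sub>E \<oplus>\<^sub>E ?s \<cdot>\<^sub>E ?j) = e"
   using ej ss scc[OF r(1)] sE jE by (simp add: E.r_distr E.m_assoc[symmetric])
  ultimately show ?thesis by simp
 qed
 \<comment> \<open>If \<open>j x\<close> were outside the radical, \<open>j\<close> would have a
   right inverse \<open>?z\<close>. Then \<open>?f = ?z j\<close> is an idempotent in the radical;
   as \<open>1 - ?f\<close> is a unit that annihilates \<open>?f\<close>, it is zero, and
   \<open>1 = j ?f ?z\<close> would vanish.\<close>
 have two: "j \<cdot>\<^sub>E x : ?J" if j: "j : ?J" and x: "x : $E" for j x
 proof (rule ccontr)
  assume "j \<cdot>\<^sub>E x ~: ?J"
  have jE: "j : $E" using j J(1) by blast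
  obtain y where y: "y : $E" "j \<cdot>\<^sub>E x \<cdot>\<^sub>E y = \<one>\<^sub>E"
   using unit[OF _ \<open>j \<cdot>\<^sub>E x ~: ?J\<close>] jE x by (auto simp: Units_def)
  let ?z = "x \<cdot>\<^sub>E y"
  have z: "?z : $E" "j \<cdot>\<^sub>E ?z = \<one>\<^sub>E" using x y jE by (auto simp: E.m_assoc)
  let ?f = "?z \<cdot>\<^sub>E j"
  have fE: "?f : $E" using z jE by simp
  have fJ: "?f : ?J" using J(5) z(1) j by blast
  have "?f \<cdot>\<^sub>E ?f = ?z \<cdot>\<^sub>E (j \<cdot>\<^sub>E ?z) \<cdot>\<^sub>E j" using z(1) jE by (simp only: E.m_assoc E.m_closed)
  also have "... = ?f" unfolding z(2) using z(1) jE by simp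
  finally have ff: "?f \<cdot>\<^sub>E ?f = ?f" .
  have u: "\<one>\<^sub>E \<oplus>\<^sub>E \<ominus>\<^sub>E ?f : Units E" using E.jacobson_unit J(4)[OF fJ] by blast
  have "(\<one>\<^sub>E \<oplus>\<^sub>E \<ominus>\<^sub>E ?f) \<cdot>\<^sub>E ?f = \<zero>\<^sub>E"
   using fE ff by (simp only: E.l_distr E.l_minus E.l_one E.r_neg E.one_closed E.a_inv_closed)
  note uf = this
  let ?u = "\<one>\<^sub>E \<oplus>\<^sub>E \<ominus>\<^sub>E ?f"
  have "?f = (inv \<^sub>E ?u \<cdot>\<^sub>E ?u) \<cdot>\<^sub>E ?f" unfolding E.Units_l_inv[OF u] using fE by (rule E.l_one[symmetric])
  also have "... = inv \<^sub>E ?u \<cdot>\<^sub>E (?u \<cdot>\<^sub>E ?f)" by (rule E.m_assoc[OF E.Units_inv_closed[OF u] E.Units_closed[OF u] fE])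
  also have "... = \<zero>\<^sub>E" unfolding uf by (rule E.r_null[OF E.Units_inv_closed[OF u]])
  finally have f0: "?f = \<zero>\<^sub>E" .
  have "\<one>\<^sub>E = (j \<cdot>\<^sub>E ?z) \<cdot>\<^sub>E (j \<cdot>\<^sub>E ?z)" unfolding z(2) by simp
  also have "... = j \<cdot>\<^sub>E ?f \<cdot>\<^sub>E ?z" using z(1) jE by (simp only: E.m_assoc E.m_closed)
  also have "... = \<zero>\<^sub>E" unfolding f0 using z(1) jE by simp
  finally show False using one_J J(2) by simp
 qed
 have ideal: "ideal ?J E"
 proof (rule idealI[OF E])
  show "subgroup ?J (add_monoid E)" using E.jacobson_left_ideal by (simp add: left_ideal_def)
 qed (use two J(5) in auto)
 let ?lam = "\<phi> \<circ> (%e. ?J +>\<^sub>E e)"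
 have "\<phi> : ring_hom (E Quot ?J) (R Quot mm)" using \<phi> by (simp add: ring_iso_def)
 hence "?lam : ring_hom E (R Quot mm)" by (rule ring_hom_trans[OF ideal.rcos_ring_hom[OF ideal]])
 moreover have "?lam e = \<zero>\<^bsub>R Quot mm\<^esub>" if "e : ?J" for e
 proof -
  have "?J +>\<^sub>E e = ?J +>\<^sub>E sc \<zero>\<^sub>R"
   using cosJ[of e "sc \<zero>\<^sub>R"] that J(1) ring_hom_zero[OF sc R.ring_axioms E] by (auto simp: E.minus_eq)
  hence "?lam e = mm +>\<^sub>R \<zero>\<^sub>R" using \<phi>sc[OF R.zero_closed] by simp
  thus ?thesis using m.a_subset by (simp add: FactRing_def)
 qed
 ultimately show ?thesis using unit \<phi>sc by (intro exI[of _ ?lam]) auto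
qed

section \<open>Endomorphism rings of modules with a group action\<close>

lemma lin_end_simps:
 "monoid.mult (lin_end R M) = (%f g. \<lambda>x\<in>$M. f (g x))"
 "monoid.one (lin_end R M) = (\<lambda>x\<in>$M. x)"
 "ring.zero (lin_end R M) = (\<lambda>x\<in>$M. \<zero>\<^sub>M)"
 "ring.add (lin_end R M) = (%f g. \<lambda>x\<in>$M. f x \<oplus>\<^sub>M g x)"
 "smult (lin_end R M) = (%r f. \<lambda>x\<in>$M. r \<odot>\<^sub>M f x)" by (simp_all add: lin_end_def)

lemma end_app:
 assumes "x : $M"
 shows "(f \<cdot>\<^bsub>lin_end R M\<^esub> g) x = f (g x)" "\<one>\<^bsub>lin_end R M\<^esub> x = x" "\<zero>\<^bsub>lin_end R M\<^esub> x = \<zero>\<^sub>M"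
  "(f \<oplus>\<^bsub>lin_end R M\<^esub> g) x = f x \<oplus>\<^sub>M g x" "(r \<odot>\<^bsub>lin_end R M\<^esub> f) x = r \<odot>\<^sub>M f x"
 using assms by (simp_all add: lin_end_def)

lemma lin_end_mem: "f : $(lin_end R M) \<longleftrightarrow> f : extensional ($M) & lin_map R M M f" by (auto simp: lin_end_def lin_map_def PiE_def)

lemma end_ext:
 assumes "f : $(lin_end R M)" "g : $(lin_end R M)" "!!x. x : $M ==> f x = g x"
 shows "f = g" using assms by (auto simp: lin_end_mem intro: extensionalityI)

lemma endI:
 assumes "module R M" and "lin_map R M M f" shows "(\<lambda>x\<in>$M. f x) : $(lin_end R M)" unfolding lin_end_mem lin_map_def
proof (intro conjI ballI)
 interpret M: module R M by fact
 note F = linD[OF assms(2)]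
 show "(\<lambda>x\<in>$M. f x) : extensional ($M)" by simp
 show "(\<lambda>x\<in>$M. f x) : $M \<rightarrow> $M" using F(1) by simp
 fix x assume x: "x : $M"
 show "(\<lambda>x\<in>$M. f x) (x \<oplus>\<^sub>M y) = (\<lambda>x\<in>$M. f x) x \<oplus>\<^sub>M (\<lambda>x\<in>$M. f x) y"
  if y: "y : $M" for y using F(2)[OF x y] x y by simp
 show "(\<lambda>x\<in>$M. f x) (r \<odot>\<^sub>M x) = r \<odot>\<^sub>M (\<lambda>x\<in>$M. f x) x" if r: "r : $R" for r
  using F(3)[OF r x] x r by simp
qed

context module
begin

lemma lin_comp:
 assumes "lin_map R M N f" "lin_map R N P g" shows "lin_map R M P (%x. g (f x))" unfolding lin_map_def by (intro conjI ballI funcsetI)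
  (simp_all add: linD[OF assms(1)] linD[OF assms(2)])

lemma lin_add:
 assumes "module R N" "lin_map R M N f" "lin_map R M N g" shows "lin_map R M N (%x. f x \<oplus>\<^sub>N g x)"
proof -
 interpret N: module R N by fact
 show ?thesis unfolding lin_map_def by (intro conjI ballI funcsetI)
   (simp_all add: linD[OF assms(2)] linD[OF assms(3)] N.M.a_ac N.smult_r_distr)
qed

lemma lin_smult:
 assumes "module R N" "lin_map R M N f" "r : $R" shows "lin_map R M N (%x. r \<odot>\<^sub>N f x)"
proof -
 interpret N: module R N by fact
 show ?thesis unfolding lin_map_def by (intro conjI ballI funcsetI)
   (simp_all add: linD[OF assms(2)] assms(3) N.smult_r_distr N.smult_assoc1[symmetric] R.m_comm)
qed

lemma lin_const_zero: "lin_map R M M (%x. \<zero>\<^sub>M)" by (auto simp: lin_map_def)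

lemma endD:
 assumes "f : $(lin_end R M)" shows "x : $M ==> f x : $M" "lin_map R M M f" using assms linD(1) by (auto simp: lin_end_mem)

lemma end_closed:
 assumes "f : $(lin_end R M)" "g : $(lin_end R M)"
 shows "f \<cdot>\<^bsub>lin_end R M\<^esub> g : $(lin_end R M)" "f \<oplus>\<^bsub>lin_end R M\<^esub> g : $(lin_end R M)"
  "r : $R ==> r \<odot>\<^bsub>lin_end R M\<^esub> f : $(lin_end R M)"
 using endI[OF module_axioms lin_comp[OF endD(2)[OF assms(2)] endD(2)[OF assms(1)]]]
  endI[OF module_axioms lin_add[OF module_axioms endD(2)[OF assms(1)] endD(2)[OF assms(2)]]]
  endI[OF module_axioms lin_smult[OF module_axioms endD(2)[OF assms(1)]]] by (simp_all add: lin_end_simps)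

lemma end_01: "\<one>\<^bsub>lin_end R M\<^esub> : $(lin_end R M)" "\<zero>\<^bsub>lin_end R M\<^esub> : $(lin_end R M)"
 using endI[OF module_axioms lin_id] endI[OF module_axioms lin_const_zero] by (simp_all add: lin_end_simps)

lemma lin_end_ring: "ring (lin_end R M)"
proof (rule ringI)
 let ?E = "lin_end R M"
 note c = end_closed and oz = end_01 and d = endD(1)
 show "abelian_group ?E"
 proof (rule abelian_groupI)
  fix f g h assume f: "f : $?E" and g: "g : $?E" and h: "h : $?E"
  show "f \<oplus>\<^sub>?E g \<oplus>\<^sub>?E h = f \<oplus>\<^sub>?E (g \<oplus>\<^sub>?E h)"
   by (rule end_ext[of _ R M]) (use f g h c d in "auto simp: end_app M.a_assoc")
  show "f \<oplus>\<^sub>?E g = g \<oplus>\<^sub>?E f" by (rule end_ext[of _ R M]) (use f g c d in "auto simp: end_app M.a_comm")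
  show "\<zero>\<^sub>?E \<oplus>\<^sub>?E f = f" by (rule end_ext[of _ R M]) (use f c oz d in "auto simp: end_app")
  have n: "(\<ominus> \<one>) \<odot>\<^sub>?E f : $?E" using c(3)[OF f f] by simp
  have "(\<ominus> \<one>) \<odot>\<^sub>?E f \<oplus>\<^sub>?E f = \<zero>\<^sub>?E"
   by (rule end_ext[of _ R M]) (use f n c oz d in "auto simp: end_app smult_l_minus M.l_neg")
  thus "EX g:$?E. g \<oplus>\<^sub>?E f = \<zero>\<^sub>?E" using n by blast
 qed (use c oz in auto)
 show "Group.monoid ?E"
 proof (rule monoidI)
  fix f g h assume f: "f : $?E" and g: "g : $?E" and h: "h : $?E"
  show "f \<cdot>\<^sub>?E g \<cdot>\<^sub>?E h = f \<cdot>\<^sub>?E (g \<cdot>\<^sub>?E h)"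
   by (rule end_ext[of _ R M]) (use f g h c d in "auto simp: end_app")
  show "\<one>\<^sub>?E \<cdot>\<^sub>?E f = f" "f \<cdot>\<^sub>?E \<one>\<^sub>?E = f"
   by (rule end_ext[of _ R M]; use f c oz d in "auto simp: end_app")+
 qed (use c oz in auto)
 fix f g h assume f: "f : $?E" and g: "g : $?E" and h: "h : $?E"
 show "(f \<oplus>\<^sub>?E g) \<cdot>\<^sub>?E h = f \<cdot>\<^sub>?E h \<oplus>\<^sub>?E g \<cdot>\<^sub>?E h"
  by (rule end_ext[of _ R M]) (use f g h c d in "auto simp: end_app")
 show "h \<cdot>\<^sub>?E (f \<oplus>\<^sub>?E g) = h \<cdot>\<^sub>?E f \<oplus>\<^sub>?E h \<cdot>\<^sub>?E g"
  by (rule end_ext[of _ R M]) (use f g h c d linD(2)[OF endD(2)[OF h]] in "auto simp: end_app")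
qed

lemma lin_end_finsum:
 assumes "F : I \<rightarrow> $(lin_end R M)" "x : $M"
 shows "(\<Oplus>\<^bsub>lin_end R M\<^esub>i\<in>I. F i) x = (\<Oplus>\<^sub>M i\<in>I. F i x)"
proof -
 interpret E: ring "lin_end R M" by (rule lin_end_ring)
 show ?thesis by (rule E.add_finsum(2)[OF M.abelian_monoid_axioms, of "$(lin_end R M)" "%f. f x" F I])
   (use assms endD(1) in "auto simp: end_app")
qed

end

text \<open>Conjugation of an endomorphism by the action, cut off outside the carrier because the
  elements of \<open>lin_end\<close> are extensional functions.\<close>

definition conj_end :: "('g, 'z) monoid_scheme => ('a, 'b, 'g) gmodule => 'g => ('b => 'b) => 'b => 'b"
 where "conj_end G M g f = (\<lambda>x\<in>$M. act M g (f (act M (inv \<^sub>G g) x)))"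

context gmodule
begin

lemma act_linear: "g : $G ==> lin_map R M M (act M g)" using act_closed act_add act_smult by (auto simp: lin_map_def)

lemma act_inv: "g : $G ==> x : $M ==> act M (inv \<^sub>G g) (act M g x) = x"
 "g : $G ==> x : $M ==> act M g (act M (inv \<^sub>G g) x) = x"
 using act_mult[of "inv \<^sub>G g" g x] act_mult[of g "inv \<^sub>G g" x] act_one by simp_all

lemma conj_end_closed:
 assumes "g : $G" "f : $(lin_end R M)"
 shows "conj_end G M g f : $(lin_end R M)" unfolding conj_end_def using assms
 by (intro endI[OF module_axioms] lin_comp[OF lin_comp[OF act_linear endD(2)] act_linear]) auto

lemma conj_end_apply: "x : $M ==> conj_end G M g f x = act M g (f (act M (inv \<^sub>G g) x))" by (simp add: conj_end_def)

lemma galgebra_lin_end: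
 assumes fin: "finite ($G)"
 shows "galgebra (lin_end R M) G (conj_end G M)"
proof -
 interpret E: ring "lin_end R M" by (rule lin_end_ring)
 note cl = conj_end_closed and ap = conj_end_apply and c = end_closed and d = endD(1)
 show ?thesis
 proof (unfold_locales)
  show "finite ($G)" by fact
  show "conj_end G M g : ring_hom (lin_end R M) (lin_end R M)" if g: "g : $G" for g
  proof (rule ring_hom_memI)
   fix f h assume f: "f : $(lin_end R M)" and h: "h : $(lin_end R M)"
   show "conj_end G M g f : $(lin_end R M)" using cl[OF g f] .
   have i: "inv \<^sub>G g : $G" using g by simp
   show "conj_end G M g (f \<cdot>\<^bsub>lin_end R M\<^esub> h) = conj_end G M g f \<cdot>\<^bsub>lin_end R M\<^esub> conj_end G M g h"
    by (rule end_ext[of _ R M])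
    (use g i f h cl c d act_closed act_inv in "auto simp: end_app ap")
   show "conj_end G M g (f \<oplus>\<^bsub>lin_end R M\<^esub> h) = conj_end G M g f \<oplus>\<^bsub>lin_end R M\<^esub> conj_end G M g h"
    by (rule end_ext[of _ R M])
    (use g i f h cl c d act_closed act_add in "auto simp: end_app ap")
  next
   show "conj_end G M g \<one>\<^bsub>lin_end R M\<^esub> = \<one>\<^bsub>lin_end R M\<^esub>" by (rule end_ext[of _ R M])
    (use g cl end_01 act_closed act_inv in "auto simp: end_app ap")
  qed
  show "conj_end G M \<one>\<^sub>G f = f" if f: "f : $(lin_end R M)" for f by (rule end_ext[of _ R M]) (use f cl d act_one in "auto simp: ap")
  show "conj_end G M (g \<cdot>\<^sub>G h) f = conj_end G M g (conj_end G M h f)"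
   if g: "g : $G" and h: "h : $G" and f: "f : $(lin_end R M)" for g h f
  proof (rule end_ext[of _ R M])
   show "conj_end G M (g \<cdot>\<^sub>G h) f : $(lin_end R M)" using cl g h f by simp
   show "conj_end G M g (conj_end G M h f) : $(lin_end R M)" using cl g h f by simp
   fix x assume x: "x : $M"
   have gx: "act M (inv \<^sub>G g) x : $M" using act_closed g x by simp
   have y: "f (act M (inv \<^sub>G h) (act M (inv \<^sub>G g) x)) : $M" using d[OF f] act_closed h gx by simp
   have "act M (inv \<^sub>G (g \<cdot>\<^sub>G h)) x = act M (inv \<^sub>G h) (act M (inv \<^sub>G g) x)"
    using act_mult[of "inv \<^sub>G h" "inv \<^sub>G g" x] g h x by (simp add: inv_mult_group)
   thus "conj_end G M (g \<cdot>\<^sub>G h) f x = conj_end G M g (conj_end G M h f) x" using ap x gx act_mult[OF g h y] by simp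
  qed
 qed
qed

lemma fixed_points_lin_end:
 assumes H: "H <= $G"
 shows "fixpts (lin_end R M) (conj_end G M) H
  = {f : $(lin_end R M). ALL h:H. ALL x:$M. f (act M h x) = act M h (f x)}"
proof -
 have "conj_end G M h f = f \<longleftrightarrow> (ALL x:$M. f (act M h x) = act M h (f x))"
  if h: "h : $G" and f: "f : $(lin_end R M)" for h f
 proof
  assume e: "conj_end G M h f = f"
  show "ALL x:$M. f (act M h x) = act M h (f x)"
  proof
   fix x assume x: "x : $M"
   have "conj_end G M h f (act M h x) = act M h (f x)" using conj_end_apply[OF act_closed[OF h x]] act_inv(1)[OF h x] by simp
   thus "f (act M h x) = act M h (f x)" using e by simp
  qed
 next
  assume e: "ALL x:$M. f (act M h x) = act M h (f x)"
  show "conj_end G M h f = f"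
  proof (rule end_ext[of _ R M])
   fix x assume x: "x : $M"
   have ix: "act M (inv \<^sub>G h) x : $M" using act_closed h x by simp
   hence "f (act M h (act M (inv \<^sub>G h) x)) = act M h (f (act M (inv \<^sub>G h) x))" using e by blast
   thus "conj_end G M h f x = f x" using conj_end_apply[OF x] act_inv(2)[OF h x] by simp
  qed (use conj_end_closed h f in auto)
 qed
 thus ?thesis unfolding fixpts_def using H by blast
qed

text \<open>The bridge from module endomorphisms over a subgroup to fixed points in the
  \<open>G\<close>-algebra: commuting with \<open>h\<close> is the same as being fixed under
  conjugation by \<open>h\<close>.\<close>

lemma gmodule_end_eq:
 assumes "subgroup H G"
 shows "gmodule_end R (G(|carrier := H|)) M
  = (lin_end R M)(|carrier := fixpts (lin_end R M) (conj_end G M) H|)"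
 using fixed_points_lin_end[OF subgroup.subset[OF assms]] by (simp add: gmodule_end_def)

end

lemma (in galgebra) fixed_points_ring:
 assumes "H <= $G" shows "ring (A(|carrier := fixd H|))"
proof (rule ringI)
 note f = fixd_cl[OF assms]
 have c: "x : $A" if "x : fixd H" for x using fixd_A[OF that] .
 show "abelian_group (A(|carrier := fixd H|))"
 proof (rule abelian_groupI)
  fix x assume "x : $(A(|carrier := fixd H|))"
  thus "EX y:$(A(|carrier := fixd H|)). y \<oplus>\<^bsub>A(|carrier := fixd H|)\<^esub> x = \<zero>\<^bsub>A(|carrier := fixd H|)\<^esub>"
   using f(3)[of x] c[of x] by (auto simp: A.l_neg intro!: bexI[of _ "\<ominus> x"])
 qed (use f c in "auto simp: A.a_ac")
 show "Group.monoid (A(|carrier := fixd H|))" by (rule monoidI) (use f c in "auto simp: A.m_assoc")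
 show "!!x y z. x : $(A(|carrier := fixd H|)) ==> y : $(A(|carrier := fixd H|)) ==>
   z : $(A(|carrier := fixd H|)) ==>
   (x \<oplus>\<^bsub>A(|carrier := fixd H|)\<^esub> y) \<cdot>\<^bsub>A(|carrier := fixd H|)\<^esub> z =
   x \<cdot>\<^bsub>A(|carrier := fixd H|)\<^esub> z \<oplus>\<^bsub>A(|carrier := fixd H|)\<^esub> y \<cdot>\<^bsub>A(|carrier := fixd H|)\<^esub> z"
  using c by (simp add: A.l_distr)
 show "!!x y z. x : $(A(|carrier := fixd H|)) ==> y : $(A(|carrier := fixd H|)) ==>
   z : $(A(|carrier := fixd H|)) ==>
   z \<cdot>\<^bsub>A(|carrier := fixd H|)\<^esub> (x \<oplus>\<^bsub>A(|carrier := fixd H|)\<^esub> y) =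
   z \<cdot>\<^bsub>A(|carrier := fixd H|)\<^esub> x \<oplus>\<^bsub>A(|carrier := fixd H|)\<^esub> z \<cdot>\<^bsub>A(|carrier := fixd H|)\<^esub> y"
  using c by (simp add: A.r_distr)
qed

lemma (in gmodule) gmodule_end_ring:
 assumes "finite ($G)"
 shows "ring (gmodule_end R G M)"
proof -
 have "G(|carrier := $G|) = G" by simp
 thus ?thesis using gmodule_end_eq[OF subgroup_self] galgebra.fixed_points_ring[OF galgebra_lin_end[OF assms], of "$G"] by simp
qed

section \<open>Tensor products and induced modules\<close>

lemma free_simps:
 "$(free_module R X) = {f. (\<forall>x. f x : $R) & finite {x. f x ~= \<zero>\<^sub>R} & (\<forall>x. x ~: X --> f x = \<zero>\<^sub>R)}"
 "ring.zero (free_module R X) = (%_. \<zero>\<^sub>R)"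
 "f \<oplus>\<^bsub>free_module R X\<^esub> g = (%x. f x \<oplus>\<^sub>R g x)"
 "r \<odot>\<^bsub>free_module R X\<^esub> f = (%x. r \<cdot>\<^sub>R f x)" by (simp_all add: free_module_def)

context cring
begin

lemma free_closed:
 assumes "f : $(free_module R X)" "g : $(free_module R X)"
 shows "f \<oplus>\<^bsub>free_module R X\<^esub> g : $(free_module R X)"
  and "r : $R ==> r \<odot>\<^bsub>free_module R X\<^esub> f : $(free_module R X)"
proof -
 have "{x. f x \<oplus> g x ~= \<zero>} <= {x. f x ~= \<zero>} \<union> {x. g x ~= \<zero>}" by auto
 hence "finite {x. f x \<oplus> g x ~= \<zero>}" by (rule finite_subset) (use assms in "auto simp: free_simps")
 thus "f \<oplus>\<^bsub>free_module R X\<^esub> g : $(free_module R X)" using assms by (auto simp: free_simps)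
 assume r: "r : $R"
 have "{x. r \<cdot> f x ~= \<zero>} <= {x. f x ~= \<zero>}" using r by auto
 hence "finite {x. r \<cdot> f x ~= \<zero>}" by (rule finite_subset) (use assms in "auto simp: free_simps")
 thus "r \<odot>\<^bsub>free_module R X\<^esub> f : $(free_module R X)" using assms r by (auto simp: free_simps)
qed

lemma free_mod: "module R (free_module R X)"
proof (rule moduleI)
 let ?F = "free_module R X"
 have v: "f x : $R" if "f : $?F" for f x using that by (simp add: free_simps)
 show "cring R" by (rule cring_axioms)
 show "abelian_group ?F"
 proof (rule abelian_groupI)
  fix f assume f: "f : $?F"
  have "\<ominus> \<one> \<odot>\<^sub>?F f : $?F" using free_closed(2)[OF f f] by simp
  moreover have "(\<ominus> \<one> \<odot>\<^sub>?F f) \<oplus>\<^sub>?F f = \<zero>\<^sub>?F"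
   unfolding free_simps using v[OF f] by (simp add: l_minus l_neg)
  ultimately show "EX y:$?F. y \<oplus>\<^sub>?F f = \<zero>\<^sub>?F" by blast
 next
  show "\<zero>\<^sub>?F : $?F" by (simp add: free_simps)
 next
  fix f g h assume "f : $?F" "g : $?F" "h : $?F"
  thus "f \<oplus>\<^sub>?F g \<oplus>\<^sub>?F h = f \<oplus>\<^sub>?F (g \<oplus>\<^sub>?F h)" by (simp add: free_simps a_assoc)
 next
  fix f g assume "f : $?F" "g : $?F"
  thus "f \<oplus>\<^sub>?F g = g \<oplus>\<^sub>?F f" by (simp add: free_simps a_comm)
 next
  fix f assume "f : $?F"
  thus "\<zero>\<^sub>?F \<oplus>\<^sub>?F f = f" by (simp add: free_simps)
 qed (rule free_closed(1))
 show "!!a x. a : $R ==> x : $?F ==> a \<odot>\<^sub>?F x : $?F" using free_closed(2) by blast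
qed (simp_all add: free_simps l_distr r_distr m_assoc)

lemma free_gen_closed: "x : X ==> free_gen R x : $(free_module R X)" by (auto simp: free_simps free_gen_def)

lemma free_module_induct [consumes 1, case_names zero add gen]:
 assumes f: "f : $(free_module R X)"
  and P0: "P \<zero>\<^bsub>free_module R X\<^esub>"
  and Padd: "!!f g. f : $(free_module R X) ==> g : $(free_module R X) ==> P f ==> P g ==>
   P (f \<oplus>\<^bsub>free_module R X\<^esub> g)"
  and Pgen: "!!r x. r : $R ==> x : X ==> P (r \<odot>\<^bsub>free_module R X\<^esub> free_gen R x)"
 shows "P f"
proof -
 let ?F = "free_module R X"
 have "P f" if "finite Y" "{x. f x ~= \<zero>} = Y" "f : $?F" for Y f using that
 proof (induction Y arbitrary: f)
  case empty
  hence "f = \<zero>\<^sub>?F" by (auto simp: free_simps)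
  thus ?case using P0 by simp
 next
  case (insert y Y)
  have y: "y : X" "f y : $R" using insert.hyps insert.prems by (auto simp: free_simps)
  have s: "{x. (f(y := \<zero>)) x ~= \<zero>} = Y" using insert.hyps insert.prems(1) by auto
  have g: "f(y := \<zero>) : $?F" using insert.prems(2) insert.hyps(1) s by (auto simp: free_simps)
  have "f = f(y := \<zero>) \<oplus>\<^sub>?F (f y \<odot>\<^sub>?F free_gen R y)"
   using insert.prems(2) by (auto simp: free_simps free_gen_def fun_eq_iff)
  thus ?case using Padd[OF g _ insert.IH[OF s g] Pgen[OF y(2,1)]] free_closed(2) free_gen_closed[OF y(1)] y(2) by metis
 qed
 from this[OF _ refl f] show ?thesis using f by (simp add: free_simps)
qed

end

section \<open>Linear maps out of free modules\<close>

definition lin_ext ::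
  "('a, 'y) ring_scheme => ('a, 'b, 'u) module_scheme => ('x => 'b) => ('x => 'a) => 'b"
 where "lin_ext R M \<beta> f = (\<Oplus>\<^sub>M x\<in>{x. f x ~= \<zero>\<^sub>R}. f x \<odot>\<^sub>M \<beta> x)"

context module
begin

text \<open>Allows functions with different supports to be summed over a common index set.\<close>

lemma lin_ext_superset:
 assumes f: "f : $(free_module R X)" and \<beta>: "!!x. x : X ==> \<beta> x : $M"
  and Y: "finite Y" "Y <= X" "{x. f x ~= \<zero>} <= Y"
 shows "lin_ext R M \<beta> f = (\<Oplus>\<^sub>M x\<in>Y. f x \<odot>\<^sub>M \<beta> x)" unfolding lin_ext_def
proof (rule M.add.finprod_mono_neutral_cong_left[OF Y(1,3)])
 have "f x \<odot>\<^sub>M \<beta> x : $M" if "x : X" for x using f \<beta>[OF that] by (simp add: free_simps)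
 thus "(%x. f x \<odot>\<^sub>M \<beta> x) : Y \<rightarrow> $M" using Y(2) by auto
 show "f i \<odot>\<^sub>M \<beta> i = \<zero>\<^sub>M" if "i : Y - {x. f x ~= \<zero>}" for i
  using that \<beta>[of i] Y(2) by (auto intro: smult_l_null)
qed auto

lemma linear_lin_ext:
 assumes \<beta>: "!!x. x : X ==> \<beta> x : $M"
 shows "lin_map R (free_module R X) M (lin_ext R M \<beta>)" unfolding lin_map_def
proof (intro conjI ballI funcsetI)
 let ?F = "free_module R X"
 have sup: "finite {x. f x ~= \<zero>}" "{x. f x ~= \<zero>} <= X" "!!x. f x : $R" if "f : $?F" for f using that by (auto simp: free_simps)
 fix f assume f: "f : $?F"
 have b: "f x \<odot>\<^sub>M \<beta> x : $M" if "x : X" for x using f \<beta>[OF that] by (simp add: free_simps)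
 show "lin_ext R M \<beta> f : $M" unfolding lin_ext_def by (rule M.finsum_closed) (use b sup(2)[OF f] in auto)
 show "lin_ext R M \<beta> (f \<oplus>\<^sub>?F g) = lin_ext R M \<beta> f \<oplus>\<^sub>M lin_ext R M \<beta> g" if g: "g : $?F" for g
 proof -
  let ?Y = "{x. f x ~= \<zero>} \<union> {x. g x ~= \<zero>}"
  have Y: "finite ?Y" "?Y <= X" using sup[OF f] sup[OF g] by auto
  have bg: "g x \<odot>\<^sub>M \<beta> x : $M" if "x : X" for x using g \<beta>[OF that] by (simp add: free_simps)
  have "lin_ext R M \<beta> (f \<oplus>\<^sub>?F g) = (\<Oplus>\<^sub>M x\<in>?Y. (f \<oplus>\<^sub>?F g) x \<odot>\<^sub>M \<beta> x)"
   by (rule lin_ext_superset[OF R.free_closed(1)[OF f g] \<beta> Y]) (auto simp: free_simps)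
  also have "... = (\<Oplus>\<^sub>M x\<in>?Y. f x \<odot>\<^sub>M \<beta> x \<oplus>\<^sub>M g x \<odot>\<^sub>M \<beta> x)"
  proof (rule M.finsum_cong')
   show "(f \<oplus>\<^sub>?F g) x \<odot>\<^sub>M \<beta> x = f x \<odot>\<^sub>M \<beta> x \<oplus>\<^sub>M g x \<odot>\<^sub>M \<beta> x" if "x : ?Y" for x
    using smult_l_distr[of "f x" "g x" "\<beta> x"] sup(3)[OF f] sup(3)[OF g] \<beta>[of x] that Y(2) by (auto simp: free_simps)
  qed (use b bg Y(2) in auto)
  also have "... = (\<Oplus>\<^sub>M x\<in>?Y. f x \<odot>\<^sub>M \<beta> x) \<oplus>\<^sub>M (\<Oplus>\<^sub>M x\<in>?Y. g x \<odot>\<^sub>M \<beta> x)"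
   using b bg Y(2) by (intro M.finsum_addf) auto
  also have "(\<Oplus>\<^sub>M x\<in>?Y. f x \<odot>\<^sub>M \<beta> x) = lin_ext R M \<beta> f"
   by (rule lin_ext_superset[OF f \<beta> Y, symmetric]) auto
  also have "(\<Oplus>\<^sub>M x\<in>?Y. g x \<odot>\<^sub>M \<beta> x) = lin_ext R M \<beta> g"
   by (rule lin_ext_superset[OF g \<beta> Y, symmetric]) auto
  finally show ?thesis .
 qed
 show "lin_ext R M \<beta> (r \<odot>\<^sub>?F f) = r \<odot>\<^sub>M lin_ext R M \<beta> f" if r: "r : $R" for r
 proof -
  let ?Y = "{x. f x ~= \<zero>}"
  have "lin_ext R M \<beta> (r \<odot>\<^sub>?F f) = (\<Oplus>\<^sub>M x\<in>?Y. (r \<odot>\<^sub>?F f) x \<odot>\<^sub>M \<beta> x)"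
   by (rule lin_ext_superset[OF R.free_closed(2)[OF f f r] \<beta> sup(1,2)[OF f]])
    (use r in "auto simp: free_simps")
  also have "... = (\<Oplus>\<^sub>M x\<in>?Y. r \<odot>\<^sub>M (f x \<odot>\<^sub>M \<beta> x))"
  proof (rule M.finsum_cong')
   show "(r \<odot>\<^sub>?F f) x \<odot>\<^sub>M \<beta> x = r \<odot>\<^sub>M (f x \<odot>\<^sub>M \<beta> x)" if "x : ?Y" for x
    using smult_assoc1[of r "f x" "\<beta> x"] sup[OF f] \<beta>[of x] that r by (auto simp: free_simps)
  qed (use b sup(2)[OF f] r in auto)
  also have "... = r \<odot>\<^sub>M lin_ext R M \<beta> f" unfolding lin_ext_def using sup(1,2)[OF f] b r by (subst finsum_smult_ldistr) auto
  finally show ?thesis .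
 qed
qed

lemma lin_ext_gen:
 assumes \<beta>: "!!x. x : X ==> \<beta> x : $M" and x: "x : X"
 shows "lin_ext R M \<beta> (free_gen R x) = \<beta> x"
proof -
 have "lin_ext R M \<beta> (free_gen R x) = (\<Oplus>\<^sub>M y\<in>{x}. free_gen R x y \<odot>\<^sub>M \<beta> y)"
  by (rule lin_ext_superset[OF R.free_gen_closed[OF x] \<beta>]) (use x in "auto simp: free_gen_def")
 thus ?thesis using \<beta>[OF x] by (simp add: free_gen_def)
qed

lemma linear_free_eqI:
 assumes f: "f : $(free_module R X)"
  and g: "lin_map R (free_module R X) M g" and h: "lin_map R (free_module R X) M h"
  and e: "!!x. x : X ==> g (free_gen R x) = h (free_gen R x)"
 shows "g f = h f" using f
proof (induction rule: R.free_module_induct)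
 case zero
 interpret F: module R "free_module R X" by (rule R.free_mod)
 show ?case using F.lin_zero[OF module_axioms g] F.lin_zero[OF module_axioms h] by simp
next
 case (add f1 f2)
 thus ?case by (simp add: linD[OF g] linD[OF h])
next
 case (gen r x)
 thus ?case by (simp add: linD[OF g] linD[OF h] R.free_gen_closed e)
qed

end

context cring
begin

text \<open>Once recognised as a linear extension, \<open>free_map\<close> inherits linearity and
  its values on generators.\<close>

lemma free_map_lin_ext:
 assumes f: "f : $(free_module R X)" and \<sigma>: "\<sigma> : X \<rightarrow> Y"
 shows "free_map R \<sigma> f = lin_ext R (free_module R Y) (%x. free_gen R (\<sigma> x)) f"
proof
 fix y
 let ?F = "free_module R Y"
 interpret F: module R ?F by (rule free_mod)
 let ?S = "{x. f x ~= \<zero>}"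
 have fx: "finite ?S" "?S <= X" "!!x. f x : $R" using f by (auto simp: free_simps)
 have "lin_ext R ?F (%x. free_gen R (\<sigma> x)) f y = (\<Oplus>x\<in>?S. (f x \<odot>\<^sub>?F free_gen R (\<sigma> x)) y)" unfolding lin_ext_def
 proof (rule F.M.add_finsum(2)[OF abelian_monoid_axioms, of "$?F" "%f. f y"])
  show "(%i. f i \<odot>\<^sub>?F free_gen R (\<sigma> i)) : ?S \<rightarrow> $?F" using fx \<sigma> free_gen_closed[of _ Y] F.smult_closed by blast
  show "x \<oplus>\<^sub>?F z : $?F" if "x : $?F" "z : $?F" for x z using free_closed(1)[OF that] .
  show "\<zero>\<^sub>?F : $?F" by (rule F.M.zero_closed)
 qed (auto simp: free_simps)
 also have "... = (\<Oplus>x\<in>?S. if x : {x. f x ~= \<zero> & \<sigma> x = y} then f x else \<zero>)"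
  by (rule finsum_cong') (use fx(3) in "auto simp: free_simps free_gen_def")
 also have "... = (\<Oplus>x\<in>{x. f x ~= \<zero> & \<sigma> x = y}. f x)" by (rule add.finprod_mono_neutral_cong_right) (use fx in auto)
 finally show "free_map R \<sigma> f y = lin_ext R ?F (%x. free_gen R (\<sigma> x)) f y" by (simp add: free_map_def)
qed

lemma linear_free_map:
 assumes "\<sigma> : X \<rightarrow> Y"
 shows "lin_map R (free_module R X) (free_module R Y) (free_map R \<sigma>)"
proof -
 interpret F': module R "free_module R Y" by (rule free_mod)
 note e = free_map_lin_ext[OF _ assms]
 have "lin_map R (free_module R X) (free_module R Y) (lin_ext R (free_module R Y) (%x. free_gen R (\<sigma> x)))"
  by (rule F'.linear_lin_ext, rule free_gen_closed, use assms in blast)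
 from linD[OF this] show ?thesis unfolding lin_map_def by (intro conjI ballI funcsetI) (simp_all add: e free_closed)
qed

lemma free_map_gen:
 assumes "\<sigma> : X \<rightarrow> Y" "x : X"
 shows "free_map R \<sigma> (free_gen R x) = free_gen R (\<sigma> x)"
proof -
 interpret F': module R "free_module R Y" by (rule free_mod)
 show ?thesis unfolding free_map_lin_ext[OF free_gen_closed[OF assms(2)] assms(1)]
  by (rule F'.lin_ext_gen[OF _ assms(2)], rule free_gen_closed, use assms(1) in blast)
qed

end

text \<open>The relations \<open>\<delta> u \<ominus> \<delta> v\<close> for \<open>(u, v)\<close> in \<open>B\<close> are imposed in addition to bilinearity.\<close>

locale tensor_quotient_data = M: module R M + N: module R N + G: group G
 for R :: "('a, 'y) ring_scheme" (structure) and M :: "('a, 'b, 'u) module_scheme"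
  and N :: "('a, 'c, 'v) module_scheme" and G :: "('g, 'z) monoid_scheme" +
 fixes B :: "(('b \<times> 'c) \<times> ('b \<times> 'c)) set" and \<sigma> :: "'g => 'b => 'b" and \<tau> :: "'g => 'c => 'c"
 assumes B_sub: "B <= ($M \<times> $N) \<times> ($M \<times> $N)"
  and \<sigma>_linear: "g : $G ==> lin_map R M M (\<sigma> g)"
  and \<sigma>_one: "x : $M ==> \<sigma> \<one>\<^sub>G x = x"
  and \<sigma>_mult: "g : $G ==> h : $G ==> x : $M ==> \<sigma> (g \<cdot>\<^sub>G h) x = \<sigma> g (\<sigma> h x)"
  and \<tau>_linear: "g : $G ==> lin_map R N N (\<tau> g)"
  and \<tau>_one: "y : $N ==> \<tau> \<one>\<^sub>G y = y"
  and \<tau>_mult: "g : $G ==> h : $G ==> y : $N ==> \<tau> (g \<cdot>\<^sub>G h) y = \<tau> g (\<tau> h y)"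
  and B_inv: "g : $G ==> ((x, y), (x', y')) : B ==> ((\<sigma> g x, \<tau> g y), (\<sigma> g x', \<tau> g y')) : B"
begin

definition F where "F = free_module R ($M \<times> $N)"
abbreviation \<delta> where "\<delta> \<equiv> free_gen R"
definition rels where "rels = bilinear_relations R M N \<union> {\<delta> (x, y) \<ominus>\<^sub>F \<delta> (x', y') | x y x' y'. ((x, y), (x', y')) : B}"
definition K where "K = (%L. submodule L R F) hull rels"
definition act_gen where "act_gen = (%g (x, y). (\<sigma> g x, \<tau> g y))"
definition TQ where "TQ = tensor_quotient R M N {\<delta> (x, y) \<ominus>\<^sub>F \<delta> (x', y') | x y x' y'. ((x, y), (x', y')) : B} act_gen"
definition cls where "cls f = K +>\<^sub>F f"
definition tens where "tens x y = cls (\<delta> (x, y))"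

sublocale F: module R F unfolding F_def by (rule M.free_mod)

lemma gen_closed: "x : $M ==> y : $N ==> \<delta> (x, y) : $F" unfolding F_def by (rule M.free_gen_closed) simp

lemma rels_cases [consumes 1, case_names add_l add_r smult_l smult_r extra]:
 assumes "f : rels"
 obtains (add_l) x x' y where "f = \<delta> (x \<oplus>\<^sub>M x', y) \<ominus>\<^sub>F (\<delta> (x, y) \<oplus>\<^sub>F \<delta> (x', y))"
   "x : $M" "x' : $M" "y : $N"
  | (add_r) x y y' where "f = \<delta> (x, y \<oplus>\<^sub>N y') \<ominus>\<^sub>F (\<delta> (x, y) \<oplus>\<^sub>F \<delta> (x, y'))"
   "x : $M" "y : $N" "y' : $N"
  | (smult_l) r x y where "f = \<delta> (r \<odot>\<^sub>M x, y) \<ominus>\<^sub>F (r \<odot>\<^sub>F \<delta> (x, y))"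
   "r : $R" "x : $M" "y : $N"
  | (smult_r) r x y where "f = \<delta> (x, r \<odot>\<^sub>N y) \<ominus>\<^sub>F (r \<odot>\<^sub>F \<delta> (x, y))"
   "r : $R" "x : $M" "y : $N"
  | (extra) x y x' y' where "f = \<delta> (x, y) \<ominus>\<^sub>F \<delta> (x', y')" "((x, y), (x', y')) : B"
 using assms unfolding rels_def bilinear_relations_def Let_def F_def[symmetric]
 apply (elim UnE)
   apply (elim CollectE exE conjE, rule that(1), assumption+)
  apply (elim CollectE exE conjE, rule that(2), assumption+)
  apply (elim CollectE exE conjE, rule that(3), assumption+)
 apply (elim CollectE exE conjE, rule that(4), assumption+)
 apply (elim CollectE exE conjE, rule that(5), assumption+)
 done

lemma relsI:
 "x : $M ==> x' : $M ==> y : $N ==>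
  \<delta> (x \<oplus>\<^sub>M x', y) \<ominus>\<^sub>F (\<delta> (x, y) \<oplus>\<^sub>F \<delta> (x', y)) : rels"
 "x : $M ==> y : $N ==> y' : $N ==>
  \<delta> (x, y \<oplus>\<^sub>N y') \<ominus>\<^sub>F (\<delta> (x, y) \<oplus>\<^sub>F \<delta> (x, y')) : rels"
 "r : $R ==> x : $M ==> y : $N ==>
  \<delta> (r \<odot>\<^sub>M x, y) \<ominus>\<^sub>F (r \<odot>\<^sub>F \<delta> (x, y)) : rels"
 "r : $R ==> x : $M ==> y : $N ==>
  \<delta> (x, r \<odot>\<^sub>N y) \<ominus>\<^sub>F (r \<odot>\<^sub>F \<delta> (x, y)) : rels"
 "((x, y), (x', y')) : B ==> \<delta> (x, y) \<ominus>\<^sub>F \<delta> (x', y') : rels"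
 unfolding rels_def bilinear_relations_def Let_def F_def[symmetric]
 apply (rule UnI1, rule UnI1, rule UnI1, rule UnI1, blast)
 apply (rule UnI1, rule UnI1, rule UnI1, rule UnI2, blast)
 apply (rule UnI1, rule UnI1, rule UnI2, blast)
 apply (rule UnI1, rule UnI2, blast)
 apply (rule UnI2, blast)
 done

lemma B_closed: "((x, y), (x', y')) : B ==> x : $M & y : $N & x' : $M & y' : $N" using B_sub by blast

lemma rels_closed: assumes "f : rels" shows "f : $F" using assms
proof (cases rule: rels_cases)
 case (extra x y x' y')
 thus ?thesis using B_closed[OF extra(2)] gen_closed by simp
qed (simp_all add: gen_closed)

lemma K_rels: "rels <= K" unfolding K_def by (rule hull_subset)

lemma K_minimal: assumes "submodule L R F" "rels <= L" shows "K <= L" using assms unfolding K_def hull_def by blast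

lemma K_submodule: "submodule K R F"
proof (rule F.submoduleI)
 have mem: "x : K \<longleftrightarrow> (\<forall>L. submodule L R F & rels <= L --> x : L)" for x by (auto simp: K_def hull_def)
 show "K <= $F" using K_minimal[OF F.carrier_is_submodule] rels_closed by blast
 show "\<zero>\<^sub>F : K" using submodule.axioms(1) subgroup.one_closed[of _ "add_monoid F"] by (fastforce simp: mem)
 show "\<ominus>\<^sub>F a : K" if "a : K" for a using that F.submoduleE(3) by (simp add: mem)
 show "a \<oplus>\<^sub>F b : K" if "a : K" "b : K" for a b using that F.submoduleE(5) by (simp add: mem)
 show "r \<odot>\<^sub>F b : K" if "r : $R" "b : K" for r b using that F.submoduleE(4) by (simp add: mem)
qed

lemma K_abelian: "abelian_subgroup K F" using submodule.axioms(1)[OF K_submodule] F.M.abelian_group_axioms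
 by (intro abelian_subgroupI3) (auto simp: additive_subgroup_def)

lemma cls_eq: assumes "f : $F" "g : $F" shows "cls f = cls g \<longleftrightarrow> f \<ominus>\<^sub>F g : K"
proof -
 interpret K: abelian_subgroup K F by (rule K_abelian)
 show ?thesis
 proof
  assume "cls f = cls g"
  hence "f : K +>\<^sub>F g" using K.a_rcos_self[OF assms(1)] by (simp add: cls_def)
  thus "f \<ominus>\<^sub>F g : K" using K.a_rcos_module[OF assms(2,1)] by (simp add: F.M.minus_eq)
 next
  assume "f \<ominus>\<^sub>F g : K"
  hence "f : K +>\<^sub>F g" using K.a_rcos_module[OF assms(2,1)] by (simp add: F.M.minus_eq)
  thus "cls f = cls g" using K.a_repr_independence'[OF _ assms(2)] by (simp add: cls_def)
 qed
qed


text \<open>The operations of the quotient record are unions over all members of a coset. For a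
  linear map that preserves \<open>K\<close> the united classes all coincide, so the union is a
  single class.\<close>

lemma cls_collapse:
 assumes \<phi>: "lin_map R F F \<phi>" and K: "!!k. k : K ==> \<phi> k : K" and f: "f : $F"
 shows "(\<Union>h\<in>cls f. cls (\<phi> h)) = cls (\<phi> f)"
proof -
 interpret K: abelian_subgroup K F by (rule K_abelian)
 note L = linD[OF \<phi>]
 have "cls (\<phi> h) = cls (\<phi> f)" if "h : cls f" for h
 proof -
  have h: "h : $F" using that K.a_elemrcos_carrier[OF f] by (simp add: cls_def)
  have "cls h = cls f" using K.a_repr_independence'[OF _ f, of h] that by (simp add: cls_def)
  hence "\<phi> (h \<ominus>\<^sub>F f) : K" using K cls_eq[OF h f] by blast
  hence "\<phi> h \<ominus>\<^sub>F \<phi> f : K"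
   using L(2)[OF h, of "\<ominus>\<^sub>F f"] F.lin_neg[OF F.module_axioms \<phi> f] f by (simp add: F.M.minus_eq)
  thus ?thesis using cls_eq L(1) h f by blast
 qed
 moreover have "f : cls f" using K.a_rcos_self[OF f] by (simp add: cls_def)
 ultimately show ?thesis by blast
qed

text \<open>Preimages of submodules are the test objects for \<open>K_minimal\<close>: invariance of
  \<open>K\<close> under the group and vanishing of a lift on \<open>K\<close> are both reduced to
  the relations in this way.\<close>

lemma vimage_submodule:
 assumes P: "module R P" and \<phi>: "lin_map R F P \<phi>" and L: "submodule L R P"
 shows "submodule {x : $F. \<phi> x : L} R F"
proof -
 interpret P: module R P by fact
 note D = linD[OF \<phi>] and E = P.submoduleE[OF L]
 have z: "\<zero>\<^sub>P : L" using submodule.axioms(1)[OF L] subgroup.one_closed[of L "add_monoid P"] by simp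
 show ?thesis by (rule F.submoduleI)
   (use D E z in "auto simp: F.lin_zero[OF P \<phi>] F.lin_neg[OF P \<phi>]")
qed

lemma linear_map_minus:
 assumes P: "module R P" and \<phi>: "lin_map R F P \<phi>" and f: "f : $F" "g : $F"
 shows "\<phi> (f \<ominus>\<^sub>F g) = \<phi> f \<ominus>\<^sub>P \<phi> g"
 using linD(2)[OF \<phi>, of f "\<ominus>\<^sub>F g"] F.lin_neg[OF P \<phi> f(2)] f
 by (simp add: F.M.minus_eq abelian_group.minus_eq[OF module.axioms(2)[OF P]])

lemma F_eqI:
 assumes "module R P" "lin_map R F P g" "lin_map R F P h" "f : $F"
  and e: "!!x y. x : $M ==> y : $N ==> g (\<delta> (x, y)) = h (\<delta> (x, y))"
 shows "g f = h f"
proof (rule module.linear_free_eqI[OF assms(1) assms(4,2,3)[unfolded F_def]])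
 fix u assume "u : $M \<times> $N"
 thus "g (\<delta> u) = h (\<delta> u)" by (cases u) (use e in blast)
qed

lemma act_gen_map:
 assumes "g : $G"
 shows "act_gen g : $M \<times> $N \<rightarrow> $M \<times> $N"
 using linD(1)[OF \<sigma>_linear[OF assms]] linD(1)[OF \<tau>_linear[OF assms]] by (auto simp: act_gen_def)

lemma act_free:
 assumes g: "g : $G"
 shows "lin_map R F F (free_map R (act_gen g))"
  and "x : $M ==> y : $N ==> free_map R (act_gen g) (\<delta> (x, y)) = \<delta> (\<sigma> g x, \<tau> g y)"
proof -
 show "lin_map R F F (free_map R (act_gen g))" unfolding F_def by (rule M.linear_free_map[OF act_gen_map[OF g]])
 show "free_map R (act_gen g) (\<delta> (x, y)) = \<delta> (\<sigma> g x, \<tau> g y)" if "x : $M" "y : $N"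
  using M.free_map_gen[OF act_gen_map[OF g], of "(x, y)"] that by (simp add: act_gen_def)
qed

lemma act_rels:
 assumes g: "g : $G" and r: "f : rels" shows "free_map R (act_gen g) f : rels"
proof -
 note L = linD[OF act_free(1)[OF g]] and m = linear_map_minus[OF F.module_axioms act_free(1)[OF g]]
  and v = act_free(2)[OF g] and s = linD[OF \<sigma>_linear[OF g]] and t = linD[OF \<tau>_linear[OF g]]
 show ?thesis using r
 proof (cases rule: rels_cases)
  case (add_l x x' y)
  thus ?thesis using relsI(1)[of "\<sigma> g x" "\<sigma> g x'" "\<tau> g y"] by (simp add: L m v s t gen_closed)
 next
  case (add_r x y y')
  thus ?thesis using relsI(2)[of "\<sigma> g x" "\<tau> g y" "\<tau> g y'"] by (simp add: L m v s t gen_closed)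
 next
  case (smult_l r x y)
  thus ?thesis using relsI(3)[of r "\<sigma> g x" "\<tau> g y"] by (simp add: L m v s t gen_closed)
 next
  case (smult_r r x y)
  thus ?thesis using relsI(4)[of r "\<sigma> g x" "\<tau> g y"] by (simp add: L m v s t gen_closed)
 next
  case (extra x y x' y')
  thus ?thesis using relsI(5)[OF B_inv[OF g extra(2)]] B_closed[OF extra(2)] by (simp add: L m v s t gen_closed)
 qed
qed

lemma act_K: assumes g: "g : $G" and k: "k : K" shows "free_map R (act_gen g) k : K"
proof -
 have "K <= {x : $F. free_map R (act_gen g) x : K}" by (rule K_minimal[OF vimage_submodule[OF F.module_axioms act_free(1)[OF g] K_submodule]])
   (use act_rels[OF g] K_rels rels_closed in blast)
 thus ?thesis using k by blast
qed

lemma TQ_ops: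
 "$TQ = cls ` $F" "\<zero>\<^sub>TQ = cls \<zero>\<^sub>F"
 "f : $F ==> h : $F ==> cls f \<oplus>\<^sub>TQ cls h = cls (f \<oplus>\<^sub>F h)"
 "r : $R ==> f : $F ==> r \<odot>\<^sub>TQ cls f = cls (r \<odot>\<^sub>F f)"
 "g : $G ==> f : $F ==> act TQ g (cls f) = cls (free_map R (act_gen g) f)"
proof -
 interpret K: abelian_subgroup K F by (rule K_abelian)
 have T: "TQ = (|carrier = a_rcosets\<^bsub>F\<^esub> K, monoid.mult = undefined, one = undefined, ring.zero = K, add = set_add F,
   smult = (%r C. \<Union>f\<in>C. cls (r \<odot>\<^sub>F f)), act = (%g C. \<Union>f\<in>C. cls (free_map R (act_gen g) f))|)"
  by (simp add: TQ_def tensor_quotient_def Let_def F_def[symmetric] K_def rels_def cls_def)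
 show "$TQ = cls ` $F" by (auto simp: T A_RCOSETS_def' cls_def)
 show "\<zero>\<^sub>TQ = cls \<zero>\<^sub>F" by (simp add: T cls_def F.M.a_coset_add_zero K.a_subset)
 show "cls f \<oplus>\<^sub>TQ cls h = cls (f \<oplus>\<^sub>F h)" if "f : $F" "h : $F" using that by (simp add: T cls_def K.a_rcos_sum)
 show "r \<odot>\<^sub>TQ cls f = cls (r \<odot>\<^sub>F f)" if r: "r : $R" and f: "f : $F"
 proof -
  have "lin_map R F F (%x. r \<odot>\<^sub>F x)" by (rule F.lin_smult[OF F.module_axioms F.lin_id r])
  from cls_collapse[OF this _ f] show ?thesis using F.submoduleE(4)[OF K_submodule r] by (simp add: T)
 qed
 show "act TQ g (cls f) = cls (free_map R (act_gen g) f)" if g: "g : $G" and f: "f : $F"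
  using cls_collapse[OF act_free(1)[OF g] act_K[OF g] f] by (simp add: T)
qed

lemma TQ_cls: assumes "z : $TQ" obtains f where "f : $F" "z = cls f" using assms by (auto simp: TQ_ops)

lemma cls_closed: "f : $F ==> cls f : $TQ" by (simp add: TQ_ops)

lemma TQ_module: "module R TQ"
proof (rule moduleI)
 show "cring R" by (rule M.R.is_cring)
 show "abelian_group TQ"
 proof (rule abelian_groupI)
  show "\<zero>\<^sub>TQ : $TQ" by (simp add: TQ_ops)
  fix x assume "x : $TQ"
  then obtain f where f: "f : $F" "x = cls f" by (rule TQ_cls)
  show "\<zero>\<^sub>TQ \<oplus>\<^sub>TQ x = x" using f by (simp add: TQ_ops)
  show "EX y:$TQ. y \<oplus>\<^sub>TQ x = \<zero>\<^sub>TQ"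
   by (rule bexI[of _ "cls (\<ominus>\<^sub>F f)"]) (use f in "simp_all add: TQ_ops F.M.l_neg")
  fix y assume "y : $TQ"
  then obtain g where g: "g : $F" "y = cls g" by (rule TQ_cls)
  show "x \<oplus>\<^sub>TQ y : $TQ" using f g by (simp add: TQ_ops(3) cls_closed)
  show "x \<oplus>\<^sub>TQ y = y \<oplus>\<^sub>TQ x" using f g by (simp add: TQ_ops(3) F.M.a_comm)
  fix z assume "z : $TQ"
  then obtain h where h: "h : $F" "z = cls h" by (rule TQ_cls)
  show "x \<oplus>\<^sub>TQ y \<oplus>\<^sub>TQ z = x \<oplus>\<^sub>TQ (y \<oplus>\<^sub>TQ z)" using f g h by (simp add: TQ_ops(3) F.M.a_assoc)
 qed
 fix a x assume a: "a : $R" and "x : $TQ"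
 then obtain f where f: "f : $F" "x = cls f" using TQ_cls by blast
 show "a \<odot>\<^sub>TQ x : $TQ" using a f by (simp add: TQ_ops(4) cls_closed)
 show "(a \<oplus> b) \<odot>\<^sub>TQ x = a \<odot>\<^sub>TQ x \<oplus>\<^sub>TQ b \<odot>\<^sub>TQ x" if "b : $R" for b
  using a f that by (simp add: TQ_ops(3,4) F.smult_l_distr)
 show "(a \<cdot> b) \<odot>\<^sub>TQ x = a \<odot>\<^sub>TQ (b \<odot>\<^sub>TQ x)" if "b : $R" for b
  using a f that by (simp add: TQ_ops(3,4) F.smult_assoc1)
 fix y assume "y : $TQ"
 then obtain g where g: "g : $F" "y = cls g" by (rule TQ_cls)
 show "a \<odot>\<^sub>TQ (x \<oplus>\<^sub>TQ y) = a \<odot>\<^sub>TQ x \<oplus>\<^sub>TQ a \<odot>\<^sub>TQ y"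
  using a f g by (simp add: TQ_ops(3,4) F.smult_r_distr)
next
 fix x assume "x : $TQ"
 thus "\<one> \<odot>\<^sub>TQ x = x" using TQ_ops(4)[OF M.R.one_closed] by (auto elim!: TQ_cls)
qed

sublocale TQ: module R TQ by (rule TQ_module)

lemma tens_closed: "x : $M ==> y : $N ==> tens x y : $TQ" by (simp add: tens_def cls_closed gen_closed)

lemma cls_rels: assumes "f : $F" "g : $F" "f \<ominus>\<^sub>F g : rels" shows "cls f = cls g" using cls_eq[OF assms(1,2)] assms(3) K_rels by blast

lemma tens_bilinear:
 "x : $M ==> x' : $M ==> y : $N ==> tens (x \<oplus>\<^sub>M x') y = tens x y \<oplus>\<^sub>TQ tens x' y"
 "x : $M ==> y : $N ==> y' : $N ==> tens x (y \<oplus>\<^sub>N y') = tens x y \<oplus>\<^sub>TQ tens x y'"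
 "r : $R ==> x : $M ==> y : $N ==> tens (r \<odot>\<^sub>M x) y = r \<odot>\<^sub>TQ tens x y"
 "r : $R ==> x : $M ==> y : $N ==> tens x (r \<odot>\<^sub>N y) = r \<odot>\<^sub>TQ tens x y" unfolding tens_def
 using cls_rels[OF _ _ relsI(1)[of x x' y]] cls_rels[OF _ _ relsI(2)[of x y y']]
  cls_rels[OF _ _ relsI(3)[of r x y]] cls_rels[OF _ _ relsI(4)[of r x y]] by (simp_all add: gen_closed TQ_ops(3,4))

lemma tens_rel: assumes "((x, y), (x', y')) : B" shows "tens x y = tens x' y'"
 unfolding tens_def using cls_rels[OF _ _ relsI(5)[OF assms]] B_closed[OF assms] by (simp add: gen_closed)

lemma TQ_gmodule: "gmodule R G TQ"
proof (intro gmodule.intro gmodule_axioms.intro)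
 note L = linD[OF act_free(1)]
 fix g x assume g: "g : $G" and "x : $TQ"
 then obtain f where f: "f : $F" "x = cls f" using TQ_cls by blast
 show "act TQ g x : $TQ" using g f L(1) by (simp add: TQ_ops(5) cls_closed)
 show "act TQ g (r \<odot>\<^sub>TQ x) = r \<odot>\<^sub>TQ act TQ g x" if "r : $R" for r using g f L(1,3) that by (simp add: TQ_ops(4,5))
 show "act TQ g (x \<oplus>\<^sub>TQ y) = act TQ g x \<oplus>\<^sub>TQ act TQ g y" if y: "y : $TQ" for y
 proof -
  obtain f' where "f' : $F" "y = cls f'" using y by (rule TQ_cls)
  thus ?thesis using g f L(1,2) by (simp add: TQ_ops(3,5))
 qed
 fix h assume h: "h : $G"
 have "lin_map R F F (%f. free_map R (act_gen g) (free_map R (act_gen h) f))" by (rule F.lin_comp[OF act_free(1)[OF h] act_free(1)[OF g]])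
 from F_eqI[OF F.module_axioms act_free(1) this f(1), of "g \<cdot>\<^sub>G h"] g h
 have "free_map R (act_gen (g \<cdot>\<^sub>G h)) f = free_map R (act_gen g) (free_map R (act_gen h) f)"
  by (simp add: act_free(2) \<sigma>_mult \<tau>_mult linD(1)[OF \<sigma>_linear] linD(1)[OF \<tau>_linear])
 thus "act TQ (g \<cdot>\<^sub>G h) x = act TQ g (act TQ h x)" using g h f L(1) by (simp add: TQ_ops(5))
next
 fix x assume "x : $TQ"
 then obtain f where f: "f : $F" "x = cls f" by (rule TQ_cls)
 from F_eqI[OF F.module_axioms act_free(1) F.lin_id f(1), of "\<one>\<^sub>G"]
 have "free_map R (act_gen \<one>\<^sub>G) f = f" by (simp add: act_free(2) \<sigma>_one \<tau>_one)
 thus "act TQ \<one>\<^sub>G x = x" using f by (simp add: TQ_ops(5))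
qed (rule TQ_module, rule G.group_axioms)

lemma act_tens:
 "g : $G ==> x : $M ==> y : $N ==> act TQ g (tens x y) = tens (\<sigma> g x) (\<tau> g y)" by (simp add: tens_def TQ_ops(5) gen_closed act_free(2))

text \<open>A scalar in front of a generator is absorbed into the first factor, so sums of pure
  tensors are enough.\<close>

lemma TQ_induct [consumes 1, case_names zero add tens]:
 assumes z: "z : $TQ" and P0: "P \<zero>\<^sub>TQ"
  and Padd: "!!u v. u : $TQ ==> v : $TQ ==> P u ==> P v ==> P (u \<oplus>\<^sub>TQ v)"
  and Pt: "!!x y. x : $M ==> y : $N ==> P (tens x y)"
 shows "P z"
proof -
 obtain f where f: "f : $F" "z = cls f" using z by (rule TQ_cls)
 have "P (cls f)" using f(1) unfolding F_def
 proof (induction rule: M.free_module_induct)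
  case zero
  thus ?case using P0 by (simp add: TQ_ops(2) F_def)
 next
  case (add f g)
  thus ?case using Padd[of "cls f" "cls g"] TQ_ops(3)[of f g] cls_closed by (simp add: F_def)
 next
  case (gen r u)
  then obtain x y where u: "u = (x, y)" "x : $M" "y : $N" by blast
  have "cls (r \<odot>\<^sub>F \<delta> u) = tens (r \<odot>\<^sub>M x) y"
   using u gen(1) TQ_ops(4)[OF gen(1), of "\<delta> u"] by (simp add: tens_bilinear(3)) (simp add: tens_def gen_closed)
  thus ?case using Pt[of "r \<odot>\<^sub>M x" y] u gen(1) by (simp add: F_def)
 qed
 thus ?thesis using f(2) by simp
qed

text \<open>The universal property. The linear extension of \<beta> kills the relations, hence
  \<open>K\<close>, so its value on a class can be read off from any representative.\<close>

lemma TQ_lift: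
 assumes P: "module R P" and \<beta>: "!!x y. x : $M ==> y : $N ==> \<beta> x y : $P"
  and \<beta>l: "!!y. y : $N ==> lin_map R M P (%x. \<beta> x y)"
  and \<beta>r: "!!x. x : $M ==> lin_map R N P (\<beta> x)"
  and \<beta>B: "!!x y x' y'. ((x, y), (x', y')) : B ==> \<beta> x y = \<beta> x' y'"
 obtains h where "lin_map R TQ P h" "!!x y. x : $M ==> y : $N ==> h (tens x y) = \<beta> x y"
proof -
 interpret P: module R P by fact
 define h0 where "h0 = lin_ext R P (%(x, y). \<beta> x y)"
 have h0: "lin_map R F P h0" unfolding h0_def F_def by (rule P.linear_lin_ext) (use \<beta> in auto)
 have v: "h0 (\<delta> (x, y)) = \<beta> x y" if "x : $M" "y : $N" for x y
  unfolding h0_def by (subst P.lin_ext_gen[where X = "$M \<times> $N"]) (use that \<beta> in auto)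
 note L = linD[OF h0] and m = linear_map_minus[OF P h0]
 have zs: "submodule {\<zero>\<^sub>P} R P" by (rule P.submoduleI) auto
 have "h0 f = \<zero>\<^sub>P" if "f : rels" for f using that
 proof (cases rule: rels_cases)
  case (add_l x x' y)
  thus ?thesis using linD(2)[OF \<beta>l, of y x x'] \<beta> by (simp add: L m v gen_closed P.M.minus_eq P.M.r_neg)
 next
  case (add_r x y y')
  thus ?thesis using linD(2)[OF \<beta>r, of x y y'] \<beta> by (simp add: L m v gen_closed P.M.minus_eq P.M.r_neg)
 next
  case (smult_l r x y)
  thus ?thesis using linD(3)[OF \<beta>l, of y r x] \<beta> by (simp add: L m v gen_closed P.M.minus_eq P.M.r_neg)
 next
  case (smult_r r x y)
  thus ?thesis using linD(3)[OF \<beta>r, of x r y] \<beta> by (simp add: L m v gen_closed P.M.minus_eq P.M.r_neg)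
 next
  case (extra x y x' y')
  thus ?thesis using \<beta>B[OF extra(2)] B_closed[OF extra(2)] \<beta> by (simp add: L m v gen_closed P.M.minus_eq P.M.r_neg)
 qed
 hence "K <= {x : $F. h0 x : {\<zero>\<^sub>P}}" by (intro K_minimal[OF vimage_submodule[OF P h0 zs]]) (use rels_closed in blast)
 hence hK: "h0 k = \<zero>\<^sub>P" if "k : K" for k using that by blast
 have eq: "h0 f = h0 g" if "f : $F" "g : $F" "cls f = cls g" for f g
 proof -
  have "h0 f \<ominus>\<^sub>P h0 g = \<zero>\<^sub>P" using hK[of "f \<ominus>\<^sub>F g"] that cls_eq[of f g] m[of f g] by simp
  moreover have "h0 f = (h0 f \<ominus>\<^sub>P h0 g) \<oplus>\<^sub>P h0 g" using L(1) that by (simp add: P.M.minus_eq P.M.a_assoc P.M.l_neg)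
  ultimately show ?thesis using L(1) that by simp
 qed
 define h where "h z = h0 (SOME f. f : $F & cls f = z)" for z
 have h: "h (cls f) = h0 f" if f: "f : $F" for f
 proof -
  have "(SOME f'. f' : $F & cls f' = cls f) : $F & cls (SOME f'. f' : $F & cls f' = cls f) = cls f" by (rule someI[of _ f]) (use f in simp)
  thus ?thesis unfolding h_def using eq f by blast
 qed
 show thesis
 proof (rule that)
  show "h (tens x y) = \<beta> x y" if "x : $M" "y : $N" for x y using that by (simp add: tens_def h gen_closed v)
  show "lin_map R TQ P h" unfolding lin_map_def
  proof (intro conjI ballI funcsetI)
   fix x assume "x : $TQ"
   then obtain f where f: "f : $F" "x = cls f" by (rule TQ_cls)
   show "h x : $P" using f L(1) by (simp add: h)
   show "h (r \<odot>\<^sub>TQ x) = r \<odot>\<^sub>P h x" if "r : $R" for r using f L(3) that by (simp add: h TQ_ops(4))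
   fix y assume "y : $TQ"
   then obtain g where g: "g : $F" "y = cls g" by (rule TQ_cls)
   show "h (x \<oplus>\<^sub>TQ y) = h x \<oplus>\<^sub>P h y" using f g L(2) by (simp add: h TQ_ops(3))
  qed
 qed
qed

lemma TQ_eqI:
 assumes z: "z : $TQ" and P: "module R P" and g: "lin_map R TQ P g" and h: "lin_map R TQ P h"
  and e: "!!x y. x : $M ==> y : $N ==> g (tens x y) = h (tens x y)"
 shows "g z = h z" using z
proof (induction rule: TQ_induct)
 case zero
 thus ?case using TQ.lin_zero[OF P g] TQ.lin_zero[OF P h] by simp
next
 case (add u v)
 thus ?case by (simp add: linD(2)[OF g] linD(2)[OF h])
qed (rule e)

end

lemma (in module) lin_sum_maps:
 assumes N: "module R N" and F: "!!i. i : I ==> lin_map R M N (F i)"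
 shows "lin_map R M N (%x. \<Oplus>\<^sub>N i\<in>I. F i x)"
proof -
 interpret N: module R N by fact
 show ?thesis
 proof (cases "finite I")
  case False
  thus ?thesis by (simp add: lin_map_def N.M.finsum_infinite)
 next
  case fin: True
  note L = linD[OF F]
  show ?thesis unfolding lin_map_def
  proof (intro conjI ballI funcsetI)
   fix x assume x: "x : $M"
   show "(\<Oplus>\<^sub>N i\<in>I. F i x) : $N" by (rule N.M.finsum_closed) (use L(1)[OF _ x] in blast)
   show "(\<Oplus>\<^sub>N i\<in>I. F i (x \<oplus>\<^sub>M y)) = (\<Oplus>\<^sub>N i\<in>I. F i x) \<oplus>\<^sub>N (\<Oplus>\<^sub>N i\<in>I. F i y)" if y: "y : $M" for y
   proof -
    have "(\<Oplus>\<^sub>N i\<in>I. F i (x \<oplus>\<^sub>M y)) = (\<Oplus>\<^sub>N i\<in>I. F i x \<oplus>\<^sub>N F i y)"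
    by (rule N.M.finsum_cong') (use L(1)[OF _ x] L(1)[OF _ y] L(2)[OF _ x y] in auto)
    also have "... = (\<Oplus>\<^sub>N i\<in>I. F i x) \<oplus>\<^sub>N (\<Oplus>\<^sub>N i\<in>I. F i y)"
    by (rule N.M.finsum_addf) (use L(1)[OF _ x] L(1)[OF _ y] in blast)+
    finally show ?thesis .
   qed
   show "(\<Oplus>\<^sub>N i\<in>I. F i (r \<odot>\<^sub>M x)) = r \<odot>\<^sub>N (\<Oplus>\<^sub>N i\<in>I. F i x)" if r: "r : $R" for r
   proof -
    have "(\<Oplus>\<^sub>N i\<in>I. F i (r \<odot>\<^sub>M x)) = (\<Oplus>\<^sub>N i\<in>I. r \<odot>\<^sub>N F i x)"
    by (rule N.M.finsum_cong') (use L(1)[OF _ x] L(3)[OF _ r x] r in auto)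
    also have "... = r \<odot>\<^sub>N (\<Oplus>\<^sub>N i\<in>I. F i x)"
    by (rule N.finsum_smult_ldistr[OF fin r, symmetric]) (use L(1)[OF _ x] in blast)
    finally show ?thesis .
   qed
  qed
 qed
qed

text \<open>The ring as a module over itself, so that linear functionals fall under the universal
  property of the tensor product.\<close>

definition ring_module :: "('a, 'y) ring_scheme => ('a, 'a) module"
 where "ring_module R = (|carrier = $R, monoid.mult = monoid.mult R, one = one R, ring.zero = ring.zero R,
  add = ring.add R, smult = monoid.mult R|)"

lemma (in cring) ring_module: "module R (ring_module R)"
proof (rule moduleI)
 show "abelian_group (ring_module R)"
 proof (rule abelian_groupI)
  fix x assume "x : $(ring_module R)"
  thus "EX y:$(ring_module R). y \<oplus>\<^bsub>ring_module R\<^esub> x = \<zero>\<^bsub>ring_module R\<^esub>"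
   by (intro bexI[of _ "\<ominus> x"]) (simp_all add: ring_module_def l_neg)
 qed (simp_all add: ring_module_def a_ac)
qed (simp_all add: ring_module_def l_distr r_distr m_assoc cring_axioms)

lemma linear_fun_iff: "lin_fun R M f \<longleftrightarrow> lin_map R M (ring_module R) f" by (simp add: lin_fun_def lin_map_def ring_module_def)

section \<open>The tensor product of two modules with diagonal action\<close>

locale tensor_pair = U: gmodule R G U + V: gmodule R G V
 for R :: "('a, 'y) ring_scheme" (structure) and G :: "('g, 'z) monoid_scheme"
  and U :: "('a, 'b, 'g) gmodule" and V :: "('a, 'c, 'g) gmodule"
begin

sublocale T: tensor_quotient_data R U V G "{}" "act U" "act V"
 by unfold_locales (auto intro: U.act_linear V.act_linear U.act_one V.act_one U.act_mult V.act_mult)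

abbreviation W where "W \<equiv> tensor_product R U V"

lemma TQ_eq: "T.TQ = W" by (simp add: T.TQ_def T.act_gen_def tensor_product_def)

lemmas W_gmodule = T.TQ_gmodule[unfolded TQ_eq]
 and W_lift = T.TQ_lift[unfolded TQ_eq]
 and W_eqI = T.TQ_eqI[unfolded TQ_eq]
 and tens_closed = T.tens_closed[unfolded TQ_eq]
 and tens_bilinear = T.tens_bilinear[unfolded TQ_eq]
 and act_tens = T.act_tens[unfolded TQ_eq]

sublocale W: gmodule R G W by (rule W_gmodule)

lemma tens_linear:
 "y : $V ==> lin_map R U W (%x. T.tens x y)" "x : $U ==> lin_map R V W (T.tens x)" by (auto simp: lin_map_def tens_closed tens_bilinear)

text \<open>The tensor product of two endomorphisms. It exists by the universal property
  (\<open>tens_end\<close>) and is determined by its values on pure tensors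
  (\<open>end_eqI\<close>), so the choice is no choice.\<close>

definition tens_end where "tens_end f h = (SOME \<phi>. \<phi> : $(lin_end R W) &
 (ALL x:$U. ALL y:$V. \<phi> (T.tens x y) = T.tens (f x) (h y)))"

lemma tens_end:
 assumes f: "f : $(lin_end R U)" and h: "h : $(lin_end R V)"
 shows "tens_end f h : $(lin_end R W)"
  and "x : $U ==> y : $V ==> tens_end f h (T.tens x y) = T.tens (f x) (h y)"
proof -
 note fc = U.endD[OF f] and hc = V.endD[OF h]
 obtain \<phi> where \<phi>: "lin_map R W W \<phi>"
   "!!x y. x : $U ==> y : $V ==> \<phi> (T.tens x y) = T.tens (f x) (h y)"
 proof (rule W_lift[OF W.module_axioms, of "%x y. T.tens (f x) (h y)"])
  show "lin_map R U W (%x. T.tens (f x) (h y))" if "y : $V" for y by (rule U.lin_comp[OF fc(2) tens_linear(1)[OF hc(1)[OF that]]])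
  show "lin_map R V W (%y. T.tens (f x) (h y))" if "x : $U" for x by (rule V.lin_comp[OF hc(2) tens_linear(2)[OF fc(1)[OF that]]])
 qed (use fc(1) hc(1) tens_closed in auto)
 have "(\<lambda>z\<in>$W. \<phi> z) : $(lin_end R W) &
  (ALL x:$U. ALL y:$V. (\<lambda>z\<in>$W. \<phi> z) (T.tens x y) = T.tens (f x) (h y))"
  using endI[OF W.module_axioms \<phi>(1)] \<phi>(2) tens_closed by simp
 hence "\<exists>\<phi>. \<phi> : $(lin_end R W) &
  (ALL x:$U. ALL y:$V. \<phi> (T.tens x y) = T.tens (f x) (h y))" by (rule exI[of _ "restrict \<phi> ($W)"])
 from someI_ex[OF this, folded tens_end_def]
 show "tens_end f h : $(lin_end R W)"
  and "x : $U ==> y : $V ==> tens_end f h (T.tens x y) = T.tens (f x) (h y)" by blast+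
qed

lemma end_eqI:
 assumes "\<phi> : $(lin_end R W)" "\<psi> : $(lin_end R W)"
  and "!!x y. x : $U ==> y : $V ==> \<phi> (T.tens x y) = \<psi> (T.tens x y)"
 shows "\<phi> = \<psi>" by (rule end_ext[OF assms(1,2)], rule W_eqI[OF _ W.module_axioms W.endD(2)[OF assms(1)] W.endD(2)[OF assms(2)]])
  (simp_all add: assms(3))

lemma tens_end_add:
 assumes "f : $(lin_end R U)" "f' : $(lin_end R U)" "h : $(lin_end R V)" "h' : $(lin_end R V)"
 shows "tens_end (f \<oplus>\<^bsub>lin_end R U\<^esub> f') h = tens_end f h \<oplus>\<^bsub>lin_end R W\<^esub> tens_end f' h"
  and "tens_end f (h \<oplus>\<^bsub>lin_end R V\<^esub> h') = tens_end f h \<oplus>\<^bsub>lin_end R W\<^esub> tens_end f h'"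
 by (rule end_eqI; simp add: tens_end assms U.end_closed V.end_closed W.end_closed end_app tens_closed
   tens_bilinear U.endD(1) V.endD(1))+

lemma tens_end_one: "tens_end \<one>\<^bsub>lin_end R U\<^esub> \<one>\<^bsub>lin_end R V\<^esub> = \<one>\<^bsub>lin_end R W\<^esub>"
 by (rule end_eqI)
  (simp_all add: tens_end U.end_01 V.end_01 W.end_01 end_app tens_closed)

lemma tens_end_conj:
 assumes "g : $G" "f : $(lin_end R U)" "h : $(lin_end R V)"
 shows "conj_end G W g (tens_end f h) = tens_end (conj_end G U g f) (conj_end G V g h)"
 by (rule end_eqI) (simp_all add: tens_end assms U.conj_end_closed V.conj_end_closed W.conj_end_closed
  U.conj_end_apply V.conj_end_apply W.conj_end_apply tens_closed act_tens U.act_closed V.act_closed U.endD(1) V.endD(1))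

text \<open>The coordinate functionals are the lifts of the bilinear products of coordinates. That
  they expand every element needs checking on pure tensors only, both sides being linear.\<close>

lemma tens_free_basis:
 assumes U: "fbasis R U I b f" and V: "fbasis R V J c g"
 obtains F where "fbasis R W (I \<times> J) (%p. T.tens (b (fst p)) (c (snd p))) F"
  "!!p x y. p : I \<times> J ==> x : $U ==> y : $V ==> F p (T.tens x y) = f (fst p) x \<cdot> g (snd p) y"
proof -
 note dU = dualD[OF basisD(1)[OF U]] and dV = dualD[OF basisD(1)[OF V]]
 have "\<exists>h. lin_fun R W h & (ALL x:$U. ALL y:$V. h (T.tens x y) = f (fst p) x \<cdot> g (snd p) y)"
  if p: "p : I \<times> J" for p
 proof -
  obtain i j where ij: "p = (i, j)" "i : I" "j : J" using p by blast
  note F = funD[OF dU(3)[OF ij(2)]] and H = funD[OF dV(3)[OF ij(3)]]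
  obtain h where "lin_map R W (ring_module R) h"
   "!!x y. x : $U ==> y : $V ==> h (T.tens x y) = f i x \<cdot> g j y"
  proof (rule W_lift[OF U.R.ring_module, of "%x y. f i x \<cdot> g j y"])
   show "lin_map R U (ring_module R) (%x. f i x \<cdot> g j y)" if "y : $V" for y
    using that by (simp add: lin_map_def ring_module_def F H U.R.l_distr U.R.m_assoc)
   show "lin_map R V (ring_module R) (%y. f i x \<cdot> g j y)" if "x : $U" for x
    using that by (simp add: lin_map_def ring_module_def F H U.R.r_distr U.R.m_lcomm)
  qed (auto simp: ring_module_def F H)
  thus ?thesis using ij(1) by (auto simp: linear_fun_iff)
 qed
 then obtain F where F: "!!p. p : I \<times> J ==> lin_fun R W (F p)"
  "!!p x y. p : I \<times> J ==> x : $U ==> y : $V ==> F p (T.tens x y) = f (fst p) x \<cdot> g (snd p) y" by metis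
 let ?e = "%p. T.tens (b (fst p)) (c (snd p))"
 have ec: "?e p : $W" if "p : I \<times> J" for p using that dU(2) dV(2) tens_closed by auto
 note Fl = funD[OF F(1)]
 define \<Psi> where "\<Psi> z = (\<Oplus>\<^sub>W p\<in>I\<times>J. F p z \<odot>\<^sub>W ?e p)" for z
 have fin: "finite (I \<times> J)" using dU(1) dV(1) by simp
 have \<Psi>: "lin_map R W W \<Psi>" unfolding \<Psi>_def
 proof (rule W.lin_sum_maps[OF W.module_axioms])
  fix p assume p: "p : I \<times> J"
  show "lin_map R W W (%z. F p z \<odot>\<^sub>W ?e p)" unfolding lin_map_def using Fl[OF p] ec[OF p] by (simp add: W.smult_l_distr W.smult_assoc1)
 qed
 have "z = \<Psi> z" if z: "z : $W" for z
 proof (rule W_eqI[OF z W.module_axioms W.lin_id \<Psi>])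
  fix x y assume x: "x : $U" and y: "y : $V"
  have tb: "T.tens (b i) y : $W" if "i : I" for i using tens_closed[OF dU(2)[OF that] y] .
  have fx: "f i x : $R" if "i : I" for i using funD(1)[OF dU(3)[OF that] x] .
  have gy: "g j y : $R" if "j : J" for j using funD(1)[OF dV(3)[OF that] y] .
  have tc: "T.tens (b i) (c j) : $W" if "i : I" "j : J" for i j using tens_closed[OF dU(2)[OF that(1)] dV(2)[OF that(2)]] .
  have "T.tens x y = T.tens (\<Oplus>\<^sub>U i\<in>I. f i x \<odot>\<^sub>U b i) y" using dU(4)[OF x] by simp
  also have "... = (\<Oplus>\<^sub>W i\<in>I. T.tens (f i x \<odot>\<^sub>U b i) y)"
   by (rule U.lin_finsum[OF W.module_axioms tens_linear(1)[OF y]]) (use fx dU(2) in auto)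
  also have "... = (\<Oplus>\<^sub>W i\<in>I. \<Oplus>\<^sub>W j\<in>J. (f i x \<cdot> g j y) \<odot>\<^sub>W T.tens (b i) (c j))"
  proof (rule W.M.finsum_cong')
   fix i assume i: "i : I"
   have l: "lin_map R V W (T.tens (f i x \<odot>\<^sub>U b i))" by (rule tens_linear(2)) (use fx[OF i] dU(2)[OF i] in simp)
   have "T.tens (f i x \<odot>\<^sub>U b i) y = T.tens (f i x \<odot>\<^sub>U b i) (\<Oplus>\<^sub>V j\<in>J. g j y \<odot>\<^sub>V c j)" using dV(4)[OF y] by simp
   also have "... = (\<Oplus>\<^sub>W j\<in>J. T.tens (f i x \<odot>\<^sub>U b i) (g j y \<odot>\<^sub>V c j))"
    by (rule V.lin_finsum[OF W.module_axioms l]) (use gy dV(2) in auto)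
   also have "... = (\<Oplus>\<^sub>W j\<in>J. (f i x \<cdot> g j y) \<odot>\<^sub>W T.tens (b i) (c j))"
   proof (rule W.M.finsum_cong')
    fix j assume j: "j : J"
    show "T.tens (f i x \<odot>\<^sub>U b i) (g j y \<odot>\<^sub>V c j) = (f i x \<cdot> g j y) \<odot>\<^sub>W T.tens (b i) (c j)"
    using fx[OF i] gy[OF j] dU(2)[OF i] dV(2)[OF j] tc[OF i j] by (simp add: tens_bilinear(3,4) W.smult_assoc1[symmetric] U.R.m_comm)
   qed (use fx[OF i] gy tc[OF i] in auto)
   finally show "T.tens (f i x \<odot>\<^sub>U b i) y = (\<Oplus>\<^sub>W j\<in>J. (f i x \<cdot> g j y) \<odot>\<^sub>W T.tens (b i) (c j))" .
  qed (use fx gy tc in "auto intro!: W.M.finsum_closed")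
  also have "... = (\<Oplus>\<^sub>W p\<in>I\<times>J. (f (fst p) x \<cdot> g (snd p) y) \<odot>\<^sub>W T.tens (b (fst p)) (c (snd p)))"
   by (rule W.M.finsum_Sigma[OF dU(1) dV(1), symmetric]) (use fx gy tc in auto)
  also have "... = \<Psi> (T.tens x y)" unfolding \<Psi>_def by (rule W.M.finsum_cong') (use F(2) x y fx gy tc in auto)
  finally show "T.tens x y = \<Psi> (T.tens x y)" .
 qed
 moreover have "F p (?e q) = (if p = q then \<one> else \<zero>)" if p: "p : I \<times> J" and q: "q : I \<times> J" for p q
 proof -
  obtain i j where p': "p = (i, j)" "i : I" "j : J" using p by blast
  obtain i' j' where q': "q = (i', j')" "i' : I" "j' : J" using q by blast
  show ?thesis using F(2)[OF p, of "b i'" "c j'"] dU(2) dV(2) basisD(2)[OF U p'(2) q'(2)] basisD(2)[OF V p'(3) q'(3)] p'(1) q' by auto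
 qed
 ultimately have "fbasis R W (I \<times> J) ?e F" unfolding fbasis_def dual_basis_def \<Psi>_def using fin ec F(1) by auto
 thus thesis using F(2) by (rule that)
qed

text \<open>The trace does not depend on the basis, so it may be computed in the product basis,
  where it splits. Multiplicativity of \<open>t\<close> rests on this.\<close>

lemma tens_end_trace:
 assumes U: "fbasis R U I b f" and V: "fbasis R V J c g" and W: "fbasis R W I' b' f'"
  and u: "u : $(lin_end R U)" and v: "v : $(lin_end R V)"
 shows "dtrace R I' b' f' (tens_end u v) = dtrace R I b f u \<cdot> dtrace R J c g v"
proof -
 note dU = dualD[OF basisD(1)[OF U]] and dV = dualD[OF basisD(1)[OF V]]
 obtain F where F: "fbasis R W (I \<times> J) (%p. T.tens (b (fst p)) (c (snd p))) F"
  "!!p x y. p : I \<times> J ==> x : $U ==> y : $V ==> F p (T.tens x y) = f (fst p) x \<cdot> g (snd p) y" using tens_free_basis[OF U V] by blast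
 have fu: "f i (u (b i)) : $R" if "i : I" for i using funD(1)[OF dU(3)[OF that] U.endD(1)[OF u dU(2)[OF that]]] .
 have gv: "g j (v (c j)) : $R" if "j : J" for j using funD(1)[OF dV(3)[OF that] V.endD(1)[OF v dV(2)[OF that]]] .
 have "dtrace R I' b' f' (tens_end u v) = (\<Oplus>p\<in>I\<times>J. F p (tens_end u v (T.tens (b (fst p)) (c (snd p)))))"
  using W.dual_trace_independent[OF basisD(1)[OF W] basisD(1)[OF F(1)] W.endD(2)[OF tens_end(1)[OF u v]]] by (simp add: dtrace_def)
 also have "... = (\<Oplus>p\<in>I\<times>J. f (fst p) (u (b (fst p))) \<cdot> g (snd p) (v (c (snd p))))"
  by (rule U.R.finsum_cong') (use fu gv in "auto simp: tens_end[OF u v] F(2) dU(2) dV(2) U.endD(1)[OF u] V.endD(1)[OF v]")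
 also have "... = (\<Oplus>i\<in>I. \<Oplus>j\<in>J. f i (u (b i)) \<cdot> g j (v (c j)))"
  by (rule U.R.finsum_Sigma[OF dU(1) dV(1)]) (use fu gv in auto)
 also have "... = (\<Oplus>i\<in>I. f i (u (b i)) \<cdot> dtrace R J c g v)"
  unfolding dtrace_def by (rule U.R.finsum_cong') (use fu gv dV(1) in "auto simp: U.R.finsum_rdistr intro!: U.R.finsum_closed")
 also have "... = dtrace R I b f u \<cdot> dtrace R J c g v" unfolding dtrace_def[of R I] by (rule U.R.finsum_ldistr[symmetric])
   (use fu gv dU(1) in "auto simp: dtrace_def intro!: U.R.finsum_closed")
 finally show ?thesis .
qed

end

section \<open>Direct summands and idempotent endomorphisms\<close>

context gmodule
begin

lemma summand_projection:
 assumes "internal_direct_sum R G M N N'"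
 obtains e where "e : $(gmodule_end R G M)" "e ` $M = N" "!!x. x : N ==> e x = x"
  "!!x. x : N' ==> e x = \<zero>\<^sub>M"
proof -
 have s: "submodule N R M" "submodule N' R M" and a: "!!g x. g : $G ==> x : N ==> act M g x : N"
   "!!g x. g : $G ==> x : N' ==> act M g x : N'"
  and i: "N \<inter> N' = {\<zero>\<^sub>M}" and p: "N <+>\<^sub>M N' = $M" using assms by (auto simp: internal_direct_sum_def gsubmodule_def)
 note E = submoduleE[OF s(1)] and E' = submoduleE[OF s(2)]
 have Nc: "x : $M" if "x : N" for x using E(1) that by blast
 have N'c: "x : $M" if "x : N'" for x using E'(1) that by blast
 have z: "\<zero>\<^sub>M : N" "\<zero>\<^sub>M : N'" using i by auto
 have uniq: "x = x'" if "x : N" "x' : N" "y : N'" "y' : N'" "x \<oplus>\<^sub>M y = x' \<oplus>\<^sub>M y'" for x x' y y'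
 proof -
  have c: "x : $M" "x' : $M" "y : $M" "y' : $M" using that Nc N'c by auto
  have "\<ominus>\<^sub>M x' \<oplus>\<^sub>M (x \<oplus>\<^sub>M y) \<oplus>\<^sub>M \<ominus>\<^sub>M y = \<ominus>\<^sub>M x' \<oplus>\<^sub>M (x' \<oplus>\<^sub>M y') \<oplus>\<^sub>M \<ominus>\<^sub>M y" using that(5) by simp
  hence e: "\<ominus>\<^sub>M x' \<oplus>\<^sub>M x = y' \<oplus>\<^sub>M \<ominus>\<^sub>M y" using c by (simp add: M.a_assoc M.r_neg M.r_neg1)
  have "\<ominus>\<^sub>M x' \<oplus>\<^sub>M x : N" using E(3)[OF that(2)] E(5) that(1) by blast
  moreover have "y' \<oplus>\<^sub>M \<ominus>\<^sub>M y : N'" using E'(3)[OF that(3)] E'(5) that(4) by blast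
  ultimately have "\<ominus>\<^sub>M x' \<oplus>\<^sub>M x = \<zero>\<^sub>M" using e i by auto
  hence "x' \<oplus>\<^sub>M (\<ominus>\<^sub>M x' \<oplus>\<^sub>M x) = x'" using c by simp
  thus ?thesis using c by (simp add: M.r_neg2)
 qed
 have ex: "EX a:N. EX b:N'. x = a \<oplus>\<^sub>M b" if "x : $M" for x using that p unfolding set_add_def' by blast
 define \<pi> where "\<pi> x = (SOME a. a : N & (EX b:N'. x = a \<oplus>\<^sub>M b))" for x
 have \<pi>: "\<pi> (a \<oplus>\<^sub>M b) = a" if "a : N" "b : N'" for a b
 proof -
  have "\<pi> (a \<oplus>\<^sub>M b) : N & (EX b':N'. a \<oplus>\<^sub>M b = \<pi> (a \<oplus>\<^sub>M b) \<oplus>\<^sub>M b')"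
   unfolding \<pi>_def by (rule someI[where x = a]) (use that in blast)
  thus ?thesis using uniq that by metis
 qed
 have lin: "lin_map R M M \<pi>" unfolding lin_map_def
 proof (intro conjI ballI funcsetI)
  fix x assume "x : $M"
  then obtain a b where ab: "a : N" "b : N'" "x = a \<oplus>\<^sub>M b" using ex by blast
  show "\<pi> x : $M" using \<pi> ab Nc by simp
  show "\<pi> (r \<odot>\<^sub>M x) = r \<odot>\<^sub>M \<pi> x" if "r : $R" for r
   using \<pi>[OF ab(1,2)] \<pi>[OF E(4)[OF that ab(1)] E'(4)[OF that ab(2)]] that ab Nc[OF ab(1)] N'c[OF ab(2)] by (simp add: smult_r_distr)
  fix y assume "y : $M"
  then obtain c d where cd: "c : N" "d : N'" "y = c \<oplus>\<^sub>M d" using ex by blast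
  have "x \<oplus>\<^sub>M y = (a \<oplus>\<^sub>M c) \<oplus>\<^sub>M (b \<oplus>\<^sub>M d)" using ab cd Nc N'c by (simp add: M.a_ac)
  thus "\<pi> (x \<oplus>\<^sub>M y) = \<pi> x \<oplus>\<^sub>M \<pi> y"
   using \<pi>[OF ab(1,2)] \<pi>[OF cd(1,2)] \<pi>[OF E(5)[OF ab(1) cd(1)] E'(5)[OF ab(2) cd(2)]] ab(3) cd(3) by simp
 qed
 let ?e = "\<lambda>x\<in>$M. \<pi> x"
 have \<pi>N: "\<pi> x = x" if "x : N" for x using \<pi>[OF that z(2)] Nc[OF that] by simp
 show thesis
 proof (rule that[of ?e])
  have "?e (act M g x) = act M g (?e x)" if g: "g : $G" and x: "x : $M" for g x
  proof -
   obtain c d where cd: "c : N" "d : N'" "x = c \<oplus>\<^sub>M d" using ex x by blast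
   thus ?thesis using \<pi>[OF cd(1,2)] \<pi>[OF a(1)[OF g cd(1)] a(2)[OF g cd(2)]] act_add[OF g Nc[OF cd(1)] N'c[OF cd(2)]] act_closed[OF g x] x
    by simp
  qed
  thus "?e : $(gmodule_end R G M)" using endI[OF module_axioms lin] by (simp add: gmodule_end_def)
  show "?e x = x" if "x : N" for x using \<pi>N[OF that] Nc[OF that] by simp
  show "?e x = \<zero>\<^sub>M" if "x : N'" for x using \<pi>[OF z(1) that] N'c[OF that] by simp
  show "?e ` $M = N"
  proof
   show "?e ` $M <= N" using ex \<pi> by fastforce
   show "N <= ?e ` $M"
   proof
    fix x assume x: "x : N"
    thus "x : ?e ` $M" by (intro image_eqI[of _ _ x]) (use \<pi>N[OF x] Nc[OF x] in simp_all)
   qed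
  qed
 qed
qed

lemma projection_summand:
 assumes e: "e : $(gmodule_end R G M)" and idem: "!!x. x : $M ==> e (e x) = e x"
 shows "internal_direct_sum R G M (e ` $M) {x : $M. e x = \<zero>\<^sub>M}"
proof -
 have el: "e : $(lin_end R M)" and eg: "!!g x. g : $G ==> x : $M ==> e (act M g x) = act M g (e x)" using e by (auto simp: gmodule_end_def)
 note d = endD[OF el] note L = linD[OF d(2)]
 have z: "e \<zero>\<^sub>M = \<zero>\<^sub>M" by (rule lin_zero[OF module_axioms d(2)])
 have az: "act M g \<zero>\<^sub>M = \<zero>\<^sub>M" if "g : $G" for g by (rule lin_zero[OF module_axioms act_linear[OF that]])
 let ?K = "{x : $M. e x = \<zero>\<^sub>M}"
 have K: "submodule ?K R M" by (rule submoduleI) (auto simp: z L lin_neg[OF module_axioms d(2)])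
 have "$M <= e ` $M <+>\<^sub>M ?K"
 proof
  fix x assume x: "x : $M"
  have "x = e x \<oplus>\<^sub>M (\<ominus>\<^sub>M e x \<oplus>\<^sub>M x)" using x d(1)[OF x] by (simp add: M.r_neg2)
  moreover have "\<ominus>\<^sub>M e x \<oplus>\<^sub>M x : ?K" using x d(1)[OF x] idem[OF x] by (simp add: L lin_neg[OF module_axioms d(2)] M.l_neg)
  ultimately show "x : e ` $M <+>\<^sub>M ?K" unfolding set_add_def' using x by blast
 qed
 moreover have "e ` $M <+>\<^sub>M ?K <= $M" unfolding set_add_def' using d(1) by auto
 moreover have "e ` $M \<inter> ?K = {\<zero>\<^sub>M}"
 proof
  show "e ` $M \<inter> ?K <= {\<zero>\<^sub>M}" using idem by auto
  show "{\<zero>\<^sub>M} <= e ` $M \<inter> ?K" using z by (auto intro: image_eqI[of _ _ "\<zero>\<^sub>M"])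
 qed
 moreover have "act M g x : e ` $M" if "g : $G" "x : e ` $M" for g x using that eg act_closed by (auto intro!: image_eqI[of _ _ "act M g _"])
 moreover have "act M g x : ?K" if "g : $G" "x : ?K" for g x using that eg act_closed az by auto
 ultimately show ?thesis unfolding internal_direct_sum_def gsubmodule_def using image_submodule[OF module_axioms d(2)] K by blast
qed

end

section \<open>Induced modules and Higman's criterion\<close>

locale induced_data = X: gmodule R "G(|carrier := Q|)" X + G: group G
 for R :: "('a, 'y) ring_scheme" (structure) and G :: "('g, 'z) monoid_scheme" and Q
  and X :: "('a, 'b, 'g) gmodule" +
 assumes Q: "subgroup Q G"
begin

abbreviation RG where "RG \<equiv> free_module R ($G)"
abbreviation lt where "lt \<equiv> %g. free_map R (%h. g \<cdot>\<^sub>G h)"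
abbreviation rt where "rt \<equiv> %q. free_map R (%h. h \<cdot>\<^sub>G q)"
definition B where "B = {((rt q a, x), (a, act X q x)) | a q x. a : $RG & q : Q & x : $X}"

lemma RG_module: "module R RG" by (rule X.R.free_mod)

lemma Q_sub: "q : Q ==> q : $G" using subgroup.mem_carrier[OF Q] .

lemma lt: assumes g: "g : $G" shows "lin_map R RG RG (lt g)" "h : $G ==> lt g (free_gen R h) = free_gen R (g \<cdot>\<^sub>G h)"
proof -
 have m: "(%h. g \<cdot>\<^sub>G h) : $G \<rightarrow> $G" using g by auto
 show "lin_map R RG RG (lt g)" by (rule X.R.linear_free_map[OF m])
 show "lt g (free_gen R h) = free_gen R (g \<cdot>\<^sub>G h)" if "h : $G" by (rule X.R.free_map_gen[OF m that])
qed

lemma rt: assumes g: "g : $G" shows "lin_map R RG RG (rt g)" "h : $G ==> rt g (free_gen R h) = free_gen R (h \<cdot>\<^sub>G g)"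
proof -
 have m: "(%h. h \<cdot>\<^sub>G g) : $G \<rightarrow> $G" using g by auto
 show "lin_map R RG RG (rt g)" by (rule X.R.linear_free_map[OF m])
 show "rt g (free_gen R h) = free_gen R (h \<cdot>\<^sub>G g)" if "h : $G" by (rule X.R.free_map_gen[OF m that])
qed

lemma RG_eqI:
 assumes "module R P" "lin_map R RG P f" "lin_map R RG P f'" "a : $RG"
  and "!!h. h : $G ==> f (free_gen R h) = f' (free_gen R h)"
 shows "f a = f' a" by (rule module.linear_free_eqI[OF assms(1,4,2,3,5)])

lemma X_act: "q : Q ==> x : $X ==> act X q x : $X" "q : Q ==> lin_map R X X (act X q)" using X.act_closed[of q x] X.act_linear[of q] by simp_all

lemma X_act_mult: "q : Q ==> q' : Q ==> x : $X ==> act X (q \<cdot>\<^sub>G q') x = act X q (act X q' x)"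
 "x : $X ==> act X \<one>\<^sub>G x = x" using X.act_mult[of q q' x] X.act_one[of x] by simp_all

lemma I_data: "tensor_quotient_data R RG X G B lt (%g x. x)"
proof (intro tensor_quotient_data.intro tensor_quotient_data_axioms.intro)
 interpret RG: module R RG by (rule RG_module)
 show "module R RG" by (rule RG_module)
 show "module R X" by (rule X.module_axioms)
 show "group G" by (rule G.group_axioms)
 show "B <= ($RG \<times> $X) \<times> ($RG \<times> $X)" unfolding B_def using linD(1)[OF rt(1)] Q_sub X_act(1) by auto
 fix g assume g: "g : $G"
 show "lin_map R RG RG (lt g)" by (rule lt(1)[OF g])
 show "lin_map R X X (%x. x)" by (rule X.lin_id)
 show "lt (g \<cdot>\<^sub>G h) a = lt g (lt h a)" if h: "h : $G" and a: "a : $RG" for h a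
  by (rule RG_eqI[OF RG_module lt(1) RG.lin_comp[OF lt(1)[OF h] lt(1)[OF g]] a])
   (use g h in "simp_all add: lt(2) G.m_assoc")
 fix a x b y assume "((a, x), (b, y)) : B"
 then obtain q where q: "q : Q" "a = rt q b" "y = act X q x" "b : $RG" "x : $X" unfolding B_def by blast
 \<comment> \<open>Left and right translations of the group algebra commute; this makes the
   relations invariant under the action of \<open>G\<close>.\<close>
 have "lt g (rt q b) = rt q (lt g b)" by (rule RG_eqI[OF RG_module RG.lin_comp[OF rt(1) lt(1)] RG.lin_comp[OF lt(1) rt(1)] q(4)])
   (use g Q_sub[OF q(1)] in "simp_all add: lt(2) rt(2) G.m_assoc")
 thus "((lt g a, x), (lt g b, y)) : B" unfolding B_def using q linD(1)[OF lt(1)[OF g]] by blast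
next
 interpret RG: module R RG by (rule RG_module)
 show "lt \<one>\<^sub>G a = a" if a: "a : $RG" for a by (rule RG_eqI[OF RG_module lt(1) RG.lin_id a]) (simp_all add: lt(2))
qed simp_all

sublocale I: tensor_quotient_data R RG X G B lt "%g x. x" by (rule I_data)

abbreviation Ind where "Ind \<equiv> induced R G Q X"

lemma TQ_eq: "I.TQ = Ind"
proof -
 let ?F = "free_module R ($RG \<times> $X)"
 have "{free_gen R (x, y) \<ominus>\<^sub>?F free_gen R (x', y') | x y x' y'. ((x, y), (x', y')) : B}
  = {free_gen R (rt q a, x) \<ominus>\<^sub>?F free_gen R (a, act X q x) | a q x. a : $RG & q : Q & x : $X}"
  (is "?L = ?R")
 proof
  show "?L <= ?R" unfolding B_def by blast
  show "?R <= ?L" unfolding B_def by blast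
 qed
 thus ?thesis by (simp add: I.TQ_def I.act_gen_def I.F_def induced_def Let_def)
qed

lemmas Ind_gmodule = I.TQ_gmodule[unfolded TQ_eq]

sublocale Ind: gmodule R G Ind by (rule Ind_gmodule)

definition ig where "ig g x = I.tens (free_gen R g) x"

lemma gen_RG: "g : $G ==> free_gen R g : $RG" by (rule X.R.free_gen_closed)

lemma ig_closed: "g : $G ==> x : $X ==> ig g x : $Ind" unfolding ig_def TQ_eq[symmetric] by (rule I.tens_closed[OF gen_RG])

lemma ig_linear: "g : $G ==> lin_map R X Ind (ig g)" using ig_closed[of g] I.tens_bilinear(4)[OF _ gen_RG[of g]] I.tens_bilinear(2)[OF gen_RG[of g]]
 by (auto simp: lin_map_def ig_def TQ_eq)

lemma ig_act: "y : $G ==> g : $G ==> x : $X ==> act Ind y (ig g x) = ig (y \<cdot>\<^sub>G g) x"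
 using I.act_tens[of y "free_gen R g" x] gen_RG[of g] by (simp add: ig_def TQ_eq lt(2))

lemma ig_rel:
 assumes "g : $G" "q : Q" "x : $X" shows "ig (g \<cdot>\<^sub>G q) x = ig g (act X q x)"
proof -
 have "((rt q (free_gen R g), x), (free_gen R g, act X q x)) : B" unfolding B_def using assms gen_RG by blast
 from I.tens_rel[OF this] show ?thesis using assms by (simp add: ig_def rt(2) Q_sub)
qed

lemma Ind_eqI:
 assumes z: "z : $Ind" and P: "module R P" and f: "lin_map R Ind P f" and h: "lin_map R Ind P h"
  and e: "!!g x. g : $G ==> x : $X ==> f (ig g x) = h (ig g x)"
 shows "f z = h z"
proof (rule I.TQ_eqI[unfolded TQ_eq, OF z P f h])
 fix a x assume a: "a : $RG" and x: "x : $X"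
 have l: "lin_map R RG Ind (%a. I.tens a x)"
  using I.tens_closed[OF _ x] I.tens_bilinear(1)[OF _ _ x] I.tens_bilinear(3)[OF _ _ x] by (auto simp: lin_map_def TQ_eq)
 have c: "lin_map R RG P (%a. k (I.tens a x))" if "lin_map R Ind P k" for k by (rule module.lin_comp[OF RG_module l that])
 show "f (I.tens a x) = h (I.tens a x)" by (rule RG_eqI[OF P c[OF f] c[OF h] a]) (use e x in "simp add: ig_def")
qed

lemma Ind_lift:
 assumes P: "module R P" and \<gamma>: "!!g. g : $G ==> lin_map R X P (\<gamma> g)"
  and \<gamma>Q: "!!g q x. g : $G ==> q : Q ==> x : $X ==> \<gamma> (g \<cdot>\<^sub>G q) x = \<gamma> g (act X q x)"
 obtains h where "lin_map R Ind P h" "!!g x. g : $G ==> x : $X ==> h (ig g x) = \<gamma> g x"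
proof -
 interpret P: module R P by fact
 note g = linD[OF \<gamma>]
 let ?\<beta> = "%a x. lin_ext R P (%g. \<gamma> g x) a"
 have l: "lin_map R RG P (%a. ?\<beta> a x)" if "x : $X" for x by (rule P.linear_lin_ext) (use g(1) that in blast)
 have v: "?\<beta> (free_gen R h) x = \<gamma> h x" if "h : $G" "x : $X" for h x by (rule P.lin_ext_gen[OF _ that(1)]) (use g(1) that(2) in blast)
 obtain k where k: "lin_map R I.TQ P k" "!!a x. a : $RG ==> x : $X ==> k (I.tens a x) = ?\<beta> a x"
 proof (rule I.TQ_lift[OF P, of ?\<beta>])
  show "?\<beta> a x : $P" if "a : $RG" "x : $X" for a x by (rule linD(1)[OF l[OF that(2)] that(1)])
  show "lin_map R RG P (%a. ?\<beta> a x)" if "x : $X" for x by (rule l[OF that])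
  show "lin_map R X P (?\<beta> a)" if a: "a : $RG" for a unfolding lin_map_def
  proof (intro conjI ballI funcsetI)
   fix x assume x: "x : $X"
   show "?\<beta> a x : $P" by (rule linD(1)[OF l[OF x] a])
   show "?\<beta> a (x \<oplus>\<^sub>X y) = ?\<beta> a x \<oplus>\<^sub>P ?\<beta> a y" if y: "y : $X" for y
    by (rule RG_eqI[OF P l I.M.lin_add[OF P l[OF x] l[OF y]] a]) (use x y in "simp_all add: v g(2)")
   show "?\<beta> a (r \<odot>\<^sub>X x) = r \<odot>\<^sub>P ?\<beta> a x" if r: "r : $R" for r
    by (rule RG_eqI[OF P l I.M.lin_smult[OF P l[OF x] r] a]) (use x r in "simp_all add: v g(3)")
  qed
  fix a x b y assume "((a, x), (b, y)) : B"
  then obtain q where q: "q : Q" "a = rt q b" "y = act X q x" "b : $RG" "x : $X" unfolding B_def by blast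
  have "?\<beta> (rt q b) x = ?\<beta> b (act X q x)" by (rule RG_eqI[OF P I.M.lin_comp[OF rt(1) l[OF q(5)]] l[OF X_act(1)[OF q(1,5)]] q(4)])
    (use q Q_sub[OF q(1)] in "simp_all add: rt(2) v \<gamma>Q X_act(1)")
  thus "?\<beta> a x = ?\<beta> b y" using q by simp
 qed (erule that, simp)
 show thesis by (rule that[of k]) (use k v gen_RG in "auto simp: TQ_eq ig_def")
qed

definition rep :: "'g set => 'g" where "rep C = (SOME g. g : C)"

lemma rep: assumes "C : lcosets \<^sub>G Q" shows "rep C : C" "rep C : $G" "C = rep C <#\<^sub>G Q"
proof -
 obtain g where g: "g : $G" "C = g <#\<^sub>G Q" using assms by (auto simp: LCOSETS_def)
 show r: "rep C : C" unfolding rep_def g(2) by (rule someI[where P = "%h. h : g <#\<^sub>G Q"], rule G.lcos_self[OF g(1) Q])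
 show rG: "rep C : $G" using r subgroup.lcosets_carrier[OF Q G.is_group assms] by blast
 show "C = rep C <#\<^sub>G Q" using G.l_repr_independence[OF _ g(1) Q, of "rep C"] r g(2) by simp
qed

lemma rep_coset: assumes "g : $G" shows "g <#\<^sub>G Q : lcosets \<^sub>G Q" "EX q:Q. rep (g <#\<^sub>G Q) = g \<cdot>\<^sub>G q"
proof -
 show 1: "g <#\<^sub>G Q : lcosets \<^sub>G Q" using assms by (auto simp: LCOSETS_def)
 show "EX q:Q. rep (g <#\<^sub>G Q) = g \<cdot>\<^sub>G q" using rep(1)[OF 1] unfolding l_coset_def by blast
qed

lemma ig_zero: "g : $G ==> ig g \<zero>\<^sub>X = \<zero>\<^sub>Ind" by (rule X.lin_zero[OF Ind.module_axioms ig_linear])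

text \<open>The map \<epsilon> projects the induced module onto its part over the coset
  \<open>Q\<close>, identified with \<open>X\<close>. Its translates by coset representatives are
  the projections onto the parts over the other cosets, and these add up to the identity.\<close>

lemma counit:
 obtains \<epsilon> where "lin_map R Ind X \<epsilon>" "!!q z. q : Q ==> z : $Ind ==> \<epsilon> (act Ind q z) = act X q (\<epsilon> z)"
  "!!z. finite ($G) ==> z : $Ind ==>
   (\<Oplus>\<^sub>Ind C\<in>lcosets \<^sub>G Q. act Ind (rep C) (ig \<one>\<^sub>G (\<epsilon> (act Ind (inv \<^sub>G (rep C)) z)))) = z"
proof -
 have mQ: "g \<cdot>\<^sub>G q : Q \<longleftrightarrow> g : Q" if "g : $G" "q : Q" for g q
  using that Q_sub[OF that(2)] subgroup.m_closed[OF Q] subgroup.m_inv_closed[OF Q that(2)] by (metis G.inv_solve_right G.m_closed)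
 obtain \<epsilon> where e: "lin_map R Ind X \<epsilon>"
  and v: "!!g x. g : $G ==> x : $X ==> \<epsilon> (ig g x) = (if g : Q then act X g x else \<zero>\<^sub>X)"
 proof (rule Ind_lift[OF X.module_axioms, of "%g x. if g : Q then act X g x else \<zero>\<^sub>X"])
  show "lin_map R X X (%x. if g : Q then act X g x else \<zero>\<^sub>X)" for g using X_act(2)[of g] X.lin_const_zero by (cases "g : Q") simp_all
  show "(if g \<cdot>\<^sub>G q : Q then act X (g \<cdot>\<^sub>G q) x else \<zero>\<^sub>X) = (if g : Q then act X g (act X q x) else \<zero>\<^sub>X)"
   if "g : $G" "q : Q" "x : $X" for g q x using mQ[OF that(1,2)] X_act_mult(1)[OF _ that(2,3)] by simp
 qed (erule that, simp)
 show thesis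
 proof (rule that[OF e])
  fix q z assume q: "q : Q" and z: "z : $Ind"
  have qG: "q : $G" by (rule Q_sub[OF q])
  have qm: "q \<cdot>\<^sub>G g : Q \<longleftrightarrow> g : Q" if "g : $G" for g
   using that qG q subgroup.m_closed[OF Q] subgroup.m_inv_closed[OF Q q] by (metis G.inv_solve_left G.m_closed)
  show "\<epsilon> (act Ind q z) = act X q (\<epsilon> z)"
  proof (rule Ind_eqI[OF z X.module_axioms Ind.lin_comp[OF Ind.act_linear[OF qG] e] Ind.lin_comp[OF e X_act(2)[OF q]]])
   fix g x assume "g : $G" "x : $X"
   thus "\<epsilon> (act Ind q (ig g x)) = act X q (\<epsilon> (ig g x))" using qm[of g] q qG X.lin_zero[OF X.module_axioms X_act(2)[OF q]]
    by (simp add: ig_act v X_act_mult(1))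
  qed
 next
  fix z assume fin: "finite ($G)" and z: "z : $Ind"
  let ?L = "%C z. act Ind (rep C) (ig \<one>\<^sub>G (\<epsilon> (act Ind (inv \<^sub>G (rep C)) z)))"
  have fL: "finite (lcosets \<^sub>G Q)" using fin by (simp add: LCOSETS_def)
  have lin: "lin_map R Ind Ind (?L C)" if "C : lcosets \<^sub>G Q" for C by (intro Ind.lin_comp[OF _ Ind.act_linear] Ind.lin_comp[OF _ ig_linear]
    Ind.lin_comp[OF _ e] Ind.act_linear G.inv_closed G.one_closed rep(2)[OF that])
  show "(\<Oplus>\<^sub>Ind C\<in>lcosets \<^sub>G Q. ?L C z) = z"
  proof (rule Ind_eqI[OF z Ind.module_axioms Ind.lin_sum_maps[OF Ind.module_axioms lin] Ind.lin_id])
   fix g x assume g: "g : $G" and x: "x : $X"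
   have "(\<Oplus>\<^sub>Ind C\<in>lcosets \<^sub>G Q. ?L C (ig g x)) = (\<Oplus>\<^sub>Ind C\<in>lcosets \<^sub>G Q. if g <#\<^sub>G Q = C then ig g x else \<zero>\<^sub>Ind)"
   proof (rule Ind.M.finsum_cong')
    fix C assume C: "C : lcosets \<^sub>G Q"
    note r = rep[OF C]
    have eq: "inv \<^sub>G (rep C) \<cdot>\<^sub>G g : Q \<longleftrightarrow> g <#\<^sub>G Q = C"
    proof
    assume "inv \<^sub>G (rep C) \<cdot>\<^sub>G g : Q"
    hence "rep C \<cdot>\<^sub>G (inv \<^sub>G (rep C) \<cdot>\<^sub>G g) : rep C <#\<^sub>G Q" unfolding l_coset_def by blast
    hence "g : rep C <#\<^sub>G Q" using r(2) g by (simp add: G.m_assoc[symmetric])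
    thus "g <#\<^sub>G Q = C" using G.l_repr_independence[OF _ r(2) Q, of g] r(3) by simp
    next
    assume "g <#\<^sub>G Q = C"
    hence "g : rep C <#\<^sub>G Q" using G.lcos_self[OF g Q] r(3) by simp
    then obtain q where "q : Q" "g = rep C \<cdot>\<^sub>G q" unfolding l_coset_def by blast
    thus "inv \<^sub>G (rep C) \<cdot>\<^sub>G g : Q" using r(2) Q_sub by (simp add: G.m_assoc[symmetric])
    qed
    have s: "?L C (ig g x) = act Ind (rep C) (ig \<one>\<^sub>G (if inv \<^sub>G (rep C) \<cdot>\<^sub>G g : Q then act X (inv \<^sub>G (rep C) \<cdot>\<^sub>G g) x else \<zero>\<^sub>X))"
    using g x r(2) by (simp add: ig_act v)
    show "?L C (ig g x) = (if g <#\<^sub>G Q = C then ig g x else \<zero>\<^sub>Ind)"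
    proof (cases "inv \<^sub>G (rep C) \<cdot>\<^sub>G g : Q")
    case True
    have "act Ind (rep C) (ig \<one>\<^sub>G (act X (inv \<^sub>G (rep C) \<cdot>\<^sub>G g) x)) = ig (rep C) (act X (inv \<^sub>G (rep C) \<cdot>\<^sub>G g) x)"
    using r(2) X_act(1)[OF True x] by (simp add: ig_act)
    also have "... = ig (rep C \<cdot>\<^sub>G (inv \<^sub>G (rep C) \<cdot>\<^sub>G g)) x" using ig_rel[OF r(2) True x] by simp
    also have "... = ig g x" using r(2) g by (simp add: G.m_assoc[symmetric])
    finally show ?thesis using True eq s by simp
    next
    case False
    thus ?thesis using eq s r(2) ig_zero[OF G.one_closed] Ind.lin_zero[OF Ind.module_axioms Ind.act_linear[OF r(2)]] by simp
    qed
   qed (use ig_closed[OF g x] in auto)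
   also have "... = ig g x" by (rule Ind.M.finsum_singleton[OF rep_coset(1)[OF g] fL]) (use ig_closed[OF g x] in auto)
   finally show "(\<Oplus>\<^sub>Ind C\<in>lcosets \<^sub>G Q. ?L C (ig g x)) = ig g x" .
  qed
 qed
qed

text \<open>Higman's criterion in a form that does not mention the induced module: \<alpha> after
  \<beta> is a \<open>Q\<close>-endomorphism of \<open>U\<close> that factors through
  \<open>X\<close> and whose transfer is the identity. The representatives \<open>rep C\<close> are
  those used in \<open>transfer\<close>.\<close>

definition higman where "higman U \<alpha> \<beta> \<longleftrightarrow> lin_map R X U \<alpha> & lin_map R U X \<beta> &
 (ALL q:Q. ALL x:$X. \<alpha> (act X q x) = act U q (\<alpha> x)) &
 (ALL q:Q. ALL u:$U. \<beta> (act U q u) = act X q (\<beta> u)) &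
 (ALL u:$U. (\<Oplus>\<^sub>U C\<in>lcosets \<^sub>G Q. act U (rep C) (\<alpha> (\<beta> (act U (inv \<^sub>G (rep C)) u)))) = u)"

text \<open>Here \<alpha> is \<open>X\<close> placed over the trivial coset followed by the
  retraction onto \<open>U\<close>, and \<beta> is the embedding of \<open>U\<close> followed by the
  counit; the identity for the counit is carried over to \<open>U\<close>.\<close>

lemma higman_of_summand:
 fixes U :: "('a, 'c, 'g) gmodule"
 assumes U: "gmodule R G U" and fin: "finite ($G)" and sum: "iso_to_direct_summand R G U Ind"
 shows "\<exists>\<alpha> \<beta>. higman U \<alpha> \<beta>"
proof -
 interpret U: gmodule R G U by fact
 obtain N N' where s: "internal_direct_sum R G Ind N N'" and iso: "gmodule_iso R G U (Ind(|carrier := N|))"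
  using sum unfolding iso_to_direct_summand_def direct_summand_def by blast
 obtain f where bij: "bij_betw f ($U) N"
  and fa: "!!x y. x : $U ==> y : $U ==> f (x \<oplus>\<^sub>U y) = f x \<oplus>\<^sub>Ind f y"
  and fs: "!!r x. r : $R ==> x : $U ==> f (r \<odot>\<^sub>U x) = r \<odot>\<^sub>Ind f x"
  and fg: "!!g x. g : $G ==> x : $U ==> f (act U g x) = act Ind g (f x)" using iso unfolding gmodule_iso_def by auto
 have N: "N <= $Ind" using s Ind.submoduleE(1) by (auto simp: internal_direct_sum_def gsubmodule_def)
 have f: "lin_map R U Ind f" using bij_betw_imp_funcset[OF bij] N fa fs by (auto simp: lin_map_def)
 obtain e where e: "e : $(gmodule_end R G Ind)" "e ` $Ind = N" "!!x. x : N ==> e x = x"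
  by (rule Ind.summand_projection[OF s], erule that, assumption, simp)
 have el: "lin_map R Ind Ind e" and eg: "!!g z. g : $G ==> z : $Ind ==> e (act Ind g z) = act Ind g (e z)"
  using e(1) Ind.endD(2)[of e] by (auto simp: gmodule_end_def)
 define h where "h z = inv_into ($U) f (e z)" for z
 have eN: "e z : N" if "z : $Ind" for z using e(2) that by blast
 have fh: "f (h z) = e z" if "z : $Ind" for z unfolding h_def using f_inv_into_f[of "e z" f "$U"] bij_betw_imp_surj_on[OF bij] eN[OF that] by simp
 have hU: "h z : $U" if "z : $Ind" for z unfolding h_def using inv_into_into[of "e z" f "$U"] bij_betw_imp_surj_on[OF bij] eN[OF that] by simp
 have inj: "x = y" if "f x = f y" "x : $U" "y : $U" for x y using inj_onD[OF bij_betw_imp_inj_on[OF bij] that] .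
 have h: "lin_map R Ind U h" unfolding lin_map_def
 proof (intro conjI ballI funcsetI)
  fix z assume z: "z : $Ind"
  show "h z : $U" by (rule hU[OF z])
  show "h (z \<oplus>\<^sub>Ind z') = h z \<oplus>\<^sub>U h z'" if z': "z' : $Ind" for z'
   by (rule inj) (use z z' in "simp_all add: fa hU fh linD(2)[OF el]")
  show "h (r \<odot>\<^sub>Ind z) = r \<odot>\<^sub>U h z" if r: "r : $R" for r by (rule inj) (use z r in "simp_all add: fs hU fh linD(3)[OF el]")
 qed
 have hg: "h (act Ind g z) = act U g (h z)" if "g : $G" "z : $Ind" for g z
  by (rule inj) (use that in "simp_all add: fg hU fh eg Ind.act_closed U.act_closed")
 have hf: "h (f u) = u" if "u : $U" for u
 proof (rule inj)
  have fu: "f u : N" using bij_betw_imp_funcset[OF bij] that by blast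
  show "f (h (f u)) = f u" using fh[OF linD(1)[OF f that]] e(3)[OF fu] by simp
 qed (rule hU[OF linD(1)[OF f that]], rule that)
 obtain \<epsilon> where eps: "lin_map R Ind X \<epsilon>" "!!q z. q : Q ==> z : $Ind ==> \<epsilon> (act Ind q z) = act X q (\<epsilon> z)"
  "!!z. finite ($G) ==> z : $Ind ==>
   (\<Oplus>\<^sub>Ind C\<in>lcosets \<^sub>G Q. act Ind (rep C) (ig \<one>\<^sub>G (\<epsilon> (act Ind (inv \<^sub>G (rep C)) z)))) = z"
  by (rule counit, erule that, simp, simp)
 have "higman U (%x. h (ig \<one>\<^sub>G x)) (%u. \<epsilon> (f u))" unfolding higman_def
 proof (intro conjI ballI)
  show "lin_map R X U (%x. h (ig \<one>\<^sub>G x))" by (rule X.lin_comp[OF ig_linear h]) simp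
  show "lin_map R U X (%u. \<epsilon> (f u))" by (rule U.lin_comp[OF f eps(1)])
  fix q assume q: "q : Q"
  have qG: "q : $G" by (rule Q_sub[OF q])
  show "h (ig \<one>\<^sub>G (act X q x)) = act U q (h (ig \<one>\<^sub>G x))" if x: "x : $X" for x
   using ig_rel[OF G.one_closed q x] ig_act[OF qG G.one_closed x] hg[OF qG ig_closed[OF G.one_closed x]] qG by simp
  show "\<epsilon> (f (act U q u)) = act X q (\<epsilon> (f u))" if u: "u : $U" for u using fg[OF qG u] eps(2)[OF q linD(1)[OF f u]] by simp
 next
  fix u assume u: "u : $U"
  note c = linD(1)[OF f] linD(1)[OF eps(1)] ig_closed Ind.act_closed U.act_closed hU rep(2)
  have "(\<Oplus>\<^sub>U C\<in>lcosets \<^sub>G Q. act U (rep C) (h (ig \<one>\<^sub>G (\<epsilon> (f (act U (inv \<^sub>G (rep C)) u))))))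
   = (\<Oplus>\<^sub>U C\<in>lcosets \<^sub>G Q. h (act Ind (rep C) (ig \<one>\<^sub>G (\<epsilon> (act Ind (inv \<^sub>G (rep C)) (f u))))))"
   by (rule U.M.finsum_cong') (use u in "auto simp: c hg fg")
  also have "... = h (\<Oplus>\<^sub>Ind C\<in>lcosets \<^sub>G Q. act Ind (rep C) (ig \<one>\<^sub>G (\<epsilon> (act Ind (inv \<^sub>G (rep C)) (f u)))))"
   by (rule Ind.lin_finsum[OF U.module_axioms h, symmetric]) (use u in "auto simp: c")
  also have "... = u" using eps(3)[OF fin linD(1)[OF f u]] hf[OF u] by simp
  finally show "(\<Oplus>\<^sub>U C\<in>lcosets \<^sub>G Q. act U (rep C) (h (ig \<one>\<^sub>G (\<epsilon> (f (act U (inv \<^sub>G (rep C)) u)))))) = u" .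
 qed
 thus ?thesis by blast
qed

text \<open>The map \<open>h\<close> is \<alpha> extended to the induced module, and
  \<open>f\<close> sends \<open>u\<close> to the sum of the elements
  \<open>ig g (\<beta> (g^-1 u))\<close> over coset representatives \<open>g\<close>. The Higman
  identity says that \<open>h\<close> after \<open>f\<close> is the identity, so \<open>f\<close>
  after \<open>h\<close> is a projection onto a copy of \<open>U\<close>.\<close>

lemma summand_of_higman:
 fixes U :: "('a, 'c, 'g) gmodule"
 assumes U: "gmodule R G U" and fin: "finite ($G)" and hig: "higman U \<alpha> \<beta>"
 shows "iso_to_direct_summand R G U Ind"
proof -
 interpret U: gmodule R G U by fact
 have a: "lin_map R X U \<alpha>" and b: "lin_map R U X \<beta>"
  and aq: "!!q x. q : Q ==> x : $X ==> \<alpha> (act X q x) = act U q (\<alpha> x)"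
  and bq: "!!q u. q : Q ==> u : $U ==> \<beta> (act U q u) = act X q (\<beta> u)"
  and ab: "!!u. u : $U ==> (\<Oplus>\<^sub>U C\<in>lcosets \<^sub>G Q. act U (rep C) (\<alpha> (\<beta> (act U (inv \<^sub>G (rep C)) u)))) = u"
  using hig unfolding higman_def by blast+
 note c = linD(1)[OF a] linD(1)[OF b] ig_closed Ind.act_closed U.act_closed rep(2)
 obtain h where h: "lin_map R Ind U h" and hv: "!!g x. g : $G ==> x : $X ==> h (ig g x) = act U g (\<alpha> x)"
 proof (rule Ind_lift[OF U.module_axioms, of "%g x. act U g (\<alpha> x)"])
  show "lin_map R X U (%x. act U g (\<alpha> x))" if "g : $G" for g by (rule X.lin_comp[OF a U.act_linear[OF that]])
  show "act U (g \<cdot>\<^sub>G q) (\<alpha> x) = act U g (\<alpha> (act X q x))" if "g : $G" "q : Q" "x : $X" for g q x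
   using that Q_sub[OF that(2)] by (simp add: aq U.act_mult c)
 qed (erule that, simp)
 have hg: "h (act Ind y z) = act U y (h z)" if y: "y : $G" and z: "z : $Ind" for y z
  by (rule Ind_eqI[OF z U.module_axioms Ind.lin_comp[OF Ind.act_linear[OF y] h] Ind.lin_comp[OF h U.act_linear[OF y]]])
   (use y in "simp add: ig_act hv U.act_mult c")
 define \<Gamma> where "\<Gamma> u C = ig (rep C) (\<beta> (act U (inv \<^sub>G (rep C)) u))" for u C
 have \<Gamma>c: "\<Gamma> u C : $Ind" if "u : $U" "C : lcosets \<^sub>G Q" for u C unfolding \<Gamma>_def using that by (simp add: c)
 \<comment> \<open>Replacing \<open>g\<close> by \<open>g q\<close> inserts \<open>q\<close> in one
   place and its inverse in another, and \<beta> commutes with \<open>q\<close>. Independence of the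
   representative is what makes \<open>f\<close> commute with \<open>G\<close>.\<close>
 have \<Gamma>g: "\<Gamma> u (g <#\<^sub>G Q) = ig g (\<beta> (act U (inv \<^sub>G g) u))" if g: "g : $G" and u: "u : $U" for u g
 proof -
  obtain q where q: "q : Q" "rep (g <#\<^sub>G Q) = g \<cdot>\<^sub>G q" using rep_coset(2)[OF g] by blast
  have qG: "q : $G" by (rule Q_sub[OF q(1)])
  have "\<Gamma> u (g <#\<^sub>G Q) = ig g (act X q (\<beta> (act U (inv \<^sub>G (g \<cdot>\<^sub>G q)) u)))"
   unfolding \<Gamma>_def q(2) by (rule ig_rel[OF g q(1)]) (use g qG u in "simp add: c")
  also have "act X q (\<beta> (act U (inv \<^sub>G (g \<cdot>\<^sub>G q)) u)) = \<beta> (act U q (act U (inv \<^sub>G (g \<cdot>\<^sub>G q)) u))"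
   by (rule bq[OF q(1), symmetric]) (use g qG u in "simp add: c")
  also have "act U q (act U (inv \<^sub>G (g \<cdot>\<^sub>G q)) u) = act U (inv \<^sub>G g) u"
   using g qG u by (simp add: G.inv_mult_group U.act_mult U.act_inv c)
  finally show ?thesis .
 qed
 define f where "f u = (\<Oplus>\<^sub>Ind C\<in>lcosets \<^sub>G Q. \<Gamma> u C)" for u
 have f: "lin_map R U Ind f" unfolding f_def \<Gamma>_def by (rule U.lin_sum_maps[OF Ind.module_axioms])
   (intro U.lin_comp[OF U.act_linear U.lin_comp[OF b ig_linear]] G.inv_closed rep(2); assumption)
 have hf: "h (f u) = u" if u: "u : $U" for u
 proof -
  have "h (f u) = (\<Oplus>\<^sub>U C\<in>lcosets \<^sub>G Q. h (\<Gamma> u C))"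
   unfolding f_def by (rule Ind.lin_finsum[OF U.module_axioms h]) (use \<Gamma>c u in blast)
  also have "... = (\<Oplus>\<^sub>U C\<in>lcosets \<^sub>G Q. act U (rep C) (\<alpha> (\<beta> (act U (inv \<^sub>G (rep C)) u))))"
   by (rule U.M.finsum_cong') (use u in "auto simp: \<Gamma>_def hv c")
  finally show ?thesis using ab[OF u] by simp
 qed
 interpret gs: gset G "lcosets \<^sub>G Q" "%g C. g <#\<^sub>G C" by (rule G.lcosets_gset[OF fin Q])
 have fg: "f (act U y u) = act Ind y (f u)" if y: "y : $G" and u: "u : $U" for y u
 proof -
  let ?s = "%C. y <#\<^sub>G C"
  have ret: "inv \<^sub>G y <#\<^sub>G (y <#\<^sub>G C) = C" "y <#\<^sub>G (inv \<^sub>G y <#\<^sub>G C) = C" if "C : lcosets \<^sub>G Q" for C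
   using gs.mult[of "inv \<^sub>G y" y C] gs.mult[of y "inv \<^sub>G y" C] gs.one[OF that] y that by simp_all
  have inj: "inj_on ?s (lcosets \<^sub>G Q)" by (rule inj_onI) (metis ret(1))
  have "?s ` (lcosets \<^sub>G Q) <= lcosets \<^sub>G Q" using gs.closed[OF y] by blast
  moreover have "lcosets \<^sub>G Q <= ?s ` (lcosets \<^sub>G Q)"
  proof
   fix C assume C: "C : lcosets \<^sub>G Q"
   show "C : ?s ` (lcosets \<^sub>G Q)" by (rule image_eqI[of _ ?s "inv \<^sub>G y <#\<^sub>G C"])
    (use ret(2)[OF C] gs.closed[OF G.inv_closed[OF y] C] in simp_all)
  qed
  ultimately have im: "?s ` (lcosets \<^sub>G Q) = lcosets \<^sub>G Q" by (rule equalityI)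
  have yu: "act U y u : $U" by (rule U.act_closed[OF y u])
  have "f (act U y u) = (\<Oplus>\<^sub>Ind C\<in>?s ` (lcosets \<^sub>G Q). \<Gamma> (act U y u) C)" unfolding im f_def ..
  also have "... = (\<Oplus>\<^sub>Ind C\<in>lcosets \<^sub>G Q. \<Gamma> (act U y u) (y <#\<^sub>G C))"
   by (rule Ind.M.finsum_reindex[OF _ inj]) (use \<Gamma>c[OF yu] im in blast)
  also have "... = (\<Oplus>\<^sub>Ind C\<in>lcosets \<^sub>G Q. act Ind y (\<Gamma> u C))"
  proof (rule Ind.M.finsum_cong')
   fix C assume C: "C : lcosets \<^sub>G Q"
   define g where "g = rep C"
   have g: "g : $G" and Cg: "C = g <#\<^sub>G Q" using rep[OF C] unfolding g_def by blast+
   have "y <#\<^sub>G (g <#\<^sub>G Q) = (y \<cdot>\<^sub>G g) <#\<^sub>G Q" using G.lcos_m_assoc[OF subgroup.subset[OF Q] y g] .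
   hence "\<Gamma> (act U y u) (y <#\<^sub>G C) = ig (y \<cdot>\<^sub>G g) (\<beta> (act U (inv \<^sub>G (y \<cdot>\<^sub>G g)) (act U y u)))"
    using \<Gamma>g[of "y \<cdot>\<^sub>G g", OF _ yu] y g Cg by simp
   also have "act U (inv \<^sub>G (y \<cdot>\<^sub>G g)) (act U y u) = act U (inv \<^sub>G g) u"
    using y g u by (simp add: G.inv_mult_group U.act_mult U.act_inv c)
   also have "ig (y \<cdot>\<^sub>G g) (\<beta> (act U (inv \<^sub>G g) u)) = act Ind y (ig g (\<beta> (act U (inv \<^sub>G g) u)))"
    by (rule ig_act[OF y g, symmetric]) (use g u in "simp add: c")
   also have "... = act Ind y (\<Gamma> u C)" using \<Gamma>g[OF g u] Cg by simp
   finally show "\<Gamma> (act U y u) (y <#\<^sub>G C) = act Ind y (\<Gamma> u C)" .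
  qed (use \<Gamma>c[OF u] Ind.act_closed[OF y] in blast)+
  also have "... = act Ind y (f u)"
   unfolding f_def by (rule Ind.lin_finsum[OF Ind.module_axioms Ind.act_linear[OF y], symmetric]) (use \<Gamma>c[OF u] in blast)
  finally show ?thesis .
 qed
 note hc = linD[OF h] and fc = linD[OF f]
 let ?e = "\<lambda>z\<in>$Ind. f (h z)"
 have e: "?e : $(gmodule_end R G Ind)" using endI[OF Ind.module_axioms Ind.lin_comp[OF h f]] by (simp add: gmodule_end_def Ind.act_closed hg fg hc(1))
 have idem: "?e (?e z) = ?e z" if "z : $Ind" for z using that hc(1) fc(1) hf by simp
 have im: "?e ` $Ind = f ` $U"
 proof
  show "?e ` $Ind <= f ` $U" using hc(1) by auto
  show "f ` $U <= ?e ` $Ind"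
  proof
   fix z assume "z : f ` $U"
   then obtain u where u: "u : $U" "z = f u" by blast
   show "z : ?e ` $Ind" by (rule image_eqI[of _ _ "f u"]) (use u fc(1) hf in simp_all)
  qed
 qed
 have "direct_summand R G (Ind(|carrier := f ` $U|)) Ind" unfolding direct_summand_def using Ind.projection_summand[OF e idem] im by auto
 moreover have "gmodule_iso R G U (Ind(|carrier := f ` $U|))" unfolding gmodule_iso_def
 proof (rule exI[of _ f], intro conjI)
  have "inj_on f ($U)" by (rule inj_onI) (metis hf)
  thus "bij_betw f ($U) ($(Ind(|carrier := f ` $U|)))" by (simp add: bij_betw_def)
 qed (simp_all add: fc fg)
 ultimately show ?thesis unfolding iso_to_direct_summand_def by blast
qed

end

section \<open>Reduction modulo the maximal ideal\<close>

context complete_local_pid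
begin

definition quot :: "'a => 'a set" where "quot r = max_ideal R +>\<^sub>R r"

lemma max_ideal: "maximalideal (max_ideal R) R" unfolding max_ideal_def by (rule theI'[OF local_ring])

text \<open>The principal ideal of a non-unit lies in a maximal ideal, of which there is only one.
  In a commutative ring left ideals are ideals, so the existence result for maximal left ideals can
  be reused.\<close>

lemma max_ideal_units:
 assumes r: "r : $R" "r ~: max_ideal R" shows "r : Units R"
proof (rule ccontr)
 assume nu: "r ~: Units R"
 have I: "ideal (PIdl r) R" by (rule cgenideal_ideal[OF r(1)])
 have left: "left_ideal J R \<longleftrightarrow> ideal J R" for J
 proof
  assume "left_ideal J R"
  note J = left_idealD[OF this]
  show "ideal J R"
  proof (rule idealI[OF ring_axioms])
   show "subgroup J (add_monoid R)" using \<open>left_ideal J R\<close> by (simp add: left_ideal_def)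
   show "x \<cdot> a : J" if "a : J" "x : $R" for a x using J(5)[OF that(2,1)] .
   show "a \<cdot> x : J" if "a : J" "x : $R" for a x using J(5)[OF that(2,1)] m_comm[of a x] J(1) that by auto
  qed
 next
  assume J: "ideal J R"
  show "left_ideal J R" using ideal.I_l_closed[OF J] additive_subgroup.a_subgroup[OF ideal.axioms(1)[OF J]] by (simp add: left_ideal_def)
 qed
 have "\<one> ~: PIdl r"
 proof
  assume "\<one> : PIdl r"
  then obtain x where "x : $R" "\<one> = x \<cdot> r" unfolding cgenideal_def by blast
  hence "r : Units R" using r(1) m_comm by (auto simp: Units_def)
  thus False using nu by blast
 qed
 then obtain J where J: "maximal_left_ideal J R" "PIdl r <= J" using exists_maximal_left_ideal[of "PIdl r"] left I by blast
 have "maximalideal J R"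
 proof (rule maximalidealI)
  show "ideal J R" "$R ~= J" using J(1) left by (auto simp: maximal_left_ideal_def)
  show "L = J \<or> L = $R" if "ideal L R" "J <= L" "L <= $R" for L using that J(1) left by (auto simp: maximal_left_ideal_def)
 qed
 hence "J = max_ideal R" using local_ring max_ideal by blast
 thus False using cgenideal_self[OF r(1)] J(2) r(2) by blast
qed

lemma max_ideal_gen: obtains w where "w : $R" "max_ideal R = {w \<cdot> r | r. r : $R}"
proof -
 have "ideal (max_ideal R) R" using max_ideal by (rule maximalideal.axioms(1))
 then obtain w where w: "w : $R" "max_ideal R = PIdl w" using exists_gen by blast
 have "PIdl w = {w \<cdot> r | r. r : $R}" unfolding cgenideal_def using m_comm w(1) by blast
 thus thesis using that w by simp
qed

lemma one_notin_max_ideal: "\<one> ~: max_ideal R"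
 using ideal.one_imp_carrier[OF maximalideal.axioms(1)[OF max_ideal]] maximalideal.I_notcarr[OF max_ideal] by auto

lemma residue_field: "field (residue_field R)" unfolding residue_field_def by (rule maximalideal.quotient_is_field[OF max_ideal is_cring])

lemma quot_hom: "quot : ring_hom R (residue_field R)" using ideal.rcos_ring_hom[OF maximalideal.axioms(1)[OF max_ideal]]
 unfolding residue_field_def quot_def[abs_def] .

lemmas quot_simps = ring_hom_closed[OF quot_hom] ring_hom_add[OF quot_hom] ring_hom_mult[OF quot_hom] ring_hom_one[OF quot_hom]

lemma quot_zero_iff: assumes "r : $R" shows "quot r = \<zero>\<^bsub>residue_field R\<^esub> \<longleftrightarrow> r : max_ideal R"
 using ideal.rcos_const_imp_mem[OF maximalideal.axioms(1)[OF max_ideal] assms]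
  abelian_group.a_coset_join2[OF abelian_group_axioms assms additive_subgroup.a_subgroup[OF ideal.axioms(1)[OF maximalideal.axioms(1)[OF max_ideal]]]]
 by (auto simp: residue_field_def quot_def FactRing_def)

lemma quot_surj: assumes "k : $(residue_field R)" obtains r where "r : $R" "quot r = k"
 using assms unfolding residue_field_def FactRing_def A_RCOSETS_def' quot_def by auto

lemma local_module:
 assumes "module R M" obtains w where "local_module R M (max_ideal R) w"
proof -
 obtain w where "w : $R" "max_ideal R = {w \<cdot> r | r. r : $R}" by (rule max_ideal_gen)
 thus thesis using that[of w] assms max_ideal_units one_notin_max_ideal by (auto intro!: local_module.intro local_module_axioms.intro)
qed

lemma absolutely_indecomposable_hom:
 assumes M: "gmodule R G M" and fin: "finite ($G)" and ai: "absolutely_indecomposable R G M"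
 obtains lam where "lam : ring_hom (gmodule_end R G M) (residue_field R)"
  "!!r. r : $R ==> lam (r \<odot>\<^bsub>lin_end R M\<^esub> \<one>\<^bsub>lin_end R M\<^esub>) = quot r"
  "!!e. e : $(gmodule_end R G M) ==> lam e ~= \<zero>\<^bsub>residue_field R\<^esub> ==> e : Units (gmodule_end R G M)"
proof -
 interpret M: gmodule R G M by fact
 let ?E = "gmodule_end R G M"
 have ops: "monoid.mult ?E = monoid.mult (lin_end R M)" "ring.add ?E = ring.add (lin_end R M)"
  "\<one>\<^sub>?E = \<one>\<^bsub>lin_end R M\<^esub>" "smult ?E = smult (lin_end R M)"
  "$?E = {f : $(lin_end R M). ALL h:$G. ALL x:$M. f (act M h x) = act M h (f x)}" by (simp_all add: gmodule_end_def)
 let ?sc = "%r. r \<odot>\<^bsub>lin_end R M\<^esub> \<one>\<^bsub>lin_end R M\<^esub>"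
 have scl: "?sc r : $(lin_end R M)" if "r : $R" for r using M.end_closed(3)[OF M.end_01(1) M.end_01(1) that] .
 have sc: "?sc : ring_hom R ?E"
 proof (rule ring_hom_memI)
  show "?sc r : $?E" if r: "r : $R" for r unfolding ops(5) using scl[OF r] r by (simp add: end_app M.act_closed M.act_smult)
  show "?sc (r \<cdot> s) = ?sc r \<cdot>\<^sub>?E ?sc s" if "r : $R" "s : $R" for r s
   unfolding ops by (rule end_ext[of _ R M]) (use that scl M.end_closed(1) in "simp_all add: end_app M.smult_assoc1")
  show "?sc (r \<oplus> s) = ?sc r \<oplus>\<^sub>?E ?sc s" if "r : $R" "s : $R" for r s
   unfolding ops by (rule end_ext[of _ R M]) (use that scl M.end_closed(2) in "simp_all add: end_app M.smult_l_distr")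
  show "?sc \<one> = \<one>\<^sub>?E" unfolding ops by (rule end_ext[of _ R M]) (use scl M.end_01 in "simp_all add: end_app")
 qed
 obtain \<phi> where \<phi>: "\<phi> : ring_iso (?E Quot jacobson_radical ?E) (R Quot max_ideal R)"
  "!!r. r : $R ==> \<phi> (jacobson_radical ?E +>\<^sub>?E ?sc r) = max_ideal R +>\<^sub>R r"
  using ai unfolding absolutely_indecomposable_def Let_def ops residue_field_def by auto
 from local_residue_hom[OF M.gmodule_end_ring[OF fin] is_cring max_ideal max_ideal_units sc \<phi>]
 show thesis using that unfolding residue_field_def quot_def by blast
qed

lemma add_pow_quot: "quot (add_pow R (n::nat) \<one>) = add_pow (residue_field R) n \<one>\<^bsub>residue_field R\<^esub>"
proof (induction n)
 interpret K: field "residue_field R" by (rule residue_field)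
 case 0
 thus ?case using ring_hom_zero[OF quot_hom ring_axioms K.ring_axioms] by simp
next
 case (Suc n)
 thus ?case using quot_simps(2)[OF add.nat_pow_closed[OF one_closed] one_closed] quot_simps(4) by (simp add: add_pow_def)
qed

lemma char_dvd:
 assumes "ring_char (residue_field R) = p"
 shows "add_pow (residue_field R) (n::nat) \<one>\<^bsub>residue_field R\<^esub> = \<zero>\<^bsub>residue_field R\<^esub> \<longleftrightarrow> p dvd n"
proof -
 interpret K: field "residue_field R" by (rule residue_field)
 show ?thesis using K.add.pow_eq_id[OF K.one_closed, of n] assms by (simp add: ring_char_def add_pow_def)
qed

end

text \<open>Coordinates are linear because they are unique: sums and multiples of expansions are
  again expansions.\<close>

lemma (in module) module_basis_free:
 assumes "module_basis R M B"
 obtains f where "fbasis R M B (%x. x) f"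
proof -
 have B: "finite B" "B <= $M"
  and ex: "!!x. x : $M ==> \<exists>!c. c : B \<rightarrow>\<^sub>E $R & x = (\<Oplus>\<^sub>M b\<in>B. c b \<odot>\<^sub>M b)"
  using assms by (auto simp: module_basis_def)
 define c where "c x = (THE c. c : B \<rightarrow>\<^sub>E $R & x = (\<Oplus>\<^sub>M b\<in>B. c b \<odot>\<^sub>M b))" for x
 have c: "c x : B \<rightarrow>\<^sub>E $R" "x = (\<Oplus>\<^sub>M b\<in>B. c x b \<odot>\<^sub>M b)" if "x : $M" for x
  using theI'[OF ex[OF that]] unfolding c_def by blast+
 have uniq: "c x b = d b" if "b : B" "!!b. b : B ==> d b : $R" "x = (\<Oplus>\<^sub>M b\<in>B. d b \<odot>\<^sub>M b)" for x d b
 proof -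
  have Bc: "b : $M" if "b : B" for b using B(2) that by blast
  have x: "x : $M" unfolding that(3) by (rule M.finsum_closed) (use that(2) Bc in auto)
  have "(\<Oplus>\<^sub>M b\<in>B. d b \<odot>\<^sub>M b) = (\<Oplus>\<^sub>M b\<in>B. restrict d B b \<odot>\<^sub>M b)"
   by (rule M.finsum_cong') (use that(2) Bc in auto)
  hence xd: "x = (\<Oplus>\<^sub>M b\<in>B. restrict d B b \<odot>\<^sub>M b)" using that(3) by (rule trans[rotated])
  have dB: "restrict d B : B \<rightarrow>\<^sub>E $R" using that(2) by simp
  have "c x = restrict d B" unfolding c_def by (rule the1_equality[OF ex[OF x]]) (rule conjI[OF dB xd])
  thus ?thesis using that(1) by simp
 qed
 have Bc: "b : $M" if "b : B" for b using B(2) that by blast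
 have cc: "c x b : $R" if "x : $M" "b : B" for x b by (rule PiE_mem[OF c(1)[OF that(1)] that(2)])
 show thesis
 proof (rule that[of "%b x. c x b"], unfold fbasis_def dual_basis_def, intro conjI ballI)
  show "lin_fun R M (%x. c x b)" if b: "b : B" for b unfolding lin_fun_def
  proof (intro conjI ballI funcsetI)
   fix x assume x: "x : $M"
   show "c x b : $R" by (rule cc[OF x b])
   show "c (x \<oplus>\<^sub>M y) b = c x b \<oplus> c y b" if y: "y : $M" for y
   proof (rule uniq[OF b])
    have "x \<oplus>\<^sub>M y = (\<Oplus>\<^sub>M b\<in>B. c x b \<odot>\<^sub>M b) \<oplus>\<^sub>M (\<Oplus>\<^sub>M b\<in>B. c y b \<odot>\<^sub>M b)"
    using c(2)[OF x] c(2)[OF y] by simp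
    also have "... = (\<Oplus>\<^sub>M b\<in>B. c x b \<odot>\<^sub>M b \<oplus>\<^sub>M c y b \<odot>\<^sub>M b)"
    by (rule M.finsum_addf[symmetric]) (use cc x y Bc in auto)
    also have "... = (\<Oplus>\<^sub>M b\<in>B. (c x b \<oplus> c y b) \<odot>\<^sub>M b)"
    by (rule M.finsum_cong') (use cc x y Bc in "auto simp: smult_l_distr")
    finally show "x \<oplus>\<^sub>M y = (\<Oplus>\<^sub>M b\<in>B. (c x b \<oplus> c y b) \<odot>\<^sub>M b)" .
   qed (use cc x y in auto)
   show "c (r \<odot>\<^sub>M x) b = r \<cdot> c x b" if r: "r : $R" for r
   proof (rule uniq[OF b])
    have "r \<odot>\<^sub>M x = r \<odot>\<^sub>M (\<Oplus>\<^sub>M b\<in>B. c x b \<odot>\<^sub>M b)" using c(2)[OF x] by simp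
    also have "... = (\<Oplus>\<^sub>M b\<in>B. r \<odot>\<^sub>M (c x b \<odot>\<^sub>M b))"
    by (rule finsum_smult_ldistr[OF B(1) r]) (use cc x Bc in auto)
    also have "... = (\<Oplus>\<^sub>M b\<in>B. (r \<cdot> c x b) \<odot>\<^sub>M b)"
    by (rule M.finsum_cong') (use cc x Bc r in "auto simp: smult_assoc1")
    finally show "r \<odot>\<^sub>M x = (\<Oplus>\<^sub>M b\<in>B. (r \<cdot> c x b) \<odot>\<^sub>M b)" .
   qed (use cc x r in auto)
  qed
  show "c b' b = (if b = b' then \<one> else \<zero>)" if b: "b : B" "b' : B" for b b'
  proof (rule uniq[OF b(1)])
   have "(\<Oplus>\<^sub>M b\<in>B. (if b = b' then \<one> else \<zero>) \<odot>\<^sub>M b) = (\<Oplus>\<^sub>M b\<in>B. if b' = b then b else \<zero>\<^sub>M)"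
    by (rule M.finsum_cong') (use Bc in auto)
   also have "... = b'" by (rule M.finsum_singleton[OF b(2) B(1)]) (use Bc in auto)
   finally show "b' = (\<Oplus>\<^sub>M b\<in>B. (if b = b' then \<one> else \<zero>) \<odot>\<^sub>M b)" by simp
  qed auto
  show "x = (\<Oplus>\<^sub>M b\<in>B. c x b \<odot>\<^sub>M b)" if "x : $M" for x by (rule c(2)[OF that])
 qed (use B in auto)
qed

lemma (in module) free_basis_rank:
 assumes B: "fbasis R M B (%x. x) g"
 shows "has_rank R M (card B)" unfolding has_rank_def module_basis_def
proof (intro exI[of _ B] conjI ballI refl)
 note d = dualD[OF basisD(1)[OF B]]
 show "finite B" "B <= $M" using d(1,2) by auto
 fix x assume x: "x : $M"
 have gx: "g b x : $R" if "b : B" for b using funD(1)[OF d(3)[OF that] x] .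
 show "\<exists>!c. c : B \<rightarrow>\<^sub>E $R & x = (\<Oplus>\<^sub>M b\<in>B. c b \<odot>\<^sub>M b)"
 proof (rule ex1I[of _ "\<lambda>b\<in>B. g b x"])
  have "(\<Oplus>\<^sub>M b\<in>B. (\<lambda>b\<in>B. g b x) b \<odot>\<^sub>M b) = (\<Oplus>\<^sub>M b\<in>B. g b x \<odot>\<^sub>M b)"
   by (rule M.finsum_cong') (use gx d(2) in auto)
  thus "(\<lambda>b\<in>B. g b x) : B \<rightarrow>\<^sub>E $R & x = (\<Oplus>\<^sub>M b\<in>B. (\<lambda>b\<in>B. g b x) b \<odot>\<^sub>M b)"
   using d(4)[OF x] gx by auto
  fix c assume c: "c : B \<rightarrow>\<^sub>E $R & x = (\<Oplus>\<^sub>M b\<in>B. c b \<odot>\<^sub>M b)"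
  have cc: "c b : $R" if "b : B" for b using c that by auto
  show "c = (\<lambda>b\<in>B. g b x)"
  proof (rule extensionalityI[of _ B])
   fix b assume b: "b : B"
   have "g b x = g b (\<Oplus>\<^sub>M b\<in>B. c b \<odot>\<^sub>M b)" by (rule arg_cong[of _ _ "g b"]) (use c in blast)
   also have "... = (\<Oplus>b'\<in>B. c b' \<cdot> g b b')" using cc d(2)
    by (subst linear_fun_finsum[OF d(3)[OF b]]) (auto intro!: R.finsum_cong' simp: funD[OF d(3)[OF b]])
   also have "... = (\<Oplus>b'\<in>B. if b = b' then c b' else \<zero>)" by (rule R.finsum_cong') (use cc basisD(2)[OF B b] in auto)
   also have "... = c b" by (rule R.finsum_singleton[OF b d(1)]) (use cc in auto)
   finally show "c b = (\<lambda>b\<in>B. g b x) b" using b by simp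
  qed (use c in "auto simp: PiE_def")
 qed
qed

section \<open>Vertices in terms of transfer maps\<close>

context gmodule
begin

lemma gmodule_restrict:
 assumes "subgroup H G" shows "gmodule R (G(|carrier := H|)) M"
proof (intro gmodule.intro gmodule_axioms.intro)
 show "group (G(|carrier := H|))" by (rule subgroup.subgroup_is_group[OF assms group_axioms])
qed (use subgroup.mem_carrier[OF assms] in "simp_all add: module_axioms act_closed act_add act_smult act_one act_mult")

lemma gmodule_sub:
 assumes "gsubmodule N R G M" shows "gmodule R G (M(|carrier := N|))"
proof (intro gmodule.intro gmodule_axioms.intro)
 have N: "submodule N R M" "!!g x. g : $G ==> x : N ==> act M g x : N" using assms by (auto simp: gsubmodule_def)
 have c: "x : $M" if "x : N" for x using submoduleE(1)[OF N(1)] that by blast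
 show "module R (M(|carrier := N|))" by (rule submodule.submodule_is_module[OF N(1) module_axioms])
 show "group G" by (rule group_axioms)
qed (use assms submoduleE(1) in "auto simp: gsubmodule_def act_add act_smult act_one act_mult subset_iff")

end

locale rep_data = gmodule R G M + P: complete_local_pid R
 for R (structure) and G and M :: "('a, 'b, 'g) gmodule" +
 fixes p :: nat and I :: "'i set" and b :: "'i => 'b" and f :: "'i => 'b => 'a"
 assumes finG: "finite ($G)" and prime: "Factorial_Ring.prime p" and char: "ring_char (residue_field R) = p"
  and basis: "fbasis R M I b f" and abs_indec: "absolutely_indecomposable R G M"
begin

abbreviation A where "A \<equiv> lin_end R M"
abbreviation c where "c \<equiv> conj_end G M"
abbreviation K where "K \<equiv> residue_field R"
abbreviation Tr where "Tr \<equiv> dtrace R I b f"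
definition t where "t a = P.quot (Tr a)"
definition Sc where "Sc = {r \<odot>\<^sub>A \<one>\<^sub>A | r. r : $R}"
definition lam where "lam = (SOME l. l : ring_hom (gmodule_end R G M) K &
 (ALL r:$R. l (r \<odot>\<^sub>A \<one>\<^sub>A) = P.quot r) &
 (ALL e:$(gmodule_end R G M). l e ~= \<zero>\<^sub>K --> e : Units (gmodule_end R G M)))"

lemma lam: "lam : ring_hom (gmodule_end R G M) K" "r : $R ==> lam (r \<odot>\<^sub>A \<one>\<^sub>A) = P.quot r"
 "e : $(gmodule_end R G M) ==> lam e ~= \<zero>\<^sub>K ==> e : Units (gmodule_end R G M)"
proof -
 obtain l where "l : ring_hom (gmodule_end R G M) K &
  (ALL r:$R. l (r \<odot>\<^sub>A \<one>\<^sub>A) = P.quot r) &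
  (ALL e:$(gmodule_end R G M). l e ~= \<zero>\<^sub>K --> e : Units (gmodule_end R G M))"
  using P.absolutely_indecomposable_hom[OF gmodule_axioms finG abs_indec] by metis
 hence "\<exists>l. l : ring_hom (gmodule_end R G M) K &
  (ALL r:$R. l (r \<odot>\<^sub>A \<one>\<^sub>A) = P.quot r) &
  (ALL e:$(gmodule_end R G M). l e ~= \<zero>\<^sub>K --> e : Units (gmodule_end R G M))" by (rule exI[of _ l])
 from someI_ex[OF this, folded lam_def]
 show "lam : ring_hom (gmodule_end R G M) K" "r : $R ==> lam (r \<odot>\<^sub>A \<one>\<^sub>A) = P.quot r"
  "e : $(gmodule_end R G M) ==> lam e ~= \<zero>\<^sub>K ==> e : Units (gmodule_end R G M)" by blast+
qed

lemma end_eq: "gmodule_end R G M = A(|carrier := fixpts A c ($G)|)" using gmodule_end_eq[OF subgroup_self] by simp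

lemma scalar:
 assumes "r : $R"
 shows "r \<odot>\<^sub>A \<one>\<^sub>A : $A" "r \<odot>\<^sub>A \<one>\<^sub>A : fixpts A c ($G)"
  "a : $A ==> (r \<odot>\<^sub>A \<one>\<^sub>A) \<cdot>\<^sub>A a = r \<odot>\<^sub>A a" "a : $A ==> a \<cdot>\<^sub>A (r \<odot>\<^sub>A \<one>\<^sub>A) = r \<odot>\<^sub>A a"
proof -
 show s: "r \<odot>\<^sub>A \<one>\<^sub>A : $A" using end_closed(3)[OF end_01(1) end_01(1) assms] .
 show "r \<odot>\<^sub>A \<one>\<^sub>A : fixpts A c ($G)"
  unfolding fixed_points_lin_end[OF subset_refl] using s assms by (simp add: end_app act_closed act_smult)
 show "(r \<odot>\<^sub>A \<one>\<^sub>A) \<cdot>\<^sub>A a = r \<odot>\<^sub>A a" if a: "a : $A"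
  by (rule end_ext[of _ R M]) (use a assms s end_closed in "simp_all add: end_app endD(1)[OF a]")
 show "a \<cdot>\<^sub>A (r \<odot>\<^sub>A \<one>\<^sub>A) = r \<odot>\<^sub>A a" if a: "a : $A" by (rule end_ext[of _ R M])
   (use a assms s end_closed in "simp_all add: end_app linD(3)[OF endD(2)[OF a]]")
qed

lemmas dual = dualD[OF basisD(1)[OF basis]]

lemma f_closed: "i : I ==> x : $M ==> f i x : $R" using funD(1)[OF dual(3)] .

lemma Tr_closed: "a : $A ==> Tr a : $R" unfolding dtrace_def by (rule R.finsum_closed) (use f_closed endD(1) dual(2) in blast)

lemma Tr_add:
 assumes "a : $A" "a' : $A" shows "Tr (a \<oplus>\<^sub>A a') = Tr a \<oplus> Tr a'"
proof -
 have c: "f i (a (b i)) : $R" "f i (a' (b i)) : $R" if "i : I" for i using f_closed[OF that] endD(1) assms dual(2)[OF that] by blast+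
 have "Tr (a \<oplus>\<^sub>A a') = (\<Oplus>i\<in>I. f i (a (b i)) \<oplus> f i (a' (b i)))" unfolding dtrace_def by (rule R.finsum_cong')
   (use c dual(2) funD(2)[OF dual(3)] endD(1)[OF assms(1)] endD(1)[OF assms(2)] in "auto simp: end_app")
 also have "... = Tr a \<oplus> Tr a'" unfolding dtrace_def by (rule R.finsum_addf) (use c in auto)
 finally show ?thesis .
qed

lemma Tr_smult:
 assumes "a : $A" "r : $R" shows "Tr (r \<odot>\<^sub>A a) = r \<cdot> Tr a"
proof -
 have c: "f i (a (b i)) : $R" if "i : I" for i using f_closed[OF that] endD(1) assms dual(2)[OF that] by blast+
 have "Tr (r \<odot>\<^sub>A a) = (\<Oplus>i\<in>I. r \<cdot> f i (a (b i)))" unfolding dtrace_def by (rule R.finsum_cong')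
   (use c assms(2) dual(2) funD(3)[OF dual(3)] endD(1)[OF assms(1)] in "auto simp: end_app")
 also have "... = r \<cdot> Tr a" unfolding dtrace_def by (rule R.finsum_rdistr[symmetric]) (use c dual(1) assms(2) in auto)
 finally show ?thesis .
qed

lemma Tr_cong: "(!!x. x : $M ==> \<phi> x = \<psi> x) ==> (!!x. x : $M ==> \<phi> x : $M) ==> Tr \<phi> = Tr \<psi>"
 unfolding dtrace_def by (rule R.finsum_cong') (use dual(2) f_closed in auto)

lemma Tr_comm:
 assumes "lin_map R M M \<phi>" "lin_map R M M \<psi>" shows "Tr (%x. \<phi> (\<psi> x)) = Tr (%x. \<psi> (\<phi> x))"
 using dual_trace_commute[OF module_axioms basisD(1)[OF basis] basisD(1)[OF basis] assms] by (simp add: comp_def)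

sublocale KF: field K by (rule P.residue_field)

text \<open>Symmetry of \<open>t\<close> and its invariance under conjugation are both instances of
  \<open>Tr_comm\<close>; scalars realise every residue because \<open>quot\<close> is onto.\<close>

sublocale traced_galgebra A G c K t lam Sc p
proof (intro traced_galgebra.intro traced_galgebra_axioms.intro galgebra_lin_end finG prime KF.domain_axioms)
 note l = ring_hom_closed[OF lam(1)] ring_hom_add[OF lam(1)] ring_hom_mult[OF lam(1)] ring_hom_one[OF lam(1)]
 show "add_pow K p \<one>\<^sub>K = \<zero>\<^sub>K" using P.char_dvd[OF char, of p] by simp
 show "t a : $K" if "a : $A" for a unfolding t_def by (rule P.quot_simps(1)[OF Tr_closed[OF that]])
 show "t (a \<oplus>\<^sub>A a') = t a \<oplus>\<^sub>K t a'" if "a : $A" "a' : $A" for a a'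
  unfolding t_def using Tr_add[OF that] P.quot_simps(2)[OF Tr_closed[OF that(1)] Tr_closed[OF that(2)]] by simp
 show "t (a \<cdot>\<^sub>A a') = t (a' \<cdot>\<^sub>A a)" if a: "a : $A" "a' : $A" for a a'
 proof -
  have "Tr (a \<cdot>\<^sub>A a') = Tr (%x. a (a' x))" by (rule Tr_cong) (use endD(1) a in "simp_all add: end_app")
  also have "... = Tr (%x. a' (a x))" by (rule Tr_comm[OF endD(2)[OF a(1)] endD(2)[OF a(2)]])
  also have "... = Tr (a' \<cdot>\<^sub>A a)" by (rule Tr_cong) (use endD(1) a in "simp_all add: end_app")
  finally show ?thesis by (simp add: t_def)
 qed
 show "t (c g a) = t a" if g: "g : $G" and a: "a : $A" for g a
 proof -
  have gi: "inv \<^sub>G g : $G" using g by simp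
  have "Tr (c g a) = Tr (%x. act M g (a (act M (inv \<^sub>G g) x)))" by (rule Tr_cong) (use endD(1) a g in "simp_all add: conj_end_apply act_closed")
  also have "... = Tr (%x. a (act M (inv \<^sub>G g) (act M g x)))"
   by (rule Tr_comm[OF act_linear[OF g] lin_comp[OF act_linear[OF gi] endD(2)[OF a]]])
  also have "... = Tr a" by (rule Tr_cong) (use endD(1) a g in "simp_all add: act_inv act_closed")
  finally show ?thesis by (simp add: t_def)
 qed
 show "Sc <= fixpts A c ($G)" unfolding Sc_def using scalar(2) by blast
 show "s \<cdot>\<^sub>A a = a \<cdot>\<^sub>A s" if "s : Sc" "a : $A" for s a using that scalar(3,4) unfolding Sc_def by auto
 show "lam a : $K" if "a : fixpts A c ($G)" for a using l(1)[of a] that by (simp add: end_eq)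
 show "lam (a \<oplus>\<^sub>A a') = lam a \<oplus>\<^sub>K lam a'"
  if "a : fixpts A c ($G)" "a' : fixpts A c ($G)" for a a' using l(2)[of a a'] that by (simp add: end_eq)
 show "lam (a \<cdot>\<^sub>A a') = lam a \<cdot>\<^sub>K lam a'"
  if "a : fixpts A c ($G)" "a' : fixpts A c ($G)" for a a' using l(3)[of a a'] that by (simp add: end_eq)
 show "lam \<one>\<^sub>A = \<one>\<^sub>K" using l(4) by (simp add: end_eq)
 show "EX a':fixpts A c ($G). a \<cdot>\<^sub>A a' = \<one>\<^sub>A & a' \<cdot>\<^sub>A a = \<one>\<^sub>A"
  if "a : fixpts A c ($G)" "lam a ~= \<zero>\<^sub>K" for a using lam(3)[of a] that by (auto simp: end_eq Units_def)
 show "EX s:Sc. lam s = lam a" if "a : fixpts A c ($G)" for a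
 proof -
  have "lam a : $K" using l(1)[of a] that by (simp add: end_eq)
  then obtain r where "r : $R" "P.quot r = lam a" by (rule P.quot_surj)
  thus ?thesis using lam(2) unfolding Sc_def by auto
 qed
qed

lemma transfer_app:
 assumes a: "a : $A" and H: "subgroup H G" and u: "u : $M"
 shows "tr G H a u = (\<Oplus>\<^sub>M C\<in>lcosets \<^sub>G H. act M (SOME g. g : C) (a (act M (inv \<^sub>G (SOME g. g : C)) u)))"
proof -
 have r: "(SOME g. g : C) : $G" if C: "C : lcosets \<^sub>G H" for C
 proof -
  obtain g where g: "g : $G" "C = g <#\<^sub>G H" using C by (auto simp: LCOSETS_def)
  have "(SOME h. h : C) : C" unfolding g(2) by (rule someI[where P = "%h. h : g <#\<^sub>G H"], rule lcos_self[OF g(1) H])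
  thus ?thesis using subgroup.lcosets_carrier[OF H is_group C] by blast
 qed
 have cl: "(%C. c (SOME g. g : C) a) : lcosets \<^sub>G H \<rightarrow> $A" using conj_end_closed[OF r a] by blast
 have "tr G H a u = (\<Oplus>\<^sub>M C\<in>lcosets \<^sub>G H. c (SOME g. g : C) a u)" unfolding transfer_def by (rule lin_end_finsum[OF cl u])
 also have "... = (\<Oplus>\<^sub>M C\<in>lcosets \<^sub>G H. act M (SOME g. g : C) (a (act M (inv \<^sub>G (SOME g. g : C)) u)))"
  by (rule M.finsum_cong') (use conj_end_apply[OF u] r act_closed endD(1)[OF a] u in auto)
 finally show ?thesis .
qed

lemma fixd_iff:
 assumes "subgroup H G"
 shows "a : fixd H \<longleftrightarrow> a : $A & (ALL h:H. ALL x:$M. a (act M h x) = act M h (a x))"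
 using fixed_points_lin_end[OF subgroup.subset[OF assms]] by simp

lemma end_sub: assumes "subgroup H G" shows "$(gmodule_end R (G(|carrier := H|)) M) = fixd H" using gmodule_end_eq[OF assms] by simp

lemma summand_direct:
 assumes H: "subgroup H G" and i: "i : fixd H" and idem: "i \<cdot>\<^sub>A i = i"
 shows "internal_direct_sum R (G(|carrier := H|)) M (i ` $M) {x : $M. i x = \<zero>\<^sub>M}"
  and "gmodule R (G(|carrier := H|)) (M(|carrier := i ` $M|))"
proof -
 interpret H: gmodule R "G(|carrier := H|)" M by (rule gmodule_restrict[OF H])
 have "i (i x) = i x" if "x : $M" for x using end_app(1)[OF that, of R i i] idem by simp
 thus 1: "internal_direct_sum R (G(|carrier := H|)) M (i ` $M) {x : $M. i x = \<zero>\<^sub>M}" using H.projection_summand end_sub[OF H] i by blast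
 show "gmodule R (G(|carrier := H|)) (M(|carrier := i ` $M|))" by (rule H.gmodule_sub) (use 1 in "simp add: internal_direct_sum_def")
qed

text \<open>Higman's criterion inside the endomorphism ring: maps \<alpha> and \<beta> between the
  image of \<open>i\<close> and \<open>M\<close> correspond to \<open>x\<close>, which is \<alpha>
  after \<open>i\<close>, and \<open>y\<close>, which is \<beta>, so that \<open>x i y\<close> is
  \<alpha> after \<beta>.\<close>

lemma summand_induced_iff:
 assumes H: "subgroup H G" and i: "i : fixd H" and idem: "i \<cdot>\<^sub>A i = i"
 shows "iso_to_direct_summand R G M (induced R G H (M(|carrier := i ` $M|))) \<longleftrightarrow>
  (EX x:fixd H. EX y:fixd H. tr G H (x \<cdot>\<^sub>A i \<cdot>\<^sub>A y) = \<one>\<^sub>A)"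
proof -
 let ?X = "M(|carrier := i ` $M|)"
 interpret X: gmodule R "G(|carrier := H|)" ?X by (rule summand_direct(2)[OF assms])
 interpret D: induced_data R G H ?X by (intro induced_data.intro induced_data_axioms.intro X.gmodule_axioms group_axioms H)
 note iA = fixd_A[OF i]
 note ic = endD(1)[OF iA] and il = endD(2)[OF iA]
 have ii: "i (i x) = i x" if "x : $M" for x using end_app(1)[OF that, of R i i] idem by simp
 have Xc: "x : $M" if "x : $?X" for x using that ic by auto
 have ig: "i (act M h x) = act M h (i x)" if "h : H" "x : $M" for h x using i that fixd_iff[OF H] by blast
 have lX: "lin_map R M ?X i" using il by (auto simp: lin_map_def)
 have lM: "lin_map R ?X M \<phi>" if "lin_map R M M \<phi>" for \<phi> using linD[OF that] Xc by (auto simp: lin_map_def)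
 show ?thesis
 proof
  assume "iso_to_direct_summand R G M (induced R G H ?X)"
  then obtain \<alpha> \<beta> where "D.higman M \<alpha> \<beta>" using D.higman_of_summand[OF gmodule_axioms finG] by blast
  hence a: "lin_map R ?X M \<alpha>" and be: "lin_map R M ?X \<beta>"
   and aq: "!!q x. q : H ==> x : $?X ==> \<alpha> (act M q x) = act M q (\<alpha> x)"
   and bq: "!!q u. q : H ==> u : $M ==> \<beta> (act M q u) = act M q (\<beta> u)"
   and ab: "!!u. u : $M ==> (\<Oplus>\<^sub>M C\<in>lcosets \<^sub>G H. act M (D.rep C) (\<alpha> (\<beta> (act M (inv \<^sub>G (D.rep C)) u)))) = u"
   unfolding D.higman_def by simp_all auto
  have bm: "lin_map R M M \<beta>" using linD[OF be] Xc by (auto simp: lin_map_def)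
  have bX: "\<beta> u : $?X" if "u : $M" for u using linD(1)[OF be that] .
  have iX: "i u : $?X" if "u : $M" for u using that by simp
  have ib: "i (\<beta> u) = \<beta> u" if "u : $M" for u using bX[OF that] ii by auto
  let ?x = "\<lambda>u\<in>$M. \<alpha> (i u)" and ?y = "\<lambda>u\<in>$M. \<beta> u"
  have x: "?x : fixd H" unfolding fixd_iff[OF H] using endI[OF module_axioms lin_comp[OF lX a]] subgroup.mem_carrier[OF H] iX
   by (simp add: act_closed ig aq)
  have y: "?y : fixd H" unfolding fixd_iff[OF H] using endI[OF module_axioms bm] subgroup.mem_carrier[OF H] by (simp add: act_closed bq)
  note xA = fixd_A[OF x] and yA = fixd_A[OF y]
  have xiy: "?x \<cdot>\<^sub>A i \<cdot>\<^sub>A ?y : $A" by (intro A.m_closed xA iA yA)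
  have v: "(?x \<cdot>\<^sub>A i \<cdot>\<^sub>A ?y) u = \<alpha> (\<beta> u)" if u: "u : $M" for u
   using u linD(1)[OF bm u] ic by (simp add: end_app ib)
  have "tr G H (?x \<cdot>\<^sub>A i \<cdot>\<^sub>A ?y) = \<one>\<^sub>A"
  proof (rule end_ext[of _ R M])
   show "tr G H (?x \<cdot>\<^sub>A i \<cdot>\<^sub>A ?y) : $A" by (rule transfer_closed[OF H], intro fixd_cl(2)[OF subgroup.subset[OF H]] x i y)
   fix u assume u: "u : $M"
   have "tr G H (?x \<cdot>\<^sub>A i \<cdot>\<^sub>A ?y) u
    = (\<Oplus>\<^sub>M C\<in>lcosets \<^sub>G H. act M (D.rep C) ((?x \<cdot>\<^sub>A i \<cdot>\<^sub>A ?y) (act M (inv \<^sub>G (D.rep C)) u)))"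
    unfolding transfer_app[OF xiy H u] D.rep_def ..
   also have "... = (\<Oplus>\<^sub>M C\<in>lcosets \<^sub>G H. act M (D.rep C) (\<alpha> (\<beta> (act M (inv \<^sub>G (D.rep C)) u))))"
    by (rule M.finsum_cong')
    (use u D.rep(2) linD(1)[OF a bX] in "auto simp: v act_closed")
   also have "... = u" by (rule ab[OF u])
   finally show "tr G H (?x \<cdot>\<^sub>A i \<cdot>\<^sub>A ?y) u = \<one>\<^sub>A u" using u by (simp add: end_app)
  qed (rule A.one_closed)
  thus "EX x:fixd H. EX y:fixd H. tr G H (x \<cdot>\<^sub>A i \<cdot>\<^sub>A y) = \<one>\<^sub>A" using x y by blast
 next
  assume "EX x:fixd H. EX y:fixd H. tr G H (x \<cdot>\<^sub>A i \<cdot>\<^sub>A y) = \<one>\<^sub>A"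
  then obtain x y where x: "x : fixd H" and y: "y : fixd H" and xy: "tr G H (x \<cdot>\<^sub>A i \<cdot>\<^sub>A y) = \<one>\<^sub>A" by blast
  note xA = fixd_A[OF x] and yA = fixd_A[OF y]
  have xiy: "x \<cdot>\<^sub>A i \<cdot>\<^sub>A y : $A" by (intro A.m_closed xA iA yA)
  have xg: "x (act M h u) = act M h (x u)" if "h : H" "u : $M" for h u using x that fixd_iff[OF H] by blast
  have yg: "y (act M h u) = act M h (y u)" if "h : H" "u : $M" for h u using y that fixd_iff[OF H] by blast
  have "D.higman M x (%u. i (y u))" unfolding D.higman_def
  proof (intro conjI ballI)
   show "lin_map R ?X M x" by (rule lM[OF endD(2)[OF xA]])
   show "lin_map R M ?X (%u. i (y u))" by (rule lin_comp[OF endD(2)[OF yA] lX])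
   show "x (act ?X q u) = act M q (x u)" if "q : H" "u : $?X" for q u using xg[OF that(1) Xc[OF that(2)]] by simp
   show "i (y (act M q u)) = act ?X q (i (y u))" if "q : H" "u : $M" for q u using yg[OF that] ig[OF that(1) endD(1)[OF yA that(2)]] by simp
   fix u assume u: "u : $M"
   have "(\<Oplus>\<^sub>M C\<in>lcosets \<^sub>G H. act M (D.rep C) (x (i (y (act M (inv \<^sub>G (D.rep C)) u)))))
    = (\<Oplus>\<^sub>M C\<in>lcosets \<^sub>G H. act M (D.rep C) ((x \<cdot>\<^sub>A i \<cdot>\<^sub>A y) (act M (inv \<^sub>G (D.rep C)) u)))"
    by (rule M.finsum_cong') (use u D.rep(2) endD(1)[OF xiy] endD(1)[OF yA] in "auto simp: act_closed end_app")
   also have "... = tr G H (x \<cdot>\<^sub>A i \<cdot>\<^sub>A y) u" unfolding transfer_app[OF xiy H u] D.rep_def ..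
   also have "... = u" using xy u by (simp add: end_app)
   finally show "(\<Oplus>\<^sub>M C\<in>lcosets \<^sub>G H. act M (D.rep C) (x (i (y (act M (inv \<^sub>G (D.rep C)) u))))) = u" .
  qed
  thus "iso_to_direct_summand R G M (induced R G H ?X)" using D.summand_of_higman[OF gmodule_axioms finG] by blast
 qed
qed

text \<open>The case \<open>i = 1\<close> of the preceding criterion.\<close>

lemma relproj_iff: assumes H: "subgroup H G" shows "relatively_projective R G M H \<longleftrightarrow> relproj H"
proof -
 have one: "\<one>\<^sub>A : fixd H" using fixd_cl(6)[OF subgroup.subset[OF H]] .
 have "M(|carrier := \<one>\<^sub>A ` $M|) = M" by (simp add: lin_end_def)
 hence "relatively_projective R G M H \<longleftrightarrow> (EX x:fixd H. EX y:fixd H. tr G H (x \<cdot>\<^sub>A \<one>\<^sub>A \<cdot>\<^sub>A y) = \<one>\<^sub>A)"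
  using summand_induced_iff[OF H one] by (simp add: relatively_projective_def)
 also have "... \<longleftrightarrow> relproj H"
 proof
  assume "EX x:fixd H. EX y:fixd H. tr G H (x \<cdot>\<^sub>A \<one>\<^sub>A \<cdot>\<^sub>A y) = \<one>\<^sub>A"
  then obtain x y where x: "x : fixd H" "y : fixd H" "tr G H (x \<cdot>\<^sub>A \<one>\<^sub>A \<cdot>\<^sub>A y) = \<one>\<^sub>A" by blast
  hence "x \<cdot>\<^sub>A \<one>\<^sub>A \<cdot>\<^sub>A y : fixd H" by (intro fixd_cl(2)[OF subgroup.subset[OF H]] one)
  thus "relproj H" unfolding relproj_def using x(3) by blast
 next
  assume "relproj H"
  then obtain a where "a : fixd H" "tr G H a = \<one>\<^sub>A" unfolding relproj_def by blast
  hence "tr G H (a \<cdot>\<^sub>A \<one>\<^sub>A \<cdot>\<^sub>A \<one>\<^sub>A) = \<one>\<^sub>A" using fixd_A[of a H] by simp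
  thus "EX x:fixd H. EX y:fixd H. tr G H (x \<cdot>\<^sub>A \<one>\<^sub>A \<cdot>\<^sub>A y) = \<one>\<^sub>A" using \<open>a : fixd H\<close> one by blast
 qed
 finally show ?thesis .
qed

lemma vertex_iff: "vertex R G M S \<longleftrightarrow> vtx S" unfolding vertex_def vtx_def using relproj_iff by auto

end

section \<open>Vertices, ranks of summands and existence of sources\<close>

context rep_data
begin

lemma K_multiple_nonzero: "add_pow K (n::nat) \<one>\<^sub>K = \<zero>\<^sub>K \<longleftrightarrow> p dvd n" by (rule P.char_dvd[OF char])

text \<open>For a Sylow \<open>p\<close>-subgroup \<open>D\<close> of \<open>S\<close> and
  \<open>a\<close> fixed by \<open>S\<close>, the transfer of \<open>a\<close> from \<open>D\<close>
  to \<open>S\<close> is \<open>|S:D|\<close> times \<open>a\<close>. If the transfer of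
  \<open>a\<close> to \<open>G\<close> is \<open>1\<close>, the one from \<open>D\<close> has
  residue \<open>|S:D|\<close>, which is nonzero, and minimality gives \<open>D = S\<close>.\<close>

lemma card_vertex:
 assumes S: "vtx S" shows "\<exists>m. card S = p ^ m"
proof -
 have SG: "subgroup S G" using S by (simp add: vtx_def)
 let ?GS = "G(|carrier := S|)"
 interpret GS: group ?GS by (rule subgroup.subgroup_is_group[OF SG is_group])
 have fS: "finite S" using finite_subset[OF subgroup.subset[OF SG] finG] .
 obtain n where n: "card S = p ^ Factorial_Ring.multiplicity p (card S) * n" "\<not> p dvd n"
 proof (rule multiplicity_decompose'[of "card S" p])
  show "card S ~= 0" using fS subgroup.one_closed[OF SG] by auto
  show "\<not> is_unit p" using prime by auto
 qed (erule that, assumption)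
 obtain D where D: "subgroup D ?GS" and cD: "card D = p ^ Factorial_Ring.multiplicity p (card S)"
  using sylow_thm[OF prime GS.is_group, of "Factorial_Ring.multiplicity p (card S)" n] n(1) fS by (auto simp: order_def)
 have DS: "D <= S" using subgroup.subset[OF D] by simp
 have DG: "subgroup D G" by (rule incl_subgroup[OF SG D])
 have "card (lcosets \<^sub>?GS D) * card D = card S" using GS.l_lagrange[OF _ D] fS by (simp add: order_def)
 hence "p ^ Factorial_Ring.multiplicity p (card S) * card (lcosets \<^sub>?GS D)
   = p ^ Factorial_Ring.multiplicity p (card S) * n" using cD by (subst n(1)[symmetric]) (simp add: mult.commute)
 hence ix: "card (lcosets \<^sub>?GS D) = n" using prime_gt_0_nat[OF prime] by simp
 obtain a where a: "a : fixd S" "tr G S a = \<one>\<^sub>A" using S unfolding vtx_def relproj_def by blast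
 note aA = fixd_A[OF a(1)]
 have aD: "a : fixd D" using fixd_mono[OF DS] a(1) by blast
 have rep: "(SOME g. g : C) : S" if C: "C : lcosets \<^sub>?GS D" for C
 proof -
  obtain g where g: "g : S" "C = g <#\<^sub>?GS D" using C by (auto simp: LCOSETS_def)
  have "(SOME h. h : C) : C" unfolding g(2) by (rule someI[where P = "%h. h : g <#\<^sub>?GS D"], rule GS.lcos_self[OF _ D]) (use g(1) in simp)
  thus ?thesis using subgroup.lcosets_carrier[OF D GS.is_group C] by auto
 qed
 have "tr ?GS D a = (\<Oplus>\<^sub>A C\<in>lcosets \<^sub>?GS D. a)"
  unfolding transfer_def by (rule A.finsum_cong') (use rep fixdD[OF a(1)] aA in auto)
 also have "... = add_pow A n a" using A.add.finprod_const[OF aA, of "lcosets \<^sub>?GS D"] ix by simp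
 finally have tr1: "tr ?GS D a = add_pow A n a" .
 have "add_pow A k a : fixd S & lam (tr G S (add_pow A k a)) = add_pow K k \<one>\<^sub>K" for k :: nat
 proof (induction k)
  case 0
  thus ?case using fixd_cl(5)[OF subgroup.subset[OF SG]] transfer_zero[OF SG] lam_zero by simp
 next
  case (Suc k)
  hence k: "add_pow A k a : fixd S" "lam (tr G S (add_pow A k a)) = add_pow K k \<one>\<^sub>K" by auto
  have e: "add_pow A (Suc k) a = add_pow A k a \<oplus>\<^sub>A a" by simp
  have "lam (tr G S (add_pow A (Suc k) a)) = lam (tr G S (add_pow A k a)) \<oplus>\<^sub>K lam (tr G S a)"
   unfolding e transfer_add[OF SG k(1) a(1)] by (rule lam_add[OF tr_fixd[OF SG k(1)] tr_fixd[OF SG a(1)]])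
  also have "... = add_pow K (Suc k) \<one>\<^sub>K" using k(2) a(2) lam_one by simp
  finally show ?case using fixd_cl(1)[OF subgroup.subset[OF SG] k(1) a(1)] e by simp
 qed
 hence "lam (tr G S (tr ?GS D a)) = add_pow K n \<one>\<^sub>K" using tr1 by simp
 hence "lam (tr G D a) ~= \<zero>\<^sub>K" using transfer_trans[OF SG D aD] K_multiple_nonzero n(2) by simp
 hence "relproj D" by (rule lam_transfer_relproj[OF DG aD])
 hence "D = S" using S DG DS by (simp add: vtx_def)
 thus ?thesis using cD by blast
qed

text \<open>The group itself qualifies, its transfer to itself being the identity; a qualifying
  subgroup of least order is minimal.\<close>

lemma vtx_exists: "\<exists>Q. vtx Q"
proof -
 let ?P = "%Q. subgroup Q G & relproj Q"
 have one: "\<one>\<^sub>A : fixd ($G)" by (rule fixdG_closed(5))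
 have "lcosets \<^sub>G ($G) = {$G}"
 proof -
  have "g <#\<^sub>G $G = $G" if "g : $G" for g using lcoset_mem_iff[OF subgroup_self that] that by (intro Set.set_eqI) (auto simp: l_coset_def)
  thus ?thesis unfolding LCOSETS_def using one_closed by auto
 qed
 moreover have "(SOME g. g : $G) : $G" using someI[of "%g. g : $G", OF one_closed] .
 ultimately have "tr G ($G) \<one>\<^sub>A = \<one>\<^sub>A" unfolding transfer_def using fixdD[OF one] by simp
 hence "?P ($G)" using one subgroup_self unfolding relproj_def by blast
 then obtain Q where Q: "?P Q" and min: "!!P. ?P P ==> card Q \<le> card P" using ex_has_least_nat[of ?P "$G" card] by blast
 have "P = Q" if "subgroup P G" "relproj P" "P <= Q" for P
  using card_subset_eq[OF _ that(3)] min[of P] that card_mono[OF _ that(3)] finite_subset[OF subgroup.subset finG] Q by fastforce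
 thus ?thesis using Q unfolding vtx_def by blast
qed

lemma image_idem: "i : $A ==> i \<cdot>\<^sub>A i = i ==> x : i ` $M ==> i x = x" using end_app(1)[of _ M R i i] by fastforce

text \<open>As a map through its image, \<open>i\<close> is inclusion after projection; in the other
  order the composite is the identity of the image, with trace the rank.\<close>

lemma rank_trace:
 assumes i: "i : $A" "i \<cdot>\<^sub>A i = i" and X: "fbasis R (M(|carrier := i ` $M|)) X (%x. x) h"
 shows "t i = add_pow K (card X) \<one>\<^sub>K"
proof -
 let ?N = "M(|carrier := i ` $M|)"
 note ic = endD(1)[OF i(1)] and il = endD(2)[OF i(1)]
 have N: "module R ?N" by (rule submodule.submodule_is_module[OF image_submodule[OF module_axioms il] module_axioms])
 interpret N: module R ?N by (rule N)
 have li: "lin_map R M ?N i" and lin: "lin_map R ?N M (%x. x)" using linD[OF il] ic by (auto simp: lin_map_def)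
 note dX = dualD[OF basisD(1)[OF X]]
 have "Tr i = dtrace R X (%x. x) h ((%x. i x) \<circ> (%x. x))"
  using dual_trace_commute[OF N basisD(1)[OF basis] basisD(1)[OF X] lin li] by (simp add: comp_def)
 also have "... = (\<Oplus>x\<in>X. \<one>)" unfolding dtrace_def
 proof (rule R.finsum_cong')
  fix x assume x: "x : X"
  have "i x = x" by (rule image_idem[OF i]) (use dX(2)[OF x] in simp)
  thus "h x (((%x. i x) \<circ> (%x. x)) x) = \<one>" using basisD(2)[OF X x x] by simp
 qed auto
 also have "... = add_pow R (card X) \<one>" using R.add.finprod_const[OF R.one_closed, of X] by simp
 finally show ?thesis using P.add_pow_quot by (simp add: t_def)
qed

lemma summand_rank:
 assumes i: "i : $A" "i \<cdot>\<^sub>A i = i"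
 obtains X h where "fbasis R (M(|carrier := i ` $M|)) X (%x. x) h" "has_rank R (M(|carrier := i ` $M|)) (card X)"
proof -
 obtain w where "local_module R M (max_ideal R) w" by (rule P.local_module[OF module_axioms])
 then interpret L: local_module R M "max_ideal R" w .
 note il = endD(2)[OF i(1)]
 obtain X h where X: "fbasis R (M(|carrier := i ` $M|)) X (%x. x) h" using L.summand_basis[OF basis il image_idem[OF i]] by blast
 have "module R (M(|carrier := i ` $M|))" by (rule submodule.submodule_is_module[OF image_submodule[OF module_axioms il] module_axioms])
 from module.free_basis_rank[OF this X] show thesis by (rule that[OF X])
qed

text \<open>Among the idempotents \<open>i\<close> for which \<open>lam\<close> does not vanish on the transfer of the ideal generated by \<open>i\<close>,
 one whose image has minimal rank projects onto a source.\<close>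

lemma source_exists:
 assumes Q: "vtx Q"
 shows "EX i:fixd Q. i \<cdot>\<^sub>A i = i & vertex_source R G M Q (M(|carrier := i ` $M|))"
proof -
 have QG: "subgroup Q G" using Q by (simp add: vtx_def)
 note fQ = fixd_cl[OF subgroup.subset[OF QG]]
 define good where "good i \<longleftrightarrow> i : fixd Q & i \<cdot>\<^sub>A i = i & (EX x:fixd Q. EX y:fixd Q. lam (tr G Q (x \<cdot>\<^sub>A i \<cdot>\<^sub>A y)) ~= \<zero>\<^sub>K)" for i
 define rk where "rk i n \<longleftrightarrow> (\<exists>X h. fbasis R (M(|carrier := i ` $M|)) X (%x. x) h & card X = n)" for i n
 have rkex: "\<exists>n. rk i n" if "i : $A" "i \<cdot>\<^sub>A i = i" for i unfolding rk_def by (rule summand_rank[OF that]) blast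
 obtain a where a: "a : fixd Q" "tr G Q a = \<one>\<^sub>A" using Q unfolding vtx_def relproj_def by blast
 have "good \<one>\<^sub>A" unfolding good_def
 proof (intro conjI bexI[OF bexI[OF _ fQ(6)] a(1)])
  have "a \<cdot>\<^sub>A \<one>\<^sub>A \<cdot>\<^sub>A \<one>\<^sub>A = a" using fixd_A[OF a(1)] by simp
  thus "lam (tr G Q (a \<cdot>\<^sub>A \<one>\<^sub>A \<cdot>\<^sub>A \<one>\<^sub>A)) ~= \<zero>\<^sub>K" using a(2) lam_one KF.one_not_zero by simp
 qed (use fQ(6) in simp_all)
 then obtain n0 i0 where "good i0 & rk i0 n0" using rkex[OF A.one_closed] A.one_closed by auto
 hence "\<exists>i. good i & rk i n0" by blast
 \<comment> \<open>The least rank of the image of a good idempotent; the identity is good, so there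
   is one.\<close>
 define n where "n = (LEAST n. \<exists>i. good i & rk i n)"
 obtain i where i: "good i" "rk i n"
  using LeastI_ex[of "%n. \<exists>i. good i & rk i n"] \<open>\<exists>i. good i & rk i n0\<close> unfolding n_def by blast
 have min: "n \<le> k" if "good j" "rk j k" for j k unfolding n_def by (rule Least_le) (use that in blast)
 have ifx: "i : fixd Q" and ii: "i \<cdot>\<^sub>A i = i" using i(1) by (auto simp: good_def)
 obtain x y where xy: "x : fixd Q" "y : fixd Q" "lam (tr G Q (x \<cdot>\<^sub>A i \<cdot>\<^sub>A y)) ~= \<zero>\<^sub>K" using i(1) by (auto simp: good_def)
 note iA = fixd_A[OF ifx] and xA = fixd_A[OF xy(1)] and yA = fixd_A[OF xy(2)]
 let ?X = "M(|carrier := i ` $M|)" and ?GQ = "G(|carrier := Q|)"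
 note dir = summand_direct[OF QG ifx ii]
 interpret X: gmodule R ?GQ ?X by (rule dir(2))
 have xiy: "x \<cdot>\<^sub>A i \<cdot>\<^sub>A y : fixd Q" by (intro fQ(2) xy ifx)
 obtain d where d: "d : fixd ($G)" "tr G Q (x \<cdot>\<^sub>A i \<cdot>\<^sub>A y) \<cdot>\<^sub>A d = \<one>\<^sub>A"
  using lam_unit[OF tr_fixd[OF QG xiy] xy(3)] by blast
 have dQ: "d : fixd Q" using fixd_mono[OF subgroup.subset[OF QG]] d(1) by blast
 have "tr G Q (x \<cdot>\<^sub>A i \<cdot>\<^sub>A (y \<cdot>\<^sub>A d)) = \<one>\<^sub>A"
  using transfer_mult_right[OF QG xiy d(1)] d(2) xA yA iA fixd_A[OF dQ] by (simp add: A.m_assoc)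
 hence iso: "iso_to_direct_summand R G M (induced R G Q ?X)" unfolding summand_induced_iff[OF QG ifx ii] using xy(1) fQ(2)[OF xy(2) dQ] by blast
 have ne: "$?X ~= {\<zero>\<^sub>?X}"
 proof
  assume z: "$?X = {\<zero>\<^sub>?X}"
  have "i = \<zero>\<^sub>A" by (rule end_ext[of _ R M]) (use iA z in "auto simp: end_app")
  thus False using xy(3) xA yA transfer_zero[OF QG] lam_zero by simp
 qed
 \<comment> \<open>A decomposition of the image of \<open>i\<close> yields orthogonal idempotents
   \<open>e'\<close> and \<open>e2\<close> with sum \<open>i\<close>. By additivity one of them is
   good, by minimality of the rank it equals \<open>i\<close>, and so the other summand is
   zero.\<close>
 have "N = {\<zero>\<^sub>M} \<or> N' = {\<zero>\<^sub>M}" if sum: "internal_direct_sum R ?GQ ?X N N'" for N N'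
 proof -
  obtain e where e: "e : $(gmodule_end R ?GQ ?X)" "e ` $?X = N" "!!x. x : N ==> e x = x" "!!x. x : N' ==> e x = \<zero>\<^sub>?X"
   by (rule X.summand_projection[OF sum], erule that, assumption, simp, simp)
  have eE: "e : $(lin_end R ?X)" and eg: "!!h u. h : Q ==> u : $?X ==> e (act M h u) = act M h (e u)" using e(1) by (auto simp: gmodule_end_def)
  note el = X.endD[OF eE]
  have Xc: "u : $M" if "u : $?X" for u using that endD(1)[OF iA] by auto
  have NX: "N <= $?X" "N' <= $?X" using sum X.submoduleE(1) by (auto simp: internal_direct_sum_def gsubmodule_def)
  have iX: "lin_map R M ?X i" using linD[OF endD(2)[OF iA]] by (auto simp: lin_map_def)
  have iX1: "i u : $?X" if "u : $M" for u using that by simp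
  have Xm: "lin_map R ?X M (%u. u)" using Xc by (auto simp: lin_map_def)
  define e' where "e' = (\<lambda>u\<in>$M. e (i u))"
  have e'l: "lin_map R M M (%u. e (i u))" using lin_comp[OF lin_comp[OF iX el(2)] Xm] by simp
  have e'Q: "e' : fixd Q" unfolding fixd_iff[OF QG] e'_def using endI[OF module_axioms e'l] ifx subgroup.mem_carrier[OF QG]
   by (simp add: act_closed fixd_iff[OF QG] eg)
  note e'A = fixd_A[OF e'Q]
  have ie: "i (e (i u)) = e (i u)" if "u : $M" for u by (rule image_idem[OF iA ii]) (use el(1)[OF iX1[OF that]] in simp)
  have ii': "i (i u) = i u" if "u : $M" for u by (rule image_idem[OF iA ii imageI[OF that]])
  have ee: "e (e u) = e u" if "u : $?X" for u by (rule e(3)) (use imageI[OF that, of e] e(2) in simp)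
  have ap: "e' u = e (i u)" "e' u : $M" if "u : $M" for u using that endD(1)[OF e'A that] by (simp_all add: e'_def)
  have ee': "e' (e (i u)) = e (i u)" if u: "u : $M" for u using ap(1)[OF Xc[OF el(1)[OF iX1[OF u]]]] ie[OF u] ee[OF iX1[OF u]] by simp
  have e'1: "i \<cdot>\<^sub>A e' = e'" "e' \<cdot>\<^sub>A i = e'" "e' \<cdot>\<^sub>A e' = e'"
   by (rule end_ext[of _ R M]; use e'A iA endD(1)[OF iA] in
    \<open>simp add: end_closed end_app ap(1) ie ii' ee'\<close>)+
  define e2 where "e2 = i \<ominus>\<^sub>A e'"
  have e2Q: "e2 : fixd Q" unfolding e2_def by (rule fQ(4)[OF ifx e'Q])
  note e2A = fixd_A[OF e2Q]
  have sum2: "i = e' \<oplus>\<^sub>A e2" unfolding e2_def using e'A iA by (simp add: A.minus_eq A.a_lcomm[of e' i] A.r_neg)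
  have e21: "e' \<cdot>\<^sub>A e2 = \<zero>\<^sub>A" "i \<cdot>\<^sub>A e2 = e2" "e2 \<cdot>\<^sub>A i = e2" unfolding e2_def using e'A iA e'1 ii
   by (simp_all add: A.minus_eq A.r_distr A.l_distr A.r_minus A.l_minus A.r_neg)
  have e22: "e2 \<cdot>\<^sub>A e2 = e2"
  proof -
   have "e2 = i \<cdot>\<^sub>A e2" using e21(2) by simp
   also have "... = (e' \<oplus>\<^sub>A e2) \<cdot>\<^sub>A e2" using sum2 by simp
   also have "... = e2 \<cdot>\<^sub>A e2" using e'A e2A e21(1) by (simp add: A.l_distr)
   finally show ?thesis by simp
  qed
  \<comment> \<open>A good idempotent below \<open>i\<close> cannot have smaller rank, and
    \<open>summand_basis\<close> then makes it the identity on the image of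
    \<open>i\<close>.\<close>
  have full: "e = i" if g: "good e" and eQ: "i \<cdot>\<^sub>A e = e" "e \<cdot>\<^sub>A i = e" for e
  proof -
   have eA: "e : $A" and ei: "e \<cdot>\<^sub>A e = e" using g fixd_A by (auto simp: good_def)
   have imX: "e u : $?X" if "u : $M" for u
   proof -
    have "e u = i (e u)" using end_app(1)[OF that, of R i e] eQ(1) by simp
    thus ?thesis using endD(1)[OF eA that] by auto
   qed
   have el: "lin_map R ?X ?X e" using linD[OF endD(2)[OF eA]] Xc imX by (auto simp: lin_map_def)
   have im: "e ` $?X = e ` $M"
   proof
    show "e ` $M <= e ` $?X"
    proof
    fix z assume "z : e ` $M"
    then obtain u where u: "u : $M" "z = e u" by blast
    have "e (i u) = e u" using end_app(1)[OF u(1), of R e i] eQ(2) by simp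
    thus "z : e ` $?X" using u by (intro image_eqI[of _ _ "i u"]) simp_all
    qed
   qed (use Xc in blast)
   obtain X0 h0 where X0: "fbasis R ?X X0 (%x. x) h0" "card X0 = n" using i(2) by (auto simp: rk_def)
   obtain w where "local_module R ?X (max_ideal R) w" by (rule P.local_module[OF X.module_axioms])
   then interpret L: local_module R ?X "max_ideal R" w .
   have idem: "e (e u) = e u" if "u : $?X" for u using end_app(1)[OF Xc[OF that], of R e e] ei by simp
   obtain Y h where Y: "fbasis R (?X(|carrier := e ` $?X|)) Y (%x. x) h"
    "(EX u:$?X. e u ~= u) --> card Y < card X0" using L.summand_basis[OF X0(1) el idem] by blast
   have "rk e (card Y)" unfolding rk_def using Y(1) im by auto
   hence "\<not> card Y < card X0" using min[OF g, of "card Y"] X0(2) by simp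
   hence fx: "ALL u:$?X. e u = u" using Y(2) by blast
   show ?thesis
   proof (rule end_ext[of _ R M])
    fix u assume u: "u : $M"
    have "e u = e (i u)" using end_app(1)[OF u, of R e i] eQ(2) by simp
    also have "... = i u" using fx u by simp
    finally show "e u = i u" .
   qed (use eA iA in auto)
  qed
  have "good e' \<or> good e2"
  proof (rule ccontr)
   assume no: "\<not> (good e' \<or> good e2)"
   have xe: "x \<cdot>\<^sub>A e' \<cdot>\<^sub>A y : fixd Q" "x \<cdot>\<^sub>A e2 \<cdot>\<^sub>A y : fixd Q" by (intro fQ(2) xy e'Q e2Q)+
   have z: "lam (tr G Q (x \<cdot>\<^sub>A e' \<cdot>\<^sub>A y)) = \<zero>\<^sub>K" "lam (tr G Q (x \<cdot>\<^sub>A e2 \<cdot>\<^sub>A y)) = \<zero>\<^sub>K"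
    using no e'Q e2Q e'1(3) e22 xy(1,2) unfolding good_def by blast+
   have "x \<cdot>\<^sub>A i \<cdot>\<^sub>A y = x \<cdot>\<^sub>A e' \<cdot>\<^sub>A y \<oplus>\<^sub>A x \<cdot>\<^sub>A e2 \<cdot>\<^sub>A y"
    unfolding sum2 using xA yA e'A e2A by (simp add: A.l_distr A.r_distr)
   hence "lam (tr G Q (x \<cdot>\<^sub>A i \<cdot>\<^sub>A y)) = \<zero>\<^sub>K"
    using transfer_add[OF QG xe] lam_add[OF tr_fixd[OF QG xe(1)] tr_fixd[OF QG xe(2)]] z by simp
   thus False using xy(3) by blast
  qed
  thus ?thesis
  proof
   assume "good e'"
   hence e'i: "e' = i" by (rule full[OF _ e'1(1,2)])
   have "u = \<zero>\<^sub>M" if u: "u : N'" for u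
   proof -
    have uX: "u : $?X" using NX(2) u by blast
    have "u = i u" using image_idem[OF iA ii, of u] uX by simp
    also have "... = e (i u)" using fun_cong[OF e'i, of u] ap(1)[OF Xc[OF uX]] by simp
    also have "... = e u" using image_idem[OF iA ii, of u] uX by simp
    finally show ?thesis using e(4)[OF u] by simp
   qed
   moreover have "\<zero>\<^sub>M : N'" using sum unfolding internal_direct_sum_def by auto
   ultimately show ?thesis by blast
  next
   assume "good e2"
   hence "e2 = i" by (rule full[OF _ e21(2,3)])
   hence e'0: "e' = \<zero>\<^sub>A" using e21(1) e'1(2) by simp
   have "u = \<zero>\<^sub>M" if u: "u : N" for u
   proof -
    have uX: "u : $?X" using NX(1) u by blast
    have "u = e u" using e(3)[OF u] by simp
    also have "... = e (i u)" using image_idem[OF iA ii, of u] uX by simp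
    also have "... = e' u" using ap(1)[OF Xc[OF uX]] by simp
    finally show ?thesis using e'0 Xc[OF uX] by (simp add: end_app)
   qed
   moreover have "\<zero>\<^sub>M : N" using sum unfolding internal_direct_sum_def by auto
   ultimately show ?thesis by blast
  qed
 qed
 hence "indecomposable R ?GQ ?X" unfolding indecomposable_def using ne by auto
 moreover have "direct_summand R ?GQ ?X M" unfolding direct_summand_def using dir(1) by blast
 ultimately have "vertex_source R G M Q ?X" unfolding vertex_source_def using Q vertex_iff iso by blast
 thus ?thesis using ifx ii by blast
qed

end

section \<open>Traces on the endomorphism ring of a source\<close>

context rep_data
begin

lemma source_idempotent:
 assumes src: "vertex_source R G M S Z"
 obtains i x0 y0 where "i : fixd S" "i \<cdot>\<^sub>A i = i" "Z = M(|carrier := i ` $M|)"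
  "x0 : fixd S" "y0 : fixd S" "tr G S (x0 \<cdot>\<^sub>A i \<cdot>\<^sub>A y0) = \<one>\<^sub>A"
proof -
 have SG: "subgroup S G" using src by (simp add: vertex_source_def vertex_def)
 interpret H: gmodule R "G(|carrier := S|)" M by (rule gmodule_restrict[OF SG])
 have iso: "iso_to_direct_summand R G M (induced R G S Z)" using src by (simp add: vertex_source_def)
 obtain N N' where N: "internal_direct_sum R (G(|carrier := S|)) M N N'" "Z = M(|carrier := N|)"
  using src unfolding vertex_source_def direct_summand_def by blast
 obtain i where i: "i : $(gmodule_end R (G(|carrier := S|)) M)" "i ` $M = N" "!!x. x : N ==> i x = x"
  by (rule H.summand_projection[OF N(1)], erule that, assumption, simp)
 have ifx: "i : fixd S" using i(1) end_sub[OF SG] by simp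
 note iA = fixd_A[OF ifx]
 have "i (i x) = i x" if "x : $M" for x by (rule i(3)) (use imageI[OF that, of i] i(2) in simp)
 hence ii: "i \<cdot>\<^sub>A i = i" by (intro end_ext[of _ R M]) (use iA in "simp_all add: end_app")
 have Z: "Z = M(|carrier := i ` $M|)" using N(2) i(2) by simp
 obtain x0 y0 where "x0 : fixd S" "y0 : fixd S" "tr G S (x0 \<cdot>\<^sub>A i \<cdot>\<^sub>A y0) = \<one>\<^sub>A"
  using summand_induced_iff[OF SG ifx ii] iso Z by blast
 thus thesis by (rule that[OF ifx ii Z])
qed

text \<open>An element \<open>j\<close> of the corner algebra in the kernel of the residue character \<open>chi\<close> is locally nilpotent
 modulo the maximal ideal: a nontrivial relation between the vectors \<open>(j ^^ k) y\<close> is a polynomial in \<open>j\<close>,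
 and after removing powers of \<open>j\<close> its constant term makes it a unit.\<close>

lemma corner_nilpotent:
 assumes L: "local_module R M (max_ideal R) w"
  and i: "i : $A" "i \<cdot>\<^sub>A i = i"
  and C: "C <= $A" "!!a. a : C ==> i \<cdot>\<^sub>A a = a"
  and Cadd: "!!a a'. a : C ==> a' : C ==> a \<oplus>\<^sub>A a' : C & chi (a \<oplus>\<^sub>A a') = chi a \<oplus>\<^sub>K chi a'"
  and Cmult: "!!a a'. a : C ==> a' : C ==> a \<cdot>\<^sub>A a' : C & chi (a \<cdot>\<^sub>A a') = chi a \<cdot>\<^sub>K chi a'"
  and Csc: "!!r. r : $R ==> r \<odot>\<^sub>A i : C & chi (r \<odot>\<^sub>A i) = P.quot r"
  and chic: "!!a. a : C ==> chi a : $K"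
  and unit: "!!a. a : C ==> chi a ~= \<zero>\<^sub>K ==> EX b:C. b \<cdot>\<^sub>A a = i"
  and j: "j : C" "chi j = \<zero>\<^sub>K"
 shows "Tr j : max_ideal R"
proof -
 interpret L: local_module R M "max_ideal R" w by fact
 have CA: "a : $A" if "a : C" for a using C(1) that by blast
 note jA = CA[OF j(1)]
 note jl = endD[OF jA] and il = endD[OF i(1)]
 have ji: "j y : i ` $M" if "y : $M" for y
 proof -
  have "j y = i (j y)" using end_app(1)[OF that, of R i j] C(2)[OF j(1)] by simp
  thus ?thesis using jl(1)[OF that] by (intro image_eqI[of _ _ "j y"])
 qed
 have iM: "y : $M" if "y : i ` $M" for y using that il(1) by blast
 have jk: "(j ^^ k) y : $M" if "y : $M" for k y by (induction k) (use that jl(1) in simp_all)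
 \<comment> \<open>Horner's scheme for the polynomial in \<open>j\<close> with coefficients
   \<open>d\<close>, as an element of the corner. Since \<open>chi j\<close> vanishes,
   \<open>chi\<close> reads off the constant coefficient.\<close>
 have horner: "EX e:C. chi e = P.quot (d 0) & (ALL y:i ` $M. e y = (\<Oplus>\<^sub>M k\<in>{..n}. d k \<odot>\<^sub>M (j ^^ k) y))"
  if "d : {..n} \<rightarrow> $R" for n :: nat and d using that
 proof (induction n arbitrary: d)
  case 0
  have d0: "d 0 : $R" using 0 by blast
  have "(d 0 \<odot>\<^sub>A i) y = (\<Oplus>\<^sub>M k\<in>{..0::nat}. d k \<odot>\<^sub>M (j ^^ k) y)" if y: "y : i ` $M" for y
   using iM[OF y] image_idem[OF i y] d0 by (simp add: end_app)
  thus ?case using Csc[OF d0] by blast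
 next
  case (Suc n)
  have d: "d k : $R" if "k \<le> Suc n" for k using Suc.prems that by auto
  have d0: "d 0 : $R" using d by simp
  obtain e where e: "e : C" "ALL y:i ` $M. e y = (\<Oplus>\<^sub>M k\<in>{..n}. d (Suc k) \<odot>\<^sub>M (j ^^ k) y)"
   using Suc.IH[of "%k. d (Suc k)"] d by auto
  let ?e = "d 0 \<odot>\<^sub>A i \<oplus>\<^sub>A j \<cdot>\<^sub>A e"
  have s: "d 0 \<odot>\<^sub>A i : C" "chi (d 0 \<odot>\<^sub>A i) = P.quot (d 0)" and je: "j \<cdot>\<^sub>A e : C" "chi (j \<cdot>\<^sub>A e) = \<zero>\<^sub>K"
   using Csc[OF d0] Cmult[OF j(1) e(1)] j(2) chic[OF e(1)] by simp_all
  have "?e : C" "chi ?e = P.quot (d 0)" using Cadd[OF s(1) je(1)] s(2) je(2) P.quot_simps(1)[OF d0] by simp_all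
  moreover have "?e y = (\<Oplus>\<^sub>M k\<in>{..Suc n}. d k \<odot>\<^sub>M (j ^^ k) y)" if y: "y : i ` $M" for y
  proof -
   have yM: "y : $M" by (rule iM[OF y])
   have c: "d k \<odot>\<^sub>M (j ^^ l) y : $M" if "k \<le> Suc n" for k l using d[OF that] jk[OF yM] by simp
   have "?e y = d 0 \<odot>\<^sub>M i y \<oplus>\<^sub>M j (e y)" using yM by (simp add: end_app)
   also have "j (e y) = (\<Oplus>\<^sub>M k\<in>{..n}. j (d (Suc k) \<odot>\<^sub>M (j ^^ k) y))"
    unfolding bspec[OF e(2) y] by (rule lin_finsum[OF module_axioms jl(2)]) (use c in auto)
   also have "... = (\<Oplus>\<^sub>M k\<in>{..n}. d (Suc k) \<odot>\<^sub>M (j ^^ Suc k) y)"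
    by (rule M.finsum_cong') (use linD(3)[OF jl(2) d jk[OF yM]] c[of "Suc _" "Suc _"] in auto)
   also have "d 0 \<odot>\<^sub>M i y \<oplus>\<^sub>M ... = ... \<oplus>\<^sub>M d 0 \<odot>\<^sub>M (j ^^ 0) y"
    unfolding image_idem[OF i y] funpow_0
    by (rule M.a_comm) (use c[of 0 0] c[of "Suc _" "Suc _"] in "auto intro!: M.finsum_closed simp del: funpow.simps")
   also have "... = (\<Oplus>\<^sub>M k\<in>{..Suc n}. d k \<odot>\<^sub>M (j ^^ k) y)" by (rule M.finsum_Suc2[symmetric]) (use c in auto)
   finally show ?thesis .
  qed
  ultimately show ?case by blast
 qed
 \<comment> \<open>If the constant coefficient lies in the maximal ideal, it is dropped and
   \<open>y\<close> replaced by \<open>j y\<close>, with the degree lowered by one. Otherwise the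
   polynomial is invertible in the corner and \<open>y\<close> itself lies in
   \<open>L.wM\<close>.\<close>
 have nil: "\<exists>a. (j ^^ a) y : L.wM"
  if "y : i ` $M" "d : {..n} \<rightarrow> $R" "(\<Oplus>\<^sub>M k\<in>{..n}. d k \<odot>\<^sub>M (j ^^ k) y) : L.wM" "\<exists>k\<le>n. d k ~: max_ideal R"
  for n :: nat and d y using that
 proof (induction n arbitrary: d y)
  case (Suc n)
  note y = Suc.prems(1) and dR = Suc.prems(2) and S = Suc.prems(3)
  have yM: "y : $M" by (rule iM[OF y])
  have d: "d k : $R" if "k \<le> Suc n" for k using dR that by auto
  have c: "d k \<odot>\<^sub>M (j ^^ l) y : $M" if "k \<le> Suc n" for k l using d[OF that] jk[OF yM] by simp
  show ?case
  proof (cases "d 0 : max_ideal R")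
   case True
   let ?T = "\<Oplus>\<^sub>M k\<in>{..n}. d (Suc k) \<odot>\<^sub>M (j ^^ k) (j y)"
   have T: "?T : $M" by (rule M.finsum_closed) (use d jk[OF jl(1)[OF yM]] in auto)
   have "(\<Oplus>\<^sub>M k\<in>{..Suc n}. d k \<odot>\<^sub>M (j ^^ k) y) = (\<Oplus>\<^sub>M k\<in>{..n}. d (Suc k) \<odot>\<^sub>M (j ^^ Suc k) y) \<oplus>\<^sub>M d 0 \<odot>\<^sub>M (j ^^ 0) y"
    by (rule M.finsum_Suc2) (use c in auto)
   hence "(\<Oplus>\<^sub>M k\<in>{..Suc n}. d k \<odot>\<^sub>M (j ^^ k) y) = ?T \<oplus>\<^sub>M d 0 \<odot>\<^sub>M y" by (simp add: funpow_swap1)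
   moreover have dw: "d 0 \<odot>\<^sub>M y : L.wM" by (rule L.wM_closed(6)[OF True yM])
   ultimately have "(?T \<oplus>\<^sub>M d 0 \<odot>\<^sub>M y) \<oplus>\<^sub>M \<ominus>\<^sub>M (d 0 \<odot>\<^sub>M y) : L.wM"
    using L.wM_closed(2)[OF S L.wM_closed(5)[OF dw]] by simp
   hence "?T : L.wM" using T L.wM_closed(1)[OF dw] by (simp add: M.a_assoc M.r_neg)
   moreover have "\<exists>k\<le>n. d (Suc k) ~: max_ideal R" using Suc.prems(4) True by (metis Suc_le_mono not0_implies_Suc)
   moreover have "(%k. d (Suc k)) : {..n} \<rightarrow> $R" using d by simp
   ultimately obtain a where "(j ^^ a) (j y) : L.wM" using Suc.IH[OF ji[OF yM]] by blast
   thus ?thesis by (intro exI[of _ "Suc a"]) (simp add: funpow_swap1)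
  next
   case False
   obtain e where e: "e : C" "chi e = P.quot (d 0)" "ALL y:i ` $M. e y = (\<Oplus>\<^sub>M k\<in>{..Suc n}. d k \<odot>\<^sub>M (j ^^ k) y)"
    using horner[OF dR] by blast
   obtain b where b: "b : C" "b \<cdot>\<^sub>A e = i" using unit[OF e(1)] e(2) False P.quot_zero_iff[OF d[of 0]] by auto
   have "y = b (e y)" using end_app(1)[OF yM, of R b e] b(2) image_idem[OF i y] by simp
   also have "... : L.wM" by (rule L.linear_map_wM[OF endD(2)[OF CA[OF b(1)]]], unfold bspec[OF e(3) y], rule S)
   finally show ?thesis by (intro exI[of _ 0]) simp
  qed
 next
  case 0
  have d0: "d 0 : $R" "d 0 ~: max_ideal R" using 0 by auto
  obtain e where e: "e : C" "chi e = P.quot (d 0)" "ALL y:i ` $M. e y = (\<Oplus>\<^sub>M k\<in>{..0}. d k \<odot>\<^sub>M (j ^^ k) y)"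
   using horner[OF 0(2)] by blast
  obtain b where b: "b : C" "b \<cdot>\<^sub>A e = i" using unit[OF e(1)] e(2) d0 P.quot_zero_iff by auto
  have "y = b (e y)" using end_app(1)[OF iM[OF 0(1)], of R b e] b(2) image_idem[OF i 0(1)] by simp
  also have "... : L.wM" by (rule L.linear_map_wM[OF endD(2)[OF CA[OF b(1)]]], unfold bspec[OF e(3) 0(1)], rule 0(3))
  finally show ?case by (intro exI[of _ 0]) simp
 qed
 show ?thesis
 proof (rule L.trace_locally_nilpotent[OF basis jl(2)])
  fix x assume x: "x : $M"
  note y = ji[OF x]
  \<comment> \<open>The iterates of \<open>j x\<close>, one more than the rank, satisfy a nontrivial
    relation modulo the maximal ideal. Starting at \<open>j x\<close> rather than \<open>x\<close>
    keeps them in the image of \<open>i\<close>.\<close>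
  obtain d where "d : {..card I} \<rightarrow> $R" "(\<Oplus>\<^sub>M k\<in>{..card I}. d k \<odot>\<^sub>M (j ^^ k) (j x)) : L.wM" "\<exists>k\<le>card I. d k ~: max_ideal R"
   using L.dependent_family[OF basis, of "%k. (j ^^ k) (j x)"] jk[OF jl(1)[OF x]] by blast
  then obtain a where "(j ^^ a) (j x) : L.wM" using nil[OF y] by blast
  thus "\<exists>a. (j ^^ a) x : L.wM" by (intro exI[of _ "Suc a"]) (simp add: funpow_swap1)
 qed
qed

text \<open>Restriction \<rho> to the image of \<open>i\<close> carries the corner to the
  endomorphisms of the source, whose residue map becomes \<open>chi\<close>. That \<open>t\<close>
  is \<open>t i\<close> times \<open>chi\<close> reduces by subtracting a scalar to elements with
  \<open>chi\<close> zero, where \<open>corner_nilpotent\<close> applies.\<close>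

lemma source_data_exists:
 assumes S: "vtx S" and i: "i : fixd S" "i \<cdot>\<^sub>A i = i"
  and x0: "x0 : fixd S" "y0 : fixd S" "tr G S (x0 \<cdot>\<^sub>A i \<cdot>\<^sub>A y0) = \<one>\<^sub>A"
  and ai: "absolutely_indecomposable R (G(|carrier := S|)) (M(|carrier := i ` $M|))"
 shows "\<exists>chi m. source_data A G c K t lam Sc p S i x0 y0 chi (t i) m"
proof -
 let ?Z = "M(|carrier := i ` $M|)" and ?GS = "G(|carrier := S|)"
 have SG: "subgroup S G" using S by (simp add: vtx_def)
 note fS = fixd_cl[OF subgroup.subset[OF SG]]
 interpret Z: gmodule R ?GS ?Z by (rule summand_direct(2)[OF SG i])
 have fin: "finite ($?GS)" using finite_subset[OF subgroup.subset[OF SG] finG] by simp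
 let ?E = "gmodule_end R ?GS ?Z"
 obtain l where l: "l : ring_hom ?E K"
  "!!r. r : $R ==> l (r \<odot>\<^bsub>lin_end R ?Z\<^esub> \<one>\<^bsub>lin_end R ?Z\<^esub>) = P.quot r"
  "!!e. e : $?E ==> l e ~= \<zero>\<^sub>K ==> e : Units ?E"
  by (rule P.absolutely_indecomposable_hom[OF Z.gmodule_axioms fin ai], erule that, simp, simp)
 have ops: "monoid.mult ?E = monoid.mult (lin_end R ?Z)" "ring.add ?E = ring.add (lin_end R ?Z)" "\<one>\<^sub>?E = \<one>\<^bsub>lin_end R ?Z\<^esub>"
  "$?E = {f : $(lin_end R ?Z). ALL h:S. ALL x:i ` $M. f (act M h x) = act M h (f x)}" by (simp_all add: gmodule_end_def)
 note iA = fixd_A[OF i(1)]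
 note il = endD[OF iA]
 define C where "C = {a : fixd S. i \<cdot>\<^sub>A a = a & a \<cdot>\<^sub>A i = a}"
 have C: "a : fixd S" "a : $A" "i \<cdot>\<^sub>A a = a" "a \<cdot>\<^sub>A i = a" if "a : C" for a using that fixd_A by (auto simp: C_def)
 have iM: "y : $M" if "y : $?Z" for y using that il(1) by auto
 have aZ: "a y : $?Z" if "a : C" "y : $M" for a y
 proof -
  have "a y = i (a y)" using end_app(1)[OF that(2), of R i a] C(3)[OF that(1)] by simp
  thus ?thesis using endD(1)[OF C(2)[OF that(1)] that(2)] by auto
 qed
 define \<rho> where "\<rho> a = (\<lambda>y\<in>$?Z. a y)" for a :: "'b => 'b"
 have ap: "\<rho> a y = a y" if "y : $?Z" for a y using that by (simp add: \<rho>_def)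
 have \<rho>l: "\<rho> a : $(lin_end R ?Z)" if a: "a : C" for a
 proof -
  have "lin_map R ?Z ?Z a" using linD[OF endD(2)[OF C(2)[OF a]]] iM aZ[OF a iM] by (auto simp: lin_map_def)
  thus ?thesis unfolding \<rho>_def by (rule endI[OF Z.module_axioms])
 qed
 have \<rho>E: "\<rho> a : $?E" if a: "a : C" for a
 proof -
  have "\<rho> a (act M h x) = act M h (\<rho> a x)" if h: "h : S" and x: "x : i ` $M" for h x
  proof -
   have x': "x : $?Z" using x by simp
   have "act M h x : $?Z" using Z.act_closed[of h x] h x by simp
   thus ?thesis using ap x' C(1)[OF a] iM[OF x'] h fixd_iff[OF SG] by simp
  qed
  thus ?thesis unfolding ops(4) using \<rho>l[OF a] by simp
 qed
 have sub: "a \<oplus>\<^sub>A a' : C" "a \<cdot>\<^sub>A a' : C" if "a : C" "a' : C" for a a'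
 proof -
  have "i \<cdot>\<^sub>A (a \<cdot>\<^sub>A a') = a \<cdot>\<^sub>A a'" using A.m_assoc[OF iA C(2)[OF that(1)] C(2)[OF that(2)]] C(3)[OF that(1)] by simp
  moreover have "(a \<cdot>\<^sub>A a') \<cdot>\<^sub>A i = a \<cdot>\<^sub>A a'" using A.m_assoc[OF C(2)[OF that(1)] C(2)[OF that(2)] iA] C(4)[OF that(2)] by simp
  ultimately show "a \<cdot>\<^sub>A a' : C" unfolding C_def using fS(2)[OF C(1)[OF that(1)] C(1)[OF that(2)]] by simp
  show "a \<oplus>\<^sub>A a' : C"
   unfolding C_def using fS(1)[OF C(1)[OF that(1)] C(1)[OF that(2)]] that[THEN C(2)] that[THEN C(3)] that[THEN C(4)] iA
   by (simp add: A.r_distr A.l_distr)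
 qed
 have iC: "i : C" using i by (simp add: C_def)
 have \<rho>hom: "\<rho> (a \<oplus>\<^sub>A a') = \<rho> a \<oplus>\<^sub>?E \<rho> a'" "\<rho> (a \<cdot>\<^sub>A a') = \<rho> a \<cdot>\<^sub>?E \<rho> a'" if "a : C" "a' : C" for a a'
 proof -
  show "\<rho> (a \<oplus>\<^sub>A a') = \<rho> a \<oplus>\<^sub>?E \<rho> a'" unfolding ops
  proof (rule end_ext[of _ R ?Z])
   fix y assume y: "y : $?Z"
   show "\<rho> (a \<oplus>\<^sub>A a') y = (\<rho> a \<oplus>\<^bsub>lin_end R ?Z\<^esub> \<rho> a') y" unfolding end_app(4)[OF y] ap[OF y] end_app(4)[OF iM[OF y]] by simp
  qed (rule \<rho>l[OF sub(1)[OF that]], rule Z.end_closed(2)[OF \<rho>l[OF that(1)] \<rho>l[OF that(2)]])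
  show "\<rho> (a \<cdot>\<^sub>A a') = \<rho> a \<cdot>\<^sub>?E \<rho> a'" unfolding ops
  proof (rule end_ext[of _ R ?Z])
   fix y assume y: "y : $?Z"
   show "\<rho> (a \<cdot>\<^sub>A a') y = (\<rho> a \<cdot>\<^bsub>lin_end R ?Z\<^esub> \<rho> a') y"
    unfolding end_app(1)[OF y] ap[OF y] ap[OF aZ[OF that(2) iM[OF y]]] end_app(1)[OF iM[OF y]] ..
  qed (rule \<rho>l[OF sub(2)[OF that]], rule Z.end_closed(1)[OF \<rho>l[OF that(1)] \<rho>l[OF that(2)]])
 qed
 define chi where "chi a = l (\<rho> a)" for a
 note lh = ring_hom_closed[OF l(1)] ring_hom_add[OF l(1)] ring_hom_mult[OF l(1)] ring_hom_one[OF l(1)]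
 have chi_add: "chi (a \<oplus>\<^sub>A a') = chi a \<oplus>\<^sub>K chi a'" and chi_mult: "chi (a \<cdot>\<^sub>A a') = chi a \<cdot>\<^sub>K chi a'"
  if "a : C" "a' : C" for a a'
  unfolding chi_def \<rho>hom[OF that] by (rule lh(2)[OF \<rho>E[OF that(1)] \<rho>E[OF that(2)]], rule lh(3)[OF \<rho>E[OF that(1)] \<rho>E[OF that(2)]])
 have chi_closed: "chi a : $K" if "a : C" for a unfolding chi_def by (rule lh(1)[OF \<rho>E[OF that]])
 have sc: "r \<odot>\<^sub>A i : C" "chi (r \<odot>\<^sub>A i) = P.quot r" if r: "r : $R" for r
 proof -
  have "r \<odot>\<^sub>A \<one>\<^sub>A : fixd S" using scalar(2)[OF r] fixd_mono[OF subgroup.subset[OF SG]] by blast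
  hence "r \<odot>\<^sub>A i : fixd S" using fS(2)[OF _ i(1)] scalar(3)[OF r iA] by metis
  moreover have "i \<cdot>\<^sub>A (r \<odot>\<^sub>A i) = r \<odot>\<^sub>A i" "(r \<odot>\<^sub>A i) \<cdot>\<^sub>A i = r \<odot>\<^sub>A i"
  proof -
   have s: "r \<odot>\<^sub>A \<one>\<^sub>A : $A" by (rule scalar(1)[OF r])
   show "i \<cdot>\<^sub>A (r \<odot>\<^sub>A i) = r \<odot>\<^sub>A i" using A.m_assoc[OF iA iA s] i(2) scalar(4)[OF r iA] by simp
   show "(r \<odot>\<^sub>A i) \<cdot>\<^sub>A i = r \<odot>\<^sub>A i" using A.m_assoc[OF s iA iA] i(2) scalar(3)[OF r iA] by simp
  qed
  ultimately show rC: "r \<odot>\<^sub>A i : C" by (simp add: C_def)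
  have "\<rho> (r \<odot>\<^sub>A i) = r \<odot>\<^bsub>lin_end R ?Z\<^esub> \<one>\<^bsub>lin_end R ?Z\<^esub>"
  proof (rule end_ext[of _ R ?Z])
   fix y assume y: "y : $?Z"
   have "i y = y" by (rule image_idem[OF iA i(2)]) (use y in simp)
   thus "\<rho> (r \<odot>\<^sub>A i) y = (r \<odot>\<^bsub>lin_end R ?Z\<^esub> \<one>\<^bsub>lin_end R ?Z\<^esub>) y"
    unfolding ap[OF y] end_app(5)[OF y] end_app(5)[OF iM[OF y]] end_app(2)[OF y] by simp
  qed (rule \<rho>l[OF rC], rule Z.end_closed(3)[OF Z.end_01(1) Z.end_01(1) r])
  thus "chi (r \<odot>\<^sub>A i) = P.quot r" using l(2)[OF r] by (simp add: chi_def)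
 qed
 have unit: "EX b:C. a \<cdot>\<^sub>A b = i & b \<cdot>\<^sub>A a = i" if a: "a : C" and ne: "chi a ~= \<zero>\<^sub>K" for a
 proof -
  have "\<rho> a : Units ?E" using l(3)[OF \<rho>E[OF a]] ne by (simp add: chi_def)
  then obtain e where eE: "e : $?E" and e: "e \<cdot>\<^sub>?E \<rho> a = \<one>\<^sub>?E" "\<rho> a \<cdot>\<^sub>?E e = \<one>\<^sub>?E" unfolding Units_def by blast
  have el: "e : $(lin_end R ?Z)" and eg: "!!h x. h : S ==> x : $?Z ==> e (act M h x) = act M h (e x)" using eE unfolding ops(4) by auto
  have ez: "e y : $?Z" if "y : $?Z" for y using Z.endD(1)[OF el that] .
  have ea: "e (a y) = y" "a (e y) = y" if y: "y : $?Z" for y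
   using fun_cong[OF e(1), of y] fun_cong[OF e(2), of y] unfolding ops end_app(1,2)[OF y] ap[OF y] ap[OF ez[OF y]] .
  define b where "b = (\<lambda>x\<in>$M. e (i x))"
  have iZ: "i x : $?Z" if "x : $M" for x using that by simp
  have li: "lin_map R M ?Z i" using linD[OF il(2)] by (auto simp: lin_map_def)
  have lZ: "lin_map R ?Z M (%x. x)" using iM by (auto simp: lin_map_def)
  have "lin_map R M M (%x. e (i x))" by (rule lin_comp[OF lin_comp[OF li Z.endD(2)[OF el]] lZ])
  hence bA: "b : $A" unfolding b_def by (rule endI[OF module_axioms])
  have bap: "b x = e (i x)" if "x : $M" for x using that by (simp add: b_def)
  have "b (act M h x) = act M h (b x)" if h: "h : S" and x: "x : $M" for h x
  proof -
   have hG: "h : $G" by (rule subgroup.mem_carrier[OF SG h])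
   have "i (act M h x) = act M h (i x)" using i(1) h x fixd_iff[OF SG] by blast
   thus ?thesis using bap[OF act_closed[OF hG x]] bap[OF x] eg[OF h iZ[OF x]] by simp
  qed
  hence bS: "b : fixd S" using bA fixd_iff[OF SG] by blast
  have idZ: "i y = y" if "y : $?Z" for y by (rule image_idem[OF iA i(2)]) (use that in simp)
  have "i \<cdot>\<^sub>A b = b" by (rule end_ext[of _ R M], rule end_closed(1)[OF iA bA], rule bA)
    (simp only: end_app bap idZ[OF ez[OF iZ]])
  moreover have "b \<cdot>\<^sub>A i = b" by (rule end_ext[of _ R M], rule end_closed(1)[OF bA iA], rule bA)
    (simp only: end_app bap il(1) idZ[OF iZ])
  moreover have "a \<cdot>\<^sub>A b = i" by (rule end_ext[of _ R M], rule end_closed(1)[OF C(2)[OF a] bA], rule iA)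
    (simp only: end_app bap ea(2)[OF iZ])
  moreover have "b \<cdot>\<^sub>A a = i"
  proof (rule end_ext[of _ R M], rule end_closed(1)[OF bA C(2)[OF a]], rule iA)
   fix x assume x: "x : $M"
   have "a x = a (i x)" using end_app(1)[OF x, of R a i] C(4)[OF a] by simp
   hence "(b \<cdot>\<^sub>A a) x = e (a (i x))" using end_app(1)[OF x, of R b a] bap[OF endD(1)[OF C(2)[OF a] x]] idZ[OF aZ[OF a x]] by simp
   thus "(b \<cdot>\<^sub>A a) x = i x" using ea(1)[OF iZ[OF x]] by simp
  qed
  ultimately show ?thesis unfolding C_def using bS by blast
 qed
 obtain w where w: "local_module R M (max_ideal R) w" by (rule P.local_module[OF module_axioms])
 have t_chi: "t a = t i \<cdot>\<^sub>K chi a" if a: "a : C" for a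
 proof -
  obtain r where r: "r : $R" "P.quot r = chi a" by (rule P.quot_surj[OF chi_closed[OF a]])
  have mr: "\<ominus> r : $R" using r(1) by simp
  \<comment> \<open>With \<open>r\<close> a lift of \<open>chi a\<close>, this difference has
    residue zero, hence trace in the maximal ideal.\<close>
  let ?j = "a \<oplus>\<^sub>A (\<ominus> r) \<odot>\<^sub>A i"
  have jC: "?j : C" by (rule sub(1)[OF a sc(1)[OF mr]])
  have q0: "P.quot r \<oplus>\<^sub>K P.quot (\<ominus> r) = \<zero>\<^sub>K"
   using P.quot_simps(2)[OF r(1) mr] P.quot_zero_iff[OF R.zero_closed] additive_subgroup.zero_closed[OF ideal.axioms(1)[OF maximalideal.axioms(1)[OF P.max_ideal]]] r(1)
   by (simp add: R.r_neg)
  hence "chi ?j = \<zero>\<^sub>K" using chi_add[OF a sc(1)[OF mr]] sc(2)[OF mr] r(2) by simp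
  hence "Tr ?j : max_ideal R"
  proof (rule corner_nilpotent[OF w iA i(2), of C chi, rotated -1])
   show "C <= $A" using C(2) by blast
   show "EX b:C. b \<cdot>\<^sub>A a = i" if "a : C" "chi a ~= \<zero>\<^sub>K" for a using unit[OF that] by blast
  qed (use C(3) sub chi_add chi_mult sc chi_closed jC in simp_all)
  hence tj: "t ?j = \<zero>\<^sub>K" unfolding t_def using P.quot_zero_iff[OF Tr_closed[OF C(2)[OF jC]]] by simp
  have t2: "t ((\<ominus> r) \<odot>\<^sub>A i) = P.quot (\<ominus> r) \<cdot>\<^sub>K t i"
   unfolding t_def Tr_smult[OF iA mr] by (rule P.quot_simps(3)[OF mr Tr_closed[OF iA]])
  have k: "t a : $K" "t i : $K" "P.quot (\<ominus> r) : $K" "P.quot r : $K" using t_closed C(2)[OF a] iA P.quot_simps(1) r(1) mr by auto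
  have z: "t a \<oplus>\<^sub>K P.quot (\<ominus> r) \<cdot>\<^sub>K t i = \<zero>\<^sub>K"
   using tj t_add[OF C(2)[OF a] C(2)[OF sc(1)[OF mr]]] t2 by simp
  have "P.quot r \<cdot>\<^sub>K t i \<oplus>\<^sub>K P.quot (\<ominus> r) \<cdot>\<^sub>K t i = \<zero>\<^sub>K"
   using KF.l_distr[OF k(4,3,2)] q0 k(2) by simp
  hence "t a = P.quot r \<cdot>\<^sub>K t i" using KF.minus_equality[OF z KF.m_closed[OF k(3,2)] k(1)]
    KF.minus_equality[OF _ KF.m_closed[OF k(3,2)] KF.m_closed[OF k(4,2)]] by simp
  thus ?thesis using KF.m_comm[OF k(4,2)] r(2) by simp
 qed
 obtain m where m: "card S = p ^ m" using card_vertex[OF S] by blast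
 have CI: "a : C" if "a : fixd S" "i \<cdot>\<^sub>A a = a" "a \<cdot>\<^sub>A i = a" for a using that by (simp add: C_def)
 have "source_data A G c K t lam Sc p S i x0 y0 chi (t i) m"
 proof (intro source_data.intro source_data_axioms.intro traced_galgebra_axioms)
  show "vtx S" by (rule S)
  show "card S = p ^ m" by (rule m)
  show "chi i = \<one>\<^sub>K"
  proof -
   have "\<one> \<odot>\<^sub>A i = i" by (rule end_ext[of _ R M]) (use iA end_closed(3)[OF iA iA] il(1) in "simp_all add: end_app")
   thus ?thesis using sc(2)[OF R.one_closed] P.quot_simps(4) by simp
  qed
  show "chi (s \<cdot>\<^sub>A i) = lam s" if s: "s : Sc" for s
  proof -
   obtain r where r: "r : $R" "s = r \<odot>\<^sub>A \<one>\<^sub>A" using s unfolding Sc_def by blast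
   thus ?thesis using scalar(3)[OF r(1) iA] sc(2)[OF r(1)] lam(2)[OF r(1)] by simp
  qed
  show "\<exists>b. b : fixd S & i \<cdot>\<^sub>A b = b & b \<cdot>\<^sub>A i = b & a \<cdot>\<^sub>A b = i & b \<cdot>\<^sub>A a = i"
   if "a : fixd S" "i \<cdot>\<^sub>A a = a" "a \<cdot>\<^sub>A i = a" "chi a ~= \<zero>\<^sub>K" for a
   using unit[OF CI[OF that(1-3)] that(4)] C by blast
  show "chi a : $K" if "a : fixd S" "i \<cdot>\<^sub>A a = a" "a \<cdot>\<^sub>A i = a" for a by (rule chi_closed[OF CI[OF that]])
  show "t a = t i \<cdot>\<^sub>K chi a" if "a : fixd S" "i \<cdot>\<^sub>A a = a" "a \<cdot>\<^sub>A i = a" for a by (rule t_chi[OF CI[OF that]])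
  show "chi (a \<oplus>\<^sub>A a') = chi a \<oplus>\<^sub>K chi a'" "chi (a \<cdot>\<^sub>A a') = chi a \<cdot>\<^sub>K chi a'"
   if "a : fixd S" "i \<cdot>\<^sub>A a = a" "a \<cdot>\<^sub>A i = a" "a' : fixd S" "i \<cdot>\<^sub>A a' = a'" "a' \<cdot>\<^sub>A i = a'" for a a'
   by (rule chi_add[OF CI[OF that(1-3)] CI[OF that(4-6)]], rule chi_mult[OF CI[OF that(1-3)] CI[OF that(4-6)]])
 qed (fact i x0 t_closed[OF iA])+
 thus ?thesis by blast
qed

end

section \<open>The multiplicity module\<close>

lemma (in module) bijective_unit:
 assumes z: "z : $(lin_end R M)" and ker: "!!x. x : $M ==> z x = \<zero>\<^sub>M ==> x = \<zero>\<^sub>M"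
  and surj: "z ` $M = $M"
 shows "z : Units (lin_end R M)"
proof -
 note d = endD[OF z] note L = linD[OF d(2)]
 have inj: "x = y" if "x : $M" "y : $M" "z x = z y" for x y
 proof -
  have "z (x \<oplus>\<^sub>M \<ominus>\<^sub>M y) = z x \<oplus>\<^sub>M \<ominus>\<^sub>M z y" using L(2) that lin_neg[OF module_axioms d(2) that(2)] by simp
  hence "x \<oplus>\<^sub>M \<ominus>\<^sub>M y = \<zero>\<^sub>M" using ker[of "x \<oplus>\<^sub>M \<ominus>\<^sub>M y"] that d(1) by (simp add: M.r_neg)
  hence "(x \<oplus>\<^sub>M \<ominus>\<^sub>M y) \<oplus>\<^sub>M y = y" using that by simp
  thus ?thesis using that by (simp add: M.a_assoc M.l_neg)
 qed
 define v where "v x = inv_into ($M) z x" for x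
 have vc: "v x : $M" and zv: "z (v x) = x" if "x : $M" for x
  unfolding v_def using inv_into_into[of x z "$M"] f_inv_into_f[of x z "$M"] that surj by simp_all
 have vl: "lin_map R M M v" unfolding lin_map_def
 proof (intro conjI ballI funcsetI)
  fix x assume x: "x : $M"
  show "v x : $M" by (rule vc[OF x])
  show "v (x \<oplus>\<^sub>M y) = v x \<oplus>\<^sub>M v y" if y: "y : $M" for y by (rule inj) (use x y vc zv L(2) in simp_all)
  show "v (r \<odot>\<^sub>M x) = r \<odot>\<^sub>M v x" if r: "r : $R" for r by (rule inj) (use x r vc zv L(3) in simp_all)
 qed
 let ?v = "\<lambda>x\<in>$M. v x"
 have vE: "?v : $(lin_end R M)" by (rule endI[OF module_axioms vl])
 have "v (z x) = x" if "x : $M" for x by (rule inj) (use that vc zv d(1) in simp_all)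
 hence "?v \<cdot>\<^bsub>lin_end R M\<^esub> z = \<one>\<^bsub>lin_end R M\<^esub>"
  by (intro end_ext[of _ R M]) (use vE z end_closed end_01 d(1) in "simp_all add: end_app")
 moreover have "z \<cdot>\<^bsub>lin_end R M\<^esub> ?v = \<one>\<^bsub>lin_end R M\<^esub>"
  by (intro end_ext[of _ R M]) (use vE z end_closed end_01 zv in "simp_all add: end_app")
 ultimately show ?thesis unfolding Units_def using vE z by blast
qed

lemma (in group) normalizer_iff:
 assumes "S <= $G" "g : $G" shows "g : normalizer G S \<longleftrightarrow> conjs G g S = S"
proof -
 have "g <#\<^sub>G S #>\<^sub>G inv g = conjs G g S" unfolding conjs_def l_coset_def r_coset_def by auto
 thus ?thesis unfolding normalizer_def stabilizer_def using assms by simp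
qed

context rep_data
begin

text \<open>If \<open>chi (i a (c g i) a' i) ~= 0\<close> then multiplication by \<open>a\<close> and \<open>a'\<close> induces, up to a unit, mutually inverse
 isomorphisms between the images of \<open>i\<close> and of its conjugate \<open>c g i\<close>, because both corners are local.\<close>

lemma conjugate_source_iso:
 assumes sd: "source_data A G c K t lam Sc p S i x0 y0 chi n m"
  and g: "g : $G" "conjs G g S = S"
  and a: "a : fixd S" "a' : fixd S" and ne: "chi (i \<cdot>\<^sub>A a \<cdot>\<^sub>A c g i \<cdot>\<^sub>A a' \<cdot>\<^sub>A i) ~= \<zero>\<^sub>K"
 shows "gmodule_iso R (G(|carrier := S|)) (conjugate_module G g (M(|carrier := i ` $M|))) (M(|carrier := i ` $M|))"
proof -
 interpret D: source_data A G c K t lam Sc p S i x0 y0 chi n m by fact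
 have SG: "subgroup S G" and SC: "S <= $G" using D.S_sub by auto
 note fS = fixd_cl[OF SC]
 note i = D.i_fixd and ii = D.i_idem
 note iA = fixd_A[OF i] and aA = fixd_A[OF a(1)] and a'A = fixd_A[OF a(2)]
 let ?i = "c g i"
 have gi: "inv \<^sub>G g : $G" using g(1) by simp
 have cfix: "c g x : fixd S" if "x : fixd S" for x using c_conj_fixd[OF SC that g(1)] g(2) by (simp add: conjs_def)
 have gS': "conjs G (inv \<^sub>G g) S = S"
 proof -
  have "conjs G (inv \<^sub>G g) S = conjs G (inv \<^sub>G g) (conjs G g S)" using g(2) by simp
  thus ?thesis using g(1) SC by (simp add: conj_set_conj conj_set_one)
 qed
 have cfix': "c (inv \<^sub>G g) x : fixd S" if "x : fixd S" for x using c_conj_fixd[OF SC that gi] gS' by (simp add: conjs_def)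
 have jS: "?i : fixd S" by (rule cfix[OF i])
 note jA = fixd_A[OF jS]
 have jj: "?i \<cdot>\<^sub>A ?i = ?i" using c_times[OF g(1) iA iA] ii by simp
 let ?w = "i \<cdot>\<^sub>A a \<cdot>\<^sub>A ?i \<cdot>\<^sub>A a' \<cdot>\<^sub>A i"
 have ww: "?w : fixd S" "i \<cdot>\<^sub>A ?w = ?w" "?w \<cdot>\<^sub>A i = ?w"
 proof -
  show "?w : fixd S" by (intro fS(2) i a jS)
  show "?w \<cdot>\<^sub>A i = ?w" using iA aA a'A jA ii by (simp add: A.m_assoc)
  have "i \<cdot>\<^sub>A ?w = (i \<cdot>\<^sub>A i) \<cdot>\<^sub>A a \<cdot>\<^sub>A ?i \<cdot>\<^sub>A a' \<cdot>\<^sub>A i" using iA aA a'A jA by (simp only: A.m_assoc A.m_closed)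
  thus "i \<cdot>\<^sub>A ?w = ?w" using ii by simp
 qed
 obtain d where d: "d : fixd S" "i \<cdot>\<^sub>A d = d" "d \<cdot>\<^sub>A i = d" "?w \<cdot>\<^sub>A d = i" using D.chi_unit[OF ww ne] by blast
 note dA = fixd_A[OF d(1)]
 \<comment> \<open>After correction by \<open>d\<close>, the inverse of \<open>?w\<close> in the
   corner, the product \<open>u v\<close> is \<open>i\<close>; hence \<open>v u\<close> is an
   idempotent in the corner of \<open>?i\<close>.\<close>
 define u where "u = i \<cdot>\<^sub>A a \<cdot>\<^sub>A ?i"
 define v where "v = ?i \<cdot>\<^sub>A a' \<cdot>\<^sub>A i \<cdot>\<^sub>A d"
 have uS: "u : fixd S" and vS: "v : fixd S" unfolding u_def v_def by (intro fS(2) i a jS d)+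
 note uA = fixd_A[OF uS] and vA = fixd_A[OF vS]
 have iu: "i \<cdot>\<^sub>A u = u" "u \<cdot>\<^sub>A ?i = u"
  using iA aA jA ii jj A.m_assoc[OF iA iA A.m_closed[OF aA jA]] by (simp_all add: u_def A.m_assoc)
 have jv: "?i \<cdot>\<^sub>A v = v" "v \<cdot>\<^sub>A i = v"
  using iA a'A jA dA jj d(3) A.m_assoc[OF jA jA A.m_closed[OF a'A A.m_closed[OF iA dA]]] by (simp_all add: v_def A.m_assoc)
 have uv: "u \<cdot>\<^sub>A v = i"
 proof -
  have "u \<cdot>\<^sub>A v = i \<cdot>\<^sub>A a \<cdot>\<^sub>A (?i \<cdot>\<^sub>A ?i) \<cdot>\<^sub>A a' \<cdot>\<^sub>A i \<cdot>\<^sub>A d"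
   unfolding u_def v_def using iA aA a'A jA dA by (simp only: A.m_assoc A.m_closed)
  thus ?thesis using jj d(4) by simp
 qed
 \<comment> \<open>The idempotent \<open>v u\<close> moved back into the corner of \<open>i\<close>,
   where residues can be taken.\<close>
 define e where "e = c (inv \<^sub>G g) (v \<cdot>\<^sub>A u)"
 have vuS: "v \<cdot>\<^sub>A u : fixd S" by (rule fS(2)[OF vS uS])
 note vuA = fixd_A[OF vuS]
 have eS: "e : fixd S" unfolding e_def by (rule cfix'[OF vuS])
 note eA = fixd_A[OF eS]
 have ci: "c (inv \<^sub>G g) ?i = i" by (rule c_inv[OF g(1) iA])
 have "?i \<cdot>\<^sub>A (v \<cdot>\<^sub>A u) = v \<cdot>\<^sub>A u" using A.m_assoc[OF jA vA uA] jv(1) by simp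
 hence ie: "i \<cdot>\<^sub>A e = e" using c_times[OF gi jA vuA] ci by (simp add: e_def)
 have "(v \<cdot>\<^sub>A u) \<cdot>\<^sub>A ?i = v \<cdot>\<^sub>A u" using A.m_assoc[OF vA uA jA] iu(2) by simp
 hence ei: "e \<cdot>\<^sub>A i = e" using c_times[OF gi vuA jA] ci by (simp add: e_def)
 have "(v \<cdot>\<^sub>A u) \<cdot>\<^sub>A (v \<cdot>\<^sub>A u) = v \<cdot>\<^sub>A (u \<cdot>\<^sub>A v) \<cdot>\<^sub>A u" using uA vA by (simp only: A.m_assoc A.m_closed)
 also have "... = v \<cdot>\<^sub>A u" using uv jv(2) by simp
 finally have vuvu: "(v \<cdot>\<^sub>A u) \<cdot>\<^sub>A (v \<cdot>\<^sub>A u) = v \<cdot>\<^sub>A u" .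
 hence ee: "e \<cdot>\<^sub>A e = e" using c_times[OF gi vuA vuA] by (simp add: e_def)
 \<comment> \<open>An idempotent with nonzero residue is invertible in the corner, hence is its
   identity.\<close>
 have one: "f = i" if f: "f : fixd S" "i \<cdot>\<^sub>A f = f" "f \<cdot>\<^sub>A i = f" "f \<cdot>\<^sub>A f = f" "chi f ~= \<zero>\<^sub>K" for f
 proof -
  obtain h where h: "h : fixd S" "h \<cdot>\<^sub>A f = i" using D.chi_unit[OF f(1-3,5)] by blast
  have "h \<cdot>\<^sub>A f = h \<cdot>\<^sub>A f \<cdot>\<^sub>A f" using f(4) A.m_assoc[OF fixd_A[OF h(1)] fixd_A[OF f(1)] fixd_A[OF f(1)]] by simp
  thus ?thesis using h(2) f(2) by simp
 qed
 \<comment> \<open>If the residue of \<open>e\<close> were zero, the complement \<open>i - e\<close>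
   would have residue \<open>1\<close> and equal \<open>i\<close>. Then \<open>v u\<close> is zero,
   and so is \<open>i\<close>, the square of \<open>u v\<close>.\<close>
 have "chi e ~= \<zero>\<^sub>K"
 proof
  assume e0: "chi e = \<zero>\<^sub>K"
  let ?f = "i \<ominus>\<^sub>A e"
  have fS': "?f : fixd S" by (rule fS(4)[OF i eS])
  note fA = fixd_A[OF fS']
  have f: "i \<cdot>\<^sub>A ?f = ?f" "?f \<cdot>\<^sub>A i = ?f" "?f \<cdot>\<^sub>A ?f = ?f" using iA eA ii ie ei ee
   by (simp_all add: A.minus_eq A.r_distr A.l_distr A.r_minus A.l_minus A.minus_minus A.r_neg A.l_neg A.a_assoc A.r_neg1 A.r_neg2)
  have "i = ?f \<oplus>\<^sub>A e" using iA eA by (simp add: A.minus_eq A.a_assoc A.l_neg)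
  hence "chi i = chi ?f \<oplus>\<^sub>K chi e" using D.chi_add[OF fS' f(1,2) eS ie ei] by metis
  hence "chi ?f = \<one>\<^sub>K" using D.chi_one e0 D.chi_closed[OF fS' f(1,2)] by simp
  hence "?f = i" using one[OF fS' f] by simp
  hence "e = \<zero>\<^sub>A"
  proof -
   assume fi: "?f = i"
   have "i = i \<oplus>\<^sub>A e" using \<open>i = ?f \<oplus>\<^sub>A e\<close> unfolding fi .
   thus ?thesis using iA eA A.add.l_cancel_one'[of i e] by simp
  qed
  hence "v \<cdot>\<^sub>A u = \<zero>\<^sub>A" using c_inv'[OF g(1) vuA] c_zero[OF g(1)] by (simp add: e_def)
  hence "i \<cdot>\<^sub>A i = \<zero>\<^sub>A"
  proof -
   assume z: "v \<cdot>\<^sub>A u = \<zero>\<^sub>A"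
   have "(u \<cdot>\<^sub>A v) \<cdot>\<^sub>A (u \<cdot>\<^sub>A v) = u \<cdot>\<^sub>A (v \<cdot>\<^sub>A u) \<cdot>\<^sub>A v" using uA vA by (simp only: A.m_assoc A.m_closed)
   thus ?thesis using z uv uA vA by simp
  qed
  hence i0: "i = \<zero>\<^sub>A" using ii by simp
  have "i \<oplus>\<^sub>A i = i" using iA i0 by simp
  hence "\<one>\<^sub>K \<oplus>\<^sub>K \<one>\<^sub>K = \<one>\<^sub>K" using D.chi_add[OF i ii ii i ii ii] D.chi_one by simp
  thus False using KF.one_not_zero KF.add.l_cancel_one'[of "\<one>\<^sub>K" "\<one>\<^sub>K"] by simp
 qed
 hence "e = i" by (rule one[OF eS ie ei ee])
 hence vu: "v \<cdot>\<^sub>A u = ?i" using c_inv'[OF g(1) vuA] by (simp add: e_def)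
 let ?Z = "M(|carrier := i ` $M|)"
 let ?f = "%x. u (act M g x)" and ?h = "%y. act M (inv \<^sub>G g) (v y)"
 note ul = endD[OF uA] and vl = endD[OF vA] and il = endD[OF iA]
 have ZM: "x : $M" if "x : i ` $M" for x using that il(1) by blast
 have idZ: "i x = x" if "x : i ` $M" for x by (rule image_idem[OF iA ii that])
 have iapp: "?i x = act M g (i (act M (inv \<^sub>G g) x))" if "x : $M" for x by (rule conj_end_apply[OF that])
 have fZ: "?f x : i ` $M" if "x : i ` $M" for x
 proof -
  have x: "act M g x : $M" by (rule act_closed[OF g(1) ZM[OF that]])
  have "u (act M g x) = i (u (act M g x))" using end_app(1)[OF x, of R i u] iu(1) by simp
  thus ?thesis using ul(1)[OF x] by (intro image_eqI[of _ _ "u (act M g x)"])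
 qed
 have hZ: "?h y : i ` $M" if "y : i ` $M" for y
 proof -
  have y: "y : $M" by (rule ZM[OF that])
  have "v y = ?i (v y)" using end_app(1)[OF y, of R ?i v] jv(1) by simp
  also have "... = act M g (i (act M (inv \<^sub>G g) (v y)))" by (rule iapp[OF vl(1)[OF y]])
  finally have "?h y = act M (inv \<^sub>G g) (act M g (i (act M (inv \<^sub>G g) (v y))))" by (rule arg_cong)
  also have "... = i (act M (inv \<^sub>G g) (v y))" by (rule act_inv(1)[OF g(1) il(1)[OF act_closed[OF gi vl(1)[OF y]]]])
  finally show ?thesis using act_closed[OF gi vl(1)[OF y]] by (intro image_eqI[of _ _ "act M (inv \<^sub>G g) (v y)"])
 qed
 have fh: "?f (?h y) = y" if "y : i ` $M" for y
 proof -
  have y: "y : $M" by (rule ZM[OF that])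
  have "?f (?h y) = u (v y)" using act_inv(2)[OF g(1) vl(1)[OF y]] by simp
  thus ?thesis using end_app(1)[OF y, of R u v] uv idZ[OF that] by simp
 qed
 have hf: "?h (?f x) = x" if "x : i ` $M" for x
 proof -
  have x: "x : $M" by (rule ZM[OF that])
  have gx: "act M g x : $M" by (rule act_closed[OF g(1) x])
  have "v (u (act M g x)) = act M g (i (act M (inv \<^sub>G g) (act M g x)))" using end_app(1)[OF gx, of R v u] vu iapp[OF gx] by simp
  also have "... = act M g x" using act_inv(1)[OF g(1) x] idZ[OF that] by simp
  finally show ?thesis using act_inv(1)[OF g(1) x] by simp
 qed
 have inv_S: "inv \<^sub>G g \<cdot>\<^sub>G s \<cdot>\<^sub>G g : $G" if "s : S" for s using that SC g(1) gi by (intro m_closed) auto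
 show ?thesis unfolding gmodule_iso_def
 proof (rule exI[of _ ?f], intro conjI ballI)
  show "bij_betw ?f ($(conjugate_module G g ?Z)) ($?Z)"
   by (rule bij_betw_byWitness[where f' = ?h]) (use fh hf fZ hZ in "auto simp: conjugate_module_def")
  fix x assume "x : $(conjugate_module G g ?Z)"
  hence x: "x : $M" using ZM by (simp add: conjugate_module_def)
  note gx = act_closed[OF g(1) x]
  show "?f (r \<odot>\<^bsub>conjugate_module G g ?Z\<^esub> x) = r \<odot>\<^sub>?Z ?f x" if "r : $R" for r
   using act_smult[OF g(1) that x] linD(3)[OF ul(2) that gx] by (simp add: conjugate_module_def)
  show "?f (act (conjugate_module G g ?Z) s x) = act ?Z s (?f x)" if "s : $(G(|carrier := S|))" for s
  proof -
   have s: "s : S" "s : $G" using that SC by auto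
   have "act M g (act M (inv \<^sub>G g \<cdot>\<^sub>G s \<cdot>\<^sub>G g) x) = act M (g \<cdot>\<^sub>G (inv \<^sub>G g \<cdot>\<^sub>G s \<cdot>\<^sub>G g)) x"
    by (rule act_mult[OF g(1) inv_S[OF s(1)] x, symmetric])
   also have "g \<cdot>\<^sub>G (inv \<^sub>G g \<cdot>\<^sub>G s \<cdot>\<^sub>G g) = s \<cdot>\<^sub>G g"
    using g(1) gi s(2) by (simp add: m_assoc[symmetric])
   finally have "act M g (act M (inv \<^sub>G g \<cdot>\<^sub>G s \<cdot>\<^sub>G g) x) = act M s (act M g x)" using act_mult[OF s(2) g(1) x] by simp
   thus ?thesis using uS s(1) gx fixd_iff[OF SG] by (simp add: conjugate_module_def)
  qed
  fix y assume "y : $(conjugate_module G g ?Z)"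
  hence y: "y : $M" using ZM by (simp add: conjugate_module_def)
  show "?f (x \<oplus>\<^bsub>conjugate_module G g ?Z\<^esub> y) = ?f x \<oplus>\<^sub>?Z ?f y"
   using act_add[OF g(1) x y] linD(2)[OF ul(2) gx act_closed[OF g(1) y]] by (simp add: conjugate_module_def)
 qed
qed

text \<open>Checks the axioms of \<open>multiplicity_data\<close> for the quotient map onto the
  endomorphisms of the multiplicity module. Two of them carry content: outside the stabiliser the
  conjugate of \<open>i\<close> lies in the kernel, and Schur's lemma.\<close>

lemma simple_multiplicity_transfer:
 fixes Mm :: "('a set, 'm) module"
 assumes sd: "source_data A G c K t lam Sc p S i x0 y0 chi n m"
  and Z: "Z = M(|carrier := i ` $M|)" and simple: "simple_multiplicity_module R G M S Z Mm T"
  and a: "a : fixd S"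
 shows "n \<cdot>\<^sub>K lam (tr G S a) = lam (tr G S i) \<cdot>\<^sub>K t a"
proof -
 interpret D: source_data A G c K t lam Sc p S i x0 y0 chi n m by fact
 have SG: "subgroup S G" and SC: "S <= $G" using D.S_sub by auto
 note fS = fixd_cl[OF SC]
 note i = D.i_fixd and ii = D.i_idem
 let ?AS = "A(|carrier := fixd S|)" and ?E = "lin_end K Mm"
 define N where "N = stabilizer_of_source R G S Z"
 have AS: "gmodule_end R (G(|carrier := S|)) M = ?AS" by (rule gmodule_end_eq[OF SG])
 have mm: "multiplicity_module R G M S Z Mm T" and nz: "$Mm ~= {\<zero>\<^sub>Mm}"
  and smp: "!!L. submodule L K Mm ==> (!!C. C : $(G(|carrier := N|) Mod S) ==> T C ` L <= L) ==>
   L = {\<zero>\<^sub>Mm} \<or> L = $Mm" using simple unfolding simple_multiplicity_module_def N_def by blast+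
 from mm obtain I \<phi> where Mm: "module K Mm" and I: "multiplicity_ideal R G M S Z I"
  and \<phi>: "\<phi> : ring_iso (?AS Quot I) ?E"
  and TU: "!!C. C : $(G(|carrier := N|) Mod S) ==> T C : Units ?E"
  and TC: "!!C g a. C : $(G(|carrier := N|) Mod S) ==> g : C ==> a : fixd S ==>
   \<phi> (I +>\<^sub>?AS c g a) = T C \<cdot>\<^sub>?E \<phi> (I +>\<^sub>?AS a) \<cdot>\<^sub>?E inv \<^sub>?E (T C)"
  unfolding multiplicity_module_def Let_def AS N_def[symmetric] conj_end_def by auto
 interpret Mm: module K Mm by (rule Mm)
 interpret E: ring ?E by (rule Mm.lin_end_ring)
 interpret AS: ring ?AS by (rule fixed_points_ring[OF SC])
 have Imax: "maximalideal I ?AS" and iI: "i ~: I"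
 proof -
  show "maximalideal I ?AS" using I unfolding multiplicity_ideal_def Let_def AS by blast
  have "gmodule_iso R (G(|carrier := S|)) (M(|carrier := i ` $M|)) Z" unfolding gmodule_iso_def Z by (rule exI[of _ "%x. x"]) (simp add: bij_betw_def)
  moreover have "i : $?AS" "i \<cdot>\<^sub>?AS i = i" using i ii by simp_all
  ultimately show "i ~: I" using I unfolding multiplicity_ideal_def Let_def AS by blast
 qed
 interpret I: maximalideal I ?AS by (rule Imax)
 interpret Q: ring "?AS Quot I" by (rule I.quotient_is_ring)
 define pi where "pi a = \<phi> (I +>\<^sub>?AS a)" for a
 have \<phi>h: "\<phi> : ring_hom (?AS Quot I) ?E" and \<phi>b: "bij_betw \<phi> ($(?AS Quot I)) ($?E)" using \<phi> by (auto simp: ring_iso_def)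
 note rh = I.rcos_ring_hom
 note h1 = ring_hom_closed[OF rh] ring_hom_add[OF rh] ring_hom_mult[OF rh] ring_hom_one[OF rh]
 note h2 = ring_hom_closed[OF \<phi>h] ring_hom_add[OF \<phi>h] ring_hom_mult[OF \<phi>h] ring_hom_one[OF \<phi>h]
 have pi0: "pi b = \<zero>\<^sub>?E \<longleftrightarrow> b : I" if b: "b : fixd S" for b
 proof -
  have bc: "b : $?AS" using b by simp
  have z: "\<phi> \<zero>\<^bsub>?AS Quot I\<^esub> = \<zero>\<^sub>?E" by (rule ring_hom_zero[OF \<phi>h Q.ring_axioms E.ring_axioms])
  have "pi b = \<zero>\<^sub>?E \<longleftrightarrow> I +>\<^sub>?AS b = \<zero>\<^bsub>?AS Quot I\<^esub>"
   using inj_on_eq_iff[OF bij_betw_imp_inj_on[OF \<phi>b] h1(1)[OF bc] Q.zero_closed] z by (simp add: pi_def)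
  also have "... \<longleftrightarrow> b : I" using I.rcos_const_imp_mem[OF bc] AS.a_coset_join2[OF bc I.a_subgroup] by (auto simp: FactRing_def)
  finally show ?thesis .
 qed
 have maxi: "(ALL a:J. a : I) \<or> J = fixd S"
  if J: "J <= fixd S" "!!a b. a : J ==> b : J ==> a \<oplus>\<^sub>A b : J"
   "!!a b. a : J ==> b : fixd S ==> a \<cdot>\<^sub>A b : J" "!!a b. a : J ==> b : fixd S ==> b \<cdot>\<^sub>A a : J"
   and IJ: "!!a. a : I ==> a : J" for J
 proof -
  have "ideal J ?AS"
  proof (rule idealI[OF AS.ring_axioms])
   show "subgroup J (add_monoid ?AS)"
   proof (rule AS.add.subgroupI)
    show "J ~= {}" using IJ I.zero_closed by blast
    fix x assume x: "x : J"
    have "\<ominus>\<^sub>?AS \<one>\<^sub>?AS : fixd S" using AS.a_inv_closed[OF AS.one_closed] by simp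
    hence "(\<ominus>\<^sub>?AS \<one>\<^sub>?AS) \<cdot>\<^sub>?AS x : J" using J(4)[OF x] by simp
    moreover have "(\<ominus>\<^sub>?AS \<one>\<^sub>?AS) \<cdot>\<^sub>?AS x = \<ominus>\<^sub>?AS x"
    using AS.l_minus[OF AS.one_closed, of x] AS.l_one[of x] J(1) x by (simp add: subset_iff)
    ultimately show "\<ominus>\<^sub>?AS x : J" by simp
   qed (use J in auto)
  qed (use J in auto)
  hence "J = I \<or> J = $?AS" by (rule I.I_maximal) (use IJ J(1) in auto)
  thus ?thesis by auto
 qed
 have Ifix: "I <= fixd S" using I.a_subset by simp
 have Iclosed: "x \<cdot>\<^sub>A b : I" "b \<cdot>\<^sub>A x : I" if "b : I" "x : fixd S" for b x
  using I.I_l_closed[of b x] I.I_r_closed[of b x] that by simp_all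
 \<comment> \<open>The operators are given for cosets of \<open>S\<close>, while
   \<open>multiplicity_data\<close> indexes them by group elements.\<close>
 define cos where "cos g = S #>\<^bsub>G(|carrier := N|)\<^esub> g" for g
 have cosC: "cos g : $(G(|carrier := N|) Mod S)" if "g : N" for g using that by (auto simp: FactGroup_def RCOSETS_def cos_def)
 have Cos: "EX g:N. C = cos g" if "C : $(G(|carrier := N|) Mod S)" for C using that by (auto simp: FactGroup_def RCOSETS_def cos_def)
 have NG: "g : $G & conjs G g S = S" if "g : N" for g
 proof -
  have gn: "g : normalizer G S" using that by (simp add: N_def stabilizer_of_source_def)
  hence "g : $G" by (simp add: normalizer_def stabilizer_def)
  thus ?thesis using gn normalizer_iff[OF SC] by blast
 qed
 have gcos: "g : cos g" if "g : N" for g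
  unfolding cos_def r_coset_def using subgroup.one_closed[OF SG] NG[OF that] by (auto intro!: bexI[of _ "\<one>\<^sub>G"])
 have "multiplicity_data A G c K t lam Sc p S i x0 y0 chi n m ?E pi N (%g. T (cos g))"
 proof (intro multiplicity_data.intro multiplicity_data_axioms.intro sd E.ring_axioms)
  show "pi a : $?E" if "a : fixd S" for a unfolding pi_def using h2(1)[OF h1(1)] that by simp
  show "pi (a \<oplus>\<^sub>A b) = pi a \<oplus>\<^sub>?E pi b" if ab: "a : fixd S" "b : fixd S" for a b
   using h1(2)[of a b] h2(2)[OF h1(1)[of a] h1(1)[of b]] ab by (simp add: pi_def)
  show "pi (a \<cdot>\<^sub>A b) = pi a \<cdot>\<^sub>?E pi b" if ab: "a : fixd S" "b : fixd S" for a b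
   using h1(3)[of a b] h2(3)[OF h1(1)[of a] h1(1)[of b]] ab by (simp add: pi_def)
  show "pi \<one>\<^sub>A = \<one>\<^sub>?E" using h1(4) h2(4) by (simp add: pi_def)
  show "EX a:fixd S. pi a = u" if u: "u : $?E" for u
  proof -
   have "u : \<phi> ` $(?AS Quot I)" unfolding bij_betw_imp_surj_on[OF \<phi>b] by (rule u)
   then obtain X where X: "u = \<phi> X" "X : $(?AS Quot I)" by (rule imageE)
   obtain b where b: "b : fixd S" "X = I +>\<^sub>?AS b"
    using X(2) unfolding FactRing_def A_RCOSETS_def' partial_object.simps by (elim UN_E singletonE) simp
   show ?thesis by (rule bexI[OF _ b(1)]) (simp add: pi_def X(1) b(2))
  qed
  show "pi i ~= \<zero>\<^sub>?E" using pi0[OF i] iI by blast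
  show "(ALL a:J. pi a = \<zero>\<^sub>?E) \<or> J = fixd S"
   if J: "J <= fixd S" "!!a b. a : J ==> b : J ==> a \<oplus>\<^sub>A b : J"
    "!!a b. a : J ==> b : fixd S ==> a \<cdot>\<^sub>A b : J" "!!a b. a : J ==> b : fixd S ==> b \<cdot>\<^sub>A a : J"
    and ker: "!!a. a : fixd S ==> pi a = \<zero>\<^sub>?E ==> a : J" for J
  proof -
   have "a : J" if "a : I" for a using ker[of a] pi0[of a] Ifix that by blast
   from maxi[OF J this] show ?thesis using pi0 J(1) by blast
  qed
  show "T (cos g) : Units ?E" if "g : N" for g by (rule TU[OF cosC[OF that]])
  show "pi (c g a) = T (cos g) \<cdot>\<^sub>?E pi a \<cdot>\<^sub>?E inv \<^sub>?E (T (cos g))" if "g : N" "a : fixd S" for g a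
   unfolding pi_def by (rule TC[OF cosC[OF that(1)] gcos[OF that(1)] that(2)])
  show "g : $G & conjs G g S = S" if "g : N" for g by (rule NG[OF that])
  show "pi (c g i) = \<zero>\<^sub>?E" if g: "g : $G" "conjs G g S = S" "g ~: N" for g
  proof (rule ccontr)
   assume ne: "pi (c g i) ~= \<zero>\<^sub>?E"
   have jS: "c g i : fixd S" using c_conj_fixd[OF SC i g(1)] g(2) by (simp add: conjs_def)
   let ?s = "%a b a'. i \<cdot>\<^sub>A a \<cdot>\<^sub>A b \<cdot>\<^sub>A a' \<cdot>\<^sub>A i"
   have iA: "i : $A" by (rule fixd_A[OF i])
   have sf: "?s a b a' : fixd S" "i \<cdot>\<^sub>A ?s a b a' = ?s a b a'" "?s a b a' \<cdot>\<^sub>A i = ?s a b a'"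
    if "a : fixd S" "b : fixd S" "a' : fixd S" for a b a'
   proof -
    note cA = fixd_A[OF that(1)] fixd_A[OF that(2)] fixd_A[OF that(3)]
    show "?s a b a' : fixd S" by (intro fS(2) i that)
    show "?s a b a' \<cdot>\<^sub>A i = ?s a b a'" using iA cA ii by (simp add: A.m_assoc)
    have "i \<cdot>\<^sub>A ?s a b a' = (i \<cdot>\<^sub>A i) \<cdot>\<^sub>A a \<cdot>\<^sub>A b \<cdot>\<^sub>A a' \<cdot>\<^sub>A i" using iA cA by (simp only: A.m_assoc A.m_closed)
    thus "i \<cdot>\<^sub>A ?s a b a' = ?s a b a'" using ii by simp
   qed
   \<comment> \<open>The elements that \<open>chi\<close> does not see through any sandwich by
     \<open>i\<close>. This ideal contains \<open>I\<close> but not \<open>i\<close>, so it equals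
     \<open>I\<close>; an element outside \<open>I\<close>, such as the conjugate of
     \<open>i\<close> here, is therefore detected, and the two sources are isomorphic.\<close>
   define J where "J = {b : fixd S. ALL a:fixd S. ALL a':fixd S. chi (?s a b a') = \<zero>\<^sub>K}"
   have "(ALL a:J. a : I) \<or> J = fixd S"
   proof (rule maxi)
    show "J <= fixd S" by (auto simp: J_def)
    show "b \<oplus>\<^sub>A b' : J" if b: "b : J" "b' : J" for b b'
    proof -
    have bS: "b : fixd S" "b' : fixd S" using b by (auto simp: J_def)
    have "chi (?s a (b \<oplus>\<^sub>A b') a') = \<zero>\<^sub>K" if aa: "a : fixd S" "a' : fixd S" for a a'
    proof -
    have "?s a (b \<oplus>\<^sub>A b') a' = ?s a b a' \<oplus>\<^sub>A ?s a b' a'"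
    using iA fixd_A[OF bS(1)] fixd_A[OF bS(2)] fixd_A[OF aa(1)] fixd_A[OF aa(2)] by (simp add: A.l_distr A.r_distr)
    thus ?thesis using D.chi_add[OF sf[OF aa(1) bS(1) aa(2)] sf[OF aa(1) bS(2) aa(2)]] b aa by (simp add: J_def)
    qed
    thus ?thesis using fS(1)[OF bS] by (simp add: J_def)
    qed
    show "b \<cdot>\<^sub>A x : J" if b: "b : J" and x: "x : fixd S" for b x
    proof -
    have bS: "b : fixd S" using b by (auto simp: J_def)
    have "chi (?s a (b \<cdot>\<^sub>A x) a') = \<zero>\<^sub>K" if aa: "a : fixd S" "a' : fixd S" for a a'
    proof -
    have "?s a (b \<cdot>\<^sub>A x) a' = ?s a b (x \<cdot>\<^sub>A a')" using iA fixd_A[OF bS] fixd_A[OF x] fixd_A[OF aa(1)] fixd_A[OF aa(2)]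
    by (simp only: A.m_assoc A.m_closed)
    thus ?thesis using b aa(1) fS(2)[OF x aa(2)] by (simp add: J_def)
    qed
    thus ?thesis using fS(2)[OF bS x] by (simp add: J_def)
    qed
    show "x \<cdot>\<^sub>A b : J" if b: "b : J" and x: "x : fixd S" for b x
    proof -
    have bS: "b : fixd S" using b by (auto simp: J_def)
    have "chi (?s a (x \<cdot>\<^sub>A b) a') = \<zero>\<^sub>K" if aa: "a : fixd S" "a' : fixd S" for a a'
    proof -
    have "?s a (x \<cdot>\<^sub>A b) a' = ?s (a \<cdot>\<^sub>A x) b a'" using iA fixd_A[OF bS] fixd_A[OF x] fixd_A[OF aa(1)] fixd_A[OF aa(2)]
    by (simp only: A.m_assoc A.m_closed)
    thus ?thesis using b aa(2) fS(2)[OF aa(1) x] by (simp add: J_def)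
    qed
    thus ?thesis using fS(2)[OF x bS] by (simp add: J_def)
    qed
    show "b : J" if b: "b : I" for b
    proof -
    have bS: "b : fixd S" using b Ifix by blast
    have "chi (?s a b a') = \<zero>\<^sub>K" if aa: "a : fixd S" "a' : fixd S" for a a'
    proof (rule ccontr)
    assume "chi (?s a b a') ~= \<zero>\<^sub>K"
    then obtain d where d: "d : fixd S" "?s a b a' \<cdot>\<^sub>A d = i" using D.chi_unit[OF sf[OF aa(1) bS aa(2)]] by blast
    have "?s a b a' : I" by (rule Iclosed(2)[OF Iclosed(2)[OF Iclosed(1)[OF b fS(2)[OF i aa(1)]] aa(2)] i])
    thus False using Iclosed(2)[of "?s a b a'" d] d iI by simp
    qed
    thus ?thesis using bS by (simp add: J_def)
    qed
   qed
   moreover have "i ~: J"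
   proof
    assume "i : J"
    hence "chi (?s i i i) = \<zero>\<^sub>K" using i by (simp add: J_def)
    thus False using ii D.chi_one KF.one_not_zero by simp
   qed
   ultimately have "ALL a:J. a : I" using i by blast
   hence "c g i ~: J" using ne pi0[OF jS] by blast
   then obtain a a' where a: "a : fixd S" "a' : fixd S" "chi (?s a (c g i) a') ~= \<zero>\<^sub>K" using jS by (auto simp: J_def)
   have "gmodule_iso R (G(|carrier := S|)) (conjugate_module G g Z) Z" unfolding Z by (rule conjugate_source_iso[OF sd g(1,2) a])
   moreover have "g : normalizer G S" using normalizer_iff[OF SC g(1)] g(2) by blast
   ultimately have "g : N" by (simp add: N_def stabilizer_of_source_def)
   thus False using g(3) by blast
  qed
  show "z = \<zero>\<^sub>?E \<or> z : Units ?E"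
   if z: "z : $?E" and comm: "!!g. g : N ==> T (cos g) \<cdot>\<^sub>?E z = z \<cdot>\<^sub>?E T (cos g)" for z
  proof (cases "z = \<zero>\<^sub>?E")
   case False
   note zd = Mm.endD[OF z] note zL = linD[OF zd(2)]
   have z0: "z \<zero>\<^sub>Mm = \<zero>\<^sub>Mm" by (rule Mm.lin_zero[OF Mm zd(2)])
   have TE: "T C : $?E" if "C : $(G(|carrier := N|) Mod S)" for C using TU[OF that] by (rule E.Units_closed)
   have Tz: "T C (z x) = z (T C x)" if C: "C : $(G(|carrier := N|) Mod S)" and x: "x : $Mm" for C x
   proof -
    obtain g where g: "g : N" "C = cos g" using Cos[OF C] by blast
    show ?thesis using fun_cong[OF comm[OF g(1)], of x] unfolding end_app(1)[OF x] g(2) .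
   qed
   \<comment> \<open>Schur's lemma: image and kernel of \<open>z\<close> are stable under all
     \<open>T C\<close>, so by simplicity a nonzero \<open>z\<close> is surjective and
     injective.\<close>
   have imz: "z ` $Mm = $Mm"
   proof -
    have "z ` $Mm = {\<zero>\<^sub>Mm} \<or> z ` $Mm = $Mm"
    proof (rule smp)
    show "submodule (z ` $Mm) K Mm" by (rule Mm.image_submodule[OF Mm zd(2)])
    show "T C ` z ` $Mm <= z ` $Mm" if C: "C : $(G(|carrier := N|) Mod S)" for C using Tz[OF C] Mm.endD(1)[OF TE[OF C]] by auto
    qed
    moreover have "z ` $Mm ~= {\<zero>\<^sub>Mm}"
    proof
    assume "z ` $Mm = {\<zero>\<^sub>Mm}"
    hence "z x = \<zero>\<^sub>Mm" if "x : $Mm" for x using that by blast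
    hence "z = \<zero>\<^sub>?E" by (intro end_ext[of _ K Mm]) (use z in "simp_all add: end_app")
    thus False using False by blast
    qed
    ultimately show ?thesis by blast
   qed
   have kerz: "{x : $Mm. z x = \<zero>\<^sub>Mm} = {\<zero>\<^sub>Mm} \<or> {x : $Mm. z x = \<zero>\<^sub>Mm} = $Mm"
   proof (rule smp)
    show "submodule {x : $Mm. z x = \<zero>\<^sub>Mm} K Mm" by (rule Mm.submoduleI) (auto simp: z0 zL Mm.lin_neg[OF Mm zd(2)])
    show "T C ` {x : $Mm. z x = \<zero>\<^sub>Mm} <= {x : $Mm. z x = \<zero>\<^sub>Mm}"
    if C: "C : $(G(|carrier := N|) Mod S)" for C
    proof
    fix y assume "y : T C ` {x : $Mm. z x = \<zero>\<^sub>Mm}"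
    then obtain x where x: "x : $Mm" "z x = \<zero>\<^sub>Mm" "y = T C x" by blast
    have "z (T C x) = T C \<zero>\<^sub>Mm" using Tz[OF C x(1)] x(2) by simp
    also have "... = \<zero>\<^sub>Mm" by (rule Mm.lin_zero[OF Mm Mm.endD(2)[OF TE[OF C]]])
    finally show "y : {x : $Mm. z x = \<zero>\<^sub>Mm}" using x Mm.endD(1)[OF TE[OF C] x(1)] by simp
    qed
   qed
   moreover have "{x : $Mm. z x = \<zero>\<^sub>Mm} ~= $Mm"
   proof
    assume a: "{x : $Mm. z x = \<zero>\<^sub>Mm} = $Mm"
    have "z ` $Mm <= {\<zero>\<^sub>Mm}"
    proof
    fix y assume "y : z ` $Mm"
    then obtain x where x: "x : $Mm" "y = z x" by blast
    have "x : {x : $Mm. z x = \<zero>\<^sub>Mm}" unfolding a by (rule x(1))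
    thus "y : {\<zero>\<^sub>Mm}" using x(2) by simp
    qed
    thus False using imz nz Mm.M.zero_closed by blast
   qed
   ultimately have "x = \<zero>\<^sub>Mm" if "x : $Mm" "z x = \<zero>\<^sub>Mm" for x using that by blast
   thus ?thesis using Mm.bijective_unit[OF z _ imz] by blast
  qed simp
 qed
 then interpret X: multiplicity_data A G c K t lam Sc p S i x0 y0 chi n m ?E pi N "%g. T (cos g)" .
 show ?thesis by (rule X.lam_transfer_trace[OF a])
qed

end

section \<open>Tensor products of modules with sources of rank prime to the characteristic\<close>

text \<open>The projection onto a source has as trace the rank of the source, and this is a unit in
  the residue field.\<close>

lemma (in rep_data) prime_rank_trace:
 assumes Q: "vtx Q" and src: "source_ranks_prime_to p R G M"
 shows "EX e:fixd Q. t e ~= \<zero>\<^sub>K"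
proof -
 obtain i where i: "i : fixd Q" "i \<cdot>\<^sub>A i = i" "vertex_source R G M Q (M(|carrier := i ` $M|))" using source_exists[OF Q] by blast
 obtain n where n: "has_rank R (M(|carrier := i ` $M|)) n" "coprime n p" using src i(3) unfolding source_ranks_prime_to_def by blast
 note iA = fixd_A[OF i(1)]
 have X: "module R (M(|carrier := i ` $M|))"
  by (rule submodule.submodule_is_module[OF image_submodule[OF module_axioms endD(2)[OF iA]] module_axioms])
 obtain B where B: "module_basis R (M(|carrier := i ` $M|)) B" "card B = n" using n(1) unfolding has_rank_def by blast
 obtain h where h: "fbasis R (M(|carrier := i ` $M|)) B (%x. x) h" by (rule module.module_basis_free[OF X B(1)])
 have "\<not> p dvd n" using n(2) prime by (metis coprime_absorb_right not_prime_unit)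
 hence "t i ~= \<zero>\<^sub>K" using rank_trace[OF iA i(2) h] K_multiple_nonzero B(2) by simp
 thus ?thesis using i(1) by blast
qed

theorem theorem1:
  fixes p :: nat
    and R :: "'a ring"
    and G :: "'g monoid"
    and U :: "('a, 'b, 'g) gmodule"
    and V :: "('a, 'c, 'g) gmodule"
    and W :: "('a, ('b \<times> 'c \<Rightarrow> 'a) set, 'g) gmodule"
    and S :: "'g set"
    and Z :: "('a, ('b \<times> 'c \<Rightarrow> 'a) set, 'g) gmodule"
    and M :: "('a set, 'm) module"
    and T :: "'g set \<Rightarrow> 'm \<Rightarrow> 'm"
  assumes "Factorial_Ring.prime p"
    and "complete_local_pid R"
    and "ring_char (residue_field R) = p"
    and "group G" and "finite (carrier G)"
    and "gmodule R G U" and "\<exists>n. has_rank R U n" and "indecomposable R G U"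
    and "gmodule R G V" and "\<exists>n. has_rank R V n" and "indecomposable R G V"
    and "source_ranks_prime_to p R G U" and "source_ranks_prime_to p R G V"
    and "W = tensor_product R U V" and "indecomposable R G W"
    and "vertex_source R G W S Z" and "simple_multiplicity_module R G W S Z M T"
    and "absolutely_indecomposable R G U" and "sources_absolutely_indecomposable R G U"
    and "absolutely_indecomposable R G V" and "sources_absolutely_indecomposable R G V"
    and "absolutely_indecomposable R G W" and "sources_absolutely_indecomposable R G W"
  shows "source_ranks_prime_to p R G W \<and>
    (\<exists>Q Q'. vertex R G U Q \<and> vertex R G V Q' \<and> vertex R G W (Q \<inter> Q') \<and>
      sylow_subgroup p (Q <#>\<^bsub>G\<^esub> Q') G)"
proof -
 note prime = assms(1) and ring = assms(2) and char = assms(3) and fin = assms(5)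
  and U = assms(6) and V = assms(9) and W = assms(14) and src = assms(16) and mult = assms(17)
 interpret Pair: tensor_pair R G U V using U V by (rule tensor_pair.intro)
 have gW: "gmodule R G W" unfolding W by (rule Pair.W_gmodule)
 obtain BU where BU: "module_basis R U BU" using assms(7) unfolding has_rank_def by blast
 obtain BV where BV: "module_basis R V BV" using assms(10) unfolding has_rank_def by blast
 obtain fU where fU: "fbasis R U BU (%x. x) fU" by (rule Pair.U.module_basis_free[OF BU])
 obtain fV where fV: "fbasis R V BV (%x. x) fV" by (rule Pair.V.module_basis_free[OF BV])
 obtain fW where fW': "fbasis R (tensor_product R U V) (BU \<times> BV) (%q. Pair.T.tens (fst q) (snd q)) fW"
  by (rule Pair.tens_free_basis[OF fU fV], erule that)
 note fW = fW'[folded W]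
 interpret U: rep_data R G U p BU "%x. x" fU by (intro rep_data.intro rep_data_axioms.intro U ring fin prime char fU assms(18))
 interpret V: rep_data R G V p BV "%x. x" fV by (intro rep_data.intro rep_data_axioms.intro V ring fin prime char fV assms(20))
 interpret W: rep_data R G W p "BU \<times> BV" "%q. Pair.T.tens (fst q) (snd q)" fW
  by (intro rep_data.intro rep_data_axioms.intro gW ring fin prime char fW assms(22))
 let ?K = "residue_field R"
 obtain Q Q' where Q: "U.vtx Q" and Q': "V.vtx Q'" using U.vtx_exists V.vtx_exists by blast
 obtain nQ nQ' where cQ: "card Q = p ^ nQ" and cQ': "card Q' = p ^ nQ'" using U.card_vertex[OF Q] V.card_vertex[OF Q'] by blast
 obtain aU where aU: "aU : U.fixd Q" "U.tr G Q aU = \<one>\<^bsub>U.A\<^esub>" using Q unfolding U.vtx_def U.relproj_def by blast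
 obtain aV where aV: "aV : V.fixd Q'" "V.tr G Q' aV = \<one>\<^bsub>V.A\<^esub>" using Q' unfolding V.vtx_def V.relproj_def by blast
 obtain eU where eU: "eU : U.fixd Q" "U.t eU ~= \<zero>\<^sub>?K" using U.prime_rank_trace[OF Q assms(12)] by blast
 obtain eV where eV: "eV : V.fixd Q'" "V.t eV ~= \<zero>\<^sub>?K" using V.prime_rank_trace[OF Q' assms(13)] by blast
 \<comment> \<open>The names of the two endomorphism algebras and of \<open>tens_end\<close> refer
   to the tensor product, which the proof treats as \<open>W\<close> from here on.\<close>
 note add = Pair.tens_end_add[folded W] and t1 = Pair.tens_end(1)[folded W]
 interpret D: pair_data "lin_end R W" G "conj_end G W" ?K W.t W.lam W.Sc p "lin_end R U" "conj_end G U" "lin_end R V" "conj_end G V"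
  Pair.tens_end U.t V.t Q Q' aU eU aV eV nQ nQ'
 proof (intro pair_data.intro pair_data_axioms.intro W.traced_galgebra_axioms U.galgebra_axioms V.galgebra_axioms)
  show "Pair.tens_end u v : $W.A" if "u : $U.A" "v : $V.A" for u v by (rule t1[OF that])
  show "Pair.tens_end (u \<oplus>\<^bsub>U.A\<^esub> u') v = Pair.tens_end u v \<oplus>\<^bsub>W.A\<^esub> Pair.tens_end u' v"
   if "u : $U.A" "u' : $U.A" "v : $V.A" for u u' v by (rule add(1)[OF that(1,2,3,3)])
  show "Pair.tens_end u (v \<oplus>\<^bsub>V.A\<^esub> v') = Pair.tens_end u v \<oplus>\<^bsub>W.A\<^esub> Pair.tens_end u v'"
   if "u : $U.A" "v : $V.A" "v' : $V.A" for u v v' by (rule add(2)[OF that(1,1,2,3)])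
  show "Pair.tens_end \<one>\<^bsub>U.A\<^esub> \<one>\<^bsub>V.A\<^esub> = \<one>\<^bsub>W.A\<^esub>" unfolding W by (rule Pair.tens_end_one)
  show "conj_end G W g (Pair.tens_end u v) = Pair.tens_end (conj_end G U g u) (conj_end G V g v)"
   if "g : $G" "u : $U.A" "v : $V.A" for g u v unfolding W by (rule Pair.tens_end_conj[OF that])
  show "W.t (Pair.tens_end u v) = U.t u \<cdot>\<^sub>?K V.t v" if "u : $U.A" "v : $V.A" for u v
   unfolding W.t_def U.t_def V.t_def Pair.tens_end_trace[OF fU fV fW' that]
   by (rule U.P.quot_simps(3)[OF U.Tr_closed[OF that(1)] V.Tr_closed[OF that(2)]])
  show "subgroup Q G" "subgroup Q' G" using Q Q' by (simp_all add: U.vtx_def V.vtx_def)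
 qed (fact U.t_closed V.t_closed U.t_c V.t_c cQ cQ' aU aV eU eV)+
 \<comment> \<open>Holds for every vertex and source of \<open>W\<close>:
   \<open>vertex_nonzero_trace\<close> finds an element of nonzero trace fixed by the vertex, and
   \<open>n_nonzero\<close> turns this into a nonzero rank.\<close>
 have trace_nonzero: "W.t i ~= \<zero>\<^sub>?K"
  if sd: "source_data W.A G W.c ?K W.t W.lam W.Sc p S' i x0 y0 chi (W.t i) m" and S': "W.vtx S'" for S' i x0 y0 chi m
 proof -
  interpret X: source_data W.A G W.c ?K W.t W.lam W.Sc p S' i x0 y0 chi "W.t i" m by (rule sd)
  obtain a where "a : W.fixd S'" "W.t a ~= \<zero>\<^sub>?K" using D.vertex_nonzero_trace[OF S'] by blast
  thus ?thesis by (rule X.n_nonzero)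
 qed
 \<comment> \<open>Proved for all vertex-source pairs, not only the pair with the simple
   multiplicity module; simplicity does not enter here.\<close>
 have ranks: "\<exists>n. has_rank R Z' n & coprime n p" if s: "vertex_source R G W S' Z'" for S' Z'
 proof -
  obtain i x0 y0 where i: "i : W.fixd S'" "i \<cdot>\<^bsub>W.A\<^esub> i = i" "Z' = W(|carrier := i ` $W|)"
   "x0 : W.fixd S'" "y0 : W.fixd S'" "W.tr G S' (x0 \<cdot>\<^bsub>W.A\<^esub> i \<cdot>\<^bsub>W.A\<^esub> y0) = \<one>\<^bsub>W.A\<^esub>"
   by (rule W.source_idempotent[OF s])
  have S': "W.vtx S'" using s W.vertex_iff by (simp add: vertex_source_def)
  have "absolutely_indecomposable R (G(|carrier := S'|)) (W(|carrier := i ` $W|))"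
   using assms(23) s i(3) unfolding sources_absolutely_indecomposable_def by blast
  then obtain chi m where "source_data W.A G W.c ?K W.t W.lam W.Sc p S' i x0 y0 chi (W.t i) m" using W.source_data_exists[OF S' i(1,2,4,5,6)] by blast
  hence ti: "W.t i ~= \<zero>\<^sub>?K" by (rule trace_nonzero[OF _ S'])
  have iA: "i : $W.A" by (rule W.fixd_A[OF i(1)])
  obtain X h where X: "fbasis R (W(|carrier := i ` $W|)) X (%x. x) h" "has_rank R (W(|carrier := i ` $W|)) (card X)"
   by (rule W.summand_rank[OF iA i(2)])
  have "\<not> p dvd card X" using ti W.rank_trace[OF iA i(2) X(1)] W.K_multiple_nonzero by simp
  hence "coprime (card X) p" by (rule coprime_commute[THEN iffD1, OF prime_imp_coprime[OF prime]])
  thus ?thesis using X(2) i(3) by blast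
 qed
 obtain i x0 y0 where i: "i : W.fixd S" "i \<cdot>\<^bsub>W.A\<^esub> i = i" "Z = W(|carrier := i ` $W|)"
  "x0 : W.fixd S" "y0 : W.fixd S" "W.tr G S (x0 \<cdot>\<^bsub>W.A\<^esub> i \<cdot>\<^bsub>W.A\<^esub> y0) = \<one>\<^bsub>W.A\<^esub>"
  by (rule W.source_idempotent[OF src])
 have S: "W.vtx S" using src W.vertex_iff by (simp add: vertex_source_def)
 have "absolutely_indecomposable R (G(|carrier := S|)) (W(|carrier := i ` $W|))"
  using assms(23) src i(3) unfolding sources_absolutely_indecomposable_def by blast
 then obtain chi m where sd: "source_data W.A G W.c ?K W.t W.lam W.Sc p S i x0 y0 chi (W.t i) m"
  using W.source_data_exists[OF S i(1,2,4,5,6)] by blast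
 obtain mS where cS: "card S = p ^ mS" using W.card_vertex[OF S] by blast
 have SG: "subgroup S G" using S by (simp add: W.vtx_def)
 have iA: "i : $W.A" by (rule W.fixd_A[OF i(1)])
 \<comment> \<open>The constants of proportionality are the trace of \<open>i\<close> and the
   residue of its transfer; only the former has to be nonzero.\<close>
 have "p ^ Factorial_Ring.multiplicity p (order G) * card S = card Q * card Q'"
 proof (rule D.order_formula[OF S cS W.t_closed[OF iA] trace_nonzero[OF sd S]])
  show "W.lam (W.tr G S i) : $?K" by (rule W.lam_closed[OF W.tr_fixd[OF SG i(1)]])
  show "W.t i \<cdot>\<^sub>?K W.lam (W.tr G S a) = W.lam (W.tr G S i) \<cdot>\<^sub>?K W.t a" if "a : W.fixd S" for a
   by (rule W.simple_multiplicity_transfer[OF sd i(3) mult that])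
 qed
 then obtain x y where xy: "x : $G" "y : $G" "W.vtx (conjs G x Q \<inter> conjs G y Q')"
  "sylow_subgroup p (conjs G x Q <#>\<^sub>G conjs G y Q') G" using D.sylow_factorization[OF S cS] by blast
 have "vertex R G U (conjs G x Q)" "vertex R G V (conjs G y Q')" "vertex R G W (conjs G x Q \<inter> conjs G y Q')"
  using U.vtx_conj[OF xy(1) Q] V.vtx_conj[OF xy(2) Q'] xy(3) U.vertex_iff V.vertex_iff W.vertex_iff by simp_all
 thus ?thesis unfolding source_ranks_prime_to_def using ranks xy(4) by blast
qed

end
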